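(* Let $X(t)$, $t\in\mathbb{R}$, be a time-dependent Wigner matrix (real symmetric, $\beta=1$, or Hermitian, $\beta=2$) with $c(s,t)=\frac{\beta}{2}\,\mathbb{E}\,Y_1(s)Y_1(t)$. Let $k_1,\dots,k_m\ge1$ be integers, $t_1,\dots,t_m\in\mathbb{R}$, and let $B_1,\dots,B_m$ be finite subsets of $\mathbb{N}=\{1,2,\dots\}$ depending on the large parameter $L$ so that the limits $$b_p=\lim_{L\to\infty}\frac{|B_p|}{L}>0,\qquad b_{pq}=\lim_{L\to\infty}\frac{|B_p\cap B_q|}{L},\qquad p,q=1,\dots,m,$$ exist. Then the $m$-dimensional random vector $$\left(L^{-\frac{k_p}{2}}\Bigl(\mathrm{Tr}\bigl(X_{B_p}(t_p)^{k_p}\bigr)-\mathbb{E}\,\mathrm{Tr}\bigl(X_{B_p}(t_p)^{k_p}\bigr)\Bigr)\right)_{p=1}^m$$ converges as $L\to\infty$ (in distribution and with all moments) to the zero mean $m$-dimensional Gaussian random vector $(\xi_p)_{p=1}^m$ with covariance $$\mathbb{E}\,\xi_p\xi_q=\frac{2k_pk_q}{\beta\pi}\int_{|z|^2=b_p,\ \mathrm{Im}\,z>0}\ \int_{|w|^2=b_q,\ \mathrm{Im}\,w>0}(x(z))^{k_p-1}(x(w))^{k_q-1}\,\frac1{2\pi}\ln\left|\frac{c(t_p,t_q)b_{pq}-zw}{c(t_p,t_q)b_{pq}-z\overline w}\right|\frac{dx(z)}{dz}\frac{dx(w)}{dw}\,dz\,dw,$$ where $x(z)=2\,\mathrm{R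e}\,z$.
   Context: **Time-dependent Wigner matrices.** Let $\{Z_{ij}(t)\}_{j>i\ge1,\,t\in\mathbb{R}}$ and $\{Y_i(t)\}_{i\ge1,\,t\in\mathbb{R}}$ be two families of stochastic processes (not necessarily Markov) indexed by $t\in\mathbb{R}$, all mutually independent; the processes $Z_{ij}$ are identically distributed, and the processes $Y_i$ are identically distributed. All have zero mean at every time, and for every integer $k\ge1$ the moments $\mathbb{E}|Z_{12}(t)|^k$ and $\mathbb{E}|Y_1(t)|^k$ are bounded uniformly in $t\in\mathbb{R}$. The $Y_i$ are real-valued. *Real symmetric case ($\beta=1$).* The $Z_{ij}$ are real-valued. With $c(s,t)=\frac12\mathbb{E}\,Y_1(s)Y_1(t)$ it is assumed that for all $s,t\in\mathbb{R}$: $c(s,t)\ge0$, $c(t,t)=1$, $\mathbb{E}\,Z_{12}(s)Z_{12}(t)=c(s,t)$, $\mathbb{E}\,Z_{12}(s)^2Z_{12}(t)^2=2c(s,t)^2+1$. *Hermitian case ($\beta=2$).* The $Z_{ij}$ are complex-valued. With $c(s,t)=\mathbb{E}\,Y_1(s)Y_1(t)$ it is assumed that for all $s,t\in\mathbb{R}$: $c(s,t)\ge0$, $c(t,t)=1$, $\mathbb{E}\,Z_{12}(s)Z_{12}(t)=0$, $\mathbb{E}\,Z_{12}(s)\overline{Z_{12}(t)}=c(s,t)$, $\mathbb{E}\,|Z_{12}(s)|^2|Z_{12}(t)|^2=c(s,t)^2+1$. The matrix $X(t)=[X(i,j\mid t)]_{i,j\ge1}$ is defined by $X(i,j\mid t)=\overline{X(j,i\mid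 t)}=Z_{ij}(t)$ for $i<j$ and $X(i,i\mid t)=Y_i(t)$. In both cases $c(s,t)=\frac\beta2\,\mathbb{E}\,Y_1(s)Y_1(t)$. **Submatrices.** For finite $B\subset\{1,2,\dots\}$, $X_B(t)$ is the $|B|\times|B|$ submatrix of $X(t)$ formed by rows and columns with indices in $B$. **Integrals.** All semicircles $\{z:|z|^2=b,\ \mathrm{Im}\,z>0\}$ are oriented so that $x(z)=2\,\mathrm{Re}\,z$ increases from $-2\sqrt b$ to $2\sqrt b$; thus $\int f(z)\frac{dx(z)}{dz}dz$ means $\int_{-2\sqrt b}^{2\sqrt b}f\,dx$ along the semicircle. "Converges with all moments" means that all joint moments of the coordinates converge to the corresponding joint moments of $(\xi_p)$. *)

theory Defs
  imports "HOL-Probability.Probability" "Jordan_Normal_Form.Matrix"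
begin

text \<open>Vectors below are those of \<open>real ^ 'm\<close>; from the second matrix library only the matrices
  of variable dimension are needed.\<close>

no_notation Matrix.vec_index (infixl \<open>$\<close> 100)
no_notation Matrix.scalar_prod (infix \<open>\<bullet>\<close> 70)

section \<open>Time-dependent Wigner matrices\<close>

definition wigner_entry ::
  "(nat \<Rightarrow> nat \<Rightarrow> real \<Rightarrow> 'a \<Rightarrow> complex) \<Rightarrow> (nat \<Rightarrow> real \<Rightarrow> 'a \<Rightarrow> real) \<Rightarrow>
    nat \<Rightarrow> nat \<Rightarrow> real \<Rightarrow> 'a \<Rightarrow> complex" where
  "wigner_entry Z Y i j t \<omega> =
    (if i < j then Z i j t \<omega> else if i = j then complex_of_real (Y i t \<omega>) else cnj (Z j i t \<omega>))"

definition wigner_cov :: "'a measure \<Rightarrow> nat \<Rightarrow> (nat \<Rightarrow> real \<Rightarrow> 'a \<Rightarrow> real) \<Rightarrow> real \<Rightarrow> real \<Rightarrow> real" where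
  "wigner_cov M \<beta> Y s t = real \<beta> / 2 * (\<integral>\<omega>. Y 1 s \<omega> * Y 1 t \<omega> \<partial>M)"

text \<open>
  \<^item> Rows and columns are indexed by the positive integers, so \<open>Z i j\<close> matters only for
    \<open>1 \<le> i < j\<close> and \<open>Y i\<close> only for \<open>1 \<le> i\<close>.
  \<^item> A process is treated as one random element of the space of all functions of time with the
    product \<open>\<sigma>\<close>-algebra. Hence \<open>indep_vars\<close> below is independence of processes (the entries of one
    process at different times may be dependent), and \<open>ident_Z\<close>, \<open>ident_Y\<close> are equality of all
    finite-dimensional distributions.
  \<^item> The entries on and above the diagonal are exactly the processes \<open>Z i j\<close> and the \<open>Y i\<close>, the
    latter read as complex-valued, so that all of them have the same codomain.
  \<^item> The real symmetric case is embedded in the complex one: there \<open>Z i j\<close> takes values in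
    \<open>\<real> \<subseteq> \<complex>\<close>.
\<close>

locale time_dependent_wigner = prob_space M for M :: "'a measure" +
  fixes \<beta> :: nat
    and Z :: "nat \<Rightarrow> nat \<Rightarrow> real \<Rightarrow> 'a \<Rightarrow> complex"
    and Y :: "nat \<Rightarrow> real \<Rightarrow> 'a \<Rightarrow> real"
  assumes beta: "\<beta> = 1 \<or> \<beta> = 2"
    and indep: "indep_vars (\<lambda>_. \<Pi>\<^sub>M t\<in>(UNIV :: real set). borel)
                  (\<lambda>(i, j) \<omega> t. wigner_entry Z Y i j t \<omega>) {(i, j). 1 \<le> i \<and> i \<le> j}"
    and ident_Z: "\<And>i j. 1 \<le> i \<Longrightarrow> i < j \<Longrightarrow>
          distr M (\<Pi>\<^sub>M t\<in>UNIV. borel) (\<lambda>\<omega> t. Z i j t \<omega>) =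
          distr M (\<Pi>\<^sub>M t\<in>UNIV. borel) (\<lambda>\<omega> t. Z 1 2 t \<omega>)"
    and ident_Y: "\<And>i. 1 \<le> i \<Longrightarrow>
          distr M (\<Pi>\<^sub>M t\<in>UNIV. borel) (\<lambda>\<omega> t. Y i t \<omega>) =
          distr M (\<Pi>\<^sub>M t\<in>UNIV. borel) (\<lambda>\<omega> t. Y 1 t \<omega>)"
    and mean_Z: "\<And>i j t. 1 \<le> i \<Longrightarrow> i < j \<Longrightarrow> expectation (Z i j t) = 0"
    and mean_Y: "\<And>i t. 1 \<le> i \<Longrightarrow> expectation (Y i t) = 0"
    and moments_Z: "\<And>k :: nat. 1 \<le> k \<Longrightarrow> \<exists>C. \<forall>t. integrable M (\<lambda>\<omega>. cmod (Z 1 2 t \<omega>) ^ k) \<and>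
          expectation (\<lambda>\<omega>. cmod (Z 1 2 t \<omega>) ^ k) \<le> C"
    and moments_Y: "\<And>k :: nat. 1 \<le> k \<Longrightarrow> \<exists>C. \<forall>t. integrable M (\<lambda>\<omega>. \<bar>Y 1 t \<omega>\<bar> ^ k) \<and>
          expectation (\<lambda>\<omega>. \<bar>Y 1 t \<omega>\<bar> ^ k) \<le> C"
    and cov_nonneg: "\<And>s t. 0 \<le> wigner_cov M \<beta> Y s t"
    and cov_diag: "\<And>t. wigner_cov M \<beta> Y t t = 1"
    and real_symmetric: "\<beta> = 1 \<Longrightarrow>
          (\<forall>i j t. \<forall>\<omega>\<in>space M. 1 \<le> i \<and> i < j \<longrightarrow> Z i j t \<omega> \<in> \<real>) \<and>
          (\<forall>s t. expectation (\<lambda>\<omega>. Z 1 2 s \<omega> * Z 1 2 t \<omega>) = complex_of_real (wigner_cov M \<beta> Y s t)) \<and>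
          (\<forall>s t. expectation (\<lambda>\<omega>. (Z 1 2 s \<omega>)\<^sup>2 * (Z 1 2 t \<omega>)\<^sup>2) =
             complex_of_real (2 * (wigner_cov M \<beta> Y s t)\<^sup>2 + 1))"
    and hermitian: "\<beta> = 2 \<Longrightarrow>
          (\<forall>s t. expectation (\<lambda>\<omega>. Z 1 2 s \<omega> * Z 1 2 t \<omega>) = 0) \<and>
          (\<forall>s t. expectation (\<lambda>\<omega>. Z 1 2 s \<omega> * cnj (Z 1 2 t \<omega>)) = complex_of_real (wigner_cov M \<beta> Y s t)) \<and>
          (\<forall>s t. expectation (\<lambda>\<omega>. (cmod (Z 1 2 s \<omega>))\<^sup>2 * (cmod (Z 1 2 t \<omega>))\<^sup>2) =
             (wigner_cov M \<beta> Y s t)\<^sup>2 + 1)"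

definition wigner_submatrix ::
  "(nat \<Rightarrow> nat \<Rightarrow> real \<Rightarrow> 'a \<Rightarrow> complex) \<Rightarrow> (nat \<Rightarrow> real \<Rightarrow> 'a \<Rightarrow> real) \<Rightarrow>
    nat set \<Rightarrow> real \<Rightarrow> 'a \<Rightarrow> complex mat" where
  "wigner_submatrix Z Y B t \<omega> = mat (card B) (card B)
    (\<lambda>(a, b). wigner_entry Z Y (sorted_list_of_set B ! a) (sorted_list_of_set B ! b) t \<omega>)"

definition mat_trace :: "'a :: comm_monoid_add mat \<Rightarrow> 'a" where
  "mat_trace A = (\<Sum>i<dim_row A. A $$ (i, i))"

text \<open>The matrix is Hermitian, so the trace is real and taking the real part only changes the type.\<close>

definition trace_power ::
  "(nat \<Rightarrow> nat \<Rightarrow> real \<Rightarrow> 'a \<Rightarrow> complex) \<Rightarrow> (nat \<Rightarrow> real \<Rightarrow> 'a \<Rightarrow> real) \<Rightarrow>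
    nat set \<Rightarrow> real \<Rightarrow> nat \<Rightarrow> 'a \<Rightarrow> real" where
  "trace_power Z Y B t k \<omega> = Re (mat_trace (wigner_submatrix Z Y B t \<omega> ^\<^sub>m k))"

section \<open>Gaussian vectors and convergence\<close>

definition normal_law :: "real \<Rightarrow> real \<Rightarrow> real measure" where
  "normal_law \<mu> \<sigma> = (if \<sigma> = 0 then return borel \<mu> else density lborel (\<lambda>x. ennreal (normal_density \<mu> \<sigma> x)))"

text \<open>A random vector is Gaussian if all linear combinations of its coordinates are normal,
  possibly degenerate; the covariance is not required to be invertible.\<close>

definition gaussian_vector_law :: "(real ^ 'm) measure \<Rightarrow> bool" where
  "gaussian_vector_law N \<longleftrightarrow> prob_space N \<and> sets N = sets borel \<and>
    (\<forall>u. \<exists>\<mu> \<sigma>. 0 \<le> \<sigma> \<and> distr N borel (\<lambda>x. u \<bullet> x) = normal_law \<mu> \<sigma>)"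

definition converges_in_distribution ::
  "'a measure \<Rightarrow> ('l \<Rightarrow> 'a \<Rightarrow> 'b :: real_normed_vector) \<Rightarrow> 'b measure \<Rightarrow> 'l filter \<Rightarrow> bool" where
  "converges_in_distribution M V N F \<longleftrightarrow>
    (\<forall>\<^sub>F L in F. V L \<in> borel_measurable M) \<and>
    (\<forall>f :: 'b \<Rightarrow> real. continuous_on UNIV f \<and> bounded (range f) \<longrightarrow>
      ((\<lambda>L. \<integral>\<omega>. f (V L \<omega>) \<partial>M) \<longlongrightarrow> (\<integral>x. f x \<partial>N)) F)"

definition converges_with_all_moments ::
  "'a measure \<Rightarrow> ('l \<Rightarrow> 'a \<Rightarrow> real ^ 'm) \<Rightarrow> (real ^ 'm) measure \<Rightarrow> 'l filter \<Rightarrow> bool" where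
  "converges_with_all_moments M V N F \<longleftrightarrow>
    (\<forall>\<alpha> :: 'm \<Rightarrow> nat.
      (\<forall>\<^sub>F L in F. integrable M (\<lambda>\<omega>. \<Prod>p\<in>UNIV. (V L \<omega> $ p) ^ \<alpha> p)) \<and>
      integrable N (\<lambda>x. \<Prod>p\<in>UNIV. (x $ p) ^ \<alpha> p) \<and>
      ((\<lambda>L. \<integral>\<omega>. (\<Prod>p\<in>UNIV. (V L \<omega> $ p) ^ \<alpha> p) \<partial>M) \<longlongrightarrow>
        (\<integral>x. (\<Prod>p\<in>UNIV. (x $ p) ^ \<alpha> p) \<partial>N)) F)"

section \<open>Integrals over semicircles\<close>

definition xcoord :: "complex \<Rightarrow> real" where
  "xcoord z = 2 * Re z"

text \<open>The point \<open>z\<close> with \<open>\<bar>z\<bar>\<^sup>2 = b\<close>, \<open>Im z \<ge> 0\<close> and \<open>xcoord z = x\<close>, for \<open>\<bar>x\<bar> \<le> 2 \<surd>b\<close>.\<close>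

definition semicircle_point :: "real \<Rightarrow> real \<Rightarrow> complex" where
  "semicircle_point b x = Complex (x / 2) (sqrt (b - (x / 2)\<^sup>2))"

text \<open>The integral of \<open>f(z) (dx(z)/dz) dz\<close> over \<open>\<bar>z\<bar>\<^sup>2 = b\<close>, \<open>Im z > 0\<close>, oriented by increasing
  \<open>x(z)\<close>.\<close>

definition semicircle_integral :: "real \<Rightarrow> (complex \<Rightarrow> real) \<Rightarrow> real" where
  "semicircle_integral b f = (LINT x:{-2 * sqrt b..2 * sqrt b}|lborel. f (semicircle_point b x))"

text \<open>Here \<open>c\<close>, \<open>b\<close>, \<open>b'\<close>, \<open>d\<close> stand for \<open>c(t\<^sub>p, t\<^sub>q)\<close>, \<open>b\<^sub>p\<close>, \<open>b\<^sub>q\<close> and \<open>b\<^sub>p\<^sub>q\<close>. Where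
  the numerator or the denominator vanishes, the logarithm takes the value \<open>ln 0 = 0\<close> of HOL; this
  happens only on a null set.\<close>

definition limit_covariance :: "nat \<Rightarrow> real \<Rightarrow> nat \<Rightarrow> nat \<Rightarrow> real \<Rightarrow> real \<Rightarrow> real \<Rightarrow> real" where
  "limit_covariance \<beta> c k l b b' d = 2 * real k * real l / (real \<beta> * pi) *
    semicircle_integral b (\<lambda>z. semicircle_integral b' (\<lambda>w.
      xcoord z ^ (k - 1) * xcoord w ^ (l - 1) *
      (1 / (2 * pi) * ln (cmod ((complex_of_real (c * d) - z * w) / (complex_of_real (c * d) - z * cnj w))))))"

end

theory Submission
  imports Defs
begin

text \<open>
  The proof is by the method of moments. \<open>Tr X\<^sub>B\<^sup>k\<close> is a sum over closed words \<open>w\<close> of length \<open>k\<close> with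
  letters in \<open>B\<close>. Splitting each edge factor of \<open>w\<close> into mean and centred part gives terms indexed by the
  set \<open>F\<close> of edges with a centred factor. Cutting off leaves shows \<open>2 |w| \<le> k + |F|\<close>, where \<open>|\<cdot>|\<close>
  counts vertices, with equality only if \<open>F\<close> is the edge set of a cycle to which \<open>w\<close> attaches trees. A
  product of such terms has nonzero mean only if every edge of every \<open>F\<close> occurs in another \<open>F\<close>. Then the
  number of vertices is at most half the total length, and equality forces the words to form pairs. This
  is Wick's recursion for the moments of linear combinations, hence the limit is Gaussian.

  For the covariance, attaching \<open>j\<close> tree vertices to a cycle of length \<open>r = k - 2 j\<close> contributes
  \<open>(k choose j) b\<^sup>j\<close>, and two matching cycles contribute \<open>2 r / \<beta> * (c b\<^sub>p\<^sub>q)\<^sup>r\<close>. On the other side, with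
  \<open>z = \<surd>b\<^sub>p exp (\<i> \<theta>)\<close>, \<open>w = \<surd>b\<^sub>q exp (\<i> \<phi>)\<close> and \<open>\<rho> = c b\<^sub>p\<^sub>q / \<surd>(b\<^sub>p b\<^sub>q) \<le> 1\<close>, the logarithm equals
  \<open>2 \<Sum>\<^sub>n \<rho>\<^sup>n / n sin (n \<theta>) sin (n \<phi>)\<close>, and the integral of \<open>k x\<^sup>k\<^sup>-\<^sup>1 sin (n \<theta>)\<close> in \<open>x\<close> is
  \<open>n \<pi> b\<^sup>k\<^sup>/\<^sup>2 (k choose (k - n) / 2)\<close>, so both sides agree term by term.
\<close>

section \<open>Closed words and admissible edge sets\<close>

text \<open>Centring edge by edge, not word by word, turns the tree part of a word into a
  deterministic weight and leaves the randomness in \<open>F\<close>. Two terms with different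
  \<open>F\<close> are then uncorrelated, and the extremal terms can be found from vertex counts
  alone. A word may have several leaves, so cutting one is not a bijection; the count is refined by
  the number of leaves, and rotation invariance lets the cut leaf sit at a fixed position, which
  closes the recursion.

  All hypotheses on mixed moments serve one purpose: the covariances of a given
  \<open>r\<close>-cycle with all cycles on the same edges add up to
  \<open>2 * r / \<beta> * c ^ r\<close>. For \<open>r \<ge> 3\<close> these are the rotations of
  the word and of its reversal, and parallel traversal contributes only for
  \<open>\<beta> = 1\<close>. The normalization of the diagonal and the mixed fourth moment make the
  loop (\<open>r = 1\<close>) and the doubled edge (\<open>r = 2\<close>) obey the same law.

  Vertex numbers are integers, so a strict inequality costs at least half a power of
  \<open>L\<close>; odd total lengths, where equality is impossible, are covered by the same
  estimate.\<close>

definition edge :: "'v::linorder \<times> 'v \<Rightarrow> 'v \<times> 'v" where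
  "edge s = (min (fst s) (snd s), max (fst s) (snd s))"

text \<open>The pairing is cyclic, so a word of length 1 has the step \<open>(u, u)\<close>:
  diagonal entries appear as loops.\<close>

definition steps :: "'v list \<Rightarrow> ('v \<times> 'v) list" where
  "steps w = zip w (rotate1 w)"

definition edges_of :: "'v::linorder list \<Rightarrow> ('v \<times> 'v) set" where
  "edges_of w = edge ` set (steps w)"

definition verts :: "('v \<times> 'v) set \<Rightarrow> 'v set" where
  "verts F = fst ` F \<union> snd ` F"

text \<open>Write the factor of each edge of the closed word \<open>w\<close> as its mean plus its centred part and expand;
  \<open>F\<close> is the set of edges that contribute the centred part. Edges traversed once have mean zero
  and therefore lie in \<open>F\<close>.\<close>

definition admissible :: "'v::linorder list \<Rightarrow> ('v \<times> 'v) set \<Rightarrow> bool" where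
  "admissible w F \<longleftrightarrow> F \<subseteq> edges_of w \<and> F \<noteq> {} \<and>
     (\<forall>e. count_list (map edge (steps w)) e = 1 \<longrightarrow> e \<in> F)"

text \<open>A vertex visited once, in the form \<open>v, u, v\<close>, whose edge contributes its mean. That mean is
  \<open>E |Z|\<^sup>2 = 1\<close>, so deleting the leaf does not change the weight of \<open>(w, F)\<close>.\<close>

definition is_leaf :: "'v::linorder list \<Rightarrow> ('v \<times> 'v) set \<Rightarrow> nat \<Rightarrow> bool" where
  "is_leaf w F j \<longleftrightarrow> j < length w \<and> count_list w (w ! j) = 1 \<and>
     w ! ((j + length w - 1) mod length w) = w ! (Suc j mod length w) \<and>
     edge (w ! j, w ! (Suc j mod length w)) \<notin> F"

definition leaves :: "'v::linorder list \<Rightarrow> ('v \<times> 'v) set \<Rightarrow> nat set" where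
  "leaves w F = {j. is_leaf w F j}"

section \<open>Edges, cyclic steps and rotations of words\<close>

lemma edge_commute: "edge (u, v) = edge (v, u)"
  by (simp add: edge_def min.commute max.commute)

lemma edge_eq_iff: "edge (u, v) = edge (u', v') \<longleftrightarrow> u = u' \<and> v = v' \<or> u = v' \<and> v = u'"
  by (auto simp: edge_def min_def max_def split: if_splits)

lemma verts_edge: "verts (insert (edge (u, v)) F) = {u, v} \<union> verts F"
  by (auto simp: verts_def edge_def min_def max_def)

lemma verts_mono: "F \<subseteq> G \<Longrightarrow> verts F \<subseteq> verts G"
  by (auto simp: verts_def)

lemma verts_edgeD: "edge (u, v) \<in> F \<Longrightarrow> u \<in> verts F \<and> v \<in> verts F"
  using verts_edge[of u v F] by (auto simp: insert_absorb)

lemma verts_edgeE: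
  assumes "v \<in> verts F" obtains e where "e \<in> F" "v = fst e \<or> v = snd e"
  using assms by (auto simp: verts_def)

lemma finite_verts [simp]: "finite F \<Longrightarrow> finite (verts F)"
  by (simp add: verts_def)

lemma length_steps [simp]: "length (steps w) = length w"
  by (simp add: steps_def)

lemma nth_steps: "j < length w \<Longrightarrow> steps w ! j = (w ! j, w ! (Suc j mod length w))"
  by (simp add: steps_def nth_rotate1)

lemma set_steps: "set (steps w) = (\<lambda>j. (w ! j, w ! (Suc j mod length w))) ` {..<length w}"
proof -
  have "set (steps w) = (\<lambda>j. steps w ! j) ` {..<length w}"
    by (auto simp: set_conv_nth)
  then show ?thesis by (simp add: nth_steps)
qed

lemma edges_of_conv_nth:
  "edges_of w = (\<lambda>j. edge (w ! j, w ! (Suc j mod length w))) ` {..<length w}"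
  by (simp add: edges_of_def set_steps image_image)

lemma finite_edges_of [simp]: "finite (edges_of w)"
  by (simp add: edges_of_def)

lemma set_steps_subset: "set (steps w) \<subseteq> set w \<times> set w"
  by (auto simp: steps_def dest: set_zip_leftD set_zip_rightD)

lemma verts_edges_of: "verts (edges_of w) = set w"
proof
  show "verts (edges_of w) \<subseteq> set w"
    using set_steps_subset[of w]
    by (fastforce simp: verts_def edges_of_def edge_def min_def max_def)
  show "set w \<subseteq> verts (edges_of w)"
  proof
    fix v assume "v \<in> set w"
    then obtain j where j: "j < length w" "v = w ! j" by (auto simp: in_set_conv_nth)
    then have "edge (v, w ! (Suc j mod length w)) \<in> edges_of w"
      by (auto simp: edges_of_conv_nth)
    then show "v \<in> verts (edges_of w)" by (rule verts_edgeD[THEN conjunct1])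
  qed
qed

lemma steps_rotate: "steps (rotate n w) = rotate n (steps w)"
proof (rule nth_equalityI)
  fix i assume "i < length (steps (rotate n w))"
  then have i: "i < length w" by simp
  then have w: "0 < length w" by linarith
  show "steps (rotate n w) ! i = rotate n (steps w) ! i"
    using i w by (simp add: nth_steps nth_rotate mod_simps)
qed simp

lemma mset_rotate: "mset (rotate n xs) = mset xs"
proof (induction n)
  case (Suc n)
  have "mset (rotate1 ys) = mset ys" for ys :: "'a list" by (cases ys) auto
  then show ?case using Suc by simp
qed simp

lemma mset_steps_rotate: "mset (steps (rotate n w)) = mset (steps w)"
  by (simp add: steps_rotate mset_rotate)

lemma edges_of_rotate [simp]: "edges_of (rotate n w) = edges_of w"
  by (simp add: edges_of_def steps_rotate)

lemma count_list_mset: "count_list xs x = count (mset xs) x"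
  by (induction xs) auto

lemma count_list_map_mset: "count_list (map f xs) x = count (image_mset f (mset xs)) x"
  by (simp add: count_list_mset)

lemma admissible_rotate [simp]: "admissible (rotate n w) F = admissible w F"
  by (simp add: admissible_def count_list_map_mset mset_steps_rotate)

text \<open>The old closing step, from the last letter to \<open>hd w\<close>, survives as the step
  to the first appended letter. Only the excursion from \<open>hd w\<close> to \<open>x\<close> and
  back is new.\<close>

lemma steps_append_leaf:
  assumes "w \<noteq> []" shows "steps (w @ [hd w, x]) = steps w @ [(hd w, x), (x, hd w)]"
proof -
  obtain a v where w: "w = a # v" using assms by (cases w) auto
  have "steps (w @ [hd w, x]) = zip ((a # v) @ [a, x]) ((v @ [a]) @ [x, a])"
    by (simp add: w steps_def)
  also have "\<dots> = zip (a # v) (v @ [a]) @ zip [a, x] [x, a]" by (rule zip_append) simp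
  finally show ?thesis by (simp add: w steps_def)
qed

lemma edges_of_append_leaf:
  "w \<noteq> [] \<Longrightarrow> edges_of (w @ [hd w, x]) = insert (edge (hd w, x)) (edges_of w)"
  by (auto simp: edges_of_def steps_append_leaf edge_commute)

section \<open>Vertices visited once and words without leaves\<close>

lemma count_list_nth_eq_1:
  assumes "count_list w (w ! j) = 1" "j < length w" "i < length w" "w ! i = w ! j"
  shows "i = j"
proof (rule ccontr)
  assume "i \<noteq> j"
  then have "2 = card {i, j}" by simp
  also have "\<dots> \<le> card {m. m < length w \<and> w ! m = w ! j}"
    using assms by (intro card_mono) auto
  also have "\<dots> = count_list w (w ! j)"
    by (simp add: count_list_eq_length_filter length_filter_conv_card eq_commute)
  finally show False using assms(1) by simp
qed

lemma count_list_map_eq_card: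
  "count_list (map f xs) y = card {i. i < length xs \<and> f (xs ! i) = y}"
proof -
  have "count_list (map f xs) y = card {i. i < length (map f xs) \<and> y = map f xs ! i}"
    by (simp only: count_list_eq_length_filter length_filter_conv_card)
  also have "{i. i < length (map f xs) \<and> y = map f xs ! i} = {i. i < length xs \<and> f (xs ! i) = y}"
    by auto
  finally show ?thesis .
qed

lemma mod_pred_Suc:
  assumes "j < k" shows "Suc ((j + k - 1) mod k) mod k = (j::nat)"
proof -
  have "Suc ((j + k - 1) mod k) mod k = Suc (j + k - 1) mod k" by (simp add: mod_Suc_eq)
  then show ?thesis using assms by simp
qed

lemma mod_Suc_pred:
  assumes "i < k" "Suc i mod k = (j::nat)" shows "i = (j + k - 1) mod k"
proof (cases "Suc i = k")
  case True then show ?thesis using assms by auto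
next
  case False then show ?thesis using assms by auto
qed

text \<open>Since \<open>w ! j\<close> occurs only at position \<open>j\<close>, an edge at that
  vertex can be traversed only by the step into or out of \<open>j\<close>. These two steps use
  different edges because the neighbouring letters differ.\<close>

lemma simple_edge:
  fixes w :: "'v::linorder list"
  assumes j: "j < length w" and c1: "count_list w (w ! j) = 1"
    and ne: "w ! ((j + length w - 1) mod length w) \<noteq> w ! (Suc j mod length w)"
  shows "count_list (map edge (steps w)) (edge (w ! j, w ! (Suc j mod length w))) = 1"
    and "count_list (map edge (steps w)) (edge (w ! j, w ! ((j + length w - 1) mod length w))) = 1"
proof -
  define k where "k = length w"
  define p where "p = (j + k - 1) mod k"
  define s where "s = Suc j mod k"
  have "0 < k" using j unfolding k_def by linarith
  then have k: "0 < k" "p < k" "s < k" "j < k" using j by (simp_all add: k_def p_def s_def)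
  have sp: "Suc p mod k = j" unfolding p_def using k by (intro mod_pred_Suc)
  have ne': "w ! p \<noteq> w ! s" using ne by (simp add: p_def s_def k_def)
  have u: "i = j" if "i < k" "w ! i = w ! j" for i
    using count_list_nth_eq_1[OF c1 j] that by (simp add: k_def)
  have "{i. i < length (steps w) \<and> edge (steps w ! i) = edge (w ! j, w ! s)} = {j}"
  proof (intro equalityI subsetI)
    fix i assume "i \<in> {i. i < length (steps w) \<and> edge (steps w ! i) = edge (w ! j, w ! s)}"
    then have i: "i < k" and e: "edge (w ! i, w ! (Suc i mod k)) = edge (w ! j, w ! s)"
      by (auto simp: nth_steps k_def)
    from e consider "w ! i = w ! j" | "w ! i = w ! s" "w ! (Suc i mod k) = w ! j"
      by (auto simp: edge_eq_iff)
    then show "i \<in> {j}"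
    proof cases
      case 1 then show ?thesis using u i by simp
    next
      case 2
      then have "Suc i mod k = j" using u k by simp
      then have "i = p" using i mod_Suc_pred by (simp add: p_def)
      then show ?thesis using 2 ne' by simp
    qed
  qed (use k in \<open>auto simp: nth_steps k_def s_def\<close>)
  then show "count_list (map edge (steps w)) (edge (w ! j, w ! (Suc j mod length w))) = 1"
    by (simp add: count_list_map_eq_card s_def k_def)
  have "{i. i < length (steps w) \<and> edge (steps w ! i) = edge (w ! j, w ! p)} = {p}"
  proof (intro equalityI subsetI)
    fix i assume "i \<in> {i. i < length (steps w) \<and> edge (steps w ! i) = edge (w ! j, w ! p)}"
    then have i: "i < k" and e: "edge (w ! i, w ! (Suc i mod k)) = edge (w ! j, w ! p)"
      by (auto simp: nth_steps k_def)
    from e consider "w ! i = w ! j" "w ! (Suc i mod k) = w ! p" | "w ! (Suc i mod k) = w ! j"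
      by (auto simp: edge_eq_iff)
    then show "i \<in> {p}"
    proof cases
      case 1
      then have "i = j" using u i by simp
      then show ?thesis using 1 ne' by (simp add: s_def)
    next
      case 2
      then have "Suc i mod k = j" using u k by simp
      then show ?thesis using i mod_Suc_pred by (simp add: p_def)
    qed
  qed (use k sp in \<open>auto simp: nth_steps k_def edge_commute\<close>)
  then show "count_list (map edge (steps w)) (edge (w ! j, w ! ((j + length w - 1) mod length w))) = 1"
    by (simp add: count_list_map_eq_card p_def k_def)
qed

text \<open>If the two neighbours agree, the only way to fail to be a leaf is that the edge lies in
  \<open>F\<close>. If they differ, the edge is traversed once and admissibility puts it into
  \<open>F\<close>.\<close>

lemma no_leaf_neighbour:
  fixes w :: "'v::linorder list"
  assumes adm: "admissible w F" and nl: "\<not> is_leaf w F j"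
    and j: "j < length w" and c1: "count_list w (w ! j) = 1"
  shows "edge (w ! j, w ! (Suc j mod length w)) \<in> F"
proof (cases "w ! ((j + length w - 1) mod length w) = w ! (Suc j mod length w)")
  case True
  then show ?thesis using nl j c1 by (auto simp: is_leaf_def)
next
  case False
  then show ?thesis using simple_edge(1)[OF j c1 False] adm unfolding admissible_def by blast
qed

text \<open>The multiplicities of the letters sum to the length; they are at least 1 on
  \<open>W\<close> and at least 2 off it. Equality of the sums is equality in every term.\<close>

lemma length_ge_counts:
  assumes "finite W" "\<And>v. v \<in> set w \<Longrightarrow> count_list w v = 1 \<Longrightarrow> v \<in> W" "W \<subseteq> set w"
  shows "2 * card (set w) \<le> length w + card W"
    and "2 * card (set w) = length w + card W \<Longrightarrow> v \<in> W \<Longrightarrow> count_list w v = 1"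
proof -
  define g where "g v = (if v \<in> W then 1 else 2::nat)" for v
  have le: "g v \<le> count_list w v" if "v \<in> set w" for v
  proof -
    have "count_list w v \<noteq> 0" using that by (simp add: count_list_0_iff)
    then show ?thesis using assms(2)[OF that] by (cases "count_list w v = 1") (auto simp: g_def)
  qed
  have "sum g (set w) = sum g W + sum g (set w - W)"
    using assms(1,3) by (metis List.finite_set add.commute sum.subset_diff)
  also have "\<dots> = card W + 2 * card (set w - W)" by (simp add: g_def)
  also have "card (set w - W) = card (set w) - card W" using assms by (simp add: card_Diff_subset)
  finally have s: "sum g (set w) + card W = 2 * card (set w)"
    using card_mono[OF _ assms(3)] by simp
  have l: "sum (count_list w) (set w) = length w" by (rule sum_count_set) auto
  have "sum g (set w) \<le> length w" using sum_mono[of "set w" g "count_list w"] le l by simp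
  then show "2 * card (set w) \<le> length w + card W" using s by simp
  assume "2 * card (set w) = length w + card W" and v: "v \<in> W"
  then have eq: "sum g (set w) = sum (count_list w) (set w)" using s l by simp
  show "count_list w v = 1"
  proof (rule ccontr)
    assume "count_list w v \<noteq> 1"
    then have "g v < count_list w v" using le[of v] v assms(3) by (auto simp: g_def)
    then have "sum g (set w) < sum (count_list w) (set w)"
      using v assms(3) le by (intro sum_strict_mono_ex1) auto
    then show False using eq by simp
  qed
qed

lemma admissible_verts: "admissible w F \<Longrightarrow> verts F \<subseteq> set w"
  using verts_mono[of F "edges_of w"] by (auto simp: admissible_def verts_edges_of)

lemma admissible_finite: "admissible w F \<Longrightarrow> finite F"
  using finite_subset[OF _ finite_edges_of] unfolding admissible_def by blast

text \<open>A letter visited once lies in \<open>verts F\<close> by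
  \<open>no_leaf_neighbour\<close>, so \<open>length_ge_counts\<close> applies with
  \<open>W = verts F\<close>. In the case of equality the vertices of \<open>F\<close> are visited
  once, and following the word from one of them never leaves \<open>F\<close>.\<close>

lemma no_leaf:
  fixes w :: "'v::linorder list"
  assumes adm: "admissible w F" and nl: "leaves w F = {}"
  shows "2 * card (set w) \<le> length w + card (verts F)"
    and "2 * card (set w) = length w + card (verts F) \<Longrightarrow> distinct w \<and> F = edges_of w"
proof -
  have nl': "\<not> is_leaf w F j" for j using nl by (auto simp: leaves_def)
  have V: "verts F \<subseteq> set w" "finite (verts F)"
    using adm by (auto simp: admissible_verts admissible_finite)
  have c: "v \<in> verts F" if v: "v \<in> set w" "count_list w v = 1" for v
  proof -
    obtain j where j: "j < length w" "v = w ! j" using v(1) by (auto simp: in_set_conv_nth)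
    show ?thesis using no_leaf_neighbour[OF adm nl' j(1)] v j(2) verts_edgeD by auto
  qed
  show "2 * card (set w) \<le> length w + card (verts F)"
    by (rule length_ge_counts(1)[OF V(2) c V(1)])
  assume eq: "2 * card (set w) = length w + card (verts F)"
  have c1: "count_list w v = 1" if "v \<in> verts F" for v
    by (rule length_ge_counts(2)[OF V(2) c V(1) eq that])
  obtain e where "e \<in> F" using adm by (auto simp: admissible_def)
  then obtain j0 where j0: "j0 < length w" "w ! j0 \<in> verts F"
    using V(1) by (metis UnI1 imageI in_set_conv_nth subset_eq verts_def)
  \<comment> \<open>Membership in \<open>verts F\<close> passes from a position to the next one,
    hence round the whole word.\<close>
  have st: "edge (w ! j, w ! (Suc j mod length w)) \<in> F \<and> w ! (Suc j mod length w) \<in> verts F"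
    if "j < length w" "w ! j \<in> verts F" for j
    using no_leaf_neighbour[OF adm nl' that(1) c1[OF that(2)]] verts_edgeD by blast
  have all: "w ! ((j0 + n) mod length w) \<in> verts F" for n
  proof (induction n)
    case (Suc n)
    have "(j0 + n) mod length w < length w" using j0 by (intro mod_less_divisor) linarith
    then show ?case using st[of "(j0 + n) mod length w"] Suc by (simp add: mod_Suc_eq)
  qed (use j0 in simp)
  have all': "w ! j \<in> verts F" if "j < length w" for j
  proof -
    \<comment> \<open>Adding \<open>length w\<close> first keeps the natural subtraction from
      truncating when \<open>j < j0\<close>.\<close>
    have "(j0 + (j + length w - j0)) mod length w = j" using that j0 by simp
    then show ?thesis using all[of "j + length w - j0"] by simp
  qed
  have "distinct w"
    unfolding distinct_conv_nth
  proof (intro allI impI)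
    fix i j assume "i < length w" "j < length w" "i \<noteq> j"
    then show "w ! i \<noteq> w ! j"
      using count_list_nth_eq_1[OF c1[OF all'], of j i] by auto
  qed
  moreover have "edges_of w \<subseteq> F"
    using st all' by (auto simp: edges_of_conv_nth)
  ultimately show "distinct w \<and> F = edges_of w"
    using adm by (auto simp: admissible_def)
qed

section \<open>Leaves under rotation; cutting and attaching a leaf\<close>

lemma is_leaf_rotate1:
  assumes "j < length w"
  shows "is_leaf (rotate1 w) F j \<longleftrightarrow> is_leaf w F (Suc j mod length w)"
proof -
  define k where "k = length w"
  have k: "0 < k" "j < k" using assms unfolding k_def by linarith+
  have *: "(Suc j mod k + k - 1) mod k = Suc ((j + k - 1) mod k) mod k"
    using k mod_pred_Suc[of j k] by (cases "Suc j = k") auto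
  have lt: "(j + k - 1) mod k < k" "Suc j mod k < k" using k by simp_all
  have "is_leaf (rotate1 w) F j \<longleftrightarrow> count_list w (w ! (Suc j mod k)) = 1 \<and>
      w ! (Suc ((j + k - 1) mod k) mod k) = w ! (Suc (Suc j mod k) mod k) \<and>
      edge (w ! (Suc j mod k), w ! (Suc (Suc j mod k) mod k)) \<notin> F"
    using k lt mset_rotate[of 1 w]
    by (simp add: is_leaf_def nth_rotate1 k_def[symmetric] count_list_mset)
  also have "\<dots> \<longleftrightarrow> is_leaf w F (Suc j mod k)"
    using lt by (simp only: is_leaf_def k_def[symmetric] *) simp
  finally show ?thesis by (simp add: k_def)
qed

lemma is_leaf_rotate:
  "j < length w \<Longrightarrow> is_leaf (rotate m w) F j \<longleftrightarrow> is_leaf w F ((m + j) mod length w)"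
proof (induction m arbitrary: j)
  case (Suc m)
  have "is_leaf (rotate (Suc m) w) F j \<longleftrightarrow> is_leaf (rotate m w) F (Suc j mod length w)"
    using Suc.prems by (simp add: is_leaf_rotate1)
  also have "\<dots> \<longleftrightarrow> is_leaf w F ((m + Suc j mod length w) mod length w)"
    using Suc.prems by (intro Suc.IH mod_less_divisor) linarith
  finally show ?case by (simp add: mod_simps)
qed simp

lemma bij_betw_Suc_mod: "bij_betw (\<lambda>j. Suc j mod k) {..<k} {..<k}"
proof (rule bij_betwI[where g = "\<lambda>j. (j + k - 1) mod k"])
  show "(\<lambda>j. Suc j mod k) \<in> {..<k} \<rightarrow> {..<k}" by (auto intro!: mod_less_divisor)
  show "(\<lambda>j. (j + k - 1) mod k) \<in> {..<k} \<rightarrow> {..<k}" by (auto intro!: mod_less_divisor)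
  show "(Suc j mod k + k - 1) mod k = j" if "j \<in> {..<k}" for j
    using mod_Suc_pred[of j k "Suc j mod k"] that by simp
  show "Suc ((j + k - 1) mod k) mod k = j" if "j \<in> {..<k}" for j
    using mod_pred_Suc that by simp
qed

lemma leaves_subset: "leaves w F \<subseteq> {..<length w}"
  by (auto simp: leaves_def is_leaf_def)

lemma finite_leaves [simp]: "finite (leaves w F)"
  using leaves_subset finite_subset by blast

lemma card_leaves_rotate1: "card (leaves (rotate1 w) F) = card (leaves w F)"
proof -
  have "bij_betw (\<lambda>j. Suc j mod length w) (leaves (rotate1 w) F) (leaves w F)"
  proof (rule bij_betw_subset[OF bij_betw_Suc_mod[of "length w"]])
    show a: "leaves (rotate1 w) F \<subseteq> {..<length w}" using leaves_subset[of "rotate1 w" F] by simp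
    show "(\<lambda>j. Suc j mod length w) ` leaves (rotate1 w) F = leaves w F"
    proof
      show "(\<lambda>j. Suc j mod length w) ` leaves (rotate1 w) F \<subseteq> leaves w F"
        using a is_leaf_rotate1[of _ w F] by (auto simp: leaves_def)
      show "leaves w F \<subseteq> (\<lambda>j. Suc j mod length w) ` leaves (rotate1 w) F"
      proof
        fix i assume i: "i \<in> leaves w F"
        then have "i \<in> (\<lambda>j. Suc j mod length w) ` {..<length w}"
          using bij_betw_Suc_mod[of "length w"] leaves_subset[of w F] by (auto simp: bij_betw_def)
        then obtain j where "j < length w" "i = Suc j mod length w" by auto
        then show "i \<in> (\<lambda>j. Suc j mod length w) ` leaves (rotate1 w) F"
          using i is_leaf_rotate1[of j w F] by (auto simp: leaves_def)
      qed
    qed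
  qed
  then show ?thesis by (rule bij_betw_same_card)
qed

text \<open>The new edge is fresh and is traversed twice, so the edges of multiplicity one stay the
  same.\<close>

lemma admissible_append_leaf:
  assumes "w \<noteq> []" "x \<notin> set w" "edge (hd w, x) \<notin> F"
  shows "admissible (w @ [hd w, x]) F \<longleftrightarrow> admissible w F"
proof -
  have e: "edge (hd w, x) \<notin> edges_of w"
    using assms verts_edgeD[of "hd w" x "edges_of w"] by (auto simp: verts_edges_of)
  then have 0: "count_list (map edge (steps w)) (edge (hd w, x)) = 0"
    by (auto simp: edges_of_def count_list_0_iff)
  have "count_list (map edge (steps (w @ [hd w, x]))) e = 1 \<longleftrightarrow> count_list (map edge (steps w)) e = 1"
    for e using assms 0
    by (cases "e = edge (hd w, x)") (auto simp: steps_append_leaf edge_commute[of x])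
  then show ?thesis
    unfolding admissible_def edges_of_append_leaf[OF assms(1)] using assms(3) by blast
qed

lemma admissible_new_edge:
  "admissible w F \<Longrightarrow> x \<notin> set w \<Longrightarrow> edge (u, x) \<notin> F"
  using verts_edgeD[of u x F] admissible_verts[of w F] by auto

text \<open>A word of length at most 2 has at most one edge. With a leaf on it that edge lies
  outside \<open>F\<close>, and \<open>F\<close> would be empty.\<close>

lemma leaf_length_ge_3:
  assumes adm: "admissible w F" and leaf: "is_leaf w F j"
  shows "3 \<le> length w"
proof (rule ccontr)
  assume "\<not> 3 \<le> length w"
  then consider "length w = 0" | "length w = 1" | "length w = 2" by linarith
  then have "edges_of w \<subseteq> {edge (w ! j, w ! (Suc j mod length w))}"
  proof cases
    case 1 then show ?thesis by (simp add: edges_of_conv_nth)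
  next
    case 2
    then have "j = 0" using leaf by (simp add: is_leaf_def)
    then show ?thesis using 2 by (simp add: edges_of_conv_nth lessThan_Suc)
  next
    case 3
    then have "j = 0 \<or> j = 1" using leaf by (auto simp: is_leaf_def)
    then show ?thesis using 3
      by (auto simp: edges_of_conv_nth lessThan_Suc numeral_2_eq_2 edge_commute)
  qed
  then show False using adm leaf by (auto simp: admissible_def is_leaf_def)
qed

text \<open>The neighbours of the last position are the last but one letter and the first letter;
  since they agree, the word without its last two letters is again closed at
  \<open>hd w'\<close>.\<close>

lemma last_leafE:
  assumes adm: "admissible w F" and leaf: "is_leaf w F (length w - 1)"
  obtains w' x where "w = w' @ [hd w', x]" "w' \<noteq> []" "x \<notin> set w'" "edge (hd w', x) \<notin> F"
    "admissible w' F"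
proof -
  define k where "k = length w"
  have k: "3 \<le> k" using leaf_length_ge_3[OF adm leaf] by (simp add: k_def)
  define w' where "w' = take (k - 2) w"
  have ne: "w' \<noteq> []" using k by (auto simp: w'_def k_def)
  have hd: "hd w' = w ! 0" using ne k by (simp add: hd_conv_nth w'_def)
  have "(k - 1 + k - 1) mod k = k - 2"
  proof -
    have "k - 1 + k - 1 = k - 2 + k" using k by linarith
    then have "(k - 1 + k - 1) mod k = (k - 2) mod k" by (metis mod_add_self2)
    then show ?thesis using k by simp
  qed
  then have eq: "w ! (k - 2) = w ! 0" and c1: "count_list w (w ! (k - 1)) = 1"
    and e: "edge (w ! (k - 1), w ! 0) \<notin> F"
    using leaf k unfolding is_leaf_def k_def[symmetric] by simp_all
  have w: "w = w' @ [hd w', w ! (k - 1)]"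
  proof (rule nth_equalityI)
    show "length w = length (w' @ [hd w', w ! (k - 1)])" using k by (simp add: w'_def k_def)
    fix i assume "i < length w"
    then consider "i < k - 2" | "i = k - 2" | "i = k - 1" unfolding k_def by linarith
    then show "w ! i = (w' @ [hd w', w ! (k - 1)]) ! i"
    proof cases
      case 1 then show ?thesis by (simp add: w'_def nth_append k_def)
    next
      case 2 then show ?thesis using eq hd k by (simp add: w'_def nth_append k_def)
    next
      case 3
      then have "i - length w' = 1" "\<not> i < length w'" using k by (auto simp: w'_def k_def)
      then show ?thesis using 3 by (simp add: nth_append)
    qed
  qed
  have x: "w ! (k - 1) \<notin> set w'"
  proof
    assume "w ! (k - 1) \<in> set w'"
    then have "0 < count_list w' (w ! (k - 1))" by (meson count_list_0_iff gr_zeroI)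
    moreover have "count_list w (w ! (k - 1)) =
        count_list w' (w ! (k - 1)) + count_list [hd w', w ! (k - 1)] (w ! (k - 1))"
      by (subst (1) w) (simp only: count_list_append)
    ultimately show False using c1 by (simp split: if_splits)
  qed
  have e': "edge (hd w', w ! (k - 1)) \<notin> F" using e edge_commute[of "w ! 0"] by (simp add: hd)
  show ?thesis
    using that[OF w ne x e'] admissible_append_leaf[OF ne x e'] w adm by simp
qed

text \<open>Rotation by \<open>Suc j\<close> moves position \<open>j\<close> to the end, where
  \<open>last_leafE\<close> applies.\<close>

lemma leafE:
  assumes adm: "admissible w F" and leaf: "is_leaf w F j"
  obtains w' x where "rotate (Suc j) w = w' @ [hd w', x]" "w' \<noteq> []" "x \<notin> set w'"
    "edge (hd w', x) \<notin> F" "admissible w' F"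
proof -
  have j: "j < length w" using leaf by (simp add: is_leaf_def)
  have "(Suc j + (length w - 1)) mod length w = (j + length w) mod length w"
    using j by (intro arg_cong2[where f = "(mod)"]) auto
  then have "is_leaf (rotate (Suc j) w) F (length (rotate (Suc j) w) - 1)"
    using is_leaf_rotate[of "length w - 1" w "Suc j" F] j leaf by simp
  from last_leafE[OF _ this] that show ?thesis using adm by (metis admissible_rotate)
qed

text \<open>Equality in \<open>admissible_order\<close>: a power counting shows that only these pairs survive in the limit.\<close>

definition good :: "'v::linorder list \<Rightarrow> ('v \<times> 'v) set \<Rightarrow> bool" where
  "good w F \<longleftrightarrow> admissible w F \<and> 2 * card (set w) = length w + card (verts F)"

lemma card_set_append_leaf:
  assumes "w \<noteq> []" "x \<notin> set w" shows "card (set (w @ [hd w, x])) = Suc (card (set w))"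
proof -
  have "set (w @ [hd w, x]) = insert x (set w)" using assms(1) by auto
  then show ?thesis using assms(2) by simp
qed

lemma good_rotate [simp]: "good (rotate n w) F = good w F"
  by (simp add: good_def)

lemma good_append_leaf:
  assumes "w \<noteq> []" "x \<notin> set w" "edge (hd w, x) \<notin> F"
  shows "good (w @ [hd w, x]) F \<longleftrightarrow> good w F"
  using admissible_append_leaf[OF assms] card_set_append_leaf[OF assms(1,2)]
  by (auto simp: good_def)

text \<open>Cutting a leaf lowers both sides by 2: one vertex and two letters go, and
  \<open>F\<close> stays.\<close>

lemma admissible_order:
  "admissible w F \<Longrightarrow> 2 * card (set w) \<le> length w + card (verts F)"
proof (induction "length w" arbitrary: w rule: less_induct)
  case less
  show ?case
  proof (cases "leaves w F = {}")
    case True then show ?thesis using no_leaf(1) less.prems by blast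
  next
    case False
    then obtain j where "is_leaf w F j" by (auto simp: leaves_def)
    then obtain w' x where w': "rotate (Suc j) w = w' @ [hd w', x]" "w' \<noteq> []" "x \<notin> set w'"
      "admissible w' F" using leafE[OF less.prems] by metis
    have l: "length w = length w' + 2"
      using arg_cong[OF w'(1), of length] by simp
    have "card (set w) = Suc (card (set w'))"
      using card_set_append_leaf[OF w'(2,3)] arg_cong[OF w'(1), of set] by simp
    then show ?thesis using less.hyps[of w'] w'(4) l by simp
  qed
qed

text \<open>\<open>c\<close> is what remains when leaves are cut until none is left. Each cut
  preserves goodness and takes two letters, which gives the parity.\<close>

lemma good_core:
  "good w F \<Longrightarrow> \<exists>c. distinct c \<and> F = edges_of c \<and> set c \<subseteq> set w \<and> length c \<le> length w \<and>
     even (length w - length c)"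
proof (induction "length w" arbitrary: w rule: less_induct)
  case less
  then have adm: "admissible w F" by (simp add: good_def)
  show ?case
  proof (cases "leaves w F = {}")
    case True
    then show ?thesis using no_leaf(2)[OF adm] less.prems by (intro exI[of _ w]) (auto simp: good_def)
  next
    case False
    then obtain j where "is_leaf w F j" by (auto simp: leaves_def)
    then obtain w' x where w': "rotate (Suc j) w = w' @ [hd w', x]" "w' \<noteq> []" "x \<notin> set w'"
      "edge (hd w', x) \<notin> F" "admissible w' F" using leafE[OF adm] by metis
    have l: "length w = length w' + 2" using arg_cong[OF w'(1), of length] by simp
    have "good (rotate (Suc j) w) F" using less.prems by (simp only: good_rotate)
    then have "good w' F" using good_append_leaf[OF w'(2-4)] w'(1) by simp
    from less.hyps[OF _ this] l obtain c where
      c: "distinct c" "F = edges_of c" "set c \<subseteq> set w'" "length c \<le> length w'" "even (length w' - length c)"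
      by auto
    have "set w' \<subseteq> set w" using arg_cong[OF w'(1), of set] by auto
    moreover have "even (length w - length c)" using c(4,5) l by simp
    ultimately show ?thesis using c l by (intro exI[of _ c]) auto
  qed
qed

text \<open>The excursion starts at \<open>hd w\<close>, which is thereby visited again, so position
  0 can no longer be a leaf. At every other old position the multiplicity and the neighbouring
  letters are unchanged.\<close>

lemma leaves_append_leaf:
  assumes adm: "admissible w F" and x: "x \<notin> set w"
  shows "leaves (w @ [hd w, x]) F = insert (Suc (length w)) (leaves w F - {0})"
proof -
  have ne: "w \<noteq> []" using adm by (auto simp: admissible_def edges_of_def steps_def)
  define k where "k = length w"
  have k: "0 < k" using ne by (simp add: k_def)
  define W where "W = w @ [hd w, x]"
  have lW: "length W = k + 2" by (simp add: W_def k_def)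
  have W0: "W ! 0 = w ! 0" and Wk: "W ! k = w ! 0" and Wk1: "W ! Suc k = x"
    using ne by (simp_all add: W_def k_def nth_append hd_conv_nth)
  have Wj: "W ! j = w ! j" if "j < k" for j using that by (simp add: W_def k_def nth_append)
  have cW: "count_list W v = count_list w v + (if w ! 0 = v then 1 else 0) + (if x = v then 1 else 0)"
    for v using ne by (simp add: W_def hd_conv_nth)
  have w0: "1 \<le> count_list w (w ! 0)"
    using k by (metis One_nat_def Suc_leI count_list_0_iff gr_zeroI k_def nth_mem)
  have xw: "x \<noteq> w ! 0" "count_list w x = 0" using x k by (auto simp: k_def count_list_0_iff)
  have "is_leaf W F j \<longleftrightarrow> j = Suc k \<or> (j \<noteq> 0 \<and> is_leaf w F j)" for j
  proof -
    consider "j = 0 \<or> j = k" | "j = Suc k" | "0 < j" "j < k" | "k + 2 \<le> j" by linarith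
    then show ?thesis
    proof cases
      case 1
      then have "W ! j = w ! 0" using W0 Wk by auto
      then have "\<not> is_leaf W F j" using cW[of "w ! 0"] w0 by (simp add: is_leaf_def)
      then show ?thesis using 1 k by (auto simp: is_leaf_def k_def)
    next
      case 2
      have "(Suc k + (k + 2) - 1) mod (k + 2) = k"
      proof -
        have "Suc k + (k + 2) - 1 = k + (k + 2)" by simp
        then have "(Suc k + (k + 2) - 1) mod (k + 2) = k mod (k + 2)" by (metis mod_add_self2)
        then show ?thesis by simp
      qed
      moreover have "edge (x, w ! 0) \<notin> F"
        using admissible_new_edge[OF adm x] by (simp add: edge_commute[of x])
      ultimately show ?thesis using 2 cW[of x] xw Wk Wk1 W0
        by (auto simp: is_leaf_def lW)
    next
      case 3
      have p: "(j + (k + 2) - 1) mod (k + 2) = j - 1" "(j + k - 1) mod k = j - 1"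
      proof -
        have "j + (k + 2) - 1 = j - 1 + (k + 2)" "j + k - 1 = j - 1 + k" using 3 by auto
        then have "(j + (k + 2) - 1) mod (k + 2) = (j - 1) mod (k + 2)" "(j + k - 1) mod k = (j - 1) mod k"
          by (metis mod_add_self2)+
        then show "(j + (k + 2) - 1) mod (k + 2) = j - 1" "(j + k - 1) mod k = j - 1"
          using 3 by simp_all
      qed
      \<comment> \<open>The last old position is now followed by position \<open>k\<close> instead
        of 0, but both carry the letter \<open>hd w\<close>.\<close>
      have s: "W ! (Suc j mod (k + 2)) = w ! (Suc j mod k)"
        using 3 Wk Wj by (cases "Suc j = k") auto
      have xj: "x \<noteq> w ! j" using x 3 by (auto simp: k_def)
      have c: "count_list W (w ! j) = 1 \<longleftrightarrow> count_list w (w ! j) = 1"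
      proof
        assume a: "count_list w (w ! j) = 1"
        have "w ! 0 \<noteq> w ! j"
          using count_list_nth_eq_1[OF a, of 0] 3 ne by (auto simp: k_def)
        then show "count_list W (w ! j) = 1" using a xj by (simp add: cW)
      next
        assume a: "count_list W (w ! j) = 1"
        have "count_list w (w ! j) \<noteq> 0" using 3 by (auto simp: count_list_0_iff k_def)
        then show "count_list w (w ! j) = 1" using a by (simp add: cW split: if_splits)
      qed
      show ?thesis
        using 3 c s p Wj[of j] Wj[of "j - 1"] by (simp add: is_leaf_def lW k_def[symmetric])
    next
      case 4
      then show ?thesis by (auto simp: is_leaf_def lW k_def[symmetric])
    qed
  qed
  then show ?thesis by (auto simp: leaves_def W_def k_def)
qed

section \<open>Weighted count of the extremal pairs\<close>

definition words :: "nat \<Rightarrow> 'v set \<Rightarrow> 'v list set" where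
  "words k B = {w. set w \<subseteq> B \<and> length w = k}"

definition cycles :: "nat \<Rightarrow> 'v set \<Rightarrow> 'v list set" where
  "cycles r B = {w. set w \<subseteq> B \<and> length w = r \<and> distinct w}"

text \<open>\<open>r\<close> is the length of the core cycle: by \<open>good_core\<close>,
  \<open>F\<close> is the edge set of a cycle, and its vertices number as many as the cycle's
  letters.\<close>

definition goods :: "nat \<Rightarrow> nat \<Rightarrow> 'v::linorder set \<Rightarrow> ('v list \<times> ('v \<times> 'v) set) set" where
  "goods k r B = {(w, F). w \<in> words k B \<and> good w F \<and> card (verts F) = r}"

lemma finite_words [simp]: "finite B \<Longrightarrow> finite (words k B)"
  by (simp add: words_def finite_lists_length_eq)

lemma finite_goods [simp]:
  assumes "finite B" shows "finite (goods k r B)"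
proof (rule finite_subset)
  show "goods k r B \<subseteq> Sigma (words k B) (\<lambda>w. Pow (edges_of w))"
    by (auto simp: goods_def good_def admissible_def)
  show "finite (Sigma (words k B) (\<lambda>w. Pow (edges_of w)))"
    using assms by (intro finite_SigmaI) auto
qed

lemma goods_admissible: "(w, F) \<in> goods k r B \<Longrightarrow> admissible w F"
  by (simp add: goods_def good_def)

lemma goods_card: "(w, F) \<in> goods k r B \<Longrightarrow> 2 * card (set w) = k + r"
  by (simp add: goods_def good_def words_def)

lemma goods_lengthE:
  assumes "(w, F) \<in> goods k r B" obtains j where "k = r + 2 * j" "1 \<le> r"
proof -
  obtain c where c: "distinct c" "F = edges_of c" "length c \<le> length w" "even (length w - length c)"
    using good_core[of w F] assms by (auto simp: goods_def)
  have r: "length c = r" using assms c by (simp add: goods_def verts_edges_of distinct_card)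
  have "F \<noteq> {}" using goods_admissible[OF assms] by (simp add: admissible_def)
  then have "c \<noteq> []" using c by (auto simp: edges_of_def steps_def)
  then have "1 \<le> r" using r by (cases c) auto
  moreover obtain j where "length w - length c = 2 * j" using c(4) by (elim evenE)
  then have "k = r + 2 * j" using c(3) r assms by (auto simp: goods_def words_def)
  ultimately show ?thesis using that by blast
qed

text \<open>For \<open>k = r\<close> the vertex count equals the length, so all letters differ. A
  leaf would need the letter \<open>hd w'\<close> on both of its sides.\<close>

lemma goods_diagonal:
  assumes r: "1 \<le> r"
  shows "goods r r B = (\<lambda>w. (w, edges_of w)) ` cycles r B"
    and "x \<in> goods r r B \<Longrightarrow> leaves (fst x) (snd x) = {}"
proof -
  have *: "distinct w \<and> F = edges_of w \<and> leaves w F = {}" if g: "(w, F) \<in> goods r r B" for w F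
  proof -
    have adm: "admissible w F" using goods_admissible[OF g] .
    have len: "length w = r" using g by (simp add: goods_def words_def)
    have "card (set w) = r" using goods_card[OF g] by simp
    then have d: "distinct w" using len by (simp add: card_distinct)
    have nl: "leaves w F = {}"
    proof (rule ccontr)
      assume "leaves w F \<noteq> {}"
      then obtain j where "is_leaf w F j" by (auto simp: leaves_def)
      then obtain w' x where w': "rotate (Suc j) w = w' @ [hd w', x]" "w' \<noteq> []"
        using leafE[OF adm] by metis
      have "distinct (rotate (Suc j) w)" using d by (simp only: distinct_rotate)
      then have "hd w' \<notin> set w'" unfolding w'(1) by simp
      then show False using w'(2) by simp
    qed
    show ?thesis using no_leaf(2)[OF adm nl] g nl by (simp add: goods_def good_def)
  qed
  show "x \<in> goods r r B \<Longrightarrow> leaves (fst x) (snd x) = {}"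
    using * by (cases x) auto
  show "goods r r B = (\<lambda>w. (w, edges_of w)) ` cycles r B"
  proof (intro equalityI subsetI)
    fix x assume x: "x \<in> goods r r B"
    obtain w F where "x = (w, F)" by (cases x)
    then show "x \<in> (\<lambda>w. (w, edges_of w)) ` cycles r B"
      using *[of w F] x by (auto simp: cycles_def goods_def words_def)
  next
    fix x assume "x \<in> (\<lambda>w. (w, edges_of w)) ` cycles r B"
    then obtain w where w: "x = (w, edges_of w)" "set w \<subseteq> B" "length w = r" "distinct w"
      by (auto simp: cycles_def)
    have "edge (w ! 0, w ! (Suc 0 mod length w)) \<in> edges_of w"
      unfolding edges_of_conv_nth by (rule image_eqI[of _ _ 0]) (use w r in auto)
    moreover have "e \<in> edges_of w" if "count_list (map edge (steps w)) e = 1" for e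
    proof -
      have "e \<in> set (map edge (steps w))" using that count_notin[of e "map edge (steps w)"] by force
      then show ?thesis by (simp add: edges_of_def)
    qed
    ultimately have "admissible w (edges_of w)" unfolding admissible_def by blast
    then show "x \<in> goods r r B"
      using w by (simp add: goods_def good_def words_def verts_edges_of distinct_card)
  qed
qed

lemma no_leaf_goods:
  assumes "(w, F) \<in> goods k r B" "leaves w F = {}" shows "k = r"
proof -
  have "distinct w \<and> F = edges_of w"
    using no_leaf(2)[OF goods_admissible[OF assms(1)] assms(2)] assms(1) by (simp add: goods_def good_def)
  then show ?thesis using assms(1)
    by (simp add: goods_def words_def verts_edges_of distinct_card)
qed

lemma inj_rotate1: "inj rotate1"
proof (rule injI)
  fix xs ys :: "'a list" assume "rotate1 xs = rotate1 ys"
  then show "xs = ys" by (cases xs; cases ys) auto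
qed

lemma rotate1_goods:
  assumes B: "finite B"
  shows "bij_betw (\<lambda>(w, F). (rotate1 w, F)) {x \<in> goods k r B. card (leaves (fst x) (snd x)) = l}
     {x \<in> goods k r B. card (leaves (fst x) (snd x)) = l}" (is "bij_betw ?f ?A ?A")
proof -
  have inj: "inj_on ?f ?A" using inj_rotate1 by (auto simp: inj_on_def)
  have "?f ` ?A \<subseteq> ?A"
    using good_rotate[of 1] by (auto simp: goods_def words_def card_leaves_rotate1)
  moreover have "finite ?A" using B by simp
  ultimately show ?thesis using inj by (auto simp: bij_betw_def endo_inj_surj)
qed

text \<open>The contribution of the pairs with exactly \<open>l\<close> leaves, relative to the bare cycles of length
  \<open>k - 2 * j\<close>. The formula solves the recursion obtained by deleting one leaf; summed over \<open>l\<close> it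
  gives \<open>k choose j\<close> by Vandermonde.\<close>

definition leaf_number :: "nat \<Rightarrow> nat \<Rightarrow> nat \<Rightarrow> complex" where
  "leaf_number j l k = (if j = 0 then of_bool (l = 0) else
     of_nat k / of_nat l * of_nat ((j - 1) choose (l - 1)) * of_nat ((k - j - 1) choose (l - 1)))"

text \<open>With \<open>j = Suc a\<close> and \<open>l = Suc m\<close>, Pascal's rule turns the left
  side into the product in \<open>key\<close>. That identity follows from the absorption rules
  \<open>AC\<close>, where \<open>k = a + c + 2\<close> makes the linear factors add up to
  \<open>k - M\<close>.\<close>

lemma leaf_number_rec:
  assumes r: "1 \<le> r" and k: "k = r + 2 * j"
  shows "of_nat (Suc l) * leaf_number (Suc j) (Suc l) (k + 2) = of_nat (k + 2) *
    (of_nat (Suc l) / of_nat k * leaf_number j (Suc l) k + (1 - of_nat l / of_nat k) * leaf_number j l k)"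
proof (cases j)
  case 0
  then show ?thesis using r k by (cases l) (auto simp: leaf_number_def)
next
  case (Suc a)
  define c where "c = r + a"
  have k': "k = a + c + 2" "k - j - 1 = c" "k + 2 - Suc j - 1 = Suc c"
    using k Suc by (simp_all add: c_def)
  have k0: "(of_nat k :: complex) \<noteq> 0" using k r by (simp del: of_nat_add)
  show ?thesis
  proof (cases l)
    case 0
    then show ?thesis using Suc k0 by (simp add: leaf_number_def)
  next
    case (Suc m)
    have b: "(of_nat (Suc m) :: complex) * of_nat (n choose Suc m) = (of_nat n - of_nat m) * of_nat (n choose m)" for n
    proof (cases "m \<le> n")
      case True
      have "Suc m * (n choose Suc m) = (n - m) * (n choose m)" 
        using binomial_absorption[of m n] binomial_absorb_comp[of n m] by simp
      then have "(of_nat (Suc m * (n choose Suc m)) :: complex) = of_nat ((n - m) * (n choose m))" by simp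
      then show ?thesis using True by (simp only: of_nat_mult of_nat_diff)
    next
      case False then show ?thesis by (simp add: binomial_eq_0)
    qed
    define M A C A' C' :: complex where "M = of_nat (Suc m)" and "A = of_nat (a choose m)"
      and "C = of_nat (c choose m)" and "A' = of_nat (a choose Suc m)" and "C' = of_nat (c choose Suc m)"
    have M: "M \<noteq> 0" unfolding M_def by (simp del: of_nat_Suc)
    have AC: "M * A' = (of_nat a - of_nat m) * A" "M * C' = (of_nat c - of_nat m) * C"
      using b[of a] b[of c] by (simp_all add: M_def A_def C_def A'_def C'_def)
    have kM: "of_nat k = of_nat a + of_nat c + (2 :: complex)" using k'(1) by simp
    have Mm: "M = of_nat m + 1" by (simp add: M_def)
    have key: "(A + A') * (C + C') = A' * C' + (of_nat k - M) / M * (A * C)"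
    proof -
      have "M * ((A + A') * (C + C') - A' * C') = M * A * C + A * (M * C') + (M * A') * C"
        by (simp add: algebra_simps)
      also have "\<dots> = (of_nat k - M) * (A * C)"
        unfolding AC unfolding kM Mm by (simp add: algebra_simps)
      finally show ?thesis using M by (simp add: field_simps)
    qed
    have l1: "(of_nat (Suc l) :: complex) \<noteq> 0" by (simp del: of_nat_Suc)
    have L: "of_nat (Suc l) * leaf_number (Suc j) (Suc l) (k + 2) = of_nat (k + 2) * ((A + A') * (C + C'))"
      using l1 k' \<open>j = Suc a\<close> \<open>l = Suc m\<close>
      by (simp add: leaf_number_def A_def A'_def C_def C'_def del: of_nat_Suc)
    have R1: "of_nat (Suc l) / of_nat k * leaf_number j (Suc l) k = A' * C'"
      using l1 k0 k' \<open>j = Suc a\<close> \<open>l = Suc m\<close>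
      by (simp add: leaf_number_def A'_def C'_def del: of_nat_Suc)
    have R2: "(1 - of_nat l / of_nat k) * leaf_number j l k = (of_nat k - M) / M * (A * C)"
      using k0 k' M \<open>j = Suc a\<close> \<open>l = Suc m\<close>
      by (simp add: leaf_number_def A_def C_def M_def[symmetric] field_simps del: of_nat_Suc of_nat_add)
    show ?thesis unfolding L R1 R2 key ..
  qed
qed

context
  fixes y :: "'v::linorder list \<times> ('v \<times> 'v) set \<Rightarrow> complex" and B :: "'v set"
  assumes B: "finite B"
    and y_rotate1: "\<And>w F. w \<noteq> [] \<Longrightarrow> set w \<subseteq> B \<Longrightarrow> y (rotate1 w, F) = y (w, F)"
    and y_leaf: "\<And>w F x. w \<noteq> [] \<Longrightarrow> set w \<subseteq> B \<Longrightarrow> x \<in> B - set w \<Longrightarrow> admissible w F \<Longrightarrow>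
       y (w @ [hd w, x], F) = y (w, F)"
begin

text \<open>The weight \<open>y\<close> stays abstract with its two invariances because the count is
  applied to covariances of two terms, once in each argument.\<close>

definition leaf_sum :: "nat \<Rightarrow> nat \<Rightarrow> nat \<Rightarrow> complex" where
  "leaf_sum k r l = sum y {x \<in> goods k r B. card (leaves (fst x) (snd x)) = l}"

lemma sum_leaf_shift:
  assumes j: "j < k"
  shows "(\<Sum>x | x \<in> goods k r B \<and> card (leaves (fst x) (snd x)) = l \<and> is_leaf (fst x) (snd x) j. y x) =
    (\<Sum>x | x \<in> goods k r B \<and> card (leaves (fst x) (snd x)) = l \<and>
        is_leaf (fst x) (snd x) (Suc j mod k). y x)"
proof -
  let ?A = "{x \<in> goods k r B. card (leaves (fst x) (snd x)) = l}"
  let ?f = "\<lambda>(w, F). (rotate1 w, F)"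
  define g where "g j x = (if is_leaf (fst x) (snd x) j then y x else 0)" for j x
  have len: "length (fst x) = k" "set (fst x) \<subseteq> B" if "x \<in> ?A" for x
    using that by (auto simp: goods_def words_def)
  have "sum (g j) ?A = (\<Sum>x\<in>?A. g j (?f x))"
    by (rule sum.reindex_bij_betw[symmetric, OF rotate1_goods[OF B]])
  also have "\<dots> = sum (g (Suc j mod k)) ?A"
  proof (rule sum.cong)
    fix x assume x: "x \<in> ?A"
    obtain w F where [simp]: "x = (w, F)" by (cases x)
    have "length w = k" "set w \<subseteq> B" "w \<noteq> []" using len[OF x] j by auto
    then show "g j (?f x) = g (Suc j mod k) x"
      using j by (simp add: g_def is_leaf_rotate1 y_rotate1)
  qed simp
  finally show ?thesis using B by (simp add: g_def sum.If_cases Int_def conj_assoc)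
qed

lemma sum_leaf_const:
  assumes "j < k"
  shows "(\<Sum>x | x \<in> goods k r B \<and> card (leaves (fst x) (snd x)) = l \<and> is_leaf (fst x) (snd x) j. y x) =
    (\<Sum>x | x \<in> goods k r B \<and> card (leaves (fst x) (snd x)) = l \<and> is_leaf (fst x) (snd x) 0. y x)"
  using assms
proof (induction j)
  case (Suc j)
  then show ?case using sum_leaf_shift[of j k r l] by simp
qed simp

text \<open>Double counting of pairs with a marked leaf: each pair has \<open>l\<close> marks, and
  by rotation invariance each of the \<open>k\<close> positions carries the same total
  weight.\<close>

lemma leaf_sum_pos:
  assumes "j < k"
  shows "of_nat l * leaf_sum k r l = of_nat k *
    (\<Sum>x | x \<in> goods k r B \<and> card (leaves (fst x) (snd x)) = l \<and> is_leaf (fst x) (snd x) j. y x)"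
proof -
  let ?A = "{x \<in> goods k r B. card (leaves (fst x) (snd x)) = l}"
  have "of_nat l * leaf_sum k r l = (\<Sum>x\<in>?A. of_nat (card (leaves (fst x) (snd x))) * y x)"
    by (simp add: leaf_sum_def sum_distrib_left)
  also have "\<dots> = (\<Sum>x\<in>?A. \<Sum>i<k. if is_leaf (fst x) (snd x) i then y x else 0)"
  proof (rule sum.cong)
    fix x assume "x \<in> ?A"
    then have "leaves (fst x) (snd x) = {..<k} \<inter> {i. is_leaf (fst x) (snd x) i}"
      using leaves_subset[of "fst x" "snd x"] by (auto simp: goods_def words_def leaves_def)
    then show "of_nat (card (leaves (fst x) (snd x))) * y x = (\<Sum>i<k. if is_leaf (fst x) (snd x) i then y x else 0)"
      by (simp add: sum.If_cases)
  qed simp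
  also have "\<dots> = (\<Sum>i<k. \<Sum>x\<in>?A. if is_leaf (fst x) (snd x) i then y x else 0)"
    by (rule sum.swap)
  also have "\<dots> = (\<Sum>i<k. \<Sum>x | x \<in> goods k r B \<and> card (leaves (fst x) (snd x)) = l \<and> is_leaf (fst x) (snd x) i. y x)"
    using B by (simp add: sum.If_cases Int_def conj_assoc)
  also have "\<dots> = (\<Sum>i<k. \<Sum>x | x \<in> goods k r B \<and> card (leaves (fst x) (snd x)) = l \<and> is_leaf (fst x) (snd x) j. y x)"
  proof (rule sum.cong)
    fix i assume "i \<in> {..<k}"
    then show "(\<Sum>x | x \<in> goods k r B \<and> card (leaves (fst x) (snd x)) = l \<and> is_leaf (fst x) (snd x) i. y x) =
        (\<Sum>x | x \<in> goods k r B \<and> card (leaves (fst x) (snd x)) = l \<and> is_leaf (fst x) (snd x) j. y x)"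
      using sum_leaf_const[of i k r l] sum_leaf_const[OF assms, of r l] by simp
  qed simp
  finally show ?thesis by simp
qed

text \<open>The word without its last leaf is a good word \<open>w\<close>, and the leaf is any
  letter of \<open>B\<close> outside it. Since \<open>2 * card (set w) = k + r\<close>, there are
  \<open>card B - (k + r) div 2\<close> such letters. Position 0 is dropped from the leaves of
  \<open>w\<close> because the new excursion revisits \<open>hd w\<close>.\<close>

lemma sum_last_leaf:
  assumes k: "1 \<le> k"
  shows "(\<Sum>x | x \<in> goods (k + 2) r B \<and> card (leaves (fst x) (snd x)) = l \<and>
            is_leaf (fst x) (snd x) (Suc k). y x) =
    (of_nat (card B) - of_nat ((k + r) div 2)) *
      (\<Sum>x | x \<in> goods k r B \<and> Suc (card (leaves (fst x) (snd x) - {0})) = l. y x)"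
proof -
  let ?A = "{x. x \<in> goods k r B \<and> Suc (card (leaves (fst x) (snd x) - {0})) = l}"
  let ?C = "{x. x \<in> goods (k + 2) r B \<and> card (leaves (fst x) (snd x)) = l \<and>
            is_leaf (fst x) (snd x) (Suc k)}"
  let ?S = "Sigma ?A (\<lambda>x. B - set (fst x))"
  let ?f = "\<lambda>((w, F), v). (w @ [hd w, v], F)"
  have ne: "w \<noteq> []" if "(w, F) \<in> goods k r B" for w F
    using that k by (auto simp: goods_def words_def)
  have inj: "inj_on ?f ?S" by (auto simp: inj_on_def)
  have im: "?f ` ?S = ?C"
  proof (intro equalityI subsetI)
    fix z assume "z \<in> ?f ` ?S"
    then obtain w F v where z: "z = (w @ [hd w, v], F)" "(w, F) \<in> ?A" "v \<in> B" "v \<notin> set w" by auto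
    then have g: "(w, F) \<in> goods k r B" and lw: "length w = k" by (auto simp: goods_def words_def)
    note adm = goods_admissible[OF g]
    have L: "leaves (w @ [hd w, v]) F = insert (Suc k) (leaves w F - {0})"
      using leaves_append_leaf[OF adm z(4)] lw by simp
    then have "is_leaf (w @ [hd w, v]) F (Suc k)" by (auto simp: leaves_def)
    moreover have "Suc k \<notin> leaves w F - {0}" using leaves_subset[of w F] lw by auto
    then have "card (leaves (w @ [hd w, v]) F) = l" using L z(2) by simp
    moreover have "(w @ [hd w, v], F) \<in> goods (k + 2) r B"
      using g z(3,4) ne[OF g] good_append_leaf[OF ne[OF g] z(4) admissible_new_edge[OF adm z(4)]]
      by (auto simp: goods_def words_def)
    ultimately show "z \<in> ?C" using z(1) by simp
  next
    fix z assume z: "z \<in> ?C"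
    obtain W F where [simp]: "z = (W, F)" by (cases z)
    have g: "(W, F) \<in> goods (k + 2) r B" and lW: "length W = k + 2" using z by (auto simp: goods_def words_def)
    have "is_leaf W F (length W - 1)" using z lW by simp
    from last_leafE[OF goods_admissible[OF g] this]
    obtain w v where w: "W = w @ [hd w, v]" "w \<noteq> []" "v \<notin> set w" "edge (hd w, v) \<notin> F" "admissible w F"
      by metis
    have lw: "length w = k" using lW w(1) by (metis add_right_cancel length_append length_Cons list.size(3) numeral_2_eq_2 add_Suc_right add.right_neutral One_nat_def plus_1_eq_Suc)
    have "good w F" using good_append_leaf[OF w(2-4)] w(1) g by (simp add: goods_def)
    then have "(w, F) \<in> goods k r B" using g lw w(1) by (auto simp: goods_def words_def)
    moreover have L: "leaves W F = insert (Suc k) (leaves w F - {0})"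
      using leaves_append_leaf[OF w(5,3)] lw w(1) by simp
    moreover have "Suc k \<notin> leaves w F - {0}" using leaves_subset[of w F] lw by auto
    ultimately have "(w, F) \<in> ?A" using z by simp
    moreover have "v \<in> B - set w" using w g by (auto simp: goods_def words_def)
    ultimately have "((w, F), v) \<in> ?S" by simp
    then show "z \<in> ?f ` ?S" using w(1) by (intro image_eqI[of _ _ "((w, F), v)"]) auto
  qed
  have "sum y ?C = sum (y \<circ> ?f) ?S"
    using sum.reindex[OF inj, of y] im by simp
  also have "\<dots> = (\<Sum>(x, v)\<in>?S. y x)"
  proof (rule sum.cong)
    fix z assume z: "z \<in> ?S"
    obtain w F v where [simp]: "z = ((w, F), v)" by (metis prod.exhaust)
    have g: "(w, F) \<in> goods k r B" using z by simp
    show "(y \<circ> ?f) z = (case z of (x, v) \<Rightarrow> y x)"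
      using z ne[OF g] g y_leaf[of w v F] goods_admissible[OF g] by (auto simp: goods_def words_def)
  qed simp
  also have "\<dots> = (\<Sum>x\<in>?A. \<Sum>v\<in>B - set (fst x). y x)"
    using B by (intro sum.Sigma[symmetric]) auto
  also have "\<dots> = (\<Sum>x\<in>?A. (of_nat (card B) - of_nat ((k + r) div 2)) * y x)"
  proof (rule sum.cong)
    fix x assume x: "x \<in> ?A"
    obtain w F where [simp]: "x = (w, F)" by (cases x)
    have g: "(w, F) \<in> goods k r B" using x by simp
    have sw: "set w \<subseteq> B" using g by (auto simp: goods_def words_def)
    have "card (B - set w) = card B - card (set w)" using sw by (simp add: card_Diff_subset)
    moreover have "card (set w) \<le> card B" using sw B by (rule card_mono[rotated])
    moreover have "card (set w) = (k + r) div 2" using goods_card[OF g] by simp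
    ultimately show "(\<Sum>v\<in>B - set (fst x). y x) = (of_nat (card B) - of_nat ((k + r) div 2)) * y x"
      by (simp add: of_nat_diff)
  qed simp
  finally show ?thesis by (simp add: sum_distrib_left)
qed

text \<open>A word with \<open>Suc l\<close> leaves, one of them last, arises from a word with
  \<open>Suc l\<close> leaves if position 0 was a leaf, which is then lost, and from a word with
  \<open>l\<close> leaves otherwise. By \<open>leaf_sum_pos\<close> a leaf at position 0 accounts
  for the fraction \<open>l / k\<close> of the weight of words with \<open>l\<close> leaves.\<close>

lemma leaf_sum_rec:
  assumes k: "1 \<le> k"
  shows "of_nat (Suc l) * leaf_sum (k + 2) r (Suc l) = of_nat (k + 2) *
    (of_nat (card B) - of_nat ((k + r) div 2)) *
    (of_nat (Suc l) / of_nat k * leaf_sum k r (Suc l) + (1 - of_nat l / of_nat k) * leaf_sum k r l)"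
proof -
  define h where "h l = (\<Sum>x | x \<in> goods k r B \<and> card (leaves (fst x) (snd x)) = l \<and>
     is_leaf (fst x) (snd x) 0. y x)" for l
  have h: "h l = of_nat l / of_nat k * leaf_sum k r l" for l
    using leaf_sum_pos[of 0 k l r] k by (simp add: h_def field_simps)
  have fin: "finite {x. x \<in> goods k r B \<and> P x}" for P using B by simp
  have split: "Suc (card (leaves w F - {0})) = Suc l \<longleftrightarrow> card (leaves w F) = Suc l \<and> is_leaf w F 0 \<or>
     card (leaves w F) = l \<and> \<not> is_leaf w F 0" for w :: "'v list" and F
  proof (cases "is_leaf w F 0")
    case True
    then have "0 \<in> leaves w F" by (simp add: leaves_def)
    then show ?thesis using card.remove[OF finite_leaves, of 0 w F] True by auto
  next
    case False
    then have "leaves w F - {0} = leaves w F" by (auto simp: leaves_def)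
    then show ?thesis using False by simp
  qed
  have "{x. x \<in> goods k r B \<and> Suc (card (leaves (fst x) (snd x) - {0})) = Suc l} =
     {x. x \<in> goods k r B \<and> card (leaves (fst x) (snd x)) = Suc l \<and> is_leaf (fst x) (snd x) 0} \<union>
     {x. x \<in> goods k r B \<and> card (leaves (fst x) (snd x)) = l \<and> \<not> is_leaf (fst x) (snd x) 0}"
    unfolding split by auto
  then have "(\<Sum>x | x \<in> goods k r B \<and> Suc (card (leaves (fst x) (snd x) - {0})) = Suc l. y x) =
     sum y ({x. x \<in> goods k r B \<and> card (leaves (fst x) (snd x)) = Suc l \<and> is_leaf (fst x) (snd x) 0} \<union>
     {x. x \<in> goods k r B \<and> card (leaves (fst x) (snd x)) = l \<and> \<not> is_leaf (fst x) (snd x) 0})"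
    by (rule arg_cong)
  also have "\<dots> = h (Suc l) + (\<Sum>x | x \<in> goods k r B \<and> card (leaves (fst x) (snd x)) = l \<and> \<not> is_leaf (fst x) (snd x) 0. y x)"
    unfolding h_def by (rule sum.union_disjoint[OF fin fin]) auto
  also have "(\<Sum>x | x \<in> goods k r B \<and> card (leaves (fst x) (snd x)) = l \<and> \<not> is_leaf (fst x) (snd x) 0. y x) =
     leaf_sum k r l - h l"
  proof -
    have "leaf_sum k r l = sum y
      ({x. x \<in> goods k r B \<and> card (leaves (fst x) (snd x)) = l \<and> is_leaf (fst x) (snd x) 0} \<union>
      {x. x \<in> goods k r B \<and> card (leaves (fst x) (snd x)) = l \<and> \<not> is_leaf (fst x) (snd x) 0})"
      unfolding leaf_sum_def by (rule arg_cong[where f = "sum y"]) auto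
    also have "\<dots> = h l + (\<Sum>x | x \<in> goods k r B \<and> card (leaves (fst x) (snd x)) = l \<and> \<not> is_leaf (fst x) (snd x) 0. y x)"
      unfolding h_def by (rule sum.union_disjoint[OF fin fin]) auto
    finally show ?thesis by simp
  qed
  also have "h (Suc l) + (leaf_sum k r l - h l) =
     of_nat (Suc l) / of_nat k * leaf_sum k r (Suc l) + (1 - of_nat l / of_nat k) * leaf_sum k r l"
    unfolding h by (simp add: algebra_simps)
  finally have X: "(\<Sum>x | x \<in> goods k r B \<and> Suc (card (leaves (fst x) (snd x) - {0})) = Suc l. y x) =
    of_nat (Suc l) / of_nat k * leaf_sum k r (Suc l) + (1 - of_nat l / of_nat k) * leaf_sum k r l" .
  have "Suc k < k + 2" by simp
  from leaf_sum_pos[OF this, of "Suc l" r] show ?thesis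
    unfolding sum_last_leaf[OF k] X by (simp only: mult.assoc)
qed

lemma leaf_sum_eq:
  assumes r: "1 \<le> r"
  shows "leaf_sum (r + 2 * j) r l = leaf_number j l (r + 2 * j) *
    (\<Prod>i<j. of_nat (card B) - of_nat (r + i)) * (\<Sum>w\<in>cycles r B. y (w, edges_of w))"
proof (induction j arbitrary: l)
  case 0
  have "leaf_sum r r l = (if l = 0 then sum y (goods r r B) else 0)"
    using goods_diagonal(2)[OF r] by (auto simp: leaf_sum_def intro!: sum.cong sum.neutral)
  also have "sum y (goods r r B) = (\<Sum>w\<in>cycles r B. y (w, edges_of w))"
    unfolding goods_diagonal(1)[OF r] by (subst sum.reindex) (auto simp: inj_on_def)
  finally show ?case by (simp add: leaf_number_def)
next
  case (Suc j)
  define k where "k = r + 2 * j"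
  have k: "1 \<le> k" "r + 2 * Suc j = k + 2" using r by (simp_all add: k_def)
  show ?case
  proof (cases l)
    case 0
    \<comment> \<open>A pair without leaves is a bare cycle of length \<open>r\<close>, and
      \<open>r < k + 2\<close>.\<close>
    have "{x \<in> goods (k + 2) r B. card (leaves (fst x) (snd x)) = 0} = {}"
      using no_leaf_goods[of _ _ "k + 2" r B] by (fastforce simp: k_def)
    then have "leaf_sum (k + 2) r 0 = 0" by (simp only: leaf_sum_def sum.empty)
    then show ?thesis unfolding k(2) using 0 by (simp add: leaf_number_def)
  next
    case (Suc m)
    define c S where "c = (of_nat (card B) - of_nat (r + j) :: complex)"
      and "S = (\<Prod>i<j. of_nat (card B) - of_nat (r + i)) * (\<Sum>w\<in>cycles r B. y (w, edges_of w))"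
    have IH: "leaf_sum k r l = leaf_number j l k * S" for l
      using Suc.IH[of l] by (simp add: k_def S_def mult.assoc)
    have half: "(k + r) div 2 = r + j" by (simp add: k_def)
    have "of_nat (Suc m) * leaf_sum (k + 2) r (Suc m) = of_nat (k + 2) * c *
      (of_nat (Suc m) / of_nat k * (leaf_number j (Suc m) k * S) + (1 - of_nat m / of_nat k) * (leaf_number j m k * S))"
      using leaf_sum_rec[OF k(1), of m r] by (simp only: half IH c_def)
    also have "\<dots> = c * S * (of_nat (k + 2) *
      (of_nat (Suc m) / of_nat k * leaf_number j (Suc m) k + (1 - of_nat m / of_nat k) * leaf_number j m k))"
      by (simp only: algebra_simps)
    also have "\<dots> = c * S * (of_nat (Suc m) * leaf_number (Suc j) (Suc m) (k + 2))"
      unfolding leaf_number_rec[OF r k_def, symmetric] ..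
    finally have "of_nat (Suc m) * leaf_sum (k + 2) r (Suc m) =
      of_nat (Suc m) * (leaf_number (Suc j) (Suc m) (k + 2) * (c * S))" by (simp only: mult_ac)
    then have "leaf_sum (k + 2) r (Suc m) = leaf_number (Suc j) (Suc m) (k + 2) * (c * S)"
      by (metis mult_cancel_left of_nat_eq_0_iff nat.distinct(1))
    then show ?thesis unfolding k(2) Suc by (simp add: c_def S_def mult_ac)
  qed
qed

text \<open>Multiplication by \<open>j\<close> cancels the denominator \<open>l\<close>, since
  \<open>j * ((j - 1) choose (l - 1)) = l * (j choose l)\<close>. The remaining convolution is
  Vandermonde's and gives \<open>k * ((k - 1) choose (j - 1))\<close>, which absorption turns into
  \<open>j * (k choose j)\<close>.\<close>

lemma sum_leaf_number:
  assumes "1 \<le> r" "k = r + 2 * j"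
  shows "(\<Sum>l\<le>k. leaf_number j l k) = of_nat (k choose j)"
proof (cases j)
  case 0
  have "(\<Sum>l\<le>k. leaf_number 0 l k) = (\<Sum>l\<le>k. if l = 0 then 1 else 0)"
    by (rule sum.cong) (auto simp: leaf_number_def)
  also have "\<dots> = 1" by (subst sum.delta) auto
  finally show ?thesis using 0 by simp
next
  case (Suc a)
  define n where "n = k - j - 1"
  have n: "n + j = k - 1" "j \<le> k" "1 \<le> k" using assms Suc by (simp_all add: n_def)
  have "of_nat j * (\<Sum>l\<le>k. leaf_number j l k) = (\<Sum>l\<le>k. of_nat j * leaf_number j l k)"
    by (simp add: sum_distrib_left)
  also have "\<dots> = (\<Sum>l\<in>{1..j}. of_nat k * (of_nat (j choose (j - l)) * of_nat (n choose (l - 1))))"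
  proof (rule sum.mono_neutral_cong_right)
    show "\<forall>l\<in>{..k} - {1..j}. of_nat j * leaf_number j l k = (0 :: complex)"
      using Suc by (auto simp: leaf_number_def binomial_eq_0)
    fix l assume l: "l \<in> {1..j}"
    have "(of_nat l :: complex) \<noteq> 0" using l by simp
    moreover have "j * ((j - 1) choose (l - 1)) = l * (j choose (j - l))"
      using l Suc binomial_absorption[of "l - 1" j] binomial_symmetric[of l j] by simp
    then have "(of_nat j :: complex) * of_nat ((j - 1) choose (l - 1)) = of_nat l * of_nat (j choose (j - l))"
      by (metis of_nat_mult)
    moreover have "of_nat j * leaf_number j l k = of_nat k / of_nat l *
        (of_nat j * of_nat ((j - 1) choose (l - 1))) * of_nat (n choose (l - 1))"
      using Suc by (simp add: leaf_number_def n_def)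
    ultimately show "of_nat j * leaf_number j l k =
        (of_nat k * (of_nat (j choose (j - l)) * of_nat (n choose (l - 1))) :: complex)"
      by simp
  qed (use n in auto)
  also have "\<dots> = of_nat k * of_nat (\<Sum>l\<in>{1..j}. (j choose (j - l)) * (n choose (l - 1)))"
    by (simp add: sum_distrib_left)
  also have "(\<Sum>l\<in>{1..j}. (j choose (j - l)) * (n choose (l - 1))) = (\<Sum>i\<le>a. (n choose i) * (j choose (a - i)))"
    by (rule sum.reindex_bij_witness[of _ Suc "\<lambda>l. l - 1"]) (use Suc in auto)
  also have "\<dots> = (k - 1) choose a" using vandermonde[of n j a] n by simp
  also have "(of_nat k * of_nat ((k - 1) choose a) :: complex) = of_nat (k * ((k - 1) choose a))" by simp
  also have "k * ((k - 1) choose a) = j * (k choose j)" using binomial_absorption[of a k] Suc by simp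
  finally have "of_nat j * (\<Sum>l\<le>k. leaf_number j l k) = of_nat j * (of_nat (k choose j) :: complex)" by simp
  then show ?thesis using Suc by (metis mult_cancel_left of_nat_eq_0_iff nat.distinct(1))
qed

text \<open>\<open>k choose j\<close> counts the ways to hang \<open>j\<close> tree vertices on a
  cycle of length \<open>r\<close>; the \<open>i\<close>-th of them has to avoid the
  \<open>r + i\<close> letters already in use.\<close>

theorem sum_goods:
  assumes r: "1 \<le> r" and k: "k = r + 2 * j"
  shows "sum y (goods k r B) = of_nat (k choose j) *
    (\<Prod>i<j. of_nat (card B) - of_nat (r + i)) * (\<Sum>w\<in>cycles r B. y (w, edges_of w))"
proof -
  have "sum y (goods k r B) = (\<Sum>l\<le>k. leaf_sum k r l)"
    unfolding leaf_sum_def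
  proof (rule sum.group[symmetric])
    show "(\<lambda>x. card (leaves (fst x) (snd x))) ` goods k r B \<subseteq> {..k}"
    proof (clarsimp)
      fix w F assume "(w, F) \<in> goods k r B"
      then show "card (leaves w F) \<le> k"
        using card_mono[OF _ leaves_subset[of w F]] by (simp add: goods_def words_def)
    qed
  qed (use B in auto)
  also have "\<dots> = (\<Sum>l\<le>k. leaf_number j l k * ((\<Prod>i<j. of_nat (card B) - of_nat (r + i)) *
      (\<Sum>w\<in>cycles r B. y (w, edges_of w))))"
    unfolding k leaf_sum_eq[OF r] mult.assoc ..
  finally show ?thesis
    by (simp only: sum_distrib_right[symmetric] sum_leaf_number[OF r k] mult.assoc)
qed

end

section \<open>Counting words with few letters\<close>

text \<open>Connectedness in terms of sets that no edge leaves. This form suits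
  \<open>partner\<close>, where \<open>W\<close> is the vertex set of another word.\<close>

definition edge_connected :: "('v \<times> 'v) set \<Rightarrow> bool" where
  "edge_connected F \<longleftrightarrow> (\<forall>W. verts F \<inter> W \<noteq> {} \<and> (\<forall>e\<in>F. fst e \<in> W \<longleftrightarrow> snd e \<in> W) \<longrightarrow> verts F \<subseteq> W)"

lemma edge_connected_edges_of: "edge_connected (edges_of c)"
  unfolding edge_connected_def
proof (intro allI impI)
  fix W assume W: "verts (edges_of c) \<inter> W \<noteq> {} \<and> (\<forall>e\<in>edges_of c. fst e \<in> W \<longleftrightarrow> snd e \<in> W)"
  then obtain j0 where j0: "j0 < length c" "c ! j0 \<in> W"
    unfolding verts_edges_of by (auto simp: in_set_conv_nth)
  have st: "c ! (Suc j mod length c) \<in> W" if "j < length c" "c ! j \<in> W" for j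
  proof -
    have "edge (c ! j, c ! (Suc j mod length c)) \<in> edges_of c" using that by (auto simp: edges_of_conv_nth)
    then have "fst (edge (c ! j, c ! (Suc j mod length c))) \<in> W \<longleftrightarrow> snd (edge (c ! j, c ! (Suc j mod length c))) \<in> W"
      using W by blast
    then show ?thesis using that by (auto simp: edge_def min_def max_def split: if_splits)
  qed
  have all: "c ! ((j0 + n) mod length c) \<in> W" for n
  proof (induction n)
    case (Suc n)
    have "(j0 + n) mod length c < length c" using j0 by (intro mod_less_divisor) linarith
    then show ?case using st[of "(j0 + n) mod length c"] Suc by (simp add: mod_Suc_eq)
  qed (use j0 in simp)
  show "verts (edges_of c) \<subseteq> W"
    unfolding verts_edges_of
  proof
    fix v assume "v \<in> set c"
    then obtain j where j: "j < length c" "v = c ! j" by (auto simp: in_set_conv_nth)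
    then have "(j0 + (j + length c - j0)) mod length c = j" using j0 by simp
    then show "v \<in> W" using all[of "j + length c - j0"] j by simp
  qed
qed

lemma edge_in_verts: "e \<in> F \<Longrightarrow> fst e \<in> verts F \<and> snd e \<in> verts F"
  by (auto simp: verts_def)

text \<open>An edge in only one \<open>F a\<close> contributes a centred factor independent of all
  others, so a product with nonzero mean satisfies this.\<close>

definition all_shared :: "'i set \<Rightarrow> ('i \<Rightarrow> 'e set) \<Rightarrow> bool" where
  "all_shared I F \<longleftrightarrow> (\<forall>a\<in>I. \<forall>e\<in>F a. \<exists>b\<in>I - {a}. e \<in> F b)"

context
  fixes I :: "'i set" and V :: "'i \<Rightarrow> 'v set" and F :: "'i \<Rightarrow> ('v \<times> 'v) set" and k :: "'i \<Rightarrow> nat"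
  assumes I: "finite I"
    and V: "\<And>a. a \<in> I \<Longrightarrow> finite (V a)" "\<And>a. a \<in> I \<Longrightarrow> verts (F a) \<subseteq> V a"
    and order: "\<And>a. a \<in> I \<Longrightarrow> 2 * card (V a) \<le> k a + card (verts (F a))"
    and shared: "all_shared I F"
begin

text \<open>The weights are chosen so that they add up to \<open>2 |V a| - |verts (F a)| \<le> k a\<close> over the vertices, while
  sharing of edges makes them add up to at least 2 over the words.\<close>

definition mult_at :: "'i \<Rightarrow> 'v \<Rightarrow> nat" where
  "mult_at a v = (if v \<in> V a then if v \<in> verts (F a) then 1 else 2 else 0)"

lemma sum_mult_at:
  assumes "a \<in> I"
  shows "(\<Sum>v\<in>\<Union> (V ` I). mult_at a v) + card (verts (F a)) = 2 * card (V a)"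
proof -
  have fin: "finite (\<Union> (V ` I))" using I V(1) by auto
  have "(\<Sum>v\<in>\<Union> (V ` I). mult_at a v) = (\<Sum>v\<in>V a. mult_at a v)"
    by (rule sum.mono_neutral_right[OF fin]) (use assms in \<open>auto simp: mult_at_def\<close>)
  also have "\<dots> = (\<Sum>v\<in>verts (F a). mult_at a v) + (\<Sum>v\<in>V a - verts (F a). mult_at a v)"
    using sum.subset_diff[OF V(2)[OF assms] V(1)[OF assms], of "mult_at a"] by simp
  also have "(\<Sum>v\<in>verts (F a). mult_at a v) = card (verts (F a))"
    using V(2)[OF assms] by (subst sum.cong[OF refl, of _ _ "\<lambda>_. 1"]) (auto simp: mult_at_def)
  also have "(\<Sum>v\<in>V a - verts (F a). mult_at a v) = 2 * card (V a - verts (F a))"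
    by (subst sum.cong[OF refl, of _ _ "\<lambda>_. 2"]) (auto simp: mult_at_def)
  also have "card (V a - verts (F a)) = card (V a) - card (verts (F a))"
    using V assms by (intro card_Diff_subset) (auto intro: finite_subset)
  finally show ?thesis using card_mono[OF V(1)[OF assms] V(2)[OF assms]] by simp
qed

text \<open>A vertex on no centred edge of some word through it has weight 2 there. Otherwise the
  centred edge through it lies in a second word, and so does the vertex.\<close>

lemma two_le_mult_at:
  assumes "v \<in> \<Union> (V ` I)" shows "2 \<le> (\<Sum>a\<in>I. mult_at a v)"
proof -
  obtain a where a: "a \<in> I" "v \<in> V a" using assms by auto
  show ?thesis
  proof (cases "v \<in> verts (F a)")
    case False
    then have "2 = mult_at a v" using a by (simp add: mult_at_def)
    also have "\<dots> \<le> (\<Sum>a\<in>I. mult_at a v)" using a I by (intro member_le_sum) auto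
    finally show ?thesis .
  next
    case True
    then obtain e where e: "e \<in> F a" "v = fst e \<or> v = snd e" by (rule verts_edgeE)
    then obtain b where b: "b \<in> I" "b \<noteq> a" "e \<in> F b" using shared a by (auto simp: all_shared_def)
    then have "v \<in> V b" using e edge_in_verts[OF b(3)] V(2)[OF b(1)] by auto
    then have "2 \<le> mult_at a v + mult_at b v" using a by (auto simp: mult_at_def)
    also have "\<dots> = (\<Sum>c\<in>{a, b}. mult_at c v)" using b by simp
    also have "\<dots> \<le> (\<Sum>a\<in>I. mult_at a v)" using a b I by (intro sum_mono2) auto
    finally show ?thesis .
  qed
qed

text \<open>Double counting of the weights over vertices and words. If the total bound is attained,
  both estimates are sharp in every term.\<close>

lemma shared_bound:
  shows "2 * card (\<Union> (V ` I)) \<le> sum k I"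
    and "2 * card (\<Union> (V ` I)) = sum k I \<Longrightarrow> a \<in> I \<Longrightarrow> 2 * card (V a) = k a + card (verts (F a))"
    and "2 * card (\<Union> (V ` I)) = sum k I \<Longrightarrow> v \<in> \<Union> (V ` I) \<Longrightarrow> (\<Sum>a\<in>I. mult_at a v) = 2"
proof -
  let ?U = "\<Union> (V ` I)"
  have fin: "finite ?U" using I V(1) by auto
  have le: "(\<Sum>v\<in>?U. mult_at a v) \<le> k a" if "a \<in> I" for a
    using sum_mult_at[OF that] order[OF that] by linarith
  have 1: "2 * card ?U \<le> (\<Sum>v\<in>?U. \<Sum>a\<in>I. mult_at a v)"
    using sum_mono[of ?U "\<lambda>_. 2" "\<lambda>v. \<Sum>a\<in>I. mult_at a v"] two_le_mult_at by simp
  have 2: "(\<Sum>v\<in>?U. \<Sum>a\<in>I. mult_at a v) = (\<Sum>a\<in>I. \<Sum>v\<in>?U. mult_at a v)" by (rule sum.swap)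
  have 3: "(\<Sum>a\<in>I. \<Sum>v\<in>?U. mult_at a v) \<le> sum k I" using le by (rule sum_mono)
  show "2 * card ?U \<le> sum k I" using 1 2 3 by linarith
  assume eq: "2 * card ?U = sum k I"
  show "2 * card (V a) = k a + card (verts (F a))" if a: "a \<in> I"
  proof (rule ccontr)
    assume "2 * card (V a) \<noteq> k a + card (verts (F a))"
    then have "(\<Sum>v\<in>?U. mult_at a v) < k a" using sum_mult_at[OF a] order[OF a] by linarith
    then have "(\<Sum>a\<in>I. \<Sum>v\<in>?U. mult_at a v) < sum k I"
      using a le I by (intro sum_strict_mono_ex1) auto
    then show False using 1 2 eq by linarith
  qed
  show "(\<Sum>a\<in>I. mult_at a v) = 2" if v: "v \<in> ?U"
  proof (rule ccontr)
    assume "(\<Sum>a\<in>I. mult_at a v) \<noteq> 2"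
    then have "2 < (\<Sum>a\<in>I. mult_at a v)" using two_le_mult_at[OF v] by linarith
    then have "(\<Sum>v\<in>?U. 2) < (\<Sum>v\<in>?U. \<Sum>a\<in>I. mult_at a v)"
      using v two_le_mult_at fin by (intro sum_strict_mono_ex1) auto
    then show False using 2 3 eq by simp
  qed
qed

text \<open>In the case of equality the weights at \<open>v\<close> add up to exactly 2, and each
  word through \<open>v\<close> takes at least 1. Two words exhaust this budget.\<close>

lemma common_vertex:
  assumes eq: "2 * card (\<Union> (V ` I)) = sum k I"
    and v: "v \<in> V a" "v \<in> V b" "a \<in> I" "b \<in> I" "a \<noteq> b"
  shows "v \<in> verts (F a)" and "c \<in> I \<Longrightarrow> v \<in> V c \<Longrightarrow> c = a \<or> c = b"
proof -
  have s: "(\<Sum>a\<in>I. mult_at a v) = 2" using shared_bound(3)[OF eq] v by auto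
  have pos: "1 \<le> mult_at c v" if "v \<in> V c" for c using that by (simp add: mult_at_def)
  have "(\<Sum>c\<in>{a, b}. mult_at c v) \<le> (\<Sum>c\<in>I. mult_at c v)" using v I by (intro sum_mono2) auto
  then have "mult_at a v + mult_at b v \<le> 2" using s v by simp
  then have "mult_at a v = 1" using pos[OF v(1)] pos[OF v(2)] by linarith
  then show "v \<in> verts (F a)" by (simp add: mult_at_def split: if_splits)
  show "c = a \<or> c = b" if c: "c \<in> I" "v \<in> V c"
  proof (rule ccontr)
    assume "\<not> (c = a \<or> c = b)"
    then have "mult_at a v + mult_at b v + mult_at c v = (\<Sum>c\<in>{a, b, c}. mult_at c v)" using v by auto
    also have "\<dots> \<le> (\<Sum>c\<in>I. mult_at c v)" using v c I by (intro sum_mono2) auto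
    finally show False using s pos[OF v(1)] pos[OF v(2)] pos[OF c(2)] by linarith
  qed
qed

text \<open>The edge lies in some further \<open>F c\<close>. Its endpoint in \<open>V b\<close> is
  then visited by \<open>a\<close>, \<open>b\<close> and \<open>c\<close>, and since at most two
  words meet there, \<open>c\<close> is \<open>b\<close>.\<close>

lemma shared_edge_step:
  assumes eq: "2 * card (\<Union> (V ` I)) = sum k I"
    and ab: "a \<in> I" "b \<in> I" "a \<noteq> b" and e: "e \<in> F a" and v: "fst e \<in> V b \<or> snd e \<in> V b"
  shows "fst e \<in> V b \<and> snd e \<in> V b"
proof -
  obtain c where c: "c \<in> I" "c \<noteq> a" "e \<in> F c" using shared ab(1) e by (auto simp: all_shared_def)
  have va: "fst e \<in> V a" "snd e \<in> V a" using edge_in_verts[OF e] V(2)[OF ab(1)] by auto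
  have vc: "fst e \<in> V c" "snd e \<in> V c" using edge_in_verts[OF c(3)] V(2)[OF c(1)] by auto
  have "c = a \<or> c = b"
    using v common_vertex(2)[OF eq va(1) _ ab c(1) vc(1)] common_vertex(2)[OF eq va(2) _ ab c(1) vc(2)] by blast
  then show ?thesis using c vc by auto
qed

text \<open>\<open>a\<close> shares the edge \<open>e\<close> with \<open>b\<close>. By
  \<open>shared_edge_step\<close> the set \<open>V b\<close> is closed along the edges of
  \<open>F a\<close>, so connectedness puts all of \<open>verts F a\<close> into \<open>V b\<close>,
  and vice versa. A third word meeting \<open>a\<close> or \<open>b\<close> would create a triple
  vertex.\<close>

lemma partner:
  assumes eq: "2 * card (\<Union> (V ` I)) = sum k I"
    and conn: "\<And>a. a \<in> I \<Longrightarrow> 2 * card (V a) = k a + card (verts (F a)) \<Longrightarrow> edge_connected (F a)"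
    and a: "a \<in> I" and e: "e \<in> F a"
  obtains b where "b \<in> I" "b \<noteq> a" "\<And>c. c \<in> I \<Longrightarrow> c \<noteq> a \<Longrightarrow> c \<noteq> b \<Longrightarrow> (V a \<union> V b) \<inter> V c = {}"
proof -
  obtain b where b: "b \<in> I" "b \<noteq> a" "e \<in> F b" using shared a e by (auto simp: all_shared_def)
  have sub: "verts (F x) \<subseteq> V y" if xy: "x \<in> I" "y \<in> I" "x \<noteq> y" "e \<in> F x" "e \<in> F y" for x y
  proof -
    have "edge_connected (F x)" using conn[OF xy(1) shared_bound(2)[OF eq xy(1)]] .
    moreover have "verts (F x) \<inter> V y \<noteq> {}"
      using edge_in_verts[OF xy(4)] edge_in_verts[OF xy(5)] V(2)[OF xy(2)] by blast
    moreover have "\<forall>e'\<in>F x. fst e' \<in> V y \<longleftrightarrow> snd e' \<in> V y"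
      using shared_edge_step[OF eq xy(1-3)] by blast
    ultimately show ?thesis unfolding edge_connected_def by blast
  qed
  have "(V a \<union> V b) \<inter> V c = {}" if c: "c \<in> I" "c \<noteq> a" "c \<noteq> b" for c
  proof (rule ccontr)
    assume "(V a \<union> V b) \<inter> V c \<noteq> {}"
    then obtain v where v: "v \<in> V c" "v \<in> V a \<or> v \<in> V b" by auto
    from v(2) show False
    proof
      assume va: "v \<in> V a"
      then have "v \<in> verts (F a)" using common_vertex(1)[OF eq va v(1) a c(1)] c by auto
      then have "v \<in> V b" using sub[OF a b(1) _ e b(3)] b(2) by auto
      then show False using common_vertex(2)[OF eq va _ a b(1) _ c(1) v(1)] b(2) c by auto
    next
      assume vb: "v \<in> V b"
      then have "v \<in> verts (F b)" using common_vertex(1)[OF eq vb v(1) b(1) c(1)] c by auto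
      then have "v \<in> V a" using sub[OF b(1) a b(2) b(3) e] by auto
      then show False using common_vertex(2)[OF eq vb _ b(1) a b(2) c(1) v(1)] c by auto
    qed
  qed
  then show ?thesis using that b by blast
qed

end

text \<open>\<open>E A\<close> stands for the mean of the product over the subfamily
  \<open>A\<close>. If some edge is unshared, both sides vanish. Otherwise \<open>large\<close>
  forces equality in the vertex bound, \<open>a0\<close> has a single partner \<open>b\<close>
  separated from all other words, and only the summand of \<open>b\<close> survives.\<close>

lemma wick_tuple:
  fixes E :: "'i set \<Rightarrow> complex" and V :: "'i \<Rightarrow> 'v set" and F :: "'i \<Rightarrow> ('v \<times> 'v) set"
  assumes I: "finite I" "a0 \<in> I"
    and V: "\<And>a. a \<in> I \<Longrightarrow> finite (V a)" "\<And>a. a \<in> I \<Longrightarrow> verts (F a) \<subseteq> V a" "\<And>a. a \<in> I \<Longrightarrow> F a \<noteq> {}"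
    and order: "\<And>a. a \<in> I \<Longrightarrow> 2 * card (V a) \<le> k a + card (verts (F a))"
    and conn: "\<And>a. a \<in> I \<Longrightarrow> 2 * card (V a) = k a + card (verts (F a)) \<Longrightarrow> edge_connected (F a)"
    and zero: "\<And>A a e. A \<subseteq> I \<Longrightarrow> a \<in> A \<Longrightarrow> e \<in> F a \<Longrightarrow> \<forall>b\<in>A - {a}. e \<notin> F b \<Longrightarrow> E A = 0"
    and mult: "\<And>A A'. A \<union> A' \<subseteq> I \<Longrightarrow> A \<inter> A' = {} \<Longrightarrow> \<forall>a\<in>A. \<forall>b\<in>A'. F a \<inter> F b = {} \<Longrightarrow>
       E (A \<union> A') = E A * E A'"
    and large: "sum k I \<le> 2 * card (\<Union> (V ` I))"
  shows "E I = (\<Sum>b\<in>I - {a0}. E {a0, b} * E (I - {a0, b}))"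
proof (cases "all_shared I F")
  case False
  then obtain a e where ae: "a \<in> I" "e \<in> F a" "\<forall>b\<in>I - {a}. e \<notin> F b" by (auto simp: all_shared_def)
  have "E {a0, b} * E (I - {a0, b}) = 0" if b: "b \<in> I - {a0}" for b
  proof (cases "a \<in> {a0, b}")
    case True
    then have "E {a0, b} = 0" using ae b I by (intro zero[of _ a e]) auto
    then show ?thesis by simp
  next
    case False
    then have "E (I - {a0, b}) = 0" using ae by (intro zero[of _ a e]) auto
    then show ?thesis by simp
  qed
  then have "(\<Sum>b\<in>I - {a0}. E {a0, b} * E (I - {a0, b})) = 0" by (rule sum.neutral[rule_format])
  moreover have "E I = 0" using ae by (intro zero[of _ a e]) auto
  ultimately show ?thesis by simp
next
  case True
  have eq: "2 * card (\<Union> (V ` I)) = sum k I"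
    using shared_bound(1)[OF I(1) V(1,2) order True] large by linarith
  obtain e where e: "e \<in> F a0" using V(3)[OF I(2)] by auto
  obtain b where b: "b \<in> I" "b \<noteq> a0" and disj: "\<And>c. c \<in> I \<Longrightarrow> c \<noteq> a0 \<Longrightarrow> c \<noteq> b \<Longrightarrow> (V a0 \<union> V b) \<inter> V c = {}"
    using partner[OF I(1) V(1,2) order True eq conn I(2) e] by blast
  have Fd: "F a \<inter> F c = {}" if "a \<in> {a0, b}" "c \<in> I" "c \<noteq> a0" "c \<noteq> b" for a c
  proof (rule ccontr)
    assume "F a \<inter> F c \<noteq> {}"
    then obtain e' where e': "e' \<in> F a" "e' \<in> F c" by auto
    have "a \<in> I" using that(1) I(2) b(1) by auto
    then have "fst e' \<in> V a" "fst e' \<in> V c"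
      using e' edge_in_verts V(2)[OF \<open>a \<in> I\<close>] V(2)[OF that(2)] by blast+
    then show False using disj[OF that(2-4)] that(1) by auto
  qed
  have "E I = E ({a0, b} \<union> (I - {a0, b}))" using I b by (intro arg_cong[where f = E]) auto
  also have "\<dots> = E {a0, b} * E (I - {a0, b})" using I b Fd by (intro mult) auto
  also have "\<dots> = (\<Sum>c\<in>{b}. E {a0, c} * E (I - {a0, c}))" by simp
  also have "\<dots> = (\<Sum>c\<in>I - {a0}. E {a0, c} * E (I - {a0, c}))"
  proof (rule sum.mono_neutral_left)
    show "\<forall>c\<in>I - {a0} - {b}. E {a0, c} * E (I - {a0, c}) = 0"
    proof
      fix c assume c: "c \<in> I - {a0} - {b}"
      then have "E {a0, c} = 0" using e I Fd[of a0 c] by (intro zero[of _ a0 e]) auto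
      then show "E {a0, c} * E (I - {a0, c}) = 0" by simp
    qed
  qed (use I b in auto)
  finally show ?thesis .
qed

section \<open>Counting words and tuples by their number of letters\<close>

text \<open>A word is coded by a list \<open>us\<close> of \<open>m\<close> letters that contains
  all of its letters and a list \<open>g\<close> of positions in \<open>us\<close>. Taking
  \<open>max 1\<close> keeps the power increasing in its exponent when \<open>B\<close> is
  empty.\<close>

lemma card_words_few_letters:
  assumes B: "finite B"
  shows "card {w. set w \<subseteq> B \<and> length w = K \<and> card (set w) \<le> v} \<le> K ^ K * (max 1 (card B)) ^ v"
proof (cases "K = 0")
  case True
  have "{w. set w \<subseteq> B \<and> length w = K \<and> card (set w) \<le> v} \<subseteq> {[]}" using True by auto
  then have "card {w. set w \<subseteq> B \<and> length w = K \<and> card (set w) \<le> v} \<le> card {[] :: 'a list}" by (intro card_mono) auto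
  also have "\<dots> \<le> K ^ K * (max 1 (card B)) ^ v" using True by simp
  finally show ?thesis .
next
  case False
  let ?S = "{w. set w \<subseteq> B \<and> length w = K \<and> card (set w) \<le> v}"
  define m where "m = min K v"
  let ?U = "{us. set us \<subseteq> B \<and> length us = m}" and ?G = "{g. set g \<subseteq> {..<K} \<and> length g = K}"
  have "?S \<subseteq> (\<lambda>(us, g). map ((!) us) g) ` (?U \<times> ?G)"
  proof
    fix w assume w: "w \<in> ?S"
    have ne: "w \<noteq> []" using w False by auto
    obtain ds where ds: "set ds = set w" "distinct ds" using finite_distinct_list[of "set w"] by auto
    have lds: "length ds \<le> m"
      using w ds card_length[of w] distinct_card[OF ds(2)] by (simp add: m_def)
    \<comment> \<open>Padding with a letter of \<open>w\<close> gives all codes the same length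
      \<open>m\<close>.\<close>
    define us where "us = ds @ replicate (m - length ds) (hd w)"
    have us: "us \<in> ?U" using w ds lds ne by (auto simp: us_def)
    have "\<forall>x\<in>set w. \<exists>i<m. us ! i = x"
    proof
      fix x assume "x \<in> set w"
      then obtain i where "i < length ds" "ds ! i = x" using ds by (metis in_set_conv_nth)
      then show "\<exists>i<m. us ! i = x" using lds by (intro exI[of _ i]) (simp add: us_def nth_append)
    qed
    then obtain f where f: "\<forall>x\<in>set w. f x < m \<and> us ! f x = x" by metis
    have "map f w \<in> ?G" using w f by (auto simp: m_def)
    moreover have "w = map ((!) us) (map f w)" using f by (simp add: map_idI)
    ultimately show "w \<in> (\<lambda>(us, g). map ((!) us) g) ` (?U \<times> ?G)" using us by (intro image_eqI[of _ _ "(us, map f w)"]) auto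
  qed
  moreover have "finite (?U \<times> ?G)" using B by (intro finite_cartesian_product finite_lists_length_eq) auto
  ultimately have "card ?S \<le> card (?U \<times> ?G)" by (meson card_image_le card_mono finite_imageI order_trans)
  also have "\<dots> = card B ^ m * K ^ K" by (simp add: card_cartesian_product card_lists_length_eq B)
  also have "card B ^ m \<le> max 1 (card B) ^ m" by (rule power_mono) auto
  also have "max 1 (card B) ^ m \<le> max 1 (card B) ^ v" by (rule power_increasing) (auto simp: m_def)
  finally show ?thesis by (simp add: mult.commute)
qed

text \<open>The lengths \<open>k a\<close> are fixed, so concatenation is injective and reduces
  tuples to single words.\<close>

lemma card_word_tuples:
  fixes Bs :: "nat \<Rightarrow> 'v set" and k :: "nat \<Rightarrow> nat"
  assumes B: "finite B" and Ba: "\<And>a. a < n \<Longrightarrow> Bs a \<subseteq> B"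
  shows "card {W \<in> (\<Pi>\<^sub>E a\<in>{..<n}. words (k a) (Bs a)). card (\<Union>a<n. set (W a)) \<le> v}
    \<le> (sum k {..<n}) ^ (sum k {..<n}) * (max 1 (card B)) ^ v"
proof -
  let ?S = "{W \<in> (\<Pi>\<^sub>E a\<in>{..<n}. words (k a) (Bs a)). card (\<Union>a<n. set (W a)) \<le> v}"
  let ?T = "{w. set w \<subseteq> B \<and> length w = sum k {..<n} \<and> card (set w) \<le> v}"
  let ?f = "\<lambda>W. concat (map W [0..<n])"
  have len: "length (W a) = k a" "set (W a) \<subseteq> B" if "W \<in> ?S" "a < n" for W a
  proof -
    have "W a \<in> words (k a) (Bs a)" using that by auto
    then show "length (W a) = k a" "set (W a) \<subseteq> B" using Ba[OF that(2)] by (auto simp: words_def)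
  qed
  have "?f ` ?S \<subseteq> ?T"
  proof
    fix w assume "w \<in> ?f ` ?S"
    then obtain W where W: "W \<in> ?S" "w = ?f W" by auto
    have "length w = (\<Sum>a\<leftarrow>[0..<n]. length (W a))" by (simp add: W(2) length_concat o_def)
    also have "\<dots> = (\<Sum>a\<leftarrow>[0..<n]. k a)"
      using len(1)[OF W(1)] by (intro arg_cong[where f = sum_list] map_cong) auto
    also have "\<dots> = sum k {..<n}" by (simp add: interv_sum_list_conv_sum_set_nat atLeast0LessThan)
    finally show "w \<in> ?T" using W len(2)[OF W(1)] by (auto simp: atLeast0LessThan)
  qed
  moreover have "inj_on ?f ?S"
  proof (rule inj_onI)
    fix W W' assume W: "W \<in> ?S" "W' \<in> ?S" "?f W = ?f W'"
    have "map W [0..<n] = map W' [0..<n]"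
      using len(1)[OF W(1)] len(1)[OF W(2)]
      by (intro concat_injective[OF W(3)]) (auto simp: set_zip)
    then have "\<forall>a<n. W a = W' a" by (auto simp: map_eq_conv)
    then show "W = W'" using W(1,2) by (intro PiE_ext[of W "{..<n}" _ W']) auto
  qed
  moreover have "finite ?T" by (rule finite_subset[OF _ finite_lists_length_eq[OF B, of "sum k {..<n}"]]) auto
  ultimately have "card ?S \<le> card ?T" by (intro card_inj_on_le)
  then show ?thesis using card_words_few_letters[OF B, of "sum k {..<n}" v] by (rule order_trans)
qed

text \<open>Expands a product of two separate expectations over one common choice for all factors,
  so that both sides of Wick's relation can be compared choice by choice.\<close>

lemma sum_PiE_split:
  fixes f g :: "('i \<Rightarrow> 'b) \<Rightarrow> 'c :: comm_semiring_1"
  assumes "finite A" "finite A'" "A \<inter> A' = {}" "\<And>i. i \<in> A \<union> A' \<Longrightarrow> finite (S i)"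
    and f: "\<And>x. f (restrict x A) = f x" and g: "\<And>x. g (restrict x A') = g x"
  shows "(\<Sum>x\<in>PiE A S. f x) * (\<Sum>x\<in>PiE A' S. g x) = (\<Sum>x\<in>PiE (A \<union> A') S. f x * g x)"
proof -
  have "(\<Sum>x\<in>PiE A S. f x) * (\<Sum>x\<in>PiE A' S. g x) = (\<Sum>(x, y)\<in>PiE A S \<times> PiE A' S. f x * g y)"
    by (simp add: sum_product sum.cartesian_product)
  also have "\<dots> = (\<Sum>x\<in>PiE (A \<union> A') S. f x * g x)"
  proof (rule sum.reindex_bij_witness[of _ "\<lambda>x. (restrict x A, restrict x A')"
        "\<lambda>(x, y) i. if i \<in> A then x i else y i"])
    fix p assume p: "p \<in> PiE A S \<times> PiE A' S"
    obtain x y where [simp]: "p = (x, y)" by (cases p)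
    have x: "x \<in> PiE A S" and y: "y \<in> PiE A' S" using p by auto
    let ?z = "\<lambda>i. if i \<in> A then x i else y i"
    have rx: "restrict ?z A = x" using x by (intro PiE_ext[of _ A _ x]) auto
    have ry: "restrict ?z A' = y" using y assms(3) by (intro PiE_ext[of _ A' _ y]) auto
    show "(restrict (case p of (x, y) \<Rightarrow> \<lambda>i. if i \<in> A then x i else y i) A,
      restrict (case p of (x, y) \<Rightarrow> \<lambda>i. if i \<in> A then x i else y i) A') = p"
      using rx ry by simp
    show "(case p of (x, y) \<Rightarrow> \<lambda>i. if i \<in> A then x i else y i) \<in> PiE (A \<union> A') S"
      using x y by (auto simp: PiE_def extensional_def Pi_iff)
    show "f (case p of (x, y) \<Rightarrow> \<lambda>i. if i \<in> A then x i else y i) *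
        g (case p of (x, y) \<Rightarrow> \<lambda>i. if i \<in> A then x i else y i) = (case p of (x, y) \<Rightarrow> f x * g y)"
      using f[of ?z] g[of ?z] rx ry by simp
  next
    fix x assume x: "x \<in> PiE (A \<union> A') S"
    show "(case (restrict x A, restrict x A') of (x, y) \<Rightarrow> \<lambda>i. if i \<in> A then x i else y i) = x"
      using x by (auto simp: fun_eq_iff PiE_def extensional_def restrict_def)
    show "(restrict x A, restrict x A') \<in> PiE A S \<times> PiE A' S" using x by auto
  qed
  finally show ?thesis .
qed

section \<open>Gaussian vectors and the method of moments\<close>

lemma quadratic_form_insert:
  fixes C :: "'i \<Rightarrow> 'i \<Rightarrow> real"
  assumes "finite S" "s \<notin> S" "\<And>p q. C p q = C q p"
  shows "(\<Sum>p\<in>insert s S. \<Sum>q\<in>insert s S. u p * u q * C p q) =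
    (u s)\<^sup>2 * C s s + 2 * u s * (\<Sum>q\<in>S. u q * C s q) + (\<Sum>p\<in>S. \<Sum>q\<in>S. u p * u q * C p q)"
proof -
  have "(\<Sum>p\<in>S. u p * u s * C p s) = u s * (\<Sum>q\<in>S. u q * C s q)"
    using assms(3) by (simp add: sum_distrib_left mult_ac)
  moreover have "(\<Sum>q\<in>S. u s * u q * C s q) = u s * (\<Sum>q\<in>S. u q * C s q)"
    by (simp add: sum_distrib_left mult_ac)
  ultimately show ?thesis
    using assms(1,2) by (simp add: sum.distrib power2_eq_square algebra_simps)
qed

text \<open>Cholesky factorization, one index at a time. If the new diagonal entry is positive, a
  rank-one form is split off and the Schur complement \<open>C'\<close> remains; if it is 0,
  semidefiniteness forces its row to vanish.\<close>

lemma psd_factorization: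
  fixes C :: "'i \<Rightarrow> 'i \<Rightarrow> real"
  assumes "finite S" "\<And>p q. C p q = C q p"
    and "\<And>u. 0 \<le> (\<Sum>p\<in>S. \<Sum>q\<in>S. u p * u q * C p q)"
  shows "\<exists>A. \<forall>p\<in>S. \<forall>q\<in>S. C p q = (\<Sum>i\<in>S. A i p * A i q)"
  using assms
proof (induction S arbitrary: C rule: finite_induct)
  case (insert s S)
  note sym = insert.prems(1) and psd = insert.prems(2)
  note quad = quadratic_form_insert[OF insert.hyps(1,2) sym]
  have S0: "(\<Sum>p\<in>S. \<Sum>q\<in>S. u' p * u' q * C p q) = (\<Sum>p\<in>S. \<Sum>q\<in>S. u p * u q * C p q)"
    if "u' = u(s := a)" for u u' a
    using that insert.hyps(2) by (intro sum.cong refl) auto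
  have S1: "(\<Sum>q\<in>S. u' q * C s q) = (\<Sum>q\<in>S. u q * C s q)" if "u' = u(s := a)" for u u' a
    using that insert.hyps(2) by (intro sum.cong refl) auto
  have diag: "0 \<le> C s s"
    using psd[of "\<lambda>p. if p = s then 1 else 0"] insert.hyps unfolding quad by (simp add: sum.neutral)
  have full: "0 \<le> a\<^sup>2 * C s s + 2 * a * (\<Sum>q\<in>S. u q * C s q) + (\<Sum>p\<in>S. \<Sum>q\<in>S. u p * u q * C p q)"
    for a u
    using psd[of "u(s := a)"] unfolding quad S0[OF refl] S1[OF refl] by simp
  show ?case
  proof (cases "C s s = 0")
    case True
    have z: "C s p = 0" if p: "p \<in> S" for p
    proof (rule ccontr)
      assume ne: "C s p \<noteq> 0"
      define u where "u q = (if q = p then 1 else 0 :: real)" for q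
      have pick: "(\<Sum>q\<in>S. u q * g q) = g p" for g
      proof -
        have "(\<Sum>q\<in>S. u q * g q) = (\<Sum>q\<in>S. if q = p then g p else 0)"
          by (intro sum.cong refl) (simp add: u_def)
        then show ?thesis using p insert.hyps(1) by simp
      qed
      have "(\<Sum>p'\<in>S. \<Sum>q\<in>S. u p' * u q * C p' q) = C p p"
        by (simp only: mult.assoc sum_distrib_left[symmetric] pick)
      with pick[of "C s"] have uC: "(\<Sum>q\<in>S. u q * C s q) = C s p"
        "(\<Sum>p'\<in>S. \<Sum>q\<in>S. u p' * u q * C p' q) = C p p" by auto
      then have "0 \<le> 2 * a * C s p + C p p" for a using full[of a u] unfolding uC True by simp
      \<comment> \<open>At this \<open>a\<close> the affine function
        \<open>2 * a * C s p + C p p\<close> takes the value -1.\<close>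
      from this[of "- (C p p + 1) / (2 * C s p)"] ne show False by (simp add: field_simps)
    qed
    have "0 \<le> (\<Sum>p\<in>S. \<Sum>q\<in>S. u p * u q * C p q)" for u using full[of 0 u] by simp
    from insert.IH[OF sym this] obtain A where A: "\<forall>p\<in>S. \<forall>q\<in>S. C p q = (\<Sum>i\<in>S. A i p * A i q)" by blast
    define A' where "A' i p = (if i = s \<or> p = s then 0 else A i p)" for i p
    have "(\<Sum>i\<in>S. A' i p * A' i q) = (if p = s \<or> q = s then 0 else \<Sum>i\<in>S. A i p * A i q)" for p q
      using insert.hyps(2) by (auto simp: A'_def intro!: sum.cong)
    then have *: "(\<Sum>i\<in>insert s S. A' i p * A' i q) = (if p = s \<or> q = s then 0 else \<Sum>i\<in>S. A i p * A i q)" for p q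
      using insert.hyps by (simp add: A'_def)
    have "C p q = (\<Sum>i\<in>insert s S. A' i p * A' i q)" if pq: "p \<in> insert s S" "q \<in> insert s S" for p q
    proof (cases "p = s \<or> q = s")
      case c: True
      have "C p q = 0" using c pq z True sym[of p s] by auto
      then show ?thesis using c *[of p q] by simp
    next
      case False
      then show ?thesis using A pq *[of p q] by auto
    qed
    then show ?thesis by blast
  next
    case False
    then have pos: "0 < C s s" using diag by simp
    define C' where "C' p q = C p q - C s p * C s q / C s s" for p q
    have sym': "C' p q = C' q p" for p q using sym by (simp add: C'_def)
    have "0 \<le> (\<Sum>p\<in>S. \<Sum>q\<in>S. u p * u q * C' p q)" for u
    proof -
      define m where "m = (\<Sum>q\<in>S. u q * C s q)"
      have "(\<Sum>p\<in>S. \<Sum>q\<in>S. u p * u q * (C s p * C s q)) = m * m"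
        unfolding m_def sum_product by (intro sum.cong refl) simp
      then have "(\<Sum>p\<in>S. \<Sum>q\<in>S. u p * u q * C' p q) =
          (\<Sum>p\<in>S. \<Sum>q\<in>S. u p * u q * C p q) - m\<^sup>2 / C s s"
        by (simp add: C'_def right_diff_distrib sum_subtractf power2_eq_square flip: sum_divide_distrib)
      \<comment> \<open>The form of the Schur complement is the minimum of the form in
        \<open>full\<close> over \<open>a\<close>, attained at
        \<open>a = - m / C s s\<close>.\<close>
      also have "\<dots> = (m / C s s)\<^sup>2 * C s s + 2 * (- m / C s s) * m + (\<Sum>p\<in>S. \<Sum>q\<in>S. u p * u q * C p q)"
        using pos by (simp add: power2_eq_square field_simps)
      also have "\<dots> \<ge> 0" using full[of "- m / C s s" u] by (simp add: m_def)
      finally show ?thesis .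
    qed
    from insert.IH[OF sym' this] obtain A where A: "\<forall>p\<in>S. \<forall>q\<in>S. C' p q = (\<Sum>i\<in>S. A i p * A i q)" by blast
    define A' where "A' i p = (if i = s then C s p / sqrt (C s s) else if p = s then 0 else A i p)" for i p
    have "(\<Sum>i\<in>S. A' i p * A' i q) = (if p = s \<or> q = s then 0 else \<Sum>i\<in>S. A i p * A i q)" for p q
      using insert.hyps(2) by (auto simp: A'_def intro!: sum.cong sum.neutral)
    then have A'_sum: "(\<Sum>i\<in>insert s S. A' i p * A' i q) = C s p * C s q / C s s + (if p = s \<or> q = s then 0 else \<Sum>i\<in>S. A i p * A i q)" for p q
      using insert.hyps pos by (simp add: A'_def real_sqrt_mult_self)
    have "C p q = (\<Sum>i\<in>insert s S. A' i p * A' i q)" if "p \<in> insert s S" "q \<in> insert s S" for p q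
    proof (cases "p = s \<or> q = s")
      case True
      then show ?thesis unfolding A'_sum using pos sym[of p s] by auto
    next
      case False
      then have "C' p q = (\<Sum>i\<in>S. A i p * A i q)" using A that by auto
      then show ?thesis unfolding A'_sum using False by (simp add: C'_def)
    qed
    then show ?thesis by blast
  qed
qed simp

text \<open>\<open>v\<close> is the variance. The quotient of factorials is the number of pairings
  of \<open>n\<close> points.\<close>

definition normal_moment :: "real \<Rightarrow> nat \<Rightarrow> real" where
  "normal_moment v n = (if even n then v ^ (n div 2) * fact n / (2 ^ (n div 2) * fact (n div 2)) else 0)"

text \<open>Wick's recursion for one variable: the first of \<open>n + 2\<close> factors has
  \<open>n + 1\<close> possible partners.\<close>

lemma normal_moment_rec:
  "normal_moment v 0 = 1" "normal_moment v 1 = 0"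
  "normal_moment v (n + 2) = real (n + 1) * v * normal_moment v n"
proof -
  show "normal_moment v (n + 2) = real (n + 1) * v * normal_moment v n"
  proof (cases "even n")
    case True
    then obtain m where "n = 2 * m" by (elim evenE)
    have "normal_moment v (n + 2) =
        v * v ^ m * (2 * (real m + 1) * (2 * real m + 1) * fact (2 * m)) / (2 * 2 ^ m * ((real m + 1) * fact m))"
      using \<open>n = 2 * m\<close> by (simp add: normal_moment_def algebra_simps)
    also have "\<dots> = (2 * real m + 1) * v * (v ^ m * fact (2 * m) / (2 ^ m * fact m))"
    proof -
      have "v * w * (2 * M * K * F) / (2 * P * (M * G)) = K * v * (w * F / (P * G))"
        if "M \<noteq> 0" for w M K F P G :: real using that by simp
      from this[of "real m + 1"] show ?thesis by (simp only: mult.assoc)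
    qed
    finally show ?thesis using \<open>n = 2 * m\<close> by (simp add: normal_moment_def)
  qed (simp add: normal_moment_def)
qed (simp_all add: normal_moment_def)

lemma prob_space_normal_law:
  assumes "0 \<le> \<sigma>" shows "prob_space (normal_law \<mu> \<sigma>)"
  using assms prob_space_normal_density[of \<sigma> \<mu>]
  by (auto simp: normal_law_def intro: prob_space_return)

lemma sets_normal_law [simp, measurable_cong]: "sets (normal_law \<mu> \<sigma>) = sets borel"
  by (simp add: normal_law_def)

lemma space_normal_law [simp]: "space (normal_law \<mu> \<sigma>) = UNIV"
  by (simp add: normal_law_def)

lemma normal_law_moment:
  assumes "0 \<le> \<sigma>"
  shows "integrable (normal_law 0 \<sigma>) (\<lambda>x. x ^ n)"
    and "(\<integral>x. x ^ n \<partial>normal_law 0 \<sigma>) = normal_moment (\<sigma>\<^sup>2) n"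
proof -
  have "integrable (normal_law 0 \<sigma>) (\<lambda>x. x ^ n) \<and> (\<integral>x. x ^ n \<partial>normal_law 0 \<sigma>) = normal_moment (\<sigma>\<^sup>2) n"
  proof (cases "\<sigma> = 0")
    case True
    have "integrable (return borel 0) (\<lambda>x::real. x ^ n)"
      by (rule integrableI_bounded) (auto simp: nn_integral_return)
    moreover have "(0::real) ^ n = normal_moment 0 n"
      by (cases "n = 0") (auto simp: normal_moment_def power_0_left elim!: evenE)
    ultimately show ?thesis using True by (simp add: normal_law_def integral_return)
  next
    case False
    then have s: "0 < \<sigma>" using assms by simp
    have i: "integrable lborel (\<lambda>x. normal_density 0 \<sigma> x * x ^ n)"
      using integrable_normal_moment[OF s, of 0 n] by simp
    have "(\<integral>x. normal_density 0 \<sigma> x * x ^ n \<partial>lborel) = normal_moment (\<sigma>\<^sup>2) n"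
    proof (cases "even n")
      case True
      then obtain k where n: "n = 2 * k" by (elim evenE)
      show ?thesis using integral_normal_moment_even[OF s, of 0 k] s
        by (simp add: n normal_moment_def power_divide field_simps)
    next
      case False
      then obtain k where n: "n = 2 * k + 1" by (elim oddE)
      show ?thesis using integral_normal_moment_odd[OF s, of 0 k] by (simp add: n normal_moment_def)
    qed
    then show ?thesis using False i
      by (simp add: normal_law_def integral_density integrable_density)
  qed
  then show "integrable (normal_law 0 \<sigma>) (\<lambda>x. x ^ n)" "(\<integral>x. x ^ n \<partial>normal_law 0 \<sigma>) = normal_moment (\<sigma>\<^sup>2) n"
    by auto
qed

lemma borel_measurable_vec_lambda:
  fixes f :: "'a \<Rightarrow> 'm::finite \<Rightarrow> real"
  assumes "\<And>p. (\<lambda>x. f x p) \<in> borel_measurable M"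
  shows "(\<lambda>x. \<chi> p. f x p) \<in> borel_measurable M"
  unfolding borel_measurable_euclidean_space[where 'c = "real ^ 'm"]
  using assms by (auto simp: Basis_vec_def inner_axis)

text \<open>The law is the image of independent standard normal variables under the factor
  \<open>A\<close> of \<open>psd_factorization\<close>, which covers singular
  \<open>C\<close>.\<close>

lemma exists_gaussian_law:
  fixes C :: "'m::finite \<Rightarrow> 'm \<Rightarrow> real"
  assumes sym: "\<And>p q. C p q = C q p"
    and psd: "\<And>u. 0 \<le> (\<Sum>p\<in>UNIV. \<Sum>q\<in>UNIV. u p * u q * C p q)"
  shows "\<exists>N :: (real ^ 'm) measure. prob_space N \<and> sets N = sets borel \<and>
    (\<forall>u. distr N borel (\<lambda>x. u \<bullet> x) = normal_law 0 (sqrt (\<Sum>p\<in>UNIV. \<Sum>q\<in>UNIV. u $ p * u $ q * C p q)))"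
proof -
  obtain A :: "'m \<Rightarrow> 'm \<Rightarrow> real" where A: "\<And>p q. C p q = (\<Sum>i\<in>UNIV. A i p * A i q)"
    using psd_factorization[OF finite sym psd] by blast
  define P where "P = (\<Pi>\<^sub>M i\<in>(UNIV :: 'm set). density lborel std_normal_density)"
  interpret D: prob_space "density lborel std_normal_density" by (rule prob_space_normal_density) simp
  interpret P: prob_space P unfolding P_def by (rule prob_space_PiM) (rule D.prob_space_axioms)
  have comp: "(\<lambda>f. f i) \<in> borel_measurable P" for i
    unfolding P_def by (rule measurable_compose[OF measurable_component_singleton[of i UNIV]]) auto
  note [measurable] = comp
  define X where "X f = (\<chi> p. \<Sum>i\<in>UNIV. A i p * f i)" for f :: "'m \<Rightarrow> real"
  have X: "X \<in> borel_measurable P" unfolding X_def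
    by (intro borel_measurable_vec_lambda) simp
  define N where "N = distr P borel X"
  have "prob_space N" unfolding N_def by (rule P.prob_space_distr) (rule X)
  moreover have "sets N = sets borel" by (simp add: N_def)
  moreover have "distr N borel (\<lambda>x. u \<bullet> x) = normal_law 0 (sqrt (\<Sum>p\<in>UNIV. \<Sum>q\<in>UNIV. u $ p * u $ q * C p q))" for u
  proof -
    define a where "a i = (\<Sum>p\<in>UNIV. u $ p * A i p)" for i
    \<comment> \<open>\<open>sum_indep_normal\<close> asks for positive deviations, so indices with
      coefficient 0 are dropped; an empty \<open>I\<close> is the degenerate law.\<close>
    define I where "I = {i. a i \<noteq> 0}"
    have "u \<bullet> X f = (\<Sum>i\<in>UNIV. a i * f i)" for f
      unfolding X_def a_def inner_vec_def
      by (simp add: sum_distrib_left sum_distrib_right mult_ac) (rule sum.swap)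
    then have uX: "u \<bullet> X f = (\<Sum>i\<in>I. a i * f i)" for f
      unfolding I_def by (simp add: sum.mono_neutral_right)
    have "(\<Sum>p\<in>UNIV. \<Sum>q\<in>UNIV. u $ p * u $ q * C p q) = (\<Sum>i\<in>UNIV. (a i)\<^sup>2)"
    proof -
      have "(\<Sum>i\<in>UNIV. (a i)\<^sup>2) = (\<Sum>i\<in>UNIV. \<Sum>p\<in>UNIV. \<Sum>q\<in>UNIV. u $ p * A i p * (u $ q * A i q))"
        by (simp add: a_def power2_eq_square sum_product)
      also have "\<dots> = (\<Sum>p\<in>UNIV. \<Sum>i\<in>UNIV. \<Sum>q\<in>UNIV. u $ p * A i p * (u $ q * A i q))"
        by (rule sum.swap)
      also have "\<dots> = (\<Sum>p\<in>UNIV. \<Sum>q\<in>UNIV. \<Sum>i\<in>UNIV. u $ p * A i p * (u $ q * A i q))"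
        by (intro sum.cong refl sum.swap)
      finally show ?thesis by (simp add: A sum_distrib_left mult_ac)
    qed
    also have "\<dots> = (\<Sum>i\<in>I. (a i)\<^sup>2)" unfolding I_def by (rule sum.mono_neutral_right) auto
    finally have Q: "(\<Sum>p\<in>UNIV. \<Sum>q\<in>UNIV. u $ p * u $ q * C p q) = (\<Sum>i\<in>I. (a i)\<^sup>2)" .
    have "distr N borel (\<lambda>x. u \<bullet> x) = distr P borel (\<lambda>f. u \<bullet> X f)"
      unfolding N_def by (subst distr_distr) (use X in \<open>auto simp: o_def\<close>)
    also have "\<dots> = distr P borel (\<lambda>f. \<Sum>i\<in>I. a i * f i)" by (simp add: uX)
    also have "\<dots> = normal_law 0 (sqrt (\<Sum>i\<in>I. (a i)\<^sup>2))"
    proof (cases "I = {}")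
      case True
      have "distr P borel (\<lambda>f. 0) = return borel (0::real)"
        by (rule measure_eqI) (auto simp: emeasure_distr P.emeasure_space_1 indicator_def)
      then show ?thesis using True by (simp add: normal_law_def)
    next
      case False
      have d: "distributed P lborel (\<lambda>f. f i) std_normal_density" for i
      proof -
        have "distr P lborel (\<lambda>f. f i) = distr P (density lborel std_normal_density) (\<lambda>f. f i)"
          by (rule distr_cong) auto
        also have "\<dots> = density lborel std_normal_density"
          unfolding P_def by (rule distr_PiM_component) (auto intro: D.prob_space_axioms)
        finally show ?thesis by (simp add: distributed_def)
      qed
      have ind: "P.indep_vars (\<lambda>_. borel) (\<lambda>i f. f i) UNIV"
      proof (subst P.indep_vars_iff_distr_eq_PiM)
        have "distr P (\<Pi>\<^sub>M i\<in>UNIV. borel) (\<lambda>f. \<lambda>i\<in>UNIV. f i) = distr P P (\<lambda>f. f)"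
          by (rule distr_cong) (auto simp: P_def intro!: sets_PiM_cong)
        also have "\<dots> = P" by (simp add: distr_id)
        also have "P = (\<Pi>\<^sub>M i\<in>UNIV. distr P borel (\<lambda>f. f i))"
        proof -
          have "distr P borel (\<lambda>f. f i) = density lborel std_normal_density" for i
            using d[of i] by (simp add: distributed_def cong: distr_cong)
          then show ?thesis by (simp add: P_def)
        qed
        finally show "distr P (\<Pi>\<^sub>M i\<in>UNIV. borel) (\<lambda>f. \<lambda>i\<in>UNIV. f i) = (\<Pi>\<^sub>M i\<in>UNIV. distr P borel (\<lambda>f. f i))" .
      qed auto
      have "P.indep_vars (\<lambda>_. borel) (\<lambda>i f. a i * f i) I"
        by (rule P.indep_vars_subset[OF P.indep_vars_compose2[OF ind, of "\<lambda>i x. a i * x"]]) auto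
      moreover have "distributed P lborel (\<lambda>f. a i * f i) (normal_density 0 \<bar>a i\<bar>)" if "i \<in> I" for i
        using P.normal_density_affine[OF d[of i], of "a i" 0] that by (simp add: I_def)
      ultimately have "distributed P lborel (\<lambda>f. \<Sum>i\<in>I. a i * f i)
          (normal_density (\<Sum>i\<in>I. 0) (sqrt (\<Sum>i\<in>I. \<bar>a i\<bar>\<^sup>2)))"
        using False by (intro P.sum_indep_normal) (auto simp: I_def)
      then have "distr P lborel (\<lambda>f. \<Sum>i\<in>I. a i * f i) = density lborel (normal_density 0 (sqrt (\<Sum>i\<in>I. (a i)\<^sup>2)))"
        by (simp add: distributed_def)
      moreover have "distr P lborel (\<lambda>f. \<Sum>i\<in>I. a i * f i) = distr P borel (\<lambda>f. \<Sum>i\<in>I. a i * f i)"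
        by (rule distr_cong) auto
      moreover have "sqrt (\<Sum>i\<in>I. (a i)\<^sup>2) \<noteq> 0"
      proof -
        obtain i where "i \<in> I" using False by auto
        then have "0 < (\<Sum>i\<in>I. (a i)\<^sup>2)" by (intro sum_pos2[of _ i]) (auto simp: I_def)
        then show ?thesis by simp
      qed
      ultimately show ?thesis by (simp add: normal_law_def)
    qed
    finally show ?thesis by (simp add: Q)
  qed
  ultimately show ?thesis by blast
qed

section \<open>Weak convergence from moments\<close>

text \<open>Taylor expansion of the characteristic function at 1, with remainder at most
  \<open>2 / fact n\<close> times the \<open>n\<close>-th absolute moment. For even \<open>n\<close>
  this moment converges too, so one \<open>n\<close> chosen for the Gaussian remainder also controls
  \<open>V L\<close> eventually.\<close>

lemma char_normal_limit:
  fixes V :: "'l \<Rightarrow> 'a \<Rightarrow> real"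
  assumes M: "prob_space M" and v: "0 \<le> v"
    and meas: "\<forall>\<^sub>F L in F. V L \<in> borel_measurable M"
    and int: "\<And>n. \<forall>\<^sub>F L in F. integrable M (\<lambda>\<omega>. V L \<omega> ^ n)"
    and mom: "\<And>n. ((\<lambda>L. \<integral>\<omega>. V L \<omega> ^ n \<partial>M) \<longlongrightarrow> normal_moment v n) F"
  shows "((\<lambda>L. \<integral>\<omega>. iexp (V L \<omega>) \<partial>M) \<longlongrightarrow> (\<integral>x. iexp x \<partial>normal_law 0 (sqrt v))) F"
proof (rule tendstoI)
  interpret M: prob_space M by fact
  define \<nu> where "\<nu> = normal_law 0 (sqrt v)"
  interpret \<nu>: prob_space \<nu> unfolding \<nu>_def by (rule prob_space_normal_law) (use v in simp)
  interpret \<nu>: real_distribution \<nu> by unfold_locales (simp_all add: \<nu>_def)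
  have \<nu>_int: "integrable \<nu> (\<lambda>x. x ^ n)" and \<nu>_mom: "(\<integral>x. x ^ n \<partial>\<nu>) = normal_moment v n" for n
    using normal_law_moment[of "sqrt v" n] v by (simp_all add: \<nu>_def)
  fix e :: real assume e: "0 < e"
  \<comment> \<open>\<open>b m\<close> is the Gaussian remainder for \<open>n = 2 * m\<close>: the
    \<open>fact n\<close> in the moment cancels, and a term of an exponential series is
    left.\<close>
  define b where "b m = 2 * ((v / 2) ^ m / fact m)" for m :: nat
  have "(\<lambda>m. (v / 2) ^ m / fact m) \<longlonglongrightarrow> 0"
    using summable_LIMSEQ_zero[OF summable_exp_generic[of "v / 2"]] by (simp add: field_simps)
  then have "b \<longlonglongrightarrow> 2 * 0" unfolding b_def by (intro tendsto_mult tendsto_const)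
  then have "\<forall>\<^sub>F m in sequentially. b m < e / 8" using e by (intro order_tendstoD) auto
  then obtain m where m: "b m < e / 8" by (auto simp: eventually_sequentially)
  define n where "n = 2 * m"
  have bn: "2 / fact n * normal_moment v n = b m"
    by (simp add: n_def b_def normal_moment_def power_divide field_simps)
  define P where "P L = (\<Sum>k\<le>n. (\<i> ^ k / fact k) * complex_of_real (\<integral>\<omega>. V L \<omega> ^ k \<partial>M))" for L
  define P\<nu> where "P\<nu> = (\<Sum>k\<le>n. (\<i> ^ k / fact k) * complex_of_real (normal_moment v k))"
  have "(P \<longlongrightarrow> P\<nu>) F" unfolding P_def P\<nu>_def by (intro tendsto_intros mom)
  then have ev1: "\<forall>\<^sub>F L in F. dist (P L) P\<nu> < e / 8" using e by (intro tendstoD) auto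
  have "((\<lambda>L. 2 / fact n * (\<integral>\<omega>. V L \<omega> ^ n \<partial>M)) \<longlongrightarrow> b m) F"
    unfolding bn[symmetric] by (intro tendsto_intros mom)
  then have ev2: "\<forall>\<^sub>F L in F. 2 / fact n * (\<integral>\<omega>. V L \<omega> ^ n \<partial>M) < e / 8" using m by (rule order_tendstoD)
  have ev3: "\<forall>\<^sub>F L in F. \<forall>k\<in>{..n}. integrable M (\<lambda>\<omega>. V L \<omega> ^ k)"
    using int by (intro eventually_ball_finite) auto
  have "cmod (char \<nu> 1 - P\<nu>) \<le> 2 / fact n * (\<integral>x. \<bar>x\<bar> ^ n \<partial>\<nu>)"
    using \<nu>.char_approx1[of n 1] \<nu>_int by (simp add: P\<nu>_def \<nu>_mom)
  also have "(\<integral>x. \<bar>x\<bar> ^ n \<partial>\<nu>) = normal_moment v n"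
    using \<nu>_mom[of n] by (simp add: n_def power_even_abs)
  finally have \<nu>b: "cmod (char \<nu> 1 - P\<nu>) < e / 8" using m unfolding bn by linarith
  show "\<forall>\<^sub>F L in F. dist (\<integral>\<omega>. iexp (V L \<omega>) \<partial>M) (\<integral>x. iexp x \<partial>normal_law 0 (sqrt v)) < e"
    using ev1 ev2 ev3 meas
  proof eventually_elim
    case (elim L)
    note [measurable] = elim(4)
    interpret D: prob_space "distr M borel (V L)" by (rule M.prob_space_distr) simp
    interpret D: real_distribution "distr M borel (V L)" by unfold_locales auto
    have "cmod (char (distr M borel (V L)) 1 - P L) \<le> 2 / fact n * (\<integral>\<omega>. \<bar>V L \<omega>\<bar> ^ n \<partial>M)"
      using D.char_approx1[of n 1] elim(3) by (simp add: P_def integrable_distr_eq integral_distr)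
    also have "(\<integral>\<omega>. \<bar>V L \<omega>\<bar> ^ n \<partial>M) = (\<integral>\<omega>. V L \<omega> ^ n \<partial>M)"
      by (simp add: n_def power_even_abs)
    also have "char (distr M borel (V L)) 1 = (\<integral>\<omega>. iexp (V L \<omega>) \<partial>M)"
      by (simp add: char_def integral_distr)
    finally have "cmod ((\<integral>\<omega>. iexp (V L \<omega>) \<partial>M) - P L) < e / 8" using elim(2) by simp
    moreover have "char \<nu> 1 = (\<integral>x. iexp x \<partial>\<nu>)" by (simp add: char_def)
    moreover have "cmod (a - d) \<le> cmod (a - p) + cmod (p - q) + cmod (d - q)" for a d p q :: complex
      using norm_triangle_ineq[of "a - p" "p - q"] norm_triangle_ineq4[of "a - q" "d - q"] by simp
    note this[of "\<integral>\<omega>. iexp (V L \<omega>) \<partial>M" "\<integral>x. iexp x \<partial>\<nu>" "P L" P\<nu>]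
    ultimately show ?case using elim(1) \<nu>b e by (simp add: dist_norm \<nu>_def[symmetric])
  qed
qed

text \<open>Trigonometric polynomials, generated so that convergence of characteristic functions
  extends to them by linearity.\<close>

inductive trig :: "(real ^ 'm::finite \<Rightarrow> complex) \<Rightarrow> bool" where
  trig_exp: "trig (\<lambda>x. c * iexp (u \<bullet> x))"
| trig_add: "trig f \<Longrightarrow> trig g \<Longrightarrow> trig (\<lambda>x. f x + g x)"

lemma trig_const: "trig (\<lambda>x. c)"
  using trig_exp[of c 0] by simp

lemma trig_mult: assumes "trig f" "trig g" shows "trig (\<lambda>x. f x * g x)"
  using assms(1)
proof induction
  case (trig_exp c u)
  show ?case using assms(2)
  proof induction
    case (trig_exp d w)
    have "(\<lambda>x. c * iexp (u \<bullet> x) * (d * iexp (w \<bullet> x))) = (\<lambda>x. c * d * iexp ((u + w) \<bullet> x))"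
      by (simp add: fun_eq_iff inner_add_left distrib_left exp_add)
    then show ?case by (simp only: trig.trig_exp)
  qed (simp add: distrib_left trig_add)
qed (simp add: distrib_right trig_add)

lemma trig_sum: "finite S \<Longrightarrow> (\<And>i. i \<in> S \<Longrightarrow> trig (f i)) \<Longrightarrow> trig (\<lambda>x. \<Sum>i\<in>S. f i x)"
  by (induction S rule: finite_induct) (auto intro: trig_const trig_add)

lemma trig_sin:
  fixes p :: "'m::finite"
  shows "trig (\<lambda>x. complex_of_real (sin (s * x $ p)))"
proof -
  have "complex_of_real (sin (s * x $ p)) =
      - \<i> / 2 * iexp (axis p s \<bullet> x) + \<i> / 2 * iexp (- axis p s \<bullet> x)" for x :: "real ^ 'm"
  proof -
    have "sin (complex_of_real y) = - \<i> / 2 * iexp y + \<i> / 2 * iexp (- y)" for y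
      unfolding sin_exp_eq by (simp add: field_simps)
    from this[of "s * x $ p"] show ?thesis by (simp add: inner_axis' flip: sin_of_real)
  qed
  then show ?thesis by (simp only: trig_add[OF trig_exp trig_exp])
qed

text \<open>Sines are trigonometric polynomials, and these form an algebra; so polynomials in the
  sines of the coordinates are covered too.\<close>

lemma trig_polynomial_sin:
  fixes P :: "real ^ 'm::finite \<Rightarrow> real"
  assumes "real_polynomial_function P"
  shows "trig (\<lambda>x. complex_of_real (P (\<chi> p. sin (s * x $ p))))"
  using assms
proof induction
  case (linear f)
  interpret bounded_linear f by fact
  have f_sum: "f y = (\<Sum>p\<in>UNIV. y $ p * f (axis p 1))" for y :: "real ^ 'm"
  proof -
    have "f y = f (\<Sum>p\<in>UNIV. y $ p *\<^sub>R axis p 1)" 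
      using basis_expansion[of y] by (simp add: scalar_mult_eq_scaleR)
    then show ?thesis by (simp add: sum scaleR)
  qed
  have "complex_of_real (f (\<chi> p. sin (s * x $ p))) =
      (\<Sum>p\<in>UNIV. complex_of_real (sin (s * x $ p)) * complex_of_real (f (axis p 1)))" for x :: "real ^ 'm"
    unfolding f_sum[of "\<chi> p. sin (s * x $ p)"] by (simp del: of_real_mult add: of_real_mult[symmetric])
  then show ?case by (simp only:) (intro trig_sum trig_mult trig_sin trig_const finite)
next
  case (const c) show ?case by (rule trig_const)
next
  case (add f g) then show ?case by (simp add: trig_add)
next
  case (mult f g) then show ?case by (simp add: trig_mult)
qed

lemma trig_continuous: "trig f \<Longrightarrow> continuous_on UNIV f"
  by (induction rule: trig.induct) (auto intro!: continuous_intros)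

lemma trig_bounded: "trig f \<Longrightarrow> \<exists>K. \<forall>x. cmod (f x) \<le> K"
proof (induction rule: trig.induct)
  case (trig_exp c u)
  then show ?case by (intro exI[of _ "cmod c"]) (simp add: norm_mult)
next
  case (trig_add f g)
  then obtain K K' where "\<forall>x. cmod (f x) \<le> K" "\<forall>x. cmod (g x) \<le> K'" by auto
  then show ?case by (intro exI[of _ "K + K'"]) (meson add_mono norm_triangle_ineq order_trans)
qed

lemma trig_integrable:
  assumes "trig f" "prob_space M" "X \<in> borel_measurable M"
  shows "integrable M (\<lambda>\<omega>. f (X \<omega>))"
proof -
  interpret prob_space M by fact
  obtain K where K: "\<forall>x. cmod (f x) \<le> K" using trig_bounded[OF assms(1)] by auto
  have "(\<lambda>\<omega>. f (X \<omega>)) \<in> borel_measurable M"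
    by (rule measurable_compose[OF assms(3) borel_measurable_continuous_onI[OF trig_continuous[OF assms(1)]]])
  then show ?thesis using K by (intro integrable_const_bound[of _ K]) auto
qed

lemma trig_tendsto:
  fixes \<xi> :: "'l \<Rightarrow> 'a \<Rightarrow> real ^ 'm::finite"
  assumes "trig f" and M: "prob_space M" and N: "prob_space N" "sets N = sets borel"
    and meas: "\<forall>\<^sub>F L in F. \<xi> L \<in> borel_measurable M"
    and char: "\<And>u. ((\<lambda>L. \<integral>\<omega>. iexp (u \<bullet> \<xi> L \<omega>) \<partial>M) \<longlongrightarrow> (\<integral>x. iexp (u \<bullet> x) \<partial>N)) F"
  shows "((\<lambda>L. \<integral>\<omega>. f (\<xi> L \<omega>) \<partial>M) \<longlongrightarrow> (\<integral>x. f x \<partial>N)) F"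
  using assms(1)
proof induction
  case (trig_exp c u)
  show ?case by (simp del: of_real_inner_1) (intro tendsto_intros char)
next
  case (trig_add f g)
  have id: "(\<lambda>x. x) \<in> borel_measurable N" by (rule measurable_ident_sets[OF N(2)])
  have "\<forall>\<^sub>F L in F. (\<integral>\<omega>. f (\<xi> L \<omega>) \<partial>M) + (\<integral>\<omega>. g (\<xi> L \<omega>) \<partial>M) = (\<integral>\<omega>. f (\<xi> L \<omega>) + g (\<xi> L \<omega>) \<partial>M)"
    using meas by eventually_elim (simp add: trig_integrable[OF trig_add.hyps(1) M] trig_integrable[OF trig_add.hyps(2) M])
  moreover have "(\<integral>x. f x + g x \<partial>N) = (\<integral>x. f x \<partial>N) + (\<integral>x. g x \<partial>N)"
    using trig_integrable[OF trig_add.hyps(1) N(1) id] trig_integrable[OF trig_add.hyps(2) N(1) id] by simp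
  ultimately show ?case
    using tendsto_add[OF trig_add.IH] by (simp add: tendsto_cong[symmetric])
qed

text \<open>The sines take values in the cube \<open>Q\<close> everywhere, so the approximant is
  bounded by \<open>K + e\<close> also outside the box. There the sum of squares divided by
  \<open>T\<^sup>2\<close> is at least 1 and pays for the error.\<close>

lemma trig_approximation:
  fixes f :: "real ^ 'm::finite \<Rightarrow> real"
  assumes f: "continuous_on UNIV f" and K: "\<And>x. \<bar>f x\<bar> \<le> K" and e: "0 < e" and T: "0 < T"
  obtains g where "trig (\<lambda>x. complex_of_real (g x))"
    "\<And>x. \<bar>f x - g x\<bar> \<le> e + (2 * K + e) * (\<Sum>p\<in>UNIV. (x $ p)\<^sup>2) / T\<^sup>2"
proof -
  define S :: "real ^ 'm \<Rightarrow> real ^ 'm" where "S x = (\<chi> p. sin (pi / (2 * T) * x $ p))" for x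
  \<comment> \<open>\<open>R\<close> inverts \<open>S\<close> on the box: the factor
    \<open>pi / (2 * T)\<close> maps \<open>[-T, T]\<close> onto the range of
    \<open>arcsin\<close>.\<close>
  define R :: "real ^ 'm \<Rightarrow> real ^ 'm" where "R y = (\<chi> p. 2 * T / pi * arcsin (y $ p))" for y
  define Q :: "(real ^ 'm) set" where "Q = cbox (\<chi> p. -1) (\<chi> p. 1)"
  have Q: "y \<in> Q \<longleftrightarrow> (\<forall>p. -1 \<le> y $ p \<and> y $ p \<le> 1)" for y by (simp add: Q_def mem_box_cart)
  have "continuous_on Q R"
    unfolding R_def by (intro continuous_intros) (auto simp: Q)
  then have "continuous_on Q (f \<circ> R)"
    by (intro continuous_on_compose continuous_on_subset[OF f]) auto
  moreover have "compact Q" by (simp add: Q_def)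
  ultimately obtain P where P: "real_polynomial_function P" "\<And>y. y \<in> Q \<Longrightarrow> \<bar>(f \<circ> R) y - P y\<bar> < e"
    using Stone_Weierstrass_real_polynomial_function e by metis
  have SQ: "S x \<in> Q" for x by (simp add: Q S_def)
  have K0: "0 \<le> K" using K[of 0] by linarith
  have "\<bar>f x - P (S x)\<bar> \<le> e + (2 * K + e) * (\<Sum>p\<in>UNIV. (x $ p)\<^sup>2) / T\<^sup>2" for x
  proof (cases "\<forall>p. \<bar>x $ p\<bar> \<le> T")
    case True
    have "R (S x) = x"
    proof (rule Finite_Cartesian_Product.vec_eq_iff[THEN iffD2], rule allI)
      fix p
      have "\<bar>pi / (2 * T) * x $ p\<bar> \<le> pi / 2"
        using True[rule_format, of p] T by (simp add: abs_mult field_simps)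
      then have "arcsin (sin (pi / (2 * T) * x $ p)) = pi / (2 * T) * x $ p"
        by (intro arcsin_sin) linarith+
      then show "R (S x) $ p = x $ p" using T by (simp add: R_def S_def)
    qed
    then have "\<bar>f x - P (S x)\<bar> \<le> e" using P(2)[OF SQ, of x] by simp
    moreover have "0 \<le> (2 * K + e) * (\<Sum>p\<in>UNIV. (x $ p)\<^sup>2) / T\<^sup>2"
      using K0 e by (intro divide_nonneg_nonneg mult_nonneg_nonneg sum_nonneg) auto
    ultimately show ?thesis by linarith
  next
    case False
    then obtain p where p: "T < \<bar>x $ p\<bar>" by (auto simp: not_le)
    have "T\<^sup>2 \<le> (x $ p)\<^sup>2" using p T by (simp add: abs_le_square_iff[symmetric])
    also have "\<dots> \<le> (\<Sum>p\<in>UNIV. (x $ p)\<^sup>2)" by (rule member_le_sum) auto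
    finally have "1 \<le> (\<Sum>p\<in>UNIV. (x $ p)\<^sup>2) / T\<^sup>2" using T by simp
    then have "(2 * K + e) * 1 \<le> (2 * K + e) * ((\<Sum>p\<in>UNIV. (x $ p)\<^sup>2) / T\<^sup>2)"
      using K0 e by (intro mult_left_mono) auto
    moreover have "\<bar>f x - P (S x)\<bar> \<le> 2 * K + e"
      using P(2)[OF SQ, of x] K[of x] K[of "R (S x)"] unfolding o_def by linarith
    ultimately show ?thesis using e by simp
  qed
  moreover have "trig (\<lambda>x. complex_of_real (P (S x)))"
    unfolding S_def by (rule trig_polynomial_sin[OF P(1)])
  ultimately show ?thesis by (intro that[of "\<lambda>x. P (S x)"])
qed

lemma approximation_expectation_bound:
  fixes X :: "'a \<Rightarrow> real ^ 'm::finite"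
  assumes P: "prob_space P" and X: "X \<in> borel_measurable P"
    and fm: "f \<in> borel_measurable borel" and K: "\<And>x. \<bar>f x\<bar> \<le> K" and K0: "0 \<le> K"
    and g: "trig (\<lambda>x. complex_of_real (g x))"
    and fg: "\<And>x. \<bar>f x - g x\<bar> \<le> e + (2 * K + e) * (\<Sum>p\<in>UNIV. (x $ p)\<^sup>2) / T\<^sup>2"
    and i2: "\<And>p. integrable P (\<lambda>\<omega>. (X \<omega> $ p)\<^sup>2)" "\<And>p. (\<integral>\<omega>. (X \<omega> $ p)\<^sup>2 \<partial>P) \<le> D p"
    and e: "0 < e"
  shows "\<bar>(\<integral>\<omega>. f (X \<omega>) \<partial>P) - (\<integral>\<omega>. g (X \<omega>) \<partial>P)\<bar> \<le> e + (2 * K + e) * sum D UNIV / T\<^sup>2"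
proof -
    interpret P: prob_space P by fact
    have ig: "integrable P (\<lambda>\<omega>. g (X \<omega>))"
      using integrable_Re[OF trig_integrable[OF g P X]] by simp
    have "(\<lambda>\<omega>. f (X \<omega>)) \<in> borel_measurable P" using measurable_compose[OF X fm] .
    then have if': "integrable P (\<lambda>\<omega>. f (X \<omega>))"
      using K by (intro P.integrable_const_bound[of _ K]) auto
    have ib: "integrable P (\<lambda>\<omega>. e + (2 * K + e) * (\<Sum>p\<in>UNIV. (X \<omega> $ p)\<^sup>2) / T\<^sup>2)"
      using i2(1) by (intro Bochner_Integration.integrable_add Bochner_Integration.integrable_divide
        integrable_mult_right Bochner_Integration.integrable_sum) auto
    have "\<bar>(\<integral>\<omega>. f (X \<omega>) \<partial>P) - (\<integral>\<omega>. g (X \<omega>) \<partial>P)\<bar> = \<bar>\<integral>\<omega>. f (X \<omega>) - g (X \<omega>) \<partial>P\<bar>"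
      using ig if' by simp
    also have "\<dots> \<le> (\<integral>\<omega>. \<bar>f (X \<omega>) - g (X \<omega>)\<bar> \<partial>P)" by (rule integral_abs_bound)
    also have "\<dots> \<le> (\<integral>\<omega>. e + (2 * K + e) * (\<Sum>p\<in>UNIV. (X \<omega> $ p)\<^sup>2) / T\<^sup>2 \<partial>P)"
      using ig if' ib fg by (intro integral_mono) auto
    also have "\<dots> = e + (2 * K + e) * (\<Sum>p\<in>UNIV. \<integral>\<omega>. (X \<omega> $ p)\<^sup>2 \<partial>P) / T\<^sup>2"
      using i2(1) by (simp add: P.prob_space)
    also have "\<dots> \<le> e + (2 * K + e) * sum D UNIV / T\<^sup>2"
      using K0 e by (intro add_left_mono divide_right_mono mult_left_mono sum_mono i2(2)) auto
    finally show ?thesis .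
qed

text \<open>On a large box a continuous function is approximated by a polynomial in the \<open>sin (x\<^sub>p / T)\<close>, that is,
  by a trigonometric polynomial; the complement of the box is controlled by the second moments.\<close>

lemma gaussian_limit_in_distribution:
  fixes \<xi> :: "'l \<Rightarrow> 'a \<Rightarrow> real ^ 'm::finite"
  assumes M: "prob_space M" and N: "prob_space N" "sets N = sets borel"
    and meas: "\<forall>\<^sub>F L in F. \<xi> L \<in> borel_measurable M"
    and char: "\<And>u. ((\<lambda>L. \<integral>\<omega>. iexp (u \<bullet> \<xi> L \<omega>) \<partial>M) \<longlongrightarrow> (\<integral>x. iexp (u \<bullet> x) \<partial>N)) F"
    and int2: "\<And>p. \<forall>\<^sub>F L in F. integrable M (\<lambda>\<omega>. (\<xi> L \<omega> $ p)\<^sup>2)"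
    and bd2: "\<And>p. \<forall>\<^sub>F L in F. (\<integral>\<omega>. (\<xi> L \<omega> $ p)\<^sup>2 \<partial>M) \<le> D p"
    and N2: "\<And>p. integrable N (\<lambda>x. (x $ p)\<^sup>2)" "\<And>p. (\<integral>x. (x $ p)\<^sup>2 \<partial>N) \<le> D p"
  shows "converges_in_distribution M \<xi> N F"
  unfolding converges_in_distribution_def
proof (intro conjI allI impI meas)
  fix f :: "real ^ 'm \<Rightarrow> real" assume f: "continuous_on UNIV f \<and> bounded (range f)"
  then obtain K where K: "\<And>x. \<bar>f x\<bar> \<le> K" by (auto simp: bounded_iff)
  have K0: "0 \<le> K" using K[of 0] by linarith
  interpret M: prob_space M by fact
  interpret N: prob_space N by fact
  have id: "(\<lambda>x. x) \<in> borel_measurable N" by (rule measurable_ident_sets[OF N(2)])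
  have fm: "f \<in> borel_measurable borel" using f by (intro borel_measurable_continuous_onI) auto
  have D0: "0 \<le> D p" for p 
    by (rule order_trans[OF _ N2(2)[of p]]) simp
  show "((\<lambda>L. \<integral>\<omega>. f (\<xi> L \<omega>) \<partial>M) \<longlongrightarrow> (\<integral>x. f x \<partial>N)) F"
  proof (rule tendstoI)
    fix e0 :: real assume e0: "0 < e0"
    define e where "e = min 1 (e0 / 6)"
    have e: "0 < e" "e \<le> 1" "6 * e \<le> e0" using e0 by (auto simp: e_def)
    \<comment> \<open>Chosen so that the tail term is at most \<open>e\<close>; the summand 1 keeps
      \<open>T\<close> positive when all second-moment bounds are 0.\<close>
    define T where "T = sqrt ((2 * K + 1) * sum D UNIV / e + 1)"
    have S0: "0 \<le> sum D UNIV" by (simp add: D0 sum_nonneg)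
    have T2: "T\<^sup>2 = (2 * K + 1) * sum D UNIV / e + 1" "0 < T"
    proof -
      have "0 \<le> (2 * K + 1) * sum D UNIV / e" using K0 S0 e by simp
      then show "T\<^sup>2 = (2 * K + 1) * sum D UNIV / e + 1" "0 < T" by (simp_all add: T_def)
    qed
    have "(2 * K + e) * sum D UNIV \<le> (2 * K + 1) * sum D UNIV"
      using e S0 by (intro mult_right_mono) auto
    also have "\<dots> \<le> e * T\<^sup>2" using e by (simp add: T2 field_simps)
    finally have small: "(2 * K + e) * sum D UNIV / T\<^sup>2 \<le> e" using T2(2) by (simp add: field_simps)
    obtain g where g: "trig (\<lambda>x. complex_of_real (g x))"
      "\<And>x. \<bar>f x - g x\<bar> \<le> e + (2 * K + e) * (\<Sum>p\<in>UNIV. (x $ p)\<^sup>2) / T\<^sup>2"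
      using trig_approximation[of f K e T] f K e T2 by blast
    have n: "\<bar>(\<integral>x. f x \<partial>N) - (\<integral>x. g x \<partial>N)\<bar> \<le> e + (2 * K + e) * sum D UNIV / T\<^sup>2"
      by (rule approximation_expectation_bound[OF N(1) id fm K K0 g N2 e(1)])
    have "((\<lambda>L. \<integral>\<omega>. complex_of_real (g (\<xi> L \<omega>)) \<partial>M) \<longlongrightarrow> (\<integral>x. complex_of_real (g x) \<partial>N)) F"
      by (rule trig_tendsto[OF g(1) M N meas char])
    then have "((\<lambda>L. \<integral>\<omega>. g (\<xi> L \<omega>) \<partial>M) \<longlongrightarrow> (\<integral>x. g x \<partial>N)) F"
      by (simp add: tendsto_of_real_iff)
    then have "\<forall>\<^sub>F L in F. dist (\<integral>\<omega>. g (\<xi> L \<omega>) \<partial>M) (\<integral>x. g x \<partial>N) < e" using e by (intro tendstoD)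
    moreover have "\<forall>\<^sub>F L in F. \<forall>p\<in>UNIV. integrable M (\<lambda>\<omega>. (\<xi> L \<omega> $ p)\<^sup>2)"
      using int2 by (intro eventually_ball_finite) auto
    moreover have "\<forall>\<^sub>F L in F. \<forall>p\<in>UNIV. (\<integral>\<omega>. (\<xi> L \<omega> $ p)\<^sup>2 \<partial>M) \<le> D p"
      using bd2 by (intro eventually_ball_finite) auto
    moreover note meas
    ultimately show "\<forall>\<^sub>F L in F. dist (\<integral>\<omega>. f (\<xi> L \<omega>) \<partial>M) (\<integral>x. f x \<partial>N) < e0"
    proof eventually_elim
      case (elim L)
      have "\<bar>(\<integral>\<omega>. f (\<xi> L \<omega>) \<partial>M) - (\<integral>\<omega>. g (\<xi> L \<omega>) \<partial>M)\<bar> \<le> e + (2 * K + e) * sum D UNIV / T\<^sup>2"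
        using elim by (intro approximation_expectation_bound[OF M _ fm K K0 g]) (auto simp: e)
      then show ?case using elim(1) n small e unfolding dist_real_def by linarith
    qed
  qed
qed

section \<open>Convergence of joint moments\<close>

text \<open>Each factor is bounded by a power of \<open>b\<close>, the largest of 1 and the
  \<open>\<bar>x $ p\<bar>\<close>. Whichever of these \<open>b\<close> is, its even power is a
  summand on the right.\<close>

lemma monomial_square_le:
  fixes x :: "real ^ 'm::finite"
  shows "(\<Prod>p\<in>UNIV. (x $ p) ^ \<alpha> p)\<^sup>2 \<le> 1 + (\<Sum>p\<in>UNIV. (x $ p) ^ (2 * sum \<alpha> UNIV))"
proof -
  define b where "b = Max (insert 1 (range (\<lambda>p. \<bar>x $ p\<bar>)))"
  have b: "1 \<le> b" "\<bar>x $ p\<bar> \<le> b" for p unfolding b_def by (rule Max_ge; simp)+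
  have "\<bar>\<Prod>p\<in>UNIV. (x $ p) ^ \<alpha> p\<bar> = (\<Prod>p\<in>UNIV. \<bar>x $ p\<bar> ^ \<alpha> p)" by (simp add: abs_prod power_abs)
  also have "\<dots> \<le> (\<Prod>p\<in>UNIV. b ^ \<alpha> p)" using b by (intro prod_mono) (auto intro: power_mono)
  also have "\<dots> = b ^ sum \<alpha> UNIV" by (rule power_sum[symmetric])
  finally have "(\<Prod>p\<in>UNIV. (x $ p) ^ \<alpha> p)\<^sup>2 \<le> (b ^ sum \<alpha> UNIV)\<^sup>2"
    using b by (subst abs_le_square_iff[symmetric]) simp
  also have "\<dots> = b ^ (2 * sum \<alpha> UNIV)" by (simp add: power_mult[symmetric] mult.commute)
  also have "\<dots> \<le> 1 + (\<Sum>p\<in>UNIV. (x $ p) ^ (2 * sum \<alpha> UNIV))"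
  proof -
    have "b \<in> insert 1 (range (\<lambda>p. \<bar>x $ p\<bar>))" unfolding b_def by (rule Max_in) auto
    then consider "b = 1" | p where "b = \<bar>x $ p\<bar>" by auto
    then show ?thesis
    proof cases
      case 1
      then show ?thesis by (simp add: sum_nonneg zero_le_even_power')
    next
      case 2
      then have "b ^ (2 * sum \<alpha> UNIV) = (x $ p) ^ (2 * sum \<alpha> UNIV)" by (simp add: power_even_abs)
      also have "\<dots> \<le> (\<Sum>p\<in>UNIV. (x $ p) ^ (2 * sum \<alpha> UNIV))"
        by (rule member_le_sum) (auto simp: zero_le_even_power')
      finally show ?thesis by simp
    qed
  qed
  finally show ?thesis .
qed

lemma monomial_square_integrable:
  fixes X :: "'a \<Rightarrow> real ^ 'm::finite" and \<alpha> :: "'m \<Rightarrow> nat"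
  defines "h \<equiv> \<lambda>x :: real ^ 'm. \<Prod>p\<in>UNIV. (x $ p) ^ \<alpha> p"
  assumes P: "prob_space P" and X: "X \<in> borel_measurable P" and n: "n = 2 * sum \<alpha> UNIV"
    and i: "\<And>p. integrable P (\<lambda>\<omega>. (X \<omega> $ p) ^ n)" "\<And>p. (\<integral>\<omega>. (X \<omega> $ p) ^ n \<partial>P) \<le> D p"
  shows "integrable P (\<lambda>\<omega>. h (X \<omega>)) \<and> integrable P (\<lambda>\<omega>. (h (X \<omega>))\<^sup>2) \<and>
    (\<integral>\<omega>. (h (X \<omega>))\<^sup>2 \<partial>P) \<le> 1 + (\<Sum>p\<in>UNIV. D p)"
proof -
    have hm: "h \<in> borel_measurable borel"
      unfolding h_def by (intro borel_measurable_continuous_onI continuous_intros)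
    interpret P: prob_space P by fact
    have m: "(\<lambda>\<omega>. h (X \<omega>)) \<in> borel_measurable P" by (rule measurable_compose[OF X hm])
    have ib: "integrable P (\<lambda>\<omega>. 1 + (\<Sum>p\<in>UNIV. (X \<omega> $ p) ^ n))" using i by simp
    have sq: "(h (X \<omega>))\<^sup>2 \<le> 1 + (\<Sum>p\<in>UNIV. (X \<omega> $ p) ^ n)" for \<omega>
      unfolding h_def n by (rule monomial_square_le)
    have i2: "integrable P (\<lambda>\<omega>. (h (X \<omega>))\<^sup>2)"
      by (rule Bochner_Integration.integrable_bound[OF ib])
        (use m sq in \<open>auto intro!: AE_I2 order_trans[OF sq] abs_ge_self\<close>)
    moreover have "integrable P (\<lambda>\<omega>. h (X \<omega>))"
      using P.square_integrable_imp_integrable[OF m i2] .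
    moreover have "(\<integral>\<omega>. (h (X \<omega>))\<^sup>2 \<partial>P) \<le> 1 + (\<Sum>p\<in>UNIV. D p)"
    proof -
      have "(\<integral>\<omega>. (h (X \<omega>))\<^sup>2 \<partial>P) \<le> (\<integral>\<omega>. 1 + (\<Sum>p\<in>UNIV. (X \<omega> $ p) ^ n) \<partial>P)"
        using i2 ib sq by (intro integral_mono) auto
      also have "\<dots> = 1 + (\<Sum>p\<in>UNIV. \<integral>\<omega>. (X \<omega> $ p) ^ n \<partial>P)" using i by (simp add: P.prob_space)
      also have "\<dots> \<le> 1 + (\<Sum>p\<in>UNIV. D p)" by (intro add_left_mono sum_mono i)
      finally show ?thesis .
    qed
    ultimately show ?thesis by blast
qed

definition clip :: "real \<Rightarrow> real \<Rightarrow> real" where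
  "clip R y = max (- R) (min R y)"

lemma abs_clip_le: "0 < R \<Longrightarrow> \<bar>clip R y\<bar> \<le> R"
  by (auto simp: clip_def)

lemma clip_error:
  assumes "0 < R" shows "\<bar>y - clip R y\<bar> \<le> y\<^sup>2 / R"
  proof (cases "\<bar>y\<bar> \<le> R")
    case False
    have "\<bar>y - clip R y\<bar> \<le> \<bar>y\<bar>" using assms by (auto simp: clip_def)
    also have "\<bar>y\<bar> * R \<le> \<bar>y\<bar> * \<bar>y\<bar>" using False by (intro mult_left_mono) auto
    then have "\<bar>y\<bar> \<le> y\<^sup>2 / R" using assms by (simp add: field_simps power2_eq_square)
    finally show ?thesis .
  qed (use assms in \<open>auto simp: clip_def\<close>)

lemma truncation_expectation_bound:
  assumes P: "prob_space P" and Y: "Y \<in> borel_measurable P" and R: "0 < R"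
      and i: "integrable P Y" "integrable P (\<lambda>\<omega>. (Y \<omega>)\<^sup>2)" "(\<integral>\<omega>. (Y \<omega>)\<^sup>2 \<partial>P) \<le> E"
  shows "\<bar>(\<integral>\<omega>. Y \<omega> \<partial>P) - (\<integral>\<omega>. clip R (Y \<omega>) \<partial>P)\<bar> \<le> E / R"
proof -
    interpret P: prob_space P by fact
    note [measurable] = Y
    have ic: "integrable P (\<lambda>\<omega>. clip R (Y \<omega>))"
      using abs_clip_le[OF R] by (intro P.integrable_const_bound[of _ R]) (auto simp: clip_def)
    have "\<bar>(\<integral>\<omega>. Y \<omega> \<partial>P) - (\<integral>\<omega>. clip R (Y \<omega>) \<partial>P)\<bar> = \<bar>\<integral>\<omega>. Y \<omega> - clip R (Y \<omega>) \<partial>P\<bar>"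
      using i ic by simp
    also have "\<dots> \<le> (\<integral>\<omega>. \<bar>Y \<omega> - clip R (Y \<omega>)\<bar> \<partial>P)" by (rule integral_abs_bound)
    also have "\<dots> \<le> (\<integral>\<omega>. (Y \<omega>)\<^sup>2 / R \<partial>P)" using i ic clip_error[OF R] by (intro integral_mono) auto
    also have "\<dots> \<le> E / R" using i(3) R by (simp add: divide_right_mono)
    finally show ?thesis .
qed

text \<open>Monomials are unbounded, so weak convergence is applied to their truncations at level
  \<open>R\<close>. The second moments of the monomials are at most \<open>E\<close> on both sides,
  hence truncation costs at most \<open>E / R\<close> uniformly in late \<open>L\<close>.\<close>

lemma gaussian_limit_moments:
  fixes \<xi> :: "'l \<Rightarrow> 'a \<Rightarrow> real ^ 'm::finite"
  assumes M: "prob_space M" and N: "prob_space N" "sets N = sets borel"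
    and conv: "converges_in_distribution M \<xi> N F"
    and int: "\<And>p n. \<forall>\<^sub>F L in F. integrable M (\<lambda>\<omega>. (\<xi> L \<omega> $ p) ^ n)"
    and bd: "\<And>p n. \<forall>\<^sub>F L in F. (\<integral>\<omega>. (\<xi> L \<omega> $ p) ^ n \<partial>M) \<le> D p n"
    and N_int: "\<And>p n. integrable N (\<lambda>x. (x $ p) ^ n)" and N_bd: "\<And>p n. (\<integral>x. (x $ p) ^ n \<partial>N) \<le> D p n"
  shows "converges_with_all_moments M \<xi> N F"
  unfolding converges_with_all_moments_def
proof
  fix \<alpha> :: "'m \<Rightarrow> nat"
  define h :: "real ^ 'm \<Rightarrow> real" where "h x = (\<Prod>p\<in>UNIV. (x $ p) ^ \<alpha> p)" for x
  define n where "n = 2 * sum \<alpha> UNIV"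
  define E where "E = 1 + (\<Sum>p\<in>UNIV. D p n)"
  have hc: "continuous_on UNIV h" unfolding h_def by (intro continuous_intros)
  have hm: "h \<in> borel_measurable borel" by (rule borel_measurable_continuous_onI[OF hc])
  have id: "(\<lambda>x. x) \<in> borel_measurable N" by (rule measurable_ident_sets[OF N(2)])
  have ev: "\<forall>\<^sub>F L in F. \<xi> L \<in> borel_measurable M \<and> (\<forall>p. integrable M (\<lambda>\<omega>. (\<xi> L \<omega> $ p) ^ n)) \<and>
      (\<forall>p. (\<integral>\<omega>. (\<xi> L \<omega> $ p) ^ n \<partial>M) \<le> D p n)"
    using conv int[of _ n] bd[of _ n]
    by (auto simp: converges_in_distribution_def eventually_conj_iff eventually_all_finite)
  have *: "integrable M (\<lambda>\<omega>. h (X \<omega>)) \<and> integrable M (\<lambda>\<omega>. (h (X \<omega>))\<^sup>2) \<and> (\<integral>\<omega>. (h (X \<omega>))\<^sup>2 \<partial>M) \<le> E"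
    if "X \<in> borel_measurable M" "\<And>p. integrable M (\<lambda>\<omega>. (X \<omega> $ p) ^ n)"
      "\<And>p. (\<integral>\<omega>. (X \<omega> $ p) ^ n \<partial>M) \<le> D p n" for X
    unfolding h_def E_def by (rule monomial_square_integrable[OF M that(1) n_def that(2,3)])
  have evM: "\<forall>\<^sub>F L in F. \<xi> L \<in> borel_measurable M \<and> integrable M (\<lambda>\<omega>. h (\<xi> L \<omega>)) \<and> integrable M (\<lambda>\<omega>. (h (\<xi> L \<omega>))\<^sup>2) \<and>
      (\<integral>\<omega>. (h (\<xi> L \<omega>))\<^sup>2 \<partial>M) \<le> E"
    using ev by eventually_elim (use * in blast)
  have EN: "integrable N h" "integrable N (\<lambda>x. (h x)\<^sup>2)" "(\<integral>x. (h x)\<^sup>2 \<partial>N) \<le> E"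
    using monomial_square_integrable[OF N(1) id n_def N_int N_bd] unfolding h_def E_def by auto
  have E0: "0 \<le> E" by (rule order_trans[OF _ EN(3)]) simp
  have "((\<lambda>L. \<integral>\<omega>. h (\<xi> L \<omega>) \<partial>M) \<longlongrightarrow> (\<integral>x. h x \<partial>N)) F"
  proof (rule tendstoI)
    fix e :: real assume e: "0 < e"
    define R where "R = 4 * E / e + 1"
    have R: "0 < R" using E0 e by (simp add: R_def add_nonneg_pos)
    have "e * R = 4 * E + e" using e by (simp add: R_def field_simps)
    then have ER: "E / R < e / 3" using R e E0 by (simp add: field_simps)
    have "continuous_on UNIV (\<lambda>x. clip R (h x))" unfolding clip_def by (intro continuous_intros hc)
    moreover have "bounded (range (\<lambda>x. clip R (h x)))" using abs_clip_le[OF R] by (auto simp: bounded_iff)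
    ultimately have "((\<lambda>L. \<integral>\<omega>. clip R (h (\<xi> L \<omega>)) \<partial>M) \<longlongrightarrow> (\<integral>x. clip R (h x) \<partial>N)) F"
      using conv by (auto simp: converges_in_distribution_def)
    then have "\<forall>\<^sub>F L in F. dist (\<integral>\<omega>. clip R (h (\<xi> L \<omega>)) \<partial>M) (\<integral>x. clip R (h x) \<partial>N) < e / 3"
      using e by (intro tendstoD) auto
    then show "\<forall>\<^sub>F L in F. dist (\<integral>\<omega>. h (\<xi> L \<omega>) \<partial>M) (\<integral>x. h x \<partial>N) < e"
      using evM
    proof eventually_elim
      case (elim L)
      have "\<bar>(\<integral>\<omega>. h (\<xi> L \<omega>) \<partial>M) - (\<integral>\<omega>. clip R (h (\<xi> L \<omega>)) \<partial>M)\<bar> \<le> E / R"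
        using elim(2) measurable_compose[OF _ hm, of "\<xi> L" M] by (intro truncation_expectation_bound M R) auto
      moreover have "\<bar>(\<integral>x. h x \<partial>N) - (\<integral>x. clip R (h x) \<partial>N)\<bar> \<le> E / R"
        using EN measurable_compose[OF id hm] by (intro truncation_expectation_bound N R) auto
      ultimately show ?case using elim(1) ER unfolding dist_real_def by linarith
    qed
  qed
  moreover have "\<forall>\<^sub>F L in F. integrable M (\<lambda>\<omega>. h (\<xi> L \<omega>))" using evM by eventually_elim auto
  ultimately show "(\<forall>\<^sub>F L in F. integrable M (\<lambda>\<omega>. \<Prod>p\<in>UNIV. (\<xi> L \<omega> $ p) ^ \<alpha> p)) \<and>
      integrable N (\<lambda>x. \<Prod>p\<in>UNIV. (x $ p) ^ \<alpha> p) \<and>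
      ((\<lambda>L. \<integral>\<omega>. (\<Prod>p\<in>UNIV. (\<xi> L \<omega> $ p) ^ \<alpha> p) \<partial>M) \<longlongrightarrow> (\<integral>x. (\<Prod>p\<in>UNIV. (x $ p) ^ \<alpha> p) \<partial>N)) F"
    using EN(1) by (simp add: h_def[symmetric])
qed

text \<open>The Cramer-Wold device in the language of moments: normal moments of all linear
  combinations determine the characteristic functions, and bounded coordinate moments upgrade weak
  convergence to joint moments.\<close>

theorem gaussian_limit:
  fixes \<xi> :: "'l \<Rightarrow> 'a \<Rightarrow> real ^ 'm::finite" and C :: "'m \<Rightarrow> 'm \<Rightarrow> real"
  defines "Q \<equiv> \<lambda>u. \<Sum>p\<in>UNIV. \<Sum>q\<in>UNIV. u p * u q * C p q"
  assumes M: "prob_space M" and F: "F \<noteq> bot" and sym: "\<And>p q. C p q = C q p"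
    and meas: "\<forall>\<^sub>F L in F. \<xi> L \<in> borel_measurable M"
    and int: "\<And>u n. \<forall>\<^sub>F L in F. integrable M (\<lambda>\<omega>. (\<Sum>p\<in>UNIV. u p * \<xi> L \<omega> $ p) ^ n)"
    and mom: "\<And>u n. ((\<lambda>L. \<integral>\<omega>. (\<Sum>p\<in>UNIV. u p * \<xi> L \<omega> $ p) ^ n \<partial>M) \<longlongrightarrow> normal_moment (Q u) n) F"
  shows "\<exists>N. gaussian_vector_law N \<and> (\<forall>p. (\<integral>x. x $ p \<partial>N) = 0) \<and>
    (\<forall>p q. (\<integral>x. x $ p * x $ q \<partial>N) = C p q) \<and>
    converges_in_distribution M \<xi> N F \<and> converges_with_all_moments M \<xi> N F"
proof -
  have nm2: "normal_moment v 2 = v" "normal_moment v 1 = 0" for v by (simp_all add: normal_moment_def)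
  \<comment> \<open>\<open>Q u\<close> is the limit of the nonnegative second moments of a linear
    combination, so semidefiniteness of \<open>C\<close> is a conclusion.\<close>
  have psd: "0 \<le> Q u" for u
  proof (rule tendsto_lowerbound[OF mom[of u 2, unfolded nm2] _ F])
    show "\<forall>\<^sub>F L in F. 0 \<le> (\<integral>\<omega>. (\<Sum>p\<in>UNIV. u p * \<xi> L \<omega> $ p)\<^sup>2 \<partial>M)" by (intro always_eventually) simp
  qed
  have inner: "u \<bullet> x = (\<Sum>p\<in>UNIV. u $ p * x $ p)" for u x :: "real ^ 'm" by (simp add: inner_vec_def)
  obtain N :: "(real ^ 'm) measure" where N: "prob_space N" "sets N = sets borel"
    and Nu: "\<And>u. distr N borel (\<lambda>x. u \<bullet> x) = normal_law 0 (sqrt (Q (\<lambda>p. u $ p)))"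
    using exists_gaussian_law[OF sym psd[unfolded Q_def]] unfolding Q_def by blast
  have im: "(\<lambda>x. u \<bullet> x) \<in> borel_measurable N" for u
    by (subst measurable_cong_sets[OF N(2) refl]) simp
  have s2: "(sqrt (Q u))\<^sup>2 = Q u" for u using psd by simp
  have N_int: "integrable N (\<lambda>x. (u \<bullet> x) ^ n)" for u n
    using normal_law_moment(1)[of "sqrt (Q (\<lambda>p. u $ p))" n] psd im[of u]
    unfolding Nu[symmetric] by (simp add: integrable_distr_eq)
  have N_mom: "(\<integral>x. (u \<bullet> x) ^ n \<partial>N) = normal_moment (Q (\<lambda>p. u $ p)) n" for u n
    using normal_law_moment(2)[of "sqrt (Q (\<lambda>p. u $ p))" n] psd im[of u]
    unfolding Nu[symmetric] s2 by (simp add: integral_distr)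
  have ax: "axis p 1 \<bullet> x = x $ p" for p and x :: "real ^ 'm" by (simp add: inner_axis')
  have pick: "(\<Sum>q\<in>UNIV. axis p 1 $ q * f q) = f p" for p and f :: "'m \<Rightarrow> real"
    using inner[of "axis p 1" "vec_lambda f"] ax[of p "vec_lambda f"] by simp
  have Q_bil: "Q u = (\<Sum>p\<in>UNIV. u p * (\<Sum>q\<in>UNIV. u q * C p q))" for u
    by (simp add: Q_def sum_distrib_left mult.assoc)
  have Q1: "Q (\<lambda>q. axis p 1 $ q) = C p p" for p
    unfolding Q_bil pick ..
  have Q2: "Q (\<lambda>r. (axis p 1 + axis q 1 :: real ^ 'm) $ r) = C p p + C p q + C q p + C q q" for p q
    by (simp add: Q_bil distrib_right distrib_left sum.distrib pick)
  have gauss: "gaussian_vector_law N"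
    unfolding gaussian_vector_law_def using N Nu psd by (metis real_sqrt_ge_zero)
  have mean: "(\<integral>x. x $ p \<partial>N) = 0" for p
    using N_mom[of "axis p 1" 1] by (simp add: ax normal_moment_def)
  have int1: "integrable N (\<lambda>x. (x $ p) ^ n)" for p n
    using N_int[of "axis p 1" n] by (simp add: ax)
  have cov: "(\<integral>x. x $ p * x $ q \<partial>N) = C p q" for p q
  proof -
    \<comment> \<open>Polarization, since the law is known only through linear functionals.\<close>
    have eq: "x $ p * x $ q = (((axis p 1 + axis q 1) \<bullet> x)\<^sup>2 - (axis p 1 \<bullet> x)\<^sup>2 - (axis q 1 \<bullet> x)\<^sup>2) / 2"
      for x :: "real ^ 'm" by (simp add: inner_add_left ax power2_eq_square algebra_simps)
    have "(\<integral>x. x $ p * x $ q \<partial>N) = (Q (\<lambda>r. (axis p 1 + axis q 1 :: real ^ 'm) $ r) - Q (\<lambda>r. axis p 1 $ r) - Q (\<lambda>r. axis q 1 $ r)) / 2"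
      unfolding eq using N_int[of _ 2] by (simp add: N_mom nm2)
    then show ?thesis unfolding Q1 Q2 using sym[of p q] by simp
  qed
  have momp: "((\<lambda>L. \<integral>\<omega>. (\<xi> L \<omega> $ p) ^ n \<partial>M) \<longlongrightarrow> normal_moment (C p p) n) F" for p n
    using mom[of "\<lambda>q. axis p 1 $ q" n] unfolding pick Q1 .
  have intp: "\<forall>\<^sub>F L in F. integrable M (\<lambda>\<omega>. (\<xi> L \<omega> $ p) ^ n)" for p n
    using int[of "\<lambda>q. axis p 1 $ q" n] unfolding pick .
  have bdp: "\<forall>\<^sub>F L in F. (\<integral>\<omega>. (\<xi> L \<omega> $ p) ^ n \<partial>M) \<le> normal_moment (C p p) n + 1" for p n
    using order_tendstoD(2)[OF momp[of p n], of "normal_moment (C p p) n + 1"] by (auto elim: eventually_mono)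
  have N_bdp: "(\<integral>x. (x $ p) ^ n \<partial>N) \<le> normal_moment (C p p) n + 1" for p n
    using N_mom[of "axis p 1" n] by (simp add: ax Q1)
  have char: "((\<lambda>L. \<integral>\<omega>. iexp (u \<bullet> \<xi> L \<omega>) \<partial>M) \<longlongrightarrow> (\<integral>x. iexp (u \<bullet> x) \<partial>N)) F" for u
  proof -
    have "\<forall>\<^sub>F L in F. (\<lambda>\<omega>. u \<bullet> \<xi> L \<omega>) \<in> borel_measurable M"
      using meas by eventually_elim simp
    then have "((\<lambda>L. \<integral>\<omega>. iexp (u \<bullet> \<xi> L \<omega>) \<partial>M) \<longlongrightarrow> (\<integral>x. iexp x \<partial>normal_law 0 (sqrt (Q (\<lambda>p. u $ p))))) F"
      by (rule char_normal_limit[OF M psd]) (unfold inner, rule int, rule mom)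
    then show ?thesis using im[of u] unfolding Nu[symmetric] by (simp add: integral_distr)
  qed
  have dist: "converges_in_distribution M \<xi> N F"
    by (rule gaussian_limit_in_distribution[OF M N meas char intp bdp int1 N_bdp])
  moreover have "converges_with_all_moments M \<xi> N F"
    by (rule gaussian_limit_moments[OF M N dist intp bdp int1 N_bdp])
  ultimately show ?thesis using gauss mean cov by blast
qed

section \<open>Walks in Wigner matrices\<close>

lemma prod_le_one_plus_sum_power:
  fixes a :: "'i \<Rightarrow> real"
  assumes I: "finite I" "card I \<le> k" and a: "\<And>i. i \<in> I \<Longrightarrow> 0 \<le> a i"
  shows "(\<Prod>i\<in>I. a i) \<le> 1 + (\<Sum>i\<in>I. a i ^ k)"
proof -
  define b where "b = Max (insert 1 (a ` I))"
  have fin: "finite (insert 1 (a ` I))" using I by simp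
  have b: "1 \<le> b" "\<And>i. i \<in> I \<Longrightarrow> a i \<le> b"
    unfolding b_def using fin by (auto intro!: Max_ge)
  have s: "0 \<le> (\<Sum>i\<in>I. a i ^ k)" using a by (intro sum_nonneg) auto
  have "(\<Prod>i\<in>I. a i) \<le> (\<Prod>i\<in>I. b)" using a b by (intro prod_mono) auto
  also have "\<dots> = b ^ card I" by simp
  also have "\<dots> \<le> b ^ k" using b(1) I(2) by (intro power_increasing)
  also have "b ^ k \<le> 1 + (\<Sum>i\<in>I. a i ^ k)"
  proof -
    have "b \<in> insert 1 (a ` I)" unfolding b_def using fin by (intro Max_in) auto
    then consider "b = 1" | i where "i \<in> I" "b = a i" by auto
    then show ?thesis
    proof cases
      case 1 then show ?thesis using s by simp
    next
      case 2
      then have "a i ^ k \<le> (\<Sum>i\<in>I. a i ^ k)" using I(1) a by (intro member_le_sum) auto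
      then show ?thesis using 2 by simp
    qed
  qed
  finally show ?thesis .
qed

lemma norm_diff_power_le:
  fixes x z :: complex
  shows "cmod (x - z) ^ q \<le> 2 ^ q * (cmod x ^ q + cmod z ^ q)"
proof -
  define m where "m = max (cmod x) (cmod z)"
  have "cmod (x - z) \<le> 2 * m" using norm_triangle_ineq4[of x z] by (simp add: m_def)
  then have "cmod (x - z) ^ q \<le> (2 * m) ^ q" by (intro power_mono) auto
  also have "\<dots> = 2 ^ q * m ^ q" by (simp add: power_mult_distrib)
  also have "m ^ q \<le> cmod x ^ q + cmod z ^ q" by (auto simp: m_def max_def)
  finally show ?thesis by simp
qed

text \<open>One sequence \<open>c\<close> of bounds serves all words of bounded length and all
  times, so the constants below do not depend on \<open>L\<close>.\<close>

definition (in prob_space) moment_bounded :: "(nat \<Rightarrow> real) \<Rightarrow> ('a \<Rightarrow> complex) \<Rightarrow> bool" where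
  "moment_bounded c f \<longleftrightarrow> f \<in> borel_measurable M \<and>
     (\<forall>q. integrable M (\<lambda>\<omega>. cmod (f \<omega>) ^ q) \<and> expectation (\<lambda>\<omega>. cmod (f \<omega>) ^ q) \<le> c q)"

context prob_space
begin

lemma moment_bounded_measurable: "moment_bounded c f \<Longrightarrow> f \<in> borel_measurable M"
  by (simp add: moment_bounded_def)

lemma moment_bounded_nonneg: "moment_bounded c f \<Longrightarrow> 0 \<le> c q"
proof -
  assume "moment_bounded c f"
  then have "expectation (\<lambda>\<omega>. cmod (f \<omega>) ^ q) \<le> c q" by (simp add: moment_bounded_def)
  then show ?thesis by (rule order_trans[rotated]) simp
qed

lemma moment_bounded_integrable: "moment_bounded c f \<Longrightarrow> integrable M f"
  unfolding moment_bounded_def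
  by (rule integrable_norm_cancel) (auto dest: spec[of _ 1])

lemma moment_bounded_expectation: "moment_bounded c f \<Longrightarrow> cmod (expectation f) \<le> c 1"
  unfolding moment_bounded_def
  by (rule order_trans[OF integral_norm_bound]) (auto dest: spec[of _ 1])

lemma moment_bounded_mono:
  "moment_bounded c f \<Longrightarrow> (\<And>q. c q \<le> c' q) \<Longrightarrow> moment_bounded c' f"
  unfolding moment_bounded_def by (meson order_trans)

lemma moment_bounded_const:
  "cmod z \<le> b \<Longrightarrow> moment_bounded (\<lambda>q. b ^ q) (\<lambda>_. z)"
  by (simp add: moment_bounded_def prob_space power_mono)

text \<open>In place of Hoelder's inequality, a product of at most \<open>k\<close> factors is
  bounded by 1 plus the sum of their \<open>k\<close>-th powers; dependent factors are
  allowed.\<close>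

lemma moment_bounded_prod:
  assumes I: "finite I" "card I \<le> k" and f: "\<And>i. i \<in> I \<Longrightarrow> moment_bounded c (f i)"
    and c: "\<And>q. 0 \<le> c q"
  shows "moment_bounded (\<lambda>q. 1 + real k * c (k * q)) (\<lambda>\<omega>. \<Prod>i\<in>I. f i \<omega>)"
proof -
  have [measurable]: "f i \<in> borel_measurable M" if "i \<in> I" for i using f[OF that] by (rule moment_bounded_measurable)
  have m: "(\<lambda>\<omega>. \<Prod>i\<in>I. f i \<omega>) \<in> borel_measurable M" by simp
  have "integrable M (\<lambda>\<omega>. cmod (\<Prod>i\<in>I. f i \<omega>) ^ q) \<and>
      expectation (\<lambda>\<omega>. cmod (\<Prod>i\<in>I. f i \<omega>) ^ q) \<le> 1 + real k * c (k * q)" for q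
  proof -
    have le: "cmod (\<Prod>i\<in>I. f i \<omega>) ^ q \<le> 1 + (\<Sum>i\<in>I. cmod (f i \<omega>) ^ (k * q))" for \<omega>
    proof -
      have "cmod (\<Prod>i\<in>I. f i \<omega>) ^ q = (\<Prod>i\<in>I. cmod (f i \<omega>) ^ q)"
        by (simp add: prod_norm[symmetric] prod_power_distrib)
      also have "\<dots> \<le> 1 + (\<Sum>i\<in>I. (cmod (f i \<omega>) ^ q) ^ k)"
        by (rule prod_le_one_plus_sum_power[OF I]) simp
      finally show ?thesis by (simp add: power_mult[symmetric] mult.commute)
    qed
    have ib: "integrable M (\<lambda>\<omega>. 1 + (\<Sum>i\<in>I. cmod (f i \<omega>) ^ (k * q)))"
      using f by (auto simp: moment_bounded_def)
    have i: "integrable M (\<lambda>\<omega>. cmod (\<Prod>i\<in>I. f i \<omega>) ^ q)"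
      by (rule Bochner_Integration.integrable_bound[OF ib])
        (use m le in \<open>auto intro!: AE_I2 order_trans[OF le] abs_ge_self\<close>)
    have "expectation (\<lambda>\<omega>. cmod (\<Prod>i\<in>I. f i \<omega>) ^ q) \<le> expectation (\<lambda>\<omega>. 1 + (\<Sum>i\<in>I. cmod (f i \<omega>) ^ (k * q)))"
      using i ib le by (intro integral_mono) auto
    also have "\<dots> = 1 + (\<Sum>i\<in>I. expectation (\<lambda>\<omega>. cmod (f i \<omega>) ^ (k * q)))"
      using f by (subst Bochner_Integration.integral_add) (auto simp: moment_bounded_def prob_space)
    also have "\<dots> \<le> 1 + (\<Sum>i\<in>I. c (k * q))"
      using f by (intro add_left_mono sum_mono) (auto simp: moment_bounded_def)
    also have "\<dots> \<le> 1 + real k * c (k * q)" using I(2) c by (auto intro: mult_right_mono)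
    finally show ?thesis using i by blast
  qed
  then show ?thesis using m by (simp add: moment_bounded_def)
qed

lemma moment_bounded_centered:
  assumes f: "moment_bounded c f"
  shows "moment_bounded (\<lambda>q. 2 ^ q * (c q + c 1 ^ q)) (\<lambda>\<omega>. f \<omega> - expectation f)"
proof -
  have [measurable]: "f \<in> borel_measurable M" using f by (rule moment_bounded_measurable)
  have "integrable M (\<lambda>\<omega>. cmod (f \<omega> - expectation f) ^ q) \<and>
      expectation (\<lambda>\<omega>. cmod (f \<omega> - expectation f) ^ q) \<le> 2 ^ q * (c q + c 1 ^ q)" for q
  proof -
    have iq: "integrable M (\<lambda>\<omega>. cmod (f \<omega>) ^ q)" "expectation (\<lambda>\<omega>. cmod (f \<omega>) ^ q) \<le> c q"
      using f by (auto simp: moment_bounded_def)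
    have ib: "integrable M (\<lambda>\<omega>. 2 ^ q * (cmod (f \<omega>) ^ q + cmod (expectation f) ^ q))"
      using iq by simp
    have le: "cmod (f \<omega> - expectation f) ^ q \<le> 2 ^ q * (cmod (f \<omega>) ^ q + cmod (expectation f) ^ q)" for \<omega>
      by (rule norm_diff_power_le)
    have i: "integrable M (\<lambda>\<omega>. cmod (f \<omega> - expectation f) ^ q)"
      by (rule Bochner_Integration.integrable_bound[OF ib])
        (use le in \<open>auto intro!: AE_I2 order_trans[OF le] abs_ge_self\<close>)
    have "expectation (\<lambda>\<omega>. cmod (f \<omega> - expectation f) ^ q)
        \<le> expectation (\<lambda>\<omega>. 2 ^ q * (cmod (f \<omega>) ^ q + cmod (expectation f) ^ q))"
      using i ib le by (intro integral_mono) auto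
    also have "\<dots> = 2 ^ q * (expectation (\<lambda>\<omega>. cmod (f \<omega>) ^ q) + cmod (expectation f) ^ q)"
      using iq by (simp add: prob_space)
    also have "\<dots> \<le> 2 ^ q * (c q + c 1 ^ q)"
      using iq(2) moment_bounded_expectation[OF f] by (intro mult_left_mono add_mono power_mono) auto
    finally show ?thesis using i by blast
  qed
  then show ?thesis by (simp add: moment_bounded_def)
qed

end

section \<open>Entries as independent paths, and products along walks\<close>

lemma prod_mset_filter_group:
  assumes "finite A" "g ` set_mset S \<subseteq> A"
  shows "(\<Prod>e\<in>A. prod_mset (image_mset f (filter_mset (\<lambda>s. g s = e) S))) = (prod_mset (image_mset f S) :: 'c :: comm_monoid_mult)"
  using assms(2)
proof (induction S)
  case (add s S)
  have "(\<Prod>e\<in>A. prod_mset (image_mset f (filter_mset (\<lambda>s. g s = e) (add_mset s S)))) =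
      (\<Prod>e\<in>A. (if g s = e then f s else 1) * prod_mset (image_mset f (filter_mset (\<lambda>s. g s = e) S)))"
    by (intro prod.cong refl) auto
  also have "\<dots> = f s * prod_mset (image_mset f S)"
    using add assms(1) by (simp add: prod.distrib)
  finally show ?case by simp
qed simp

lemma borel_measurable_prod_mset:
  fixes f :: "'s \<Rightarrow> 'a \<Rightarrow> complex"
  assumes "\<And>s. s \<in># S \<Longrightarrow> f s \<in> borel_measurable N"
  shows "(\<lambda>x. prod_mset (image_mset (\<lambda>s. f s x) S)) \<in> borel_measurable N"
  using assms by (induction S) auto

lemma prod_mset_conv_prod:
  "prod_mset (image_mset f (mset xs)) = (\<Prod>j<length xs. f (xs ! j) :: 'c :: comm_monoid_mult)"
proof -
  have "prod_mset (image_mset f (mset xs)) = prod_list (map f xs)"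
    by (metis mset_map prod_mset_prod_list)
  then show ?thesis by (simp add: prod.list_conv_set_nth atLeast0LessThan)
qed

definition valid_edges :: "(nat \<times> nat) set" where
  "valid_edges = {(i, j). 1 \<le> i \<and> i \<le> j}"

lemma edge_valid: "1 \<le> fst s \<Longrightarrow> 1 \<le> snd s \<Longrightarrow> edge s \<in> valid_edges"
  by (auto simp: edge_def valid_edges_def)

lemma edges_of_valid: "set w \<subseteq> {1..} \<Longrightarrow> edges_of w \<subseteq> valid_edges"
  using set_steps_subset[of w] by (fastforce simp: edges_of_def intro!: edge_valid)

context time_dependent_wigner
begin

abbreviation paths :: "(real \<Rightarrow> complex) measure" where
  "paths \<equiv> \<Pi>\<^sub>M t\<in>UNIV. borel"

definition entry :: "real \<Rightarrow> nat \<times> nat \<Rightarrow> 'a \<Rightarrow> complex" where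
  "entry t s \<omega> = wigner_entry Z Y (fst s) (snd s) t \<omega>"

definition path :: "nat \<times> nat \<Rightarrow> 'a \<Rightarrow> real \<Rightarrow> complex" where
  "path e \<omega> = (\<lambda>t. entry t e \<omega>)"

lemma entry_swap: "entry t (v, u) \<omega> = cnj (entry t (u, v) \<omega>)"
  by (auto simp: entry_def wigner_entry_def)

lemma entry_conv_path:
  "entry t s \<omega> = (if fst s \<le> snd s then path (edge s) \<omega> t else cnj (path (edge s) \<omega> t))"
  by (cases s) (auto simp: path_def edge_def entry_def wigner_entry_def min_def max_def)

lemma indep_path: "indep_vars (\<lambda>_. paths) path valid_edges"
proof -
  have "path = (\<lambda>(i, j) \<omega> t. wigner_entry Z Y i j t \<omega>)"
    by (auto simp: fun_eq_iff path_def entry_def)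
  then show ?thesis using indep by (simp add: valid_edges_def)
qed

lemma path_measurable: "e \<in> valid_edges \<Longrightarrow> path e \<in> measurable M paths"
  using indep_path by (auto simp: indep_vars_def)

text \<open>The representative with the same law: all off-diagonal paths are compared with
  \<open>(1, 2)\<close>, all diagonal ones with \<open>(1, 1)\<close>.\<close>

definition edge_type :: "nat \<times> nat \<Rightarrow> nat \<times> nat" where
  "edge_type e = (if fst e < snd e then (1, 2) else (1, 1))"

lemma edge_type_valid [simp]: "edge_type e \<in> valid_edges"
  by (auto simp: edge_type_def valid_edges_def)

lemma eval_measurable: "(\<lambda>f. f t) \<in> borel_measurable paths"
  by (rule measurable_component_singleton) simp

text \<open>\<open>ident_Y\<close> speaks of real paths; their law is pushed forward along the
  inclusion of real into complex paths.\<close>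

lemma distr_path_diag:
  assumes "1 \<le> i"
  shows "distr M paths (path (i, i)) = distr (distr M (\<Pi>\<^sub>M t\<in>UNIV. borel) (\<lambda>\<omega> t. Y i t \<omega>)) paths (\<lambda>f t. complex_of_real (f t))"
proof -
  have m1: "(\<lambda>f t. complex_of_real (f t)) \<in> measurable (\<Pi>\<^sub>M t\<in>(UNIV :: real set). borel) paths"
    by (rule measurable_PiM_single') (auto intro!: borel_measurable_of_real measurable_component_singleton)
  have m2: "(\<lambda>f t. Re (f t)) \<in> measurable paths (\<Pi>\<^sub>M t\<in>(UNIV :: real set). borel)"
    by (rule measurable_PiM_single')
      (auto intro!: measurable_compose[OF eval_measurable borel_measurable_Re])
  have p: "path (i, i) = (\<lambda>\<omega> t. complex_of_real (Y i t \<omega>))"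
    by (simp add: path_def entry_def wigner_entry_def fun_eq_iff)
  \<comment> \<open>Measurability of the real path is recovered as the real part of the complex one,
    which is measurable by \<open>indep\<close>.\<close>
  have "path (i, i) \<in> measurable M paths" 
    using assms by (intro path_measurable) (simp add: valid_edges_def)
  from measurable_compose[OF this m2] have m3: "(\<lambda>\<omega> t. Y i t \<omega>) \<in> measurable M (\<Pi>\<^sub>M t\<in>UNIV. borel)"
    by (simp add: p)
  show ?thesis by (subst distr_distr[OF m1 m3]) (simp add: p comp_def)
qed

lemma distr_path: "e \<in> valid_edges \<Longrightarrow> distr M paths (path e) = distr M paths (path (edge_type e))"
proof -
  assume e: "e \<in> valid_edges"
  obtain i j where ij: "e = (i, j)" "1 \<le> i" "i \<le> j" using e by (auto simp: valid_edges_def)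
  show ?thesis
  proof (cases "i < j")
    case True
    have "path (a, b) = (\<lambda>\<omega> t. Z a b t \<omega>)" if "a < b" for a b
      using that by (simp add: path_def entry_def wigner_entry_def fun_eq_iff)
    then show ?thesis using True ij ident_Z[OF ij(2) True] by (simp add: edge_type_def)
  next
    case False
    then have "e = (i, i)" using ij by simp
    then show ?thesis using ij distr_path_diag[of i] distr_path_diag[of 1] ident_Y[of i]
      by (simp add: edge_type_def)
  qed
qed

lemma path_transfer:
  fixes h :: "(real \<Rightarrow> complex) \<Rightarrow> 'b :: {banach, second_countable_topology}"
  assumes e: "e \<in> valid_edges" and h: "h \<in> borel_measurable paths"
  shows "integrable M (\<lambda>\<omega>. h (path e \<omega>)) \<longleftrightarrow> integrable M (\<lambda>\<omega>. h (path (edge_type e) \<omega>))"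
    and "expectation (\<lambda>\<omega>. h (path e \<omega>)) = expectation (\<lambda>\<omega>. h (path (edge_type e) \<omega>))"
proof -
  note m = path_measurable[OF e] path_measurable[OF edge_type_valid]
  show "integrable M (\<lambda>\<omega>. h (path e \<omega>)) \<longleftrightarrow> integrable M (\<lambda>\<omega>. h (path (edge_type e) \<omega>))"
    using integrable_distr_eq[OF m(1) h] integrable_distr_eq[OF m(2) h, of e] distr_path[OF e] by simp
  show "expectation (\<lambda>\<omega>. h (path e \<omega>)) = expectation (\<lambda>\<omega>. h (path (edge_type e) \<omega>))"
    using integral_distr[OF m(1) h] integral_distr[OF m(2) h, of e] distr_path[OF e] by simp
qed

lemma entry_measurable:
  assumes "1 \<le> fst s" "1 \<le> snd s" shows "entry t s \<in> borel_measurable M"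
proof -
  note p = measurable_compose[OF path_measurable[OF edge_valid[OF assms]] eval_measurable, of t]
  have "entry t s = (if fst s \<le> snd s then (\<lambda>\<omega>. path (edge s) \<omega> t) else (\<lambda>\<omega>. cnj (path (edge s) \<omega> t)))"
    by (auto simp: fun_eq_iff entry_conv_path)
  then show ?thesis using p borel_measurable_continuous_onI[OF continuous_on_cnj[OF continuous_on_id]]
    by (auto intro: measurable_compose)
qed

lemma entry_moments:
  "\<exists>c. (\<forall>q. 0 \<le> c q) \<and> (\<forall>t s. 1 \<le> fst s \<longrightarrow> 1 \<le> snd s \<longrightarrow> moment_bounded c (entry t s))"
proof -
  have "\<forall>q. \<exists>C. \<forall>t. (integrable M (\<lambda>\<omega>. cmod (Z 1 2 t \<omega>) ^ q) \<and> expectation (\<lambda>\<omega>. cmod (Z 1 2 t \<omega>) ^ q) \<le> C) \<and>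
     (integrable M (\<lambda>\<omega>. \<bar>Y 1 t \<omega>\<bar> ^ q) \<and> expectation (\<lambda>\<omega>. \<bar>Y 1 t \<omega>\<bar> ^ q) \<le> C)"
  proof
    fix q :: nat
    show "\<exists>C. \<forall>t. (integrable M (\<lambda>\<omega>. cmod (Z 1 2 t \<omega>) ^ q) \<and> expectation (\<lambda>\<omega>. cmod (Z 1 2 t \<omega>) ^ q) \<le> C) \<and>
     (integrable M (\<lambda>\<omega>. \<bar>Y 1 t \<omega>\<bar> ^ q) \<and> expectation (\<lambda>\<omega>. \<bar>Y 1 t \<omega>\<bar> ^ q) \<le> C)"
    proof (cases "q = 0")
      case True
      then show ?thesis by (intro exI[of _ 1]) (simp add: prob_space)
    next
      case False
      then have "1 \<le> q" by simp
      from moments_Z[OF this] moments_Y[OF this] obtain C C' where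
        "\<forall>t. integrable M (\<lambda>\<omega>. cmod (Z 1 2 t \<omega>) ^ q) \<and> expectation (\<lambda>\<omega>. cmod (Z 1 2 t \<omega>) ^ q) \<le> C"
        "\<forall>t. integrable M (\<lambda>\<omega>. \<bar>Y 1 t \<omega>\<bar> ^ q) \<and> expectation (\<lambda>\<omega>. \<bar>Y 1 t \<omega>\<bar> ^ q) \<le> C'" by blast
      then show ?thesis by (intro exI[of _ "max C C'"]) (auto simp: le_max_iff_disj)
    qed
  qed
  then obtain c where c: "\<And>q t. (integrable M (\<lambda>\<omega>. cmod (Z 1 2 t \<omega>) ^ q) \<and> expectation (\<lambda>\<omega>. cmod (Z 1 2 t \<omega>) ^ q) \<le> c q) \<and>
     (integrable M (\<lambda>\<omega>. \<bar>Y 1 t \<omega>\<bar> ^ q) \<and> expectation (\<lambda>\<omega>. \<bar>Y 1 t \<omega>\<bar> ^ q) \<le> c q)" by metis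
  have mb: "moment_bounded c (entry t s)" if s: "1 \<le> fst s" "1 \<le> snd s" for t s
  proof -
    have "integrable M (\<lambda>\<omega>. cmod (entry t s \<omega>) ^ q) \<and> expectation (\<lambda>\<omega>. cmod (entry t s \<omega>) ^ q) \<le> c q" for q
    proof -
      have m: "(\<lambda>f. cmod (f t) ^ q) \<in> borel_measurable paths"
        by (intro borel_measurable_power measurable_compose[OF eval_measurable borel_measurable_norm])
      have eq: "cmod (entry t s \<omega>) = cmod (path (edge s) \<omega> t)" for \<omega> by (simp add: entry_conv_path)
      have "path (1, 2) \<omega> t = Z 1 2 t \<omega>" "path (1, 1) \<omega> t = complex_of_real (Y 1 t \<omega>)" for \<omega>
        by (simp_all add: path_def entry_def wigner_entry_def)
      then show ?thesis
        unfolding eq path_transfer[OF edge_valid[OF s] m] using c[of t q]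
        by (auto simp: edge_type_def)
    qed
    then show ?thesis using entry_measurable[OF s] by (simp add: moment_bounded_def)
  qed
  have "0 \<le> c q" for q using moment_bounded_nonneg[OF mb[of "(1, 1)"]] by simp
  then show ?thesis using mb by blast
qed

lemma expectation_prod_path:
  fixes g :: "nat \<times> nat \<Rightarrow> (real \<Rightarrow> complex) \<Rightarrow> complex"
  assumes D: "finite D" "D \<subseteq> valid_edges"
    and g: "\<And>e. e \<in> D \<Longrightarrow> g e \<in> borel_measurable paths"
    and i: "\<And>e. e \<in> D \<Longrightarrow> integrable M (\<lambda>\<omega>. g e (path e \<omega>))"
  shows "expectation (\<lambda>\<omega>. \<Prod>e\<in>D. g e (path e \<omega>)) = (\<Prod>e\<in>D. expectation (\<lambda>\<omega>. g e (path e \<omega>)))"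
    and "integrable M (\<lambda>\<omega>. \<Prod>e\<in>D. g e (path e \<omega>))"
proof -
  have "indep_vars (\<lambda>_. borel) (\<lambda>e \<omega>. g e (path e \<omega>)) D"
    by (rule indep_vars_compose2[OF indep_vars_subset[OF indep_path D(2)] g])
  then show "expectation (\<lambda>\<omega>. \<Prod>e\<in>D. g e (path e \<omega>)) = (\<Prod>e\<in>D. expectation (\<lambda>\<omega>. g e (path e \<omega>)))"
    "integrable M (\<lambda>\<omega>. \<Prod>e\<in>D. g e (path e \<omega>))"
    using indep_vars_lebesgue_integral[OF D(1) _ i] indep_vars_integrable[OF D(1) _ i] by auto
qed

definition edge_steps :: "nat list \<Rightarrow> nat \<times> nat \<Rightarrow> (nat \<times> nat) multiset" where
  "edge_steps w e = filter_mset (\<lambda>s. edge s = e) (mset (steps w))"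

definition edge_prod :: "real \<Rightarrow> nat list \<Rightarrow> nat \<times> nat \<Rightarrow> 'a \<Rightarrow> complex" where
  "edge_prod t w e \<omega> = prod_mset (image_mset (\<lambda>s. entry t s \<omega>) (edge_steps w e))"

text \<open>The factor of an edge as a functional of the whole path of its entry; independence and equality in
  law of the entries are available only on the level of paths.\<close>

definition edge_fun :: "real \<Rightarrow> nat list \<Rightarrow> nat \<times> nat \<Rightarrow> (real \<Rightarrow> complex) \<Rightarrow> complex" where
  "edge_fun t w e f = prod_mset (image_mset (\<lambda>s. if fst s \<le> snd s then f t else cnj (f t)) (edge_steps w e))"

definition walk_prod :: "real \<Rightarrow> nat list \<Rightarrow> 'a \<Rightarrow> complex" where
  "walk_prod t w \<omega> = prod_mset (image_mset (\<lambda>s. entry t s \<omega>) (mset (steps w)))"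

text \<open>The summand of \<open>F = snd x\<close> when each edge factor is written as centred part
  plus mean and the product is multiplied out.\<close>

definition walk_term :: "real \<Rightarrow> nat list \<times> (nat \<times> nat) set \<Rightarrow> 'a \<Rightarrow> complex" where
  "walk_term t x \<omega> = (\<Prod>e\<in>snd x. edge_prod t (fst x) e \<omega> - expectation (edge_prod t (fst x) e)) *
     (\<Prod>e\<in>edges_of (fst x) - snd x. expectation (edge_prod t (fst x) e))"

lemma edge_prod_conv_path: "edge_prod t w e \<omega> = edge_fun t w e (path e \<omega>)"
  unfolding edge_prod_def edge_fun_def
  by (intro arg_cong[where f = prod_mset] image_mset_cong) (auto simp: edge_steps_def entry_conv_path)

lemma edge_fun_measurable: "edge_fun t w e \<in> borel_measurable paths"
  unfolding edge_fun_def
proof (rule borel_measurable_prod_mset)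
  fix s :: "nat \<times> nat"
  show "(\<lambda>f. if fst s \<le> snd s then f t else cnj (f t)) \<in> borel_measurable paths"
    using eval_measurable measurable_compose[OF eval_measurable borel_measurable_continuous_onI[OF continuous_on_cnj[OF continuous_on_id]]]
    by (cases "fst s \<le> snd s") auto
qed

lemma walk_prod_conv_edges: "walk_prod t w \<omega> = (\<Prod>e\<in>edges_of w. edge_prod t w e \<omega>)"
  unfolding walk_prod_def edge_prod_def edge_steps_def
  by (rule prod_mset_filter_group[symmetric]) (auto simp: edges_of_def)

lemma entry_prod_mset_moments:
  "\<exists>c. (\<forall>q. 0 \<le> c q) \<and> (\<forall>t S. size S \<le> k \<longrightarrow> (\<forall>s. s \<in># S \<longrightarrow> 1 \<le> fst s \<and> 1 \<le> snd s) \<longrightarrow>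
       moment_bounded c (\<lambda>\<omega>. prod_mset (image_mset (\<lambda>s. entry t s \<omega>) S)))"
proof -
  obtain c where c: "\<And>q. 0 \<le> c q" "\<And>t s. 1 \<le> fst s \<Longrightarrow> 1 \<le> snd s \<Longrightarrow> moment_bounded c (entry t s)"
    using entry_moments by blast
  show ?thesis
  proof (intro exI[of _ "\<lambda>q. 1 + real k * c (k * q)"] conjI allI impI)
    show "0 \<le> 1 + real k * c (k * q)" for q using c(1) by simp
    fix t and S :: "(nat \<times> nat) multiset"
    assume S: "size S \<le> k" "\<forall>s. s \<in># S \<longrightarrow> 1 \<le> fst s \<and> 1 \<le> snd s"
    obtain xs where xs: "S = mset xs" by (metis ex_mset)
    have "moment_bounded c (entry t (xs ! j))" if "j \<in> {..<length xs}" for j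
      using S(2)[rule_format, of "xs ! j"] that c(2) by (simp add: xs)
    then have "moment_bounded (\<lambda>q. 1 + real k * c (k * q)) (\<lambda>\<omega>. \<Prod>j\<in>{..<length xs}. entry t (xs ! j) \<omega>)"
      using S(1) c(1) by (intro moment_bounded_prod) (auto simp: xs)
    then show "moment_bounded (\<lambda>q. 1 + real k * c (k * q)) (\<lambda>\<omega>. prod_mset (image_mset (\<lambda>s. entry t s \<omega>) S))"
      by (simp add: xs prod_mset_conv_prod)
  qed
qed

lemma steps_pos: "set w \<subseteq> {1..} \<Longrightarrow> s \<in># mset (steps w) \<Longrightarrow> 1 \<le> fst s \<and> 1 \<le> snd s"
  using set_steps_subset[of w] by fastforce

lemma walk_moments:
  "\<exists>c. (\<forall>q. 0 \<le> c q) \<and> (\<forall>t w e. length w \<le> k \<longrightarrow> set w \<subseteq> {1..} \<longrightarrow>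
     moment_bounded c (edge_prod t w e) \<and> moment_bounded c (walk_prod t w))"
proof -
  obtain c where c: "\<And>q. 0 \<le> c q"
    "\<And>t S. size S \<le> k \<Longrightarrow> \<forall>s. s \<in># S \<longrightarrow> 1 \<le> fst s \<and> 1 \<le> snd s \<Longrightarrow>
       moment_bounded c (\<lambda>\<omega>. prod_mset (image_mset (\<lambda>s. entry t s \<omega>) S))"
    using entry_prod_mset_moments[of k] by blast
  show ?thesis
  proof (intro exI[of _ c] conjI allI impI)
    show "0 \<le> c q" for q by (rule c(1))
    fix t e and w :: "nat list" assume w: "length w \<le> k" "set w \<subseteq> {1..}"
    have "size (edge_steps w e) \<le> size (mset (steps w))" unfolding edge_steps_def by (rule size_filter_mset_lesseq)
    then show "moment_bounded c (edge_prod t w e)"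
      unfolding edge_prod_def[abs_def] using w steps_pos[OF w(2)] by (intro c(2)) (auto simp: edge_steps_def)
    show "moment_bounded c (walk_prod t w)"
      unfolding walk_prod_def[abs_def] using w steps_pos[OF w(2)] by (intro c(2)) auto
  qed
qed

lemma edge_prod_centered_moments:
  "\<exists>c. (\<forall>q. 0 \<le> c q) \<and> (\<forall>t w e. length w \<le> k \<longrightarrow> set w \<subseteq> {1..} \<longrightarrow>
     moment_bounded c (\<lambda>\<omega>. edge_prod t w e \<omega> - expectation (edge_prod t w e)) \<and>
     moment_bounded c (\<lambda>\<omega>. expectation (edge_prod t w e)))"
proof -
  obtain c where c: "\<And>q. 0 \<le> c q"
    "\<And>t w e. length w \<le> k \<Longrightarrow> set w \<subseteq> {1..} \<Longrightarrow> moment_bounded c (edge_prod t w e)"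
    using walk_moments[of k] by blast
  define c' where "c' q = 2 ^ q * (c q + c 1 ^ q) + c 1 ^ q" for q
  show ?thesis
  proof (intro exI[of _ c'] conjI allI impI)
    show "0 \<le> c' q" for q using c(1) by (simp add: c'_def)
    fix t e and w :: "nat list" assume w: "length w \<le> k" "set w \<subseteq> {1..}"
    show "moment_bounded c' (\<lambda>\<omega>. edge_prod t w e \<omega> - expectation (edge_prod t w e))"
      by (rule moment_bounded_mono[OF moment_bounded_centered[OF c(2)[OF w]]]) (simp add: c'_def c(1))
    show "moment_bounded c' (\<lambda>\<omega>. expectation (edge_prod t w e))"
      by (rule moment_bounded_mono[OF moment_bounded_const[OF moment_bounded_expectation[OF c(2)[OF w]]]])
        (simp add: c'_def c(1))
  qed
qed

lemma walk_term_moments: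
  "\<exists>c. (\<forall>q. 0 \<le> c q) \<and> (\<forall>t w F. length w \<le> k \<longrightarrow> set w \<subseteq> {1..} \<longrightarrow> F \<subseteq> edges_of w \<longrightarrow>
     moment_bounded c (walk_term t (w, F)))"
proof -
  obtain c where c: "\<And>q. 0 \<le> c q"
    "\<And>t w e. length w \<le> k \<Longrightarrow> set w \<subseteq> {1..} \<Longrightarrow> moment_bounded c (\<lambda>\<omega>. edge_prod t w e \<omega> - expectation (edge_prod t w e))"
    "\<And>t w e. length w \<le> k \<Longrightarrow> set w \<subseteq> {1..} \<Longrightarrow> moment_bounded c (\<lambda>\<omega>. expectation (edge_prod t w e))"
    using edge_prod_centered_moments[of k] by blast
  show ?thesis
  proof (intro exI[of _ "\<lambda>q. 1 + real k * c (k * q)"] conjI allI impI)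
    show "0 \<le> 1 + real k * c (k * q)" for q using c(1) by simp
    fix t F and w :: "nat list" assume w: "length w \<le> k" "set w \<subseteq> {1..}" and F: "F \<subseteq> edges_of w"
    let ?g = "\<lambda>e \<omega>. if e \<in> F then edge_prod t w e \<omega> - expectation (edge_prod t w e) else expectation (edge_prod t w e)"
    have "card (edges_of w) \<le> length (steps w)"
      unfolding edges_of_def by (metis card_image_le card_length List.finite_set order_trans)
    then have k: "card (edges_of w) \<le> k" using w by simp
    have g: "moment_bounded c (?g e)" for e using c(2,3)[OF w, of t e] by (cases "e \<in> F") auto
    have "walk_term t (w, F) \<omega> = (\<Prod>e\<in>edges_of w. ?g e \<omega>)" for \<omega>
    proof -
      have "(\<Prod>e\<in>edges_of w. ?g e \<omega>) = (\<Prod>e\<in>F. ?g e \<omega>) * (\<Prod>e\<in>edges_of w - F. ?g e \<omega>)"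
        using prod.subset_diff[OF F, of "\<lambda>e. ?g e \<omega>"] by (simp add: mult.commute)
      also have "(\<Prod>e\<in>F. ?g e \<omega>) = (\<Prod>e\<in>F. edge_prod t w e \<omega> - expectation (edge_prod t w e))"
        by (intro prod.cong) auto
      also have "(\<Prod>e\<in>edges_of w - F. ?g e \<omega>) = (\<Prod>e\<in>edges_of w - F. expectation (edge_prod t w e))"
        by (intro prod.cong) auto
      finally show ?thesis by (simp add: walk_term_def)
    qed
    then show "moment_bounded (\<lambda>q. 1 + real k * c (k * q)) (walk_term t (w, F))"
      using moment_bounded_prod[OF finite_edges_of k g c(1)] by presburger
  qed
qed


section \<open>First, second and fourth moments of the entries\<close>

abbreviation covar :: "real \<Rightarrow> real \<Rightarrow> real" where
  "covar \<equiv> wigner_cov M \<beta> Y"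

lemma covar_commute: "covar s t = covar t s"
  by (simp add: wigner_cov_def mult.commute)

lemma beta_pos: "0 < \<beta>"
  using beta by auto

lemma path_eval_1: "path (1, 2) \<omega> t = Z 1 2 t \<omega>" "path (1, 1) \<omega> t = complex_of_real (Y 1 t \<omega>)"
  by (simp_all add: path_def entry_def wigner_entry_def)

text \<open>Both spellings of the index 1 occur, because simplification turns it into
  \<open>Suc 0\<close>.\<close>

lemmas path_eval = path_eval_1 path_eval_1[unfolded One_nat_def]

lemma cnj_Z_1: "\<beta> = 1 \<Longrightarrow> \<omega> \<in> space M \<Longrightarrow> cnj (Z 1 2 t \<omega>) = Z 1 2 t \<omega>"
  using real_symmetric by (simp add: Reals_cnj_iff)

lemmas cnj_Z = cnj_Z_1 cnj_Z_1[unfolded One_nat_def]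

lemma measurable_cnj_eval: "(\<lambda>f. cnj (f t)) \<in> borel_measurable paths"
  by (rule measurable_compose[OF eval_measurable borel_measurable_continuous_onI]) (intro continuous_intros)

lemma expectation_path_mult_cnj:
  assumes e: "e \<in> valid_edges"
  shows "expectation (\<lambda>\<omega>. path e \<omega> s * cnj (path e \<omega> t)) =
    complex_of_real (if fst e < snd e then covar s t else 2 / real \<beta> * covar s t)"
proof -
  have m: "(\<lambda>f. f s * cnj (f t)) \<in> borel_measurable paths"
    by (intro borel_measurable_times eval_measurable measurable_cnj_eval)
  have "expectation (\<lambda>\<omega>. path (1, 2) \<omega> s * cnj (path (1, 2) \<omega> t)) = covar s t"
  proof (cases "\<beta> = 1")
    case True
    have "expectation (\<lambda>\<omega>. Z 1 2 s \<omega> * cnj (Z 1 2 t \<omega>)) = expectation (\<lambda>\<omega>. Z 1 2 s \<omega> * Z 1 2 t \<omega>)"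
      by (intro Bochner_Integration.integral_cong) (use True in \<open>simp_all add: cnj_Z\<close>)
    then show ?thesis using real_symmetric[OF True] by (simp add: path_eval)
  next
    case False
    then show ?thesis using beta hermitian by (simp add: path_eval)
  qed
  moreover have "expectation (\<lambda>\<omega>. path (1, 1) \<omega> s * cnj (path (1, 1) \<omega> t)) = 2 / real \<beta> * covar s t"
    using beta_pos by (simp add: path_eval wigner_cov_def flip: of_real_mult)
  ultimately show ?thesis
    unfolding path_transfer(2)[OF e m] by (simp add: edge_type_def)
qed

lemma expectation_path_mult:
  assumes e: "e \<in> valid_edges" "fst e < snd e"
  shows "expectation (\<lambda>\<omega>. path e \<omega> s * path e \<omega> t) = (if \<beta> = 1 then covar s t else 0)"
proof -
  have m: "(\<lambda>f. f s * f t) \<in> borel_measurable paths"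
    by (intro borel_measurable_times eval_measurable)
  have "expectation (\<lambda>\<omega>. path (1, 2) \<omega> s * path (1, 2) \<omega> t) = (if \<beta> = 1 then covar s t else 0)"
    using beta real_symmetric hermitian by (auto simp: path_eval)
  then show ?thesis
    unfolding path_transfer(2)[OF e(1) m] using e(2) by (simp add: edge_type_def)
qed

text \<open>The expression unifies the values for \<open>\<beta> = 1\<close> and
  \<open>\<beta> = 2\<close>. The real hypothesis concerns squares, which coincide with squared
  moduli for real values.\<close>

lemma expectation_path_fourth:
  assumes e: "e \<in> valid_edges" "fst e < snd e"
  shows "expectation (\<lambda>\<omega>. (cmod (path e \<omega> s))\<^sup>2 * (cmod (path e \<omega> t))\<^sup>2) = 1 + 2 / real \<beta> * (covar s t)\<^sup>2"
proof -
  have m: "(\<lambda>f. (cmod (f s))\<^sup>2 * (cmod (f t))\<^sup>2) \<in> borel_measurable paths"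
    by (intro borel_measurable_times borel_measurable_power measurable_compose[OF eval_measurable borel_measurable_norm])
  have "expectation (\<lambda>\<omega>. (cmod (Z 1 2 s \<omega>))\<^sup>2 * (cmod (Z 1 2 t \<omega>))\<^sup>2) = 1 + 2 / real \<beta> * (covar s t)\<^sup>2"
  proof (cases "\<beta> = 1")
    case True
    have sq: "complex_of_real ((cmod (Z 1 2 t \<omega>))\<^sup>2) = (Z 1 2 t \<omega>)\<^sup>2" if "\<omega> \<in> space M" for \<omega> t
      using complex_norm_square[of "Z 1 2 t \<omega>"] cnj_Z(1)[OF True that] by (simp add: power2_eq_square)
    have "complex_of_real (expectation (\<lambda>\<omega>. (cmod (Z 1 2 s \<omega>))\<^sup>2 * (cmod (Z 1 2 t \<omega>))\<^sup>2)) =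
        expectation (\<lambda>\<omega>. complex_of_real ((cmod (Z 1 2 s \<omega>))\<^sup>2) * complex_of_real ((cmod (Z 1 2 t \<omega>))\<^sup>2))"
      by (simp only: of_real_mult[symmetric] integral_complex_of_real)
    also have "\<dots> = expectation (\<lambda>\<omega>. (Z 1 2 s \<omega>)\<^sup>2 * (Z 1 2 t \<omega>)\<^sup>2)"
      by (intro Bochner_Integration.integral_cong refl) (simp only: sq)
    also have "\<dots> = complex_of_real (2 * (covar s t)\<^sup>2 + 1)" using real_symmetric[OF True] by blast
    finally have "expectation (\<lambda>\<omega>. (cmod (Z 1 2 s \<omega>))\<^sup>2 * (cmod (Z 1 2 t \<omega>))\<^sup>2) = 2 * (covar s t)\<^sup>2 + 1"
      unfolding of_real_eq_iff .
    then show ?thesis using True by simp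
  next
    case False
    then show ?thesis using beta hermitian by simp
  qed
  then show ?thesis
    unfolding path_transfer(2)[OF e(1) m] using e(2) by (simp add: edge_type_def path_eval)
qed

lemma expectation_path:
  assumes e: "e \<in> valid_edges" shows "expectation (\<lambda>\<omega>. path e \<omega> t) = 0"
proof -
  have "expectation (\<lambda>\<omega>. path (edge_type e) \<omega> t) = 0"
    using mean_Z[of 1 2 t] mean_Y[of 1 t] by (simp add: edge_type_def path_eval)
  then show ?thesis by (simp only: path_transfer(2)[OF e eval_measurable])
qed

lemma expectation_entry:
  assumes "1 \<le> fst s" "1 \<le> snd s" shows "expectation (entry t s) = 0"
proof -
  have "entry t s = (if fst s \<le> snd s then (\<lambda>\<omega>. path (edge s) \<omega> t) else (\<lambda>\<omega>. cnj (path (edge s) \<omega> t)))"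
    by (auto simp: fun_eq_iff entry_conv_path)
  then show ?thesis using expectation_path[OF edge_valid[OF assms], of t] by simp
qed

lemma expectation_entry_opposite:
  assumes "1 \<le> u" "1 \<le> v"
  shows "expectation (\<lambda>\<omega>. entry s (u, v) \<omega> * entry t (v, u) \<omega>) =
    complex_of_real (if u = v then 2 / real \<beta> * covar s t else covar s t)"
proof -
  have ev: "edge (u, v) \<in> valid_edges" using assms by (intro edge_valid) auto
  have lt: "fst (edge (u, v)) < snd (edge (u, v)) \<longleftrightarrow> u \<noteq> v" by (auto simp: edge_def min_def max_def)
  show ?thesis
  proof (cases "u \<le> v")
    case True
    have "entry s (u, v) \<omega> * entry t (v, u) \<omega> = path (edge (u, v)) \<omega> s * cnj (path (edge (u, v)) \<omega> t)" for \<omega>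
      unfolding entry_swap[of t v u] using True by (simp add: entry_conv_path)
    then show ?thesis using expectation_path_mult_cnj[OF ev, of s t] lt by simp
  next
    case False
    have "entry s (u, v) \<omega> * entry t (v, u) \<omega> = path (edge (u, v)) \<omega> t * cnj (path (edge (u, v)) \<omega> s)" for \<omega>
      unfolding entry_swap[of t v u] using False by (simp add: entry_conv_path mult.commute)
    then show ?thesis using expectation_path_mult_cnj[OF ev, of t s] lt covar_commute[of s t] by simp
  qed
qed

lemma expectation_entry_same:
  assumes "1 \<le> u" "1 \<le> v" "u \<noteq> v"
  shows "expectation (\<lambda>\<omega>. entry s (u, v) \<omega> * entry t (u, v) \<omega>) = (if \<beta> = 1 then covar s t else 0)"
proof -
  have ev: "edge (u, v) \<in> valid_edges" using assms by (intro edge_valid) auto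
  have lt: "fst (edge (u, v)) < snd (edge (u, v))" using assms(3) by (auto simp: edge_def min_def max_def)
  show ?thesis
  proof (cases "u \<le> v")
    case True
    then show ?thesis using expectation_path_mult[OF ev lt, of s t] by (simp add: entry_conv_path)
  next
    case False
    have "expectation (\<lambda>\<omega>. entry s (u, v) \<omega> * entry t (u, v) \<omega>) =
        cnj (expectation (\<lambda>\<omega>. path (edge (u, v)) \<omega> s * path (edge (u, v)) \<omega> t))"
      using False by (simp add: entry_conv_path flip: integral_cnj complex_cnj_mult)
    then show ?thesis unfolding expectation_path_mult[OF ev lt] by simp
  qed
qed

section \<open>Centred walks as sums over admissible edge sets\<close>

lemma size_edge_steps: "size (edge_steps w e) = count_list (map edge (steps w)) e"
  by (simp add: edge_steps_def count_list_eq_length_filter filter_map o_def eq_commute flip: mset_filter)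

lemma edge_prod_moment:
  assumes "set w \<subseteq> {1..}"
  shows "integrable M (edge_prod t w e)" "edge_prod t w e \<in> borel_measurable M"
proof -
  obtain c where "moment_bounded c (edge_prod t w e)" using walk_moments[of "length w"] assms by blast
  then show "integrable M (edge_prod t w e)" "edge_prod t w e \<in> borel_measurable M"
    by (rule moment_bounded_integrable, rule moment_bounded_measurable)
qed

lemma expectation_simple_edge:
  assumes w: "set w \<subseteq> {1..}" and e: "count_list (map edge (steps w)) e = 1"
  shows "expectation (edge_prod t w e) = 0"
proof -
  have "size (edge_steps w e) = 1" using e by (simp add: size_edge_steps)
  then obtain s where s: "edge_steps w e = {#s#}" using size_1_singleton_mset by blast
  then have "s \<in># edge_steps w e" by simp
  then have "s \<in># mset (steps w)" unfolding edge_steps_def by (metis mset_subset_eqD multiset_filter_subset)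
  then have "1 \<le> fst s" "1 \<le> snd s" using steps_pos[OF w] by blast+
  then have "expectation (entry t s) = 0" by (rule expectation_entry)
  moreover have "edge_prod t w e = entry t s" by (simp add: edge_prod_def fun_eq_iff s)
  ultimately show ?thesis by simp
qed

lemma expectation_walk_prod:
  assumes w: "set w \<subseteq> {1..}"
  shows "expectation (walk_prod t w) = (\<Prod>e\<in>edges_of w. expectation (edge_prod t w e))"
proof -
  have eq: "edge_prod t w e = (\<lambda>\<omega>. edge_fun t w e (path e \<omega>))" for e
    by (simp add: edge_prod_conv_path fun_eq_iff)
  have wp: "walk_prod t w = (\<lambda>\<omega>. \<Prod>e\<in>edges_of w. edge_fun t w e (path e \<omega>))"
    by (simp add: walk_prod_conv_edges edge_prod_conv_path fun_eq_iff)
  show ?thesis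
    unfolding wp eq
    by (rule expectation_prod_path(1)[OF finite_edges_of edges_of_valid[OF w] edge_fun_measurable])
      (rule edge_prod_moment(1)[OF w, of t, unfolded eq])
qed

lemma finite_admissible: "finite {F. admissible w F}"
  by (rule finite_subset[of _ "Pow (edges_of w)"]) (auto simp: admissible_def)

text \<open>In the expansion over all subsets \<open>F\<close> of the edges, the empty set gives the
  mean by independence, and a set that misses an edge traversed once carries a vanishing
  mean.\<close>

lemma walk_prod_centered:
  assumes w: "set w \<subseteq> {1..}"
  shows "walk_prod t w \<omega> - expectation (walk_prod t w) = (\<Sum>F | admissible w F. walk_term t (w, F) \<omega>)"
proof -
  have "walk_prod t w \<omega> = (\<Prod>e\<in>edges_of w. (edge_prod t w e \<omega> - expectation (edge_prod t w e)) + expectation (edge_prod t w e))"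
    by (simp add: walk_prod_conv_edges)
  also have "\<dots> = (\<Sum>F\<in>Pow (edges_of w). walk_term t (w, F) \<omega>)"
    by (subst prod_add) (simp_all add: walk_term_def)
  also have "\<dots> = walk_term t (w, {}) \<omega> + (\<Sum>F\<in>Pow (edges_of w) - {{}}. walk_term t (w, F) \<omega>)"
    by (rule sum.remove) auto
  also have "walk_term t (w, {}) \<omega> = expectation (walk_prod t w)"
    by (simp add: walk_term_def expectation_walk_prod[OF w])
  also have "(\<Sum>F\<in>Pow (edges_of w) - {{}}. walk_term t (w, F) \<omega>) = (\<Sum>F | admissible w F. walk_term t (w, F) \<omega>)"
  proof (rule sum.mono_neutral_right)
    show "\<forall>F\<in>Pow (edges_of w) - {{}} - {F. admissible w F}. walk_term t (w, F) \<omega> = 0"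
    proof
      fix F assume "F \<in> Pow (edges_of w) - {{}} - {F. admissible w F}"
      then obtain e where e: "count_list (map edge (steps w)) e = 1" "e \<notin> F" unfolding admissible_def by blast
      have "e \<in> set (map edge (steps w))" using e(1) count_notin[of e "map edge (steps w)"] by force
      then have "e \<in> edges_of w - F" using e(2) by (simp add: edges_of_def)
      then have "(\<Prod>e\<in>edges_of w - F. expectation (edge_prod t w e)) = 0"
        using expectation_simple_edge[OF w e(1), of t] by (intro prod_zero) auto
      then show "walk_term t (w, F) \<omega> = 0" by (simp add: walk_term_def)
    qed
  qed (auto simp: admissible_def)
  finally show ?thesis by simp
qed

section \<open>Expectations of products of terms and exact Wick relations\<close>

definition term_expect :: "('i \<Rightarrow> real) \<Rightarrow> ('i \<Rightarrow> nat list) \<Rightarrow> ('i \<Rightarrow> (nat \<times> nat) set) \<Rightarrow> 'i set \<Rightarrow> complex" where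
  "term_expect \<tau> w F A = expectation (\<lambda>\<omega>. \<Prod>a\<in>A. walk_term (\<tau> a) (w a, F a) \<omega>)"

text \<open>The product over words is rearranged by edges, and distinct edges belong to independent
  paths. The edges range over all of \<open>I\<close> although the words range over
  \<open>A\<close>: this gives every subfamily the same index set, with factor 1 at edges that it
  does not meet.\<close>

lemma term_expect_factor:
  assumes I: "finite I" and w: "\<And>a. a \<in> I \<Longrightarrow> set (w a) \<subseteq> {1..}" and F: "\<And>a. a \<in> I \<Longrightarrow> F a \<subseteq> edges_of (w a)"
    and A: "A \<subseteq> I"
  shows "term_expect \<tau> w F A = (\<Prod>a\<in>A. \<Prod>e\<in>edges_of (w a) - F a. expectation (edge_prod (\<tau> a) (w a) e)) *
    (\<Prod>e\<in>\<Union> (F ` I). expectation (\<lambda>\<omega>. \<Prod>a | a \<in> A \<and> e \<in> F a.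
        edge_prod (\<tau> a) (w a) e \<omega> - expectation (edge_prod (\<tau> a) (w a) e)))"
proof -
  define D where "D = \<Union> (F ` I)"
  define \<kappa> where "\<kappa> = (\<Prod>a\<in>A. \<Prod>e\<in>edges_of (w a) - F a. expectation (edge_prod (\<tau> a) (w a) e))"
  define g where "g e f = (\<Prod>a | a \<in> A \<and> e \<in> F a. edge_fun (\<tau> a) (w a) e f - expectation (edge_prod (\<tau> a) (w a) e))" for e f
  have finA: "finite A" using I A finite_subset by blast
  have finF: "finite (F a)" if "a \<in> I" for a using F[OF that] finite_edges_of finite_subset by blast
  have finD: "finite D" unfolding D_def using I finF by auto
  have D: "D \<subseteq> valid_edges" unfolding D_def using F w edges_of_valid by blast
  have gm: "g e \<in> borel_measurable paths" for e
    unfolding g_def by (intro borel_measurable_prod borel_measurable_diff edge_fun_measurable borel_measurable_const)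
  have gp: "g e (path e \<omega>) = (\<Prod>a | a \<in> A \<and> e \<in> F a. edge_prod (\<tau> a) (w a) e \<omega> - expectation (edge_prod (\<tau> a) (w a) e))" for e \<omega>
    by (simp add: g_def edge_prod_conv_path)
  have gi: "integrable M (\<lambda>\<omega>. g e (path e \<omega>))" for e
  proof -
    define k where "k = Max (insert 0 ((\<lambda>a. length (w a)) ` A))"
    have k: "length (w a) \<le> k" if "a \<in> A" for a unfolding k_def using that finA by (intro Max_ge) auto
    obtain c where c: "\<And>q. 0 \<le> c q"
      "\<And>t w e. length w \<le> k \<Longrightarrow> set w \<subseteq> {1..} \<Longrightarrow> moment_bounded c (\<lambda>\<omega>. edge_prod t w e \<omega> - expectation (edge_prod t w e))"
      using edge_prod_centered_moments[of k] by blast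
    have "moment_bounded (\<lambda>q. 1 + real (card A) * c (card A * q))
      (\<lambda>\<omega>. \<Prod>a | a \<in> A \<and> e \<in> F a. edge_prod (\<tau> a) (w a) e \<omega> - expectation (edge_prod (\<tau> a) (w a) e))"
    proof (rule moment_bounded_prod)
      show "finite {a. a \<in> A \<and> e \<in> F a}" "card {a. a \<in> A \<and> e \<in> F a} \<le> card A"
        using finA by (auto intro: card_mono)
      show "moment_bounded c (\<lambda>\<omega>. edge_prod (\<tau> a) (w a) e \<omega> - expectation (edge_prod (\<tau> a) (w a) e))"
        if "a \<in> {a. a \<in> A \<and> e \<in> F a}" for a
        using that A w by (intro c(2) k) blast+
    qed (rule c(1))
    then show ?thesis unfolding gp by (rule moment_bounded_integrable)
  qed
  have "(\<Prod>a\<in>A. walk_term (\<tau> a) (w a, F a) \<omega>) = \<kappa> * (\<Prod>e\<in>D. g e (path e \<omega>))" for \<omega>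
  proof -
    have "(\<Prod>a\<in>A. walk_term (\<tau> a) (w a, F a) \<omega>) =
        (\<Prod>a\<in>A. \<Prod>e\<in>F a. edge_prod (\<tau> a) (w a) e \<omega> - expectation (edge_prod (\<tau> a) (w a) e)) * \<kappa>"
      by (simp add: walk_term_def prod.distrib \<kappa>_def)
    also have "(\<Prod>a\<in>A. \<Prod>e\<in>F a. edge_prod (\<tau> a) (w a) e \<omega> - expectation (edge_prod (\<tau> a) (w a) e)) =
        (\<Prod>a\<in>A. \<Prod>e | e \<in> D \<and> e \<in> F a. edge_prod (\<tau> a) (w a) e \<omega> - expectation (edge_prod (\<tau> a) (w a) e))"
      using A by (intro prod.cong refl) (auto simp: D_def)
    also have "\<dots> = (\<Prod>e\<in>D. \<Prod>a | a \<in> A \<and> e \<in> F a. edge_prod (\<tau> a) (w a) e \<omega> - expectation (edge_prod (\<tau> a) (w a) e))"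
      by (rule prod.swap_restrict[OF finA finD])
    finally show ?thesis by (simp add: gp mult.commute)
  qed
  then have "term_expect \<tau> w F A = \<kappa> * (\<Prod>e\<in>D. expectation (\<lambda>\<omega>. g e (path e \<omega>)))"
    by (simp add: term_expect_def expectation_prod_path(1)[OF finD D gm gi])
  then show ?thesis by (simp only: gp \<kappa>_def D_def)
qed

text \<open>At the edge \<open>e\<close> a single centred factor is left, and its mean is 0.\<close>

lemma term_expect_zero:
  assumes I: "finite I" and w: "\<And>a. a \<in> I \<Longrightarrow> set (w a) \<subseteq> {1..}" and F: "\<And>a. a \<in> I \<Longrightarrow> F a \<subseteq> edges_of (w a)"
    and A: "A \<subseteq> I" and e: "a \<in> A" "e \<in> F a" "\<forall>b\<in>A - {a}. e \<notin> F b"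
  shows "term_expect \<tau> w F A = 0"
proof -
  have "{b. b \<in> A \<and> e \<in> F b} = {a}" using e by auto
  then have "expectation (\<lambda>\<omega>. \<Prod>b | b \<in> A \<and> e \<in> F b. edge_prod (\<tau> b) (w b) e \<omega> - expectation (edge_prod (\<tau> b) (w b) e)) = 0"
    using edge_prod_moment[OF w, of a "\<tau> a" e] A e(1) by (simp add: subset_iff prob_space)
  moreover have "finite (\<Union> (F ` I))" using I F finite_edges_of finite_subset by blast
  moreover have "e \<in> \<Union> (F ` I)" using A e by auto
  ultimately have "(\<Prod>e\<in>\<Union> (F ` I). expectation (\<lambda>\<omega>. \<Prod>a | a \<in> A \<and> e \<in> F a.
        edge_prod (\<tau> a) (w a) e \<omega> - expectation (edge_prod (\<tau> a) (w a) e))) = 0"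
    by (intro prod_zero bexI[of _ e])
  then show ?thesis
    using term_expect_factor[where I = I and w = w and F = F and \<tau> = \<tau>, OF I w F A] by (simp only: mult_zero_right)
qed

text \<open>At each edge at most one of the two families is present, so the edge factors
  multiply.\<close>

lemma term_expect_mult:
  assumes I: "finite I" and w: "\<And>a. a \<in> I \<Longrightarrow> set (w a) \<subseteq> {1..}" and F: "\<And>a. a \<in> I \<Longrightarrow> F a \<subseteq> edges_of (w a)"
    and A: "A \<union> A' \<subseteq> I" "A \<inter> A' = {}" and disj: "\<forall>a\<in>A. \<forall>b\<in>A'. F a \<inter> F b = {}"
  shows "term_expect \<tau> w F (A \<union> A') = term_expect \<tau> w F A * term_expect \<tau> w F A'"
proof -
  define h where "h A e = expectation (\<lambda>\<omega>. \<Prod>b | b \<in> A \<and> e \<in> F b. edge_prod (\<tau> b) (w b) e \<omega> - expectation (edge_prod (\<tau> b) (w b) e))" for A e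
  have fin: "finite A" "finite A'" using A(1) I finite_subset by blast+
  have "h (A \<union> A') e = h A e * h A' e" for e
  proof -
    have "{b. b \<in> A \<and> e \<in> F b} = {} \<or> {b. b \<in> A' \<and> e \<in> F b} = {}" using disj by blast
    moreover have "{b. b \<in> A \<union> A' \<and> e \<in> F b} = {b. b \<in> A \<and> e \<in> F b} \<union> {b. b \<in> A' \<and> e \<in> F b}" by auto
    ultimately show ?thesis by (auto simp only: h_def Un_empty_left Un_empty_right prod.empty)
      (simp_all add: prob_space)
  qed
  then have "(\<Prod>e\<in>\<Union> (F ` I). h (A \<union> A') e) = (\<Prod>e\<in>\<Union> (F ` I). h A e) * (\<Prod>e\<in>\<Union> (F ` I). h A' e)"
    by (simp only: prod.distrib)
  moreover have "term_expect \<tau> w F S = (\<Prod>a\<in>S. \<Prod>e\<in>edges_of (w a) - F a. expectation (edge_prod (\<tau> a) (w a) e)) *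
      (\<Prod>e\<in>\<Union> (F ` I). h S e)" if "S \<subseteq> I" for S
    unfolding h_def by (rule term_expect_factor[OF I w F that])
  ultimately show ?thesis using A fin by (simp add: prod.union_disjoint mult_ac)
qed

definition walk_expect :: "('i \<Rightarrow> real) \<Rightarrow> ('i \<Rightarrow> nat list) \<Rightarrow> 'i set \<Rightarrow> complex" where
  "walk_expect \<tau> w A = expectation (\<lambda>\<omega>. \<Prod>a\<in>A. walk_prod (\<tau> a) (w a) \<omega> - expectation (walk_prod (\<tau> a) (w a)))"

lemma integrable_prod_walk_term:
  assumes A: "finite A" and w: "\<And>a. a \<in> A \<Longrightarrow> set (w a) \<subseteq> {1..}" and F: "\<And>a. a \<in> A \<Longrightarrow> F a \<subseteq> edges_of (w a)"
  shows "integrable M (\<lambda>\<omega>. \<Prod>a\<in>A. walk_term (\<tau> a) (w a, F a) \<omega>)"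
proof -
  define k where "k = Max (insert 0 ((\<lambda>a. length (w a)) ` A))"
  have k: "length (w a) \<le> k" if "a \<in> A" for a unfolding k_def using that A by (intro Max_ge) auto
  obtain c where c: "\<And>q. 0 \<le> c q"
    "\<And>t w F. length w \<le> k \<Longrightarrow> set w \<subseteq> {1..} \<Longrightarrow> F \<subseteq> edges_of w \<Longrightarrow> moment_bounded c (walk_term t (w, F))"
    using walk_term_moments[of k] by blast
  have "moment_bounded (\<lambda>q. 1 + real (card A) * c (card A * q)) (\<lambda>\<omega>. \<Prod>a\<in>A. walk_term (\<tau> a) (w a, F a) \<omega>)"
    by (rule moment_bounded_prod[OF A order_refl c(2)[OF k w F] c(1)])
  then show ?thesis by (rule moment_bounded_integrable)
qed

lemma walk_expect_expand:
  assumes A: "finite A" and w: "\<And>a. a \<in> A \<Longrightarrow> set (w a) \<subseteq> {1..}"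
  shows "walk_expect \<tau> w A = (\<Sum>\<Phi>\<in>(\<Pi>\<^sub>E a\<in>A. {F. admissible (w a) F}). term_expect \<tau> w \<Phi> A)"
proof -
  have "walk_expect \<tau> w A = expectation (\<lambda>\<omega>. \<Prod>a\<in>A. \<Sum>F | admissible (w a) F. walk_term (\<tau> a) (w a, F) \<omega>)"
    unfolding walk_expect_def using w by (simp add: walk_prod_centered cong: prod.cong)
  also have "\<dots> = expectation (\<lambda>\<omega>. \<Sum>\<Phi>\<in>(\<Pi>\<^sub>E a\<in>A. {F. admissible (w a) F}). \<Prod>a\<in>A. walk_term (\<tau> a) (w a, \<Phi> a) \<omega>)"
    by (subst prod_sum_PiE[OF A finite_admissible]) simp
  also have "\<dots> = (\<Sum>\<Phi>\<in>(\<Pi>\<^sub>E a\<in>A. {F. admissible (w a) F}). term_expect \<tau> w \<Phi> A)"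
    unfolding term_expect_def
  proof (rule Bochner_Integration.integral_sum)
    fix \<Phi> assume "\<Phi> \<in> (\<Pi>\<^sub>E a\<in>A. {F. admissible (w a) F})"
    then have F: "\<And>a. a \<in> A \<Longrightarrow> \<Phi> a \<subseteq> edges_of (w a)" unfolding PiE_def Pi_def admissible_def by blast
    show "integrable M (\<lambda>\<omega>. \<Prod>a\<in>A. walk_term (\<tau> a) (w a, \<Phi> a) \<omega>)"
      by (rule integrable_prod_walk_term[OF A w F])
  qed
  finally show ?thesis .
qed

lemma term_expect_restrict: "term_expect \<tau> w (restrict \<Phi> A) A = term_expect \<tau> w \<Phi> A"
  unfolding term_expect_def by (intro arg_cong[where f = expectation] ext prod.cong) auto

text \<open>For words with many letters the relation is exact: \<open>wick_tuple\<close> gives it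
  for each choice \<open>\<Phi>\<close> of admissible sets, and the choices on
  \<open>{a0, b}\<close> and on the other words recombine to choices on \<open>I\<close>.\<close>

lemma walk_expect_wick:
  assumes I: "finite I" "a0 \<in> I" and w: "\<And>a. a \<in> I \<Longrightarrow> set (w a) \<subseteq> {1..}"
    and large: "(\<Sum>a\<in>I. length (w a)) \<le> 2 * card (\<Union>a\<in>I. set (w a))"
  shows "walk_expect \<tau> w I = (\<Sum>b\<in>I - {a0}. walk_expect \<tau> w {a0, b} * walk_expect \<tau> w (I - {a0, b}))"
proof -
  let ?S = "\<lambda>a. {F. admissible (w a) F}"
  have "(\<Sum>b\<in>I - {a0}. walk_expect \<tau> w {a0, b} * walk_expect \<tau> w (I - {a0, b})) =
    (\<Sum>b\<in>I - {a0}. \<Sum>\<Phi>\<in>PiE I ?S. term_expect \<tau> w \<Phi> {a0, b} * term_expect \<tau> w \<Phi> (I - {a0, b}))"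
  proof (rule sum.cong[OF refl])
    fix b assume b: "b \<in> I - {a0}"
    have ex: "walk_expect \<tau> w A = (\<Sum>\<Phi>\<in>PiE A ?S. term_expect \<tau> w \<Phi> A)" if A: "A \<subseteq> I" for A
    proof (rule walk_expect_expand)
      show "finite A" using A I(1) by (rule finite_subset)
      show "set (w a) \<subseteq> {1..}" if "a \<in> A" for a using A that w by blast
    qed
    have "walk_expect \<tau> w {a0, b} * walk_expect \<tau> w (I - {a0, b}) =
      (\<Sum>\<Phi>\<in>PiE {a0, b} ?S. term_expect \<tau> w \<Phi> {a0, b}) * (\<Sum>\<Phi>\<in>PiE (I - {a0, b}) ?S. term_expect \<tau> w \<Phi> (I - {a0, b}))"
      using I b by (intro arg_cong2[where f = "(*)"] ex) auto
    also have "\<dots> = (\<Sum>\<Phi>\<in>PiE ({a0, b} \<union> (I - {a0, b})) ?S. term_expect \<tau> w \<Phi> {a0, b} * term_expect \<tau> w \<Phi> (I - {a0, b}))"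
      using I by (intro sum_PiE_split) (auto simp: finite_admissible term_expect_restrict)
    also have "{a0, b} \<union> (I - {a0, b}) = I" using I b by auto
    finally show "walk_expect \<tau> w {a0, b} * walk_expect \<tau> w (I - {a0, b}) =
      (\<Sum>\<Phi>\<in>PiE I ?S. term_expect \<tau> w \<Phi> {a0, b} * term_expect \<tau> w \<Phi> (I - {a0, b}))" .
  qed
  also have "\<dots> = (\<Sum>\<Phi>\<in>PiE I ?S. \<Sum>b\<in>I - {a0}. term_expect \<tau> w \<Phi> {a0, b} * term_expect \<tau> w \<Phi> (I - {a0, b}))"
    by (rule sum.swap)
  also have "\<dots> = (\<Sum>\<Phi>\<in>PiE I ?S. term_expect \<tau> w \<Phi> I)"
  proof (rule sum.cong[OF refl])
    fix \<Phi> assume "\<Phi> \<in> PiE I ?S"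
    then have adm: "admissible (w a) (\<Phi> a)" if "a \<in> I" for a using that by auto
    then have F: "\<Phi> a \<subseteq> edges_of (w a)" if "a \<in> I" for a using that by (auto simp: admissible_def)
    have "term_expect \<tau> w \<Phi> I = (\<Sum>b\<in>I - {a0}. term_expect \<tau> w \<Phi> {a0, b} * term_expect \<tau> w \<Phi> (I - {a0, b}))"
    proof (rule wick_tuple[OF I, where V = "\<lambda>a. set (w a)" and F = \<Phi> and k = "\<lambda>a. length (w a)"])
      show "verts (\<Phi> a) \<subseteq> set (w a)" if "a \<in> I" for a by (rule admissible_verts[OF adm[OF that]])
      show "\<Phi> a \<noteq> {}" if "a \<in> I" for a using adm[OF that] unfolding admissible_def by blast
      show "2 * card (set (w a)) \<le> length (w a) + card (verts (\<Phi> a))" if "a \<in> I" for a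
        by (rule admissible_order[OF adm[OF that]])
      show "edge_connected (\<Phi> a)" if "a \<in> I" "2 * card (set (w a)) = length (w a) + card (verts (\<Phi> a))" for a
      proof -
        have "good (w a) (\<Phi> a)" using adm[OF that(1)] that(2) unfolding good_def by blast
        from good_core[OF this] show ?thesis using edge_connected_edges_of by auto
      qed
      show "term_expect \<tau> w \<Phi> A = 0" if "A \<subseteq> I" "a \<in> A" "e \<in> \<Phi> a" "\<forall>b\<in>A - {a}. e \<notin> \<Phi> b" for A a e
        by (rule term_expect_zero[OF I(1) w F that])
      show "term_expect \<tau> w \<Phi> (A \<union> A') = term_expect \<tau> w \<Phi> A * term_expect \<tau> w \<Phi> A'"
        if "A \<union> A' \<subseteq> I" "A \<inter> A' = {}" "\<forall>a\<in>A. \<forall>b\<in>A'. \<Phi> a \<inter> \<Phi> b = {}" for A A'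
        by (rule term_expect_mult[OF I(1) w F that])
    qed (use large in auto)
    then show "(\<Sum>b\<in>I - {a0}. term_expect \<tau> w \<Phi> {a0, b} * term_expect \<tau> w \<Phi> (I - {a0, b})) = term_expect \<tau> w \<Phi> I" by simp
  qed
  also have "\<dots> = walk_expect \<tau> w I" by (rule walk_expect_expand[OF I(1) w, symmetric])
  finally show ?thesis by simp
qed

end

section \<open>Traces of matrix powers as sums over closed words\<close>

lemma words_Suc: "bij_betw (\<lambda>(w, z). w @ [z]) (words k B \<times> B) (words (Suc k) B)"
proof (rule bij_betwI[where g = "\<lambda>w. (butlast w, last w)"])
  show "(\<lambda>(w, z). w @ [z]) \<in> words k B \<times> B \<rightarrow> words (Suc k) B" by (auto simp: words_def)
  show "(\<lambda>w. (butlast w, last w)) \<in> words (Suc k) B \<rightarrow> words k B \<times> B"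
  proof
    fix w assume w: "w \<in> words (Suc k) B"
    then have "w \<noteq> []" by (auto simp: words_def)
    then show "(butlast w, last w) \<in> words k B \<times> B"
      using w by (auto simp: words_def dest: in_set_butlastD)
  qed
  show "(butlast ((\<lambda>(w, z). w @ [z]) x), last ((\<lambda>(w, z). w @ [z]) x)) = x" if "x \<in> words k B \<times> B" for x
    by (cases x) simp
  show "(\<lambda>(w, z). w @ [z]) (butlast w, last w) = w" if "w \<in> words (Suc k) B" for w
    using that by (auto simp: words_def intro: append_butlast_last_id)
qed

text \<open>The word lists the vertices from which the \<open>Suc k\<close> steps start; the end
  vertex \<open>xs ! j\<close> is only the target of the last step.\<close>

lemma matrix_power_entry:
  fixes g :: "'v \<times> 'v \<Rightarrow> complex"
  assumes xs: "distinct xs" "set xs = B" "length xs = n" and ij: "i < n" "j < n"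
  defines "A \<equiv> mat n n (\<lambda>(a, b). g (xs ! a, xs ! b))"
  shows "(A ^\<^sub>m Suc k) $$ (i, j) =
    (\<Sum>w | w \<in> words (Suc k) B \<and> hd w = xs ! i. prod_list (map g (zip w (tl w @ [xs ! j]))))"
  using ij
proof (induction k arbitrary: j)
  case 0
  have xB: "xs ! i \<in> B" using 0 xs by auto
  have "{w. w \<in> words (Suc 0) B \<and> hd w = xs ! i} = {[xs ! i]}"
    using xB by (auto simp: words_def length_Suc_conv)
  then show ?case using 0 by (simp add: A_def)
next
  case (Suc k)
  have A: "A \<in> carrier_mat n n" by (simp add: A_def)
  have B: "finite B" using xs by auto
  have bij: "bij_betw ((!) xs) {..<n} B" using bij_betw_nth[OF xs(1) _ xs(2)[symmetric], of "{..<n}"] xs(3) by simp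
  let ?S = "{w. w \<in> words (Suc k) B \<and> hd w = xs ! i}"
  have "(A ^\<^sub>m Suc (Suc k)) $$ (i, j) = (\<Sum>a<n. (A ^\<^sub>m Suc k) $$ (i, a) * A $$ (a, j))"
    using Suc.prems A by (simp add: Matrix.scalar_prod_def atLeast0LessThan pow_carrier_mat[OF A])
  also have "\<dots> = (\<Sum>a<n. (\<Sum>w\<in>?S. prod_list (map g (zip w (tl w @ [xs ! a]))) * g (xs ! a, xs ! j)))"
    using Suc by (intro sum.cong refl) (simp add: A_def sum_distrib_right)
  also have "\<dots> = (\<Sum>z\<in>B. (\<Sum>w\<in>?S. prod_list (map g (zip w (tl w @ [z]))) * g (z, xs ! j)))"
    by (rule sum.reindex_bij_betw[OF bij])
  also have "\<dots> = (\<Sum>w\<in>?S. \<Sum>z\<in>B. prod_list (map g (zip w (tl w @ [z]))) * g (z, xs ! j))"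
    by (rule sum.swap)
  also have "\<dots> = (\<Sum>(w, z)\<in>?S \<times> B. prod_list (map g (zip w (tl w @ [z]))) * g (z, xs ! j))"
    by (rule sum.cartesian_product)
  also have "\<dots> = (\<Sum>x\<in>?S \<times> B. (\<lambda>w. prod_list (map g (zip w (tl w @ [xs ! j])))) ((\<lambda>(w, z). w @ [z]) x))"
  proof (rule sum.cong[OF refl])
    fix x assume x: "x \<in> ?S \<times> B"
    obtain w z where [simp]: "x = (w, z)" by (cases x)
    have "w \<noteq> []" using x by (auto simp: words_def)
    then obtain a v where "w = a # v" by (cases w) auto
    moreover have "zip ((a # v) @ [z]) ((v @ [z]) @ [xs ! j]) = zip (a # v) (v @ [z]) @ zip [z] [xs ! j]"
      by (rule zip_append) simp
    ultimately show "(case x of (w, z) \<Rightarrow> prod_list (map g (zip w (tl w @ [z]))) * g (z, xs ! j)) =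
      (\<lambda>w. prod_list (map g (zip w (tl w @ [xs ! j])))) ((\<lambda>(w, z). w @ [z]) x)"
      by simp
  qed
  also have "\<dots> = (\<Sum>w | w \<in> words (Suc (Suc k)) B \<and> hd w = xs ! i. prod_list (map g (zip w (tl w @ [xs ! j]))))"
  proof (rule sum.reindex_bij_betw)
    show "bij_betw (\<lambda>(w, z). w @ [z]) (?S \<times> B) {w. w \<in> words (Suc (Suc k)) B \<and> hd w = xs ! i}"
    proof (rule bij_betw_subset[OF words_Suc[of "Suc k" B]])
      show "?S \<times> B \<subseteq> words (Suc k) B \<times> B" by auto
      show "(\<lambda>(w, z). w @ [z]) ` (?S \<times> B) = {w. w \<in> words (Suc (Suc k)) B \<and> hd w = xs ! i}"
      proof (intro equalityI subsetI)
        fix w assume "w \<in> (\<lambda>(w, z). w @ [z]) ` (?S \<times> B)"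
        then obtain v z where v: "w = v @ [z]" "v \<in> ?S" "z \<in> B" by auto
        then have "v \<noteq> []" by (auto simp: words_def)
        then show "w \<in> {w. w \<in> words (Suc (Suc k)) B \<and> hd w = xs ! i}" using v by (auto simp: words_def)
      next
        fix w assume w: "w \<in> {w. w \<in> words (Suc (Suc k)) B \<and> hd w = xs ! i}"
        then obtain v z where v: "v \<in> words (Suc k) B" "z \<in> B" "w = v @ [z]"
        proof -
          have "w \<in> (\<lambda>(w, z). w @ [z]) ` (words (Suc k) B \<times> B)"
            using w words_Suc[of "Suc k" B] by (simp add: bij_betw_def)
          then show ?thesis using that by auto
        qed
        then have "v \<noteq> []" by (auto simp: words_def)
        then have "hd v = xs ! i" using w v by simp
        then show "w \<in> (\<lambda>(w, z). w @ [z]) ` (?S \<times> B)" using v by (intro image_eqI[of _ _ "(v, z)"]) auto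
      qed
    qed
  qed
  finally show ?case .
qed

lemma rotate1_zip: "length xs = length ys \<Longrightarrow> rotate1 (zip xs ys) = zip (rotate1 xs) (rotate1 ys)"
  by (cases xs; cases ys) simp_all

text \<open>On the diagonal the end vertex is \<open>hd w\<close>, so the pairing with the shifted
  word becomes \<open>steps w\<close>.\<close>

lemma mat_trace_power:
  fixes g :: "'v \<times> 'v \<Rightarrow> complex"
  assumes xs: "distinct xs" "set xs = B" "length xs = n" and k: "1 \<le> k"
  shows "mat_trace (mat n n (\<lambda>(a, b). g (xs ! a, xs ! b)) ^\<^sub>m k) = (\<Sum>w\<in>words k B. prod_list (map g (steps w)))"
proof -
  define A where "A = mat n n (\<lambda>(a, b). g (xs ! a, xs ! b))"
  obtain k' where k': "k = Suc k'" using k by (cases k) auto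
  have B: "finite B" using xs by auto
  have bij: "bij_betw ((!) xs) {..<n} B" using bij_betw_nth[OF xs(1) _ xs(2)[symmetric], of "{..<n}"] xs(3) by simp
  have "A ^\<^sub>m k \<in> carrier_mat n n" by (rule pow_carrier_mat) (simp add: A_def)
  then have "mat_trace (A ^\<^sub>m k) = (\<Sum>i<n. (A ^\<^sub>m k) $$ (i, i))"
    unfolding mat_trace_def by (metis carrier_matD(1))
  also have "\<dots> = (\<Sum>i<n. \<Sum>w | w \<in> words k B \<and> hd w = xs ! i. prod_list (map g (zip w (tl w @ [xs ! i]))))"
    unfolding k' A_def by (intro sum.cong refl matrix_power_entry[OF xs]) auto
  also have "\<dots> = (\<Sum>x\<in>B. \<Sum>w | w \<in> words k B \<and> hd w = x. prod_list (map g (zip w (tl w @ [x]))))"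
    by (rule sum.reindex_bij_betw[OF bij])
  also have "\<dots> = (\<Sum>x\<in>B. \<Sum>w | w \<in> words k B \<and> hd w = x. prod_list (map g (steps w)))"
  proof (intro sum.cong refl)
    fix x w assume w: "w \<in> {w. w \<in> words k B \<and> hd w = x}"
    then have "w \<noteq> []" using k by (auto simp: words_def)
    then show "prod_list (map g (zip w (tl w @ [x]))) = prod_list (map g (steps w))"
      using w by (cases w) (auto simp: steps_def)
  qed
  also have "\<dots> = (\<Sum>w\<in>words k B. prod_list (map g (steps w)))"
  proof (rule sum.group)
    show "hd ` words k B \<subseteq> B"
    proof
      fix x assume "x \<in> hd ` words k B"
      then obtain w where "w \<in> words k B" "x = hd w" by auto
      then show "x \<in> B" using k hd_in_set[of w] by (cases w) (auto simp: words_def)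
    qed
  qed (use B in auto)
  finally show ?thesis by (simp add: A_def)
qed

lemma mset_steps_rev: "mset (steps (rev w)) = image_mset prod.swap (mset (steps w))"
proof (cases w)
  case Nil then show ?thesis by (simp add: steps_def)
next
  case (Cons a v)
  have "rev (steps (rev w)) = zip w (rev (rotate1 (rev w)))" by (simp add: steps_def zip_rev[symmetric])
  have "rotate1 (zip (rev (rotate1 (rev w))) w) = zip (rotate1 (rev (rotate1 (rev w)))) (rotate1 w)"
    by (rule rotate1_zip) simp
  moreover have "rotate1 (rev (rotate1 (rev w))) = w"
  proof (cases "rev w")
    case Nil then show ?thesis by (simp add: Cons)
  next
    case c: (Cons b u)
    then show ?thesis by simp
  qed
  ultimately have "rotate1 (zip (rev (rotate1 (rev w))) w) = steps w" by (simp add: steps_def)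
  then have "mset (zip (rev (rotate1 (rev w))) w) = mset (steps w)"
    using mset_rotate[of 1 "zip (rev (rotate1 (rev w))) w"] by simp
  moreover have "mset (steps (rev w)) = mset (zip w (rev (rotate1 (rev w))))"
    using \<open>rev (steps (rev w)) = zip w (rev (rotate1 (rev w)))\<close> by (metis mset_rev)
  moreover have "zip w (rev (rotate1 (rev w))) = map prod.swap (zip (rev (rotate1 (rev w))) w)"
    by (simp add: zip_commute[of w] prod.swap_def case_prod_unfold)
  ultimately show ?thesis by (metis mset_map)
qed

context time_dependent_wigner
begin

lemma cnj_walk_prod: "cnj (walk_prod t w \<omega>) = walk_prod t (rev w) \<omega>"
proof -
  have "cnj (prod_mset (image_mset f S)) = prod_mset (image_mset (\<lambda>s. cnj (f s)) S)" for f and S :: "(nat \<times> nat) multiset"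
    by (induction S) auto
  moreover have "entry t (prod.swap s) \<omega> = cnj (entry t s \<omega>)" for s
    by (cases s) (simp add: entry_swap[symmetric] del: complex_cnj_cnj)
  ultimately show ?thesis by (simp add: walk_prod_def mset_steps_rev multiset.map_comp o_def)
qed

text \<open>Conjugation flips every step and thus permutes the words by reversal. The sum is
  therefore real, and \<open>Re\<close> in \<open>trace_power\<close> loses nothing.\<close>

lemma trace_power_conv_walks:
  assumes B: "finite B" and k: "1 \<le> k"
  shows "complex_of_real (trace_power Z Y B t k \<omega>) = (\<Sum>w\<in>words k B. walk_prod t w \<omega>)"
proof -
  have "mat_trace (wigner_submatrix Z Y B t \<omega> ^\<^sub>m k) = (\<Sum>w\<in>words k B. prod_list (map (\<lambda>s. entry t s \<omega>) (steps w)))"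
    using mat_trace_power[of "sorted_list_of_set B" B "card B" k "\<lambda>s. entry t s \<omega>"] B k
    by (simp add: wigner_submatrix_def entry_def)
  also have "\<dots> = (\<Sum>w\<in>words k B. walk_prod t w \<omega>)"
    unfolding walk_prod_def by (intro sum.cong refl) (metis mset_map prod_mset_prod_list)
  finally have tr: "mat_trace (wigner_submatrix Z Y B t \<omega> ^\<^sub>m k) = (\<Sum>w\<in>words k B. walk_prod t w \<omega>)" .
  have "cnj (\<Sum>w\<in>words k B. walk_prod t w \<omega>) = (\<Sum>w\<in>words k B. walk_prod t (rev w) \<omega>)"
    by (simp add: cnj_walk_prod)
  also have "\<dots> = (\<Sum>w\<in>words k B. walk_prod t w \<omega>)"
    by (rule sum.reindex_bij_witness[of _ rev rev]) (auto simp: words_def)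
  finally have "(\<Sum>w\<in>words k B. walk_prod t w \<omega>) \<in> \<real>" by (simp add: Reals_cnj_iff)
  then show ?thesis unfolding trace_power_def tr by (rule of_real_Re)
qed

section \<open>Centred traces and their approximate Wick relation\<close>

definition fluct :: "nat set \<Rightarrow> real \<Rightarrow> nat \<Rightarrow> 'a \<Rightarrow> complex" where
  "fluct B t k \<omega> = (\<Sum>w\<in>words k B. walk_prod t w \<omega> - expectation (walk_prod t w))"

lemma walk_prod_integrable: "set w \<subseteq> {1..} \<Longrightarrow> integrable M (walk_prod t w)"
  using walk_moments[of "length w"] by (blast intro: moment_bounded_integrable)

lemma fluct_conv_trace:
  assumes B: "finite B" "B \<subseteq> {1..}" and k: "1 \<le> k"
  shows "complex_of_real (trace_power Z Y B t k \<omega> - expectation (trace_power Z Y B t k)) = fluct B t k \<omega>"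
    and "trace_power Z Y B t k \<in> borel_measurable M"
proof -
  have i: "integrable M (walk_prod t w)" if "w \<in> words k B" for w
    using that B(2) by (intro walk_prod_integrable) (auto simp: words_def)
  have "complex_of_real (expectation (trace_power Z Y B t k)) = expectation (\<lambda>\<omega>. \<Sum>w\<in>words k B. walk_prod t w \<omega>)"
    by (simp only: trace_power_conv_walks[OF B(1) k, symmetric] integral_complex_of_real)
  also have "\<dots> = (\<Sum>w\<in>words k B. expectation (walk_prod t w))" using i by (rule Bochner_Integration.integral_sum)
  finally show "complex_of_real (trace_power Z Y B t k \<omega> - expectation (trace_power Z Y B t k)) = fluct B t k \<omega>"
    by (simp add: trace_power_conv_walks[OF B(1) k] fluct_def sum_subtractf)
  have "(\<lambda>\<omega>. Re (\<Sum>w\<in>words k B. walk_prod t w \<omega>)) \<in> borel_measurable M"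
    using i by (intro borel_measurable_Re[THEN measurable_compose[rotated]] borel_measurable_sum) auto
  then show "trace_power Z Y B t k \<in> borel_measurable M"
    by (simp add: trace_power_conv_walks[OF B(1) k, symmetric])
qed

lemma walk_expect_bound:
  "\<exists>C. 0 \<le> C \<and> (\<forall>\<tau> w A. finite A \<longrightarrow> card A \<le> n \<longrightarrow> (\<forall>a\<in>A. length (w a) \<le> k \<and> set (w a) \<subseteq> {1..}) \<longrightarrow>
     integrable M (\<lambda>\<omega>. \<Prod>a\<in>A. walk_prod (\<tau> a) (w a) \<omega> - expectation (walk_prod (\<tau> a) (w a))) \<and>
     cmod (walk_expect \<tau> w (A :: 'i set)) \<le> C)"
proof -
  obtain c where c: "\<And>q. 0 \<le> c q" "\<And>t w. length w \<le> k \<Longrightarrow> set w \<subseteq> {1..} \<Longrightarrow> moment_bounded c (walk_prod t w)"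
    using walk_moments[of k] by blast
  define c' where "c' q = 2 ^ q * (c q + c 1 ^ q)" for q
  have c': "0 \<le> c' q" for q using c(1) by (simp add: c'_def)
  show ?thesis
  proof (intro exI[of _ "1 + real n * c' (n * 1)"] conjI allI impI)
    show "0 \<le> 1 + real n * c' (n * 1)" using c' by simp
    fix \<tau> :: "'i \<Rightarrow> real" and w :: "'i \<Rightarrow> nat list" and A :: "'i set"
    assume A: "finite A" "card A \<le> n" and w: "\<forall>a\<in>A. length (w a) \<le> k \<and> set (w a) \<subseteq> {1..}"
    have mb: "moment_bounded (\<lambda>q. 1 + real n * c' (n * q))
        (\<lambda>\<omega>. \<Prod>a\<in>A. walk_prod (\<tau> a) (w a) \<omega> - expectation (walk_prod (\<tau> a) (w a)))"
    proof (rule moment_bounded_prod[OF A])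
      show "moment_bounded c' (\<lambda>\<omega>. walk_prod (\<tau> a) (w a) \<omega> - expectation (walk_prod (\<tau> a) (w a)))" if "a \<in> A" for a
        unfolding c'_def using w that by (intro moment_bounded_centered c(2)) auto
    qed (rule c')
    show "integrable M (\<lambda>\<omega>. \<Prod>a\<in>A. walk_prod (\<tau> a) (w a) \<omega> - expectation (walk_prod (\<tau> a) (w a)))"
      using mb by (rule moment_bounded_integrable)
    show "cmod (walk_expect \<tau> w A) \<le> 1 + real n * c' (n * 1)"
      using moment_bounded_expectation[OF mb] by (simp add: walk_expect_def)
  qed
qed

lemma prod_fluct:
  assumes A: "finite A" and B: "\<And>a. a \<in> A \<Longrightarrow> finite (Bs a) \<and> Bs a \<subseteq> {1..}"
  shows "integrable M (\<lambda>\<omega>. \<Prod>a\<in>A. fluct (Bs a) (\<tau> a) (k a) \<omega>)"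
    and "expectation (\<lambda>\<omega>. \<Prod>a\<in>A. fluct (Bs a) (\<tau> a) (k a) \<omega>) =
      (\<Sum>W\<in>(\<Pi>\<^sub>E a\<in>A. words (k a) (Bs a)). walk_expect \<tau> W A)"
proof -
  define K where "K = Max (insert 0 (k ` A))"
  have K: "k a \<le> K" if "a \<in> A" for a unfolding K_def using that A by (intro Max_ge) auto
  have eq: "(\<Prod>a\<in>A. fluct (Bs a) (\<tau> a) (k a) \<omega>) =
      (\<Sum>W\<in>(\<Pi>\<^sub>E a\<in>A. words (k a) (Bs a)). \<Prod>a\<in>A. walk_prod (\<tau> a) (W a) \<omega> - expectation (walk_prod (\<tau> a) (W a)))" for \<omega>
    unfolding fluct_def using B by (intro prod_sum_PiE[OF A]) auto
  have i: "integrable M (\<lambda>\<omega>. \<Prod>a\<in>A. walk_prod (\<tau> a) (W a) \<omega> - expectation (walk_prod (\<tau> a) (W a)))"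
    if W: "W \<in> (\<Pi>\<^sub>E a\<in>A. words (k a) (Bs a))" for W
  proof -
    have "\<forall>a\<in>A. length (W a) \<le> K \<and> set (W a) \<subseteq> {1..}"
    proof
      fix a assume a: "a \<in> A"
      then have "W a \<in> words (k a) (Bs a)" using W by auto
      then show "length (W a) \<le> K \<and> set (W a) \<subseteq> {1..}" using K[OF a] B[OF a] by (auto simp: words_def)
    qed
    then show ?thesis using walk_expect_bound[where n = "card A" and k = K] A by blast
  qed
  show "integrable M (\<lambda>\<omega>. \<Prod>a\<in>A. fluct (Bs a) (\<tau> a) (k a) \<omega>)"
    unfolding eq using i by (rule Bochner_Integration.integrable_sum)
  show "expectation (\<lambda>\<omega>. \<Prod>a\<in>A. fluct (Bs a) (\<tau> a) (k a) \<omega>) =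
      (\<Sum>W\<in>(\<Pi>\<^sub>E a\<in>A. words (k a) (Bs a)). walk_expect \<tau> W A)"
    unfolding eq walk_expect_def using i by (rule Bochner_Integration.integral_sum)
qed

lemma walk_expect_restrict: "walk_expect \<tau> (restrict w A) A = walk_expect \<tau> w A"
  unfolding walk_expect_def by (intro arg_cong[where f = expectation] ext prod.cong) auto

text \<open>Expanded over tuples of words, the two sides differ only at tuples with few letters, by
  \<open>walk_expect_wick\<close>. Each difference is bounded uniformly, and
  \<open>card_word_tuples\<close> bounds the number of such tuples.\<close>

lemma fluct_wick_bound:
  fixes k :: "nat \<Rightarrow> nat"
  assumes n: "1 \<le> n"
  shows "\<exists>C\<ge>0. \<forall>\<tau> Bs B. finite B \<longrightarrow> B \<subseteq> {1..} \<longrightarrow> (\<forall>a<n. Bs a \<subseteq> B) \<longrightarrow>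
    cmod (expectation (\<lambda>\<omega>. \<Prod>a<n. fluct (Bs a) (\<tau> a) (k a) \<omega>) -
      (\<Sum>b\<in>{..<n} - {0}. expectation (\<lambda>\<omega>. \<Prod>a\<in>{0, b}. fluct (Bs a) (\<tau> a) (k a) \<omega>) *
         expectation (\<lambda>\<omega>. \<Prod>a\<in>{..<n} - {0, b}. fluct (Bs a) (\<tau> a) (k a) \<omega>)))
    \<le> C * real (max 1 (card B)) ^ ((sum k {..<n} - 1) div 2)"
proof -
  define K where "K = Max (insert 0 (k ` {..<n}))"
  define s where "s = sum k {..<n}"
  \<comment> \<open>More than \<open>v\<close> letters means \<open>s \<le> 2 * card\<close>, the
    case in which Wick's relation is exact.\<close>
  define v where "v = (s - 1) div 2"
  have K: "k a \<le> K" if "a < n" for a unfolding K_def using that by (intro Max_ge) auto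
  obtain C where C: "0 \<le> C" "\<And>\<tau> w A. finite A \<Longrightarrow> card A \<le> n + 2 \<Longrightarrow> \<forall>a\<in>A. length (w a) \<le> K \<and> set (w a) \<subseteq> {1..} \<Longrightarrow>
     cmod (walk_expect \<tau> w (A :: nat set)) \<le> C"
    using walk_expect_bound[where n = "n + 2" and k = K and ?'i = nat] by blast
  define C' where "C' = C + real n * (C * C)"
  show ?thesis
  proof (intro exI[of _ "C' * real (s ^ s)"] conjI allI impI)
    show "0 \<le> C' * real (s ^ s)" using C(1) by (simp add: C'_def)
    fix \<tau> :: "nat \<Rightarrow> real" and Bs :: "nat \<Rightarrow> nat set" and B :: "nat set" assume B: "finite B" "B \<subseteq> {1..}" and Bs: "\<forall>a<n. Bs a \<subseteq> B"
    let ?I = "{..<n}" and ?S = "\<lambda>a. words (k a) (Bs a)"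
    have Bs': "finite (Bs a) \<and> Bs a \<subseteq> {1..}" if "a \<in> ?I" for a
      using Bs B that finite_subset by blast
    have fin: "finite (?S a)" if "a \<in> ?I" for a using Bs'[OF that] by simp
    define \<delta> where "\<delta> W = walk_expect \<tau> W ?I - (\<Sum>b\<in>?I - {0}. walk_expect \<tau> W {0, b} * walk_expect \<tau> W (?I - {0, b}))" for W
    have prod2: "expectation (\<lambda>\<omega>. \<Prod>a\<in>{0, b}. fluct (Bs a) (\<tau> a) (k a) \<omega>) *
         expectation (\<lambda>\<omega>. \<Prod>a\<in>?I - {0, b}. fluct (Bs a) (\<tau> a) (k a) \<omega>) =
         (\<Sum>W\<in>PiE ?I ?S. walk_expect \<tau> W {0, b} * walk_expect \<tau> W (?I - {0, b}))" if b: "b \<in> ?I - {0}" for b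
    proof -
      have sub: "{0, b} \<subseteq> ?I" using b n by auto
      have "expectation (\<lambda>\<omega>. \<Prod>a\<in>{0, b}. fluct (Bs a) (\<tau> a) (k a) \<omega>) = (\<Sum>W\<in>PiE {0, b} ?S. walk_expect \<tau> W {0, b})"
        using sub Bs' by (intro prod_fluct(2)) auto
      moreover have "expectation (\<lambda>\<omega>. \<Prod>a\<in>?I - {0, b}. fluct (Bs a) (\<tau> a) (k a) \<omega>) = (\<Sum>W\<in>PiE (?I - {0, b}) ?S. walk_expect \<tau> W (?I - {0, b}))"
        using Bs' by (intro prod_fluct(2)) auto
      moreover have "(\<Sum>W\<in>PiE {0, b} ?S. walk_expect \<tau> W {0, b}) * (\<Sum>W\<in>PiE (?I - {0, b}) ?S. walk_expect \<tau> W (?I - {0, b})) =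
         (\<Sum>W\<in>PiE ({0, b} \<union> (?I - {0, b})) ?S. walk_expect \<tau> W {0, b} * walk_expect \<tau> W (?I - {0, b}))"
        using sub fin by (intro sum_PiE_split walk_expect_restrict) auto
      moreover have "{0, b} \<union> (?I - {0, b}) = ?I" using sub by auto
      ultimately show ?thesis by (simp only:)
    qed
    have "expectation (\<lambda>\<omega>. \<Prod>a<n. fluct (Bs a) (\<tau> a) (k a) \<omega>) = (\<Sum>W\<in>PiE ?I ?S. walk_expect \<tau> W ?I)"
      using Bs' by (intro prod_fluct(2)) auto
    then have "expectation (\<lambda>\<omega>. \<Prod>a<n. fluct (Bs a) (\<tau> a) (k a) \<omega>) -
      (\<Sum>b\<in>?I - {0}. expectation (\<lambda>\<omega>. \<Prod>a\<in>{0, b}. fluct (Bs a) (\<tau> a) (k a) \<omega>) *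
         expectation (\<lambda>\<omega>. \<Prod>a\<in>?I - {0, b}. fluct (Bs a) (\<tau> a) (k a) \<omega>)) =
      (\<Sum>W\<in>PiE ?I ?S. walk_expect \<tau> W ?I) - (\<Sum>b\<in>?I - {0}. \<Sum>W\<in>PiE ?I ?S. walk_expect \<tau> W {0, b} * walk_expect \<tau> W (?I - {0, b}))"
      using prod2 by simp
    also have "(\<Sum>b\<in>?I - {0}. \<Sum>W\<in>PiE ?I ?S. walk_expect \<tau> W {0, b} * walk_expect \<tau> W (?I - {0, b})) =
       (\<Sum>W\<in>PiE ?I ?S. \<Sum>b\<in>?I - {0}. walk_expect \<tau> W {0, b} * walk_expect \<tau> W (?I - {0, b}))" by (rule sum.swap)
    also have "(\<Sum>W\<in>PiE ?I ?S. walk_expect \<tau> W ?I) - \<dots> = (\<Sum>W\<in>PiE ?I ?S. \<delta> W)"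
      by (simp add: \<delta>_def sum_subtractf)
    also have "cmod \<dots> \<le> (\<Sum>W\<in>PiE ?I ?S. cmod (\<delta> W))" by (rule norm_sum)
    also have "\<dots> \<le> (\<Sum>W\<in>PiE ?I ?S. if card (\<Union>a<n. set (W a)) \<le> v then C' else 0)"
    proof (rule sum_mono)
      fix W assume W: "W \<in> PiE ?I ?S"
      have Wa: "length (W a) = k a" "set (W a) \<subseteq> {1..}" if "a \<in> ?I" for a
      proof -
        have "W a \<in> words (k a) (Bs a)" using W that by auto
        then show "length (W a) = k a" "set (W a) \<subseteq> {1..}" using Bs'[OF that] by (auto simp: words_def)
      qed
      have bd: "cmod (walk_expect \<tau> W A) \<le> C" if "A \<subseteq> ?I" for A
      proof (rule C(2))
        show "finite A" using that finite_subset by blast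
        show "card A \<le> n + 2" using card_mono[OF _ that] by simp
        show "\<forall>a\<in>A. length (W a) \<le> K \<and> set (W a) \<subseteq> {1..}"
          using that Wa K by (metis lessThan_iff subsetD)
      qed
      have le: "cmod (\<delta> W) \<le> C'"
      proof -
        have "cmod (\<Sum>b\<in>?I - {0}. walk_expect \<tau> W {0, b} * walk_expect \<tau> W (?I - {0, b})) \<le> (\<Sum>b\<in>?I - {0}. C * C)"
        proof (rule sum_norm_le)
          fix b assume "b \<in> ?I - {0}"
          then show "cmod (walk_expect \<tau> W {0, b} * walk_expect \<tau> W (?I - {0, b})) \<le> C * C"
            unfolding norm_mult using C(1) n by (intro mult_mono bd) auto
        qed
        also have "\<dots> \<le> real n * (C * C)"
          using C(1) card_mono[of ?I "?I - {0}"] by (auto intro!: mult_right_mono)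
        finally show ?thesis unfolding \<delta>_def C'_def using bd[of ?I]
          by (intro order_trans[OF norm_triangle_ineq4] add_mono) auto
      qed
      have z: "\<delta> W = 0" if "\<not> card (\<Union>a<n. set (W a)) \<le> v"
      proof -
        have "s \<le> 2 * card (\<Union>a<n. set (W a))" using that unfolding v_def by linarith
        then have "(\<Sum>a\<in>?I. length (W a)) \<le> 2 * card (\<Union>a\<in>?I. set (W a))" using Wa by (simp add: s_def)
        then show ?thesis unfolding \<delta>_def using walk_expect_wick[of ?I 0 W \<tau>] Wa n by auto
      qed
      show "cmod (\<delta> W) \<le> (if card (\<Union>a<n. set (W a)) \<le> v then C' else 0)" using le z by auto
    qed
    also have "\<dots> = C' * real (card {W \<in> PiE ?I ?S. card (\<Union>a<n. set (W a)) \<le> v})"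
    proof -
      have "finite (PiE ?I ?S)" using fin by (intro finite_PiE) auto
      then show ?thesis by (simp add: sum.If_cases Int_def)
    qed
    also have "\<dots> \<le> C' * real (s ^ s * (max 1 (card B)) ^ v)"
    proof (rule mult_left_mono)
      show "real (card {W \<in> PiE ?I ?S. card (\<Union>a<n. set (W a)) \<le> v}) \<le> real (s ^ s * (max 1 (card B)) ^ v)"
        unfolding of_nat_le_iff s_def using card_word_tuples[OF B(1), of n Bs k v] Bs by auto
      show "0 \<le> C'" using C(1) by (simp add: C'_def)
    qed
    finally show "cmod (expectation (\<lambda>\<omega>. \<Prod>a<n. fluct (Bs a) (\<tau> a) (k a) \<omega>) -
      (\<Sum>b\<in>{..<n} - {0}. expectation (\<lambda>\<omega>. \<Prod>a\<in>{0, b}. fluct (Bs a) (\<tau> a) (k a) \<omega>) *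
         expectation (\<lambda>\<omega>. \<Prod>a\<in>{..<n} - {0, b}. fluct (Bs a) (\<tau> a) (k a) \<omega>)))
      \<le> C' * real (s ^ s) * real (max 1 (card B)) ^ ((sum k {..<n} - 1) div 2)"
      by (simp add: v_def s_def mult.assoc)
  qed
qed

end

section \<open>Covariances and cycles\<close>

lemma distinct_count_1: "distinct w \<Longrightarrow> v \<in> set w \<Longrightarrow> count_list w v = 1"
  by (induction w) auto

lemma cycle_index:
  assumes "3 \<le> (r::nat)" "j < r"
  shows "(j + r - 1) mod r \<noteq> Suc j mod r" "(j + r - 1) mod r \<noteq> j" "Suc j mod r \<noteq> j"
    "(j + r - 1) mod r < r" "Suc j mod r < r"
proof -
  have s: "Suc j mod r = (if Suc j = r then 0 else Suc j)" using assms by auto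
  have p: "(j + r - 1) mod r = (if j = 0 then r - 1 else j - 1)"
  proof (cases "j = 0")
    case False
    then have "j + r - 1 = j - 1 + r" by simp
    then have "(j + r - 1) mod r = (j - 1) mod r" by (metis mod_add_self2)
    then show ?thesis using False assms by simp
  qed (use assms in simp)
  show "(j + r - 1) mod r \<noteq> Suc j mod r" "(j + r - 1) mod r \<noteq> j" "Suc j mod r \<noteq> j"
    "(j + r - 1) mod r < r" "Suc j mod r < r"
    unfolding s p using assms by auto
qed

lemma cycle_simple:
  assumes w: "distinct w" "3 \<le> length w"
  shows "e \<in> edges_of w \<Longrightarrow> count_list (map edge (steps w)) e = 1" and "card (edges_of w) = length w"
proof -
  have c: "count_list (map edge (steps w)) e = 1" if e: "e \<in> edges_of w" for e
  proof -
    obtain j where j: "j < length w" "e = edge (w ! j, w ! (Suc j mod length w))"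
      using e by (auto simp: edges_of_conv_nth)
    note ci = cycle_index[OF w(2) j(1)]
    have "w ! ((j + length w - 1) mod length w) \<noteq> w ! (Suc j mod length w)"
      using ci nth_eq_iff_index_eq[OF w(1) ci(4,5)] by simp
    then show ?thesis
      using simple_edge(1)[OF j(1) distinct_count_1[OF w(1) nth_mem[OF j(1)]]] j(2) by simp
  qed
  then show "e \<in> edges_of w \<Longrightarrow> count_list (map edge (steps w)) e = 1" .
  have "sum (count_list (map edge (steps w))) (edges_of w) = length (map edge (steps w))"
    by (rule sum_count_set) (auto simp: edges_of_def)
  then show "card (edges_of w) = length w" using c by simp
qed

lemma cycle_neighbour:
  assumes w: "distinct w" and j: "j < length w" and e: "edge (w ! j, v) \<in> edges_of w"
  shows "v = w ! (Suc j mod length w) \<or> v = w ! ((j + length w - 1) mod length w)"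
proof -
  obtain i where i: "i < length w" "edge (w ! j, v) = edge (w ! i, w ! (Suc i mod length w))"
    using e by (auto simp: edges_of_conv_nth)
  have si: "Suc i mod length w < length w" using i(1) by (intro mod_less_divisor) linarith
  from i(2) consider "w ! j = w ! i" "v = w ! (Suc i mod length w)" | "w ! j = w ! (Suc i mod length w)" "v = w ! i"
    by (auto simp: edge_eq_iff)
  then show ?thesis
  proof cases
    case 1
    then show ?thesis using nth_eq_iff_index_eq[OF w j i(1)] by simp
  next
    case 2
    then have "Suc i mod length w = j" using nth_eq_iff_index_eq[OF w j si] by simp
    then show ?thesis using mod_Suc_pred[OF i(1)] 2 by simp
  qed
qed

lemma edge_step_mem: "j < length w \<Longrightarrow> edge (w ! j, w ! (Suc j mod length w)) \<in> edges_of w"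
  by (auto simp: edges_of_conv_nth)

text \<open>From two consecutive vertices on, the next one is forced: it is the neighbour of the
  current vertex other than the previous vertex.\<close>

lemma cycle_unique:
  assumes x: "distinct x" "3 \<le> length x" and y: "distinct y" "length y = length x"
    and e: "edges_of x = edges_of y" and h: "x ! 0 = y ! 0" "x ! 1 = y ! 1"
  shows "x = y"
proof (rule nth_equalityI)
  fix i assume "i < length x"
  then have "x ! i = y ! i \<and> (Suc i < length x \<longrightarrow> x ! Suc i = y ! Suc i)"
  proof (induction i)
    case 0 then show ?case using h by simp
  next
    case (Suc i)
    then have IH: "x ! i = y ! i" "x ! Suc i = y ! Suc i" by auto
    have "x ! Suc (Suc i) = y ! Suc (Suc i)" if l: "Suc (Suc i) < length x"
    proof -
      have "edge (x ! Suc i, x ! (Suc (Suc i) mod length x)) \<in> edges_of y"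
        using edge_step_mem[of "Suc i" x] e Suc.prems by simp
      then have "edge (y ! Suc i, x ! Suc (Suc i)) \<in> edges_of y" using l IH by simp
      from cycle_neighbour[OF y(1) _ this] l y(2)
      have "x ! Suc (Suc i) = y ! Suc (Suc i) \<or> x ! Suc (Suc i) = y ! ((Suc i + length y - 1) mod length y)" by auto
      moreover have "(Suc i + length y - 1) mod length y = i" using l y(2) by simp
      moreover have "x ! Suc (Suc i) \<noteq> x ! i" using nth_eq_iff_index_eq[OF x(1), of "Suc (Suc i)" i] l by simp
      ultimately show ?thesis using IH by auto
    qed
    then show ?case using IH by simp
  qed
  then show "x ! i = y ! i" by simp
qed (use y in simp)

text \<open>Rotate \<open>w\<close> and its reversal so that they start like \<open>w'\<close>. The
  second letter of \<open>w'\<close> is one of the two neighbours of the first, and by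
  \<open>cycle_unique\<close> it decides between the two.\<close>

lemma cycle_classification:
  assumes w: "distinct w" "3 \<le> length w" and w': "distinct w'" "length w' = length w" "edges_of w' = edges_of w"
  shows "w' \<in> (\<lambda>m. rotate m w) ` {..<length w} \<union> (\<lambda>m. rotate m (rev w)) ` {..<length w}"
proof -
  have s: "set w' = set w" using w'(3) by (metis verts_edges_of)
  have r: "0 < length w" using w by linarith
  then have "w' ! 0 \<in> set w" using s w'(2) nth_mem by metis
  then obtain m where m: "m < length w" "w ! m = w' ! 0" by (auto simp: in_set_conv_nth)
  have y: "distinct (rotate m w)" "length (rotate m w) = length w" "edges_of w' = edges_of (rotate m w)"
    "rotate m w ! 0 = w' ! 0" using w w' m r by (auto simp: nth_rotate)
  have "w \<noteq> []" using r by auto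
  obtain m' where m': "m' < length w" "rev w ! m' = w' ! 0"
    using \<open>w' ! 0 \<in> set w\<close> by (metis in_set_conv_nth length_rev set_rev)
  have er: "edges_of (rev w) = edges_of w"
  proof -
    have "set (steps (rev w)) = prod.swap ` set (steps w)"
      using arg_cong[OF mset_steps_rev[of w], of set_mset] by simp
    then show ?thesis
      unfolding edges_of_def by (auto simp: image_image edge_commute intro!: image_cong split: prod.splits)
  qed
  have z: "distinct (rotate m' (rev w))" "length (rotate m' (rev w)) = length w" "edges_of w' = edges_of (rotate m' (rev w))"
    "rotate m' (rev w) ! 0 = w' ! 0" using w w' m' r er by (auto simp: nth_rotate)
  \<comment> \<open>The second letter of the rotated reversal is the cyclic predecessor of the
    common first letter in \<open>w\<close>.\<close>
  have ry: "rotate m' (rev w) ! 1 = rotate m w ! (length w - 1)"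
  proof -
    have "rev w ! m' = w ! (length w - 1 - m')" using m' by (simp add: rev_nth)
    then have mm: "m = length w - 1 - m'"
      using m m' nth_eq_iff_index_eq[OF w(1) m(1), of "length w - 1 - m'"] by simp
    have "rotate m' (rev w) ! 1 = rev w ! (Suc m' mod length w)" using w(2) by (simp add: nth_rotate)
    also have "\<dots> = w ! (length w - 1 - (Suc m' mod length w))" using r by (simp add: rev_nth)
    also have "length w - 1 - (Suc m' mod length w) = (m + (length w - 1)) mod length w"
    proof (cases "Suc m' = length w")
      case True then show ?thesis using mm r by simp
    next
      case False
      then have "Suc m' < length w" using m'(1) by simp
      then have "m + (length w - 1) = (length w - 1 - Suc m') + length w" using mm by simp
      then have "(m + (length w - 1)) mod length w = (length w - 1 - Suc m') mod length w" by (metis mod_add_self2)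
      then show ?thesis using \<open>Suc m' < length w\<close> by simp
    qed
    also have "w ! \<dots> = rotate m w ! (length w - 1)" using r by (simp add: nth_rotate)
    finally show ?thesis .
  qed
  have "edge (w' ! 0, w' ! (Suc 0 mod length w')) \<in> edges_of w'" using r w'(2) by (intro edge_step_mem) simp
  then have "edge (rotate m w ! 0, w' ! 1) \<in> edges_of (rotate m w)"
    using y w(2) w'(2) by simp
  from cycle_neighbour[OF y(1) _ this]
  have "w' ! 1 = rotate m w ! 1 \<or> w' ! 1 = rotate m w ! (length w - 1)" using y(2) r w(2) by simp
  then show ?thesis
  proof
    assume "w' ! 1 = rotate m w ! 1"
    then have "w' = rotate m w" using y w w' by (intro cycle_unique) auto
    then show ?thesis using m by auto
  next
    assume "w' ! 1 = rotate m w ! (length w - 1)"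
    then have "w' = rotate m' (rev w)" using z w w' ry by (intro cycle_unique) auto
    then show ?thesis using m' by auto
  qed
qed

lemma edges_of_rev: "edges_of (rev w) = edges_of w"
proof -
  have "set (steps (rev w)) = prod.swap ` set (steps w)"
    using arg_cong[OF mset_steps_rev[of w], of set_mset] by simp
  then show ?thesis
    unfolding edges_of_def by (auto simp: image_image edge_commute intro!: image_cong split: prod.splits)
qed

lemma cycle_rotations_inj:
  assumes "distinct w" shows "inj_on (\<lambda>m. rotate m w) {..<length w}"
proof (rule inj_onI)
  fix m m' assume m: "m \<in> {..<length w}" "m' \<in> {..<length w}" and e: "rotate m w = rotate m' w"
  then have "0 < length w" by auto
  then have "w ! m = w ! m'" using arg_cong[OF e, of "\<lambda>x. x ! 0"] m by (simp add: nth_rotate)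
  then show "m = m'" using nth_eq_iff_index_eq[OF assms] m by simp
qed

text \<open>An equality would make the set of directed steps symmetric. Then the step out of
  \<open>w ! 1\<close> would lead back to \<open>w ! 0\<close>, which is impossible for at least
  three distinct letters.\<close>

lemma cycle_rotations_disjoint:
  assumes w: "distinct w" "3 \<le> length w"
  shows "(\<lambda>m. rotate m w) ` {..<length w} \<inter> (\<lambda>m. rotate m (rev w)) ` {..<length w} = {}"
proof (rule ccontr)
  assume "\<not> ?thesis"
  then obtain m m' where e: "rotate m w = rotate m' (rev w)" by auto
  have "mset (steps w) = image_mset prod.swap (mset (steps w))"
    using arg_cong[OF e, of "\<lambda>x. mset (steps x)"] by (simp add: mset_steps_rotate mset_steps_rev)
  then have "set (steps w) = prod.swap ` set (steps w)" by (metis set_image_mset set_mset_mset)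
  moreover have r: "0 < length w" using w(2) by linarith
  then have "(w ! 0, w ! (Suc 0 mod length w)) \<in> set (steps w)" unfolding set_steps by (intro image_eqI[of _ _ 0]) auto
  then have "prod.swap (w ! 0, w ! (Suc 0 mod length w)) \<in> prod.swap ` set (steps w)" by (rule imageI)
  ultimately have "prod.swap (w ! 0, w ! (Suc 0 mod length w)) \<in> set (steps w)" by (metis (no_types))
  then have "(w ! 1, w ! 0) \<in> set (steps w)" using w(2) by simp
  then obtain i where i: "i < length w" "w ! 1 = w ! i" "w ! 0 = w ! (Suc i mod length w)"
    unfolding set_steps by auto
  have "Suc i mod length w < length w" using r by simp
  then have "Suc i mod length w = 0" "i = 1"
    using nth_eq_iff_index_eq[OF w(1) r, of "Suc i mod length w"] nth_eq_iff_index_eq[OF w(1) i(1), of 1] i w(2) by auto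
  then show False using w(2) by simp
qed

text \<open>Written with real factors, the falling factorial also covers \<open>card B < r\<close>,
  where it has a factor 0.\<close>

lemma card_cycles:
  assumes "finite B" shows "real (card (cycles r B)) = (\<Prod>i<r. real (card B) - real i)"
proof (cases "r \<le> card B")
  case True
  have "card (cycles r B) = \<Prod>{card B - r + 1..card B}"
    using card_lists_distinct_length_eq[OF assms True] by (simp add: cycles_def conj_commute conj_left_commute)
  also have "\<dots> = (\<Prod>i<r. card B - i)"
    by (rule prod.reindex_bij_witness[of _ "\<lambda>i. card B - i" "\<lambda>i. card B - i"]) (use True in auto)
  finally show ?thesis using True by (simp add: of_nat_diff)
next
  case False
  have "cycles r B = {}"
  proof (rule ccontr)
    assume "cycles r B \<noteq> {}"
    then obtain w where w: "set w \<subseteq> B" "length w = r" "distinct w" by (auto simp: cycles_def)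
    then have "r \<le> card B" using card_mono[OF assms w(1)] by (simp add: distinct_card)
    then show False using False by simp
  qed
  moreover have "(\<Prod>i<r. real (card B) - real i) = 0" using False by (intro prod_zero) auto
  ultimately show ?thesis by simp
qed

lemma card_word_pairs:
  assumes "finite B" "B1 \<subseteq> B" "B2 \<subseteq> B"
  shows "card {x \<in> words k B1 \<times> words l B2. card (set (fst x) \<union> set (snd x)) \<le> v} \<le> (k + l) ^ (k + l) * max 1 (card B) ^ v"
proof -
  let ?S = "{x \<in> words k B1 \<times> words l B2. card (set (fst x) \<union> set (snd x)) \<le> v}"
  let ?T = "{w. set w \<subseteq> B \<and> length w = k + l \<and> card (set w) \<le> v}"
  have "inj_on (\<lambda>x. fst x @ snd x) ?S" by (auto simp: inj_on_def words_def)
  moreover have "(\<lambda>x. fst x @ snd x) ` ?S \<subseteq> ?T" using assms by (fastforce simp: words_def)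
  moreover have "finite ?T" by (rule finite_subset[OF _ finite_lists_length_eq[OF assms(1), of "k + l"]]) auto
  ultimately have "card ?S \<le> card ?T" by (intro card_inj_on_le)
  then show ?thesis using card_words_few_letters[OF assms(1), of "k + l" v] by (rule order_trans)
qed

section \<open>Reduction of covariances to good pairs\<close>

context time_dependent_wigner
begin

definition pair_expect :: "real \<Rightarrow> real \<Rightarrow> nat list \<times> (nat \<times> nat) set \<Rightarrow> nat list \<times> (nat \<times> nat) set \<Rightarrow> complex" where
  "pair_expect s t x x' = expectation (\<lambda>\<omega>. walk_term s x \<omega> * walk_term t x' \<omega>)"

definition walk_pairs :: "nat \<Rightarrow> nat set \<Rightarrow> (nat list \<times> (nat \<times> nat) set) set" where
  "walk_pairs k B = Sigma (words k B) (\<lambda>w. {F. admissible w F})"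

lemma finite_walk_pairs: "finite B \<Longrightarrow> finite (walk_pairs k B)"
  unfolding walk_pairs_def using finite_admissible by (intro finite_SigmaI) auto

lemma pair_expect_conv_term:
  "pair_expect s t x x' = term_expect (\<lambda>i. if i = 0 then s else t) (\<lambda>i. if i = 0 then fst x else fst x')
     (\<lambda>i. if i = 0 then snd x else snd x') {0, 1 :: nat}"
  unfolding pair_expect_def term_expect_def by simp

text \<open>For two words, sharing of all centred edges means that the two sets coincide. The rest
  is the vertex bound for a family of two; its equality case makes both words extremal.\<close>

lemma pair_expect_nonzero:
  assumes x: "set (fst x) \<subseteq> {1..}" "admissible (fst x) (snd x)"
    and x': "set (fst x') \<subseteq> {1..}" "admissible (fst x') (snd x')"
    and nz: "pair_expect s t x x' \<noteq> 0"
  shows "snd x = snd x'"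
    and "2 * card (set (fst x) \<union> set (fst x')) \<le> length (fst x) + length (fst x')"
    and "2 * card (set (fst x) \<union> set (fst x')) = length (fst x) + length (fst x') \<Longrightarrow>
       good (fst x) (snd x) \<and> good (fst x') (snd x')"
proof -
  let ?w = "\<lambda>i::nat. if i = 0 then fst x else fst x'" and ?F = "\<lambda>i::nat. if i = 0 then snd x else snd x'"
  let ?V = "\<lambda>i. set (?w i)" and ?k = "\<lambda>i. length (?w i)"
  let ?I = "{0, 1 :: nat}"
  have w: "set (?w a) \<subseteq> {1..}" and adm: "admissible (?w a) (?F a)" for a using x x' by auto
  have F: "?F a \<subseteq> edges_of (?w a)" for a using adm[of a] by (auto simp: admissible_def split: if_splits)
  have ind: "e \<in> ?F b" if "a \<in> ?I" "e \<in> ?F a" "b \<in> ?I" "b \<noteq> a" for a b e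
  proof (rule ccontr)
    assume "e \<notin> ?F b"
    moreover have "?I - {a} = {b}" using that by auto
    ultimately have "\<forall>b\<in>?I - {a}. e \<notin> ?F b" by auto
    then have "pair_expect s t x x' = 0"
      unfolding pair_expect_conv_term using w F that by (intro term_expect_zero[of ?I _ _ ?I a e]) auto
    then show False using nz by simp
  qed
  show "snd x = snd x'" using ind[of 0 _ 1] ind[of 1 _ 0] by auto
  have sh: "all_shared ?I ?F" unfolding all_shared_def using \<open>snd x = snd x'\<close> by auto
  have fV: "finite (?V a)" for a by simp
  have vV: "verts (?F a) \<subseteq> ?V a" for a by (rule admissible_verts[OF adm])
  have ord: "2 * card (?V a) \<le> ?k a + card (verts (?F a))" for a by (rule admissible_order[OF adm])
  note sb = shared_bound[where V = ?V and F = ?F and k = ?k and I = ?I, OF _ fV vV ord sh]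
  have U: "\<Union> (?V ` ?I) = set (fst x) \<union> set (fst x')" "sum ?k ?I = length (fst x) + length (fst x')" by auto
  show "2 * card (set (fst x) \<union> set (fst x')) \<le> length (fst x) + length (fst x')"
    using sb(1) unfolding U by simp
  assume "2 * card (set (fst x) \<union> set (fst x')) = length (fst x) + length (fst x')"
  then have "2 * card (?V a) = ?k a + card (verts (?F a))" if "a \<in> ?I" for a
    using sb(2)[OF _ _ that] unfolding U by simp
  from this[of 0] this[of 1] show "good (fst x) (snd x) \<and> good (fst x') (snd x')"
    using adm[of 0] adm[of 1] by (simp add: good_def)
qed

lemma pair_expect_bound:
  "\<exists>C\<ge>0. \<forall>s t x x'. set (fst x) \<subseteq> {1..} \<longrightarrow> admissible (fst x) (snd x) \<longrightarrow> length (fst x) \<le> k \<longrightarrow>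
     set (fst x') \<subseteq> {1..} \<longrightarrow> admissible (fst x') (snd x') \<longrightarrow> length (fst x') \<le> k \<longrightarrow>
     integrable M (\<lambda>\<omega>. walk_term s x \<omega> * walk_term t x' \<omega>) \<and> cmod (pair_expect s t x x') \<le> C"
proof -
  obtain c where c: "\<And>q. 0 \<le> c q"
    "\<And>t w F. length w \<le> k \<Longrightarrow> set w \<subseteq> {1..} \<Longrightarrow> F \<subseteq> edges_of w \<Longrightarrow> moment_bounded c (walk_term t (w, F))"
    using walk_term_moments[of k] by blast
  show ?thesis
  proof (intro exI[of _ "1 + real 2 * c (2 * 1)"] conjI allI impI)
    show "0 \<le> 1 + real 2 * c (2 * 1)" using c(1)[of "2 * 1"] by simp
    fix s t and x x' :: "nat list \<times> (nat \<times> nat) set"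
    assume x: "set (fst x) \<subseteq> {1..}" "admissible (fst x) (snd x)" "length (fst x) \<le> k"
      and x': "set (fst x') \<subseteq> {1..}" "admissible (fst x') (snd x')" "length (fst x') \<le> k"
    have mx: "moment_bounded c (walk_term s x)" "moment_bounded c (walk_term t x')"
      using c(2)[OF x(3,1), of "snd x" s] c(2)[OF x'(3,1), of "snd x'" t] x(2) x'(2) by (simp_all add: admissible_def)
    have "moment_bounded (\<lambda>q. 1 + real 2 * c (2 * q)) (\<lambda>\<omega>. \<Prod>i\<in>{0, 1::nat}. (if i = 0 then walk_term s x \<omega> else walk_term t x' \<omega>))"
    proof (rule moment_bounded_prod)
      show "moment_bounded c (\<lambda>\<omega>. if i = 0 then walk_term s x \<omega> else walk_term t x' \<omega>)" for i :: nat
        using mx by (cases "i = 0") auto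
    qed (use c in auto)
    then have mb: "moment_bounded (\<lambda>q. 1 + real 2 * c (2 * q)) (\<lambda>\<omega>. walk_term s x \<omega> * walk_term t x' \<omega>)" by simp
    show "integrable M (\<lambda>\<omega>. walk_term s x \<omega> * walk_term t x' \<omega>)" using mb by (rule moment_bounded_integrable)
    show "cmod (pair_expect s t x x') \<le> 1 + real 2 * c (2 * 1)"
      unfolding pair_expect_def using mb by (rule moment_bounded_expectation)
  qed
qed

lemma fluct_conv_pairs:
  assumes "B \<subseteq> {1..}" "finite B"
  shows "fluct B t k \<omega> = (\<Sum>x\<in>walk_pairs k B. walk_term t x \<omega>)"
proof -
  have "fluct B t k \<omega> = (\<Sum>w\<in>words k B. \<Sum>F | admissible w F. walk_term t (w, F) \<omega>)"
    unfolding fluct_def using assms by (intro sum.cong refl walk_prod_centered) (auto simp: words_def)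
  also have "\<dots> = (\<Sum>(w, F)\<in>walk_pairs k B. walk_term t (w, F) \<omega>)"
    unfolding walk_pairs_def using assms finite_admissible by (intro sum.Sigma) auto
  finally show ?thesis by simp
qed

lemma card_admissible: "card {F. admissible w F} \<le> 2 ^ length w"
proof -
  have "card {F. admissible w F} \<le> card (Pow (edges_of w))"
    by (intro card_mono) (auto simp: admissible_def)
  also have "\<dots> = 2 ^ card (edges_of w)" by (simp add: card_Pow)
  also have "card (edges_of w) \<le> length (steps w)"
    unfolding edges_of_def by (metis card_image_le card_length List.finite_set order_trans)
  then have "(2::nat) ^ card (edges_of w) \<le> 2 ^ length w" by (intro power_increasing) auto
  finally show ?thesis .
qed

definition good_pairs :: "nat \<Rightarrow> nat set \<Rightarrow> (nat list \<times> (nat \<times> nat) set) set" where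
  "good_pairs k B = {x. fst x \<in> words k B \<and> good (fst x) (snd x)}"

lemma good_pairs_subset: "good_pairs k B \<subseteq> walk_pairs k B"
  by (auto simp: good_pairs_def walk_pairs_def good_def)

lemma sum_walk_pairs:
  fixes h :: "nat list \<Rightarrow> real"
  assumes "finite D"
  shows "(\<Sum>x\<in>walk_pairs m D. h (fst x)) = (\<Sum>w\<in>words m D. real (card {F. admissible w F}) * h w)"
proof -
  have "(\<Sum>w\<in>words m D. real (card {F. admissible w F}) * h w) = (\<Sum>w\<in>words m D. \<Sum>F | admissible w F. h w)"
    by simp
  also have "\<dots> = (\<Sum>(w, F)\<in>walk_pairs m D. h w)"
    unfolding walk_pairs_def using assms finite_admissible by (intro sum.Sigma) auto
  finally show ?thesis by (simp add: case_prod_unfold)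
qed

text \<open>Two terms with nonzero covariance use at most \<open>(k + l) / 2\<close> letters
  together, and strictly fewer unless both are good. The discarded word pairs are thus counted by
  \<open>card_word_pairs\<close>; the powers of 2 bound the number of sets \<open>F\<close> per
  word.\<close>

lemma covariance_good_pairs:
  "\<exists>C\<ge>0. \<forall>s t B B1 B2. finite B \<longrightarrow> B \<subseteq> {1..} \<longrightarrow> B1 \<subseteq> B \<longrightarrow> B2 \<subseteq> B \<longrightarrow>
    cmod (expectation (\<lambda>\<omega>. fluct B1 s k \<omega> * fluct B2 t l \<omega>) -
      (\<Sum>x\<in>good_pairs k B1. \<Sum>x'\<in>good_pairs l B2. pair_expect s t x x'))
    \<le> C * real (max 1 (card B)) ^ ((k + l - 1) div 2)"
proof -
  define v where "v = (k + l - 1) div 2"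
  obtain C where C: "0 \<le> C" "\<And>s t x x'. set (fst x) \<subseteq> {1..} \<Longrightarrow> admissible (fst x) (snd x) \<Longrightarrow> length (fst x) \<le> max k l \<Longrightarrow>
     set (fst x') \<subseteq> {1..} \<Longrightarrow> admissible (fst x') (snd x') \<Longrightarrow> length (fst x') \<le> max k l \<Longrightarrow>
     integrable M (\<lambda>\<omega>. walk_term s x \<omega> * walk_term t x' \<omega>) \<and> cmod (pair_expect s t x x') \<le> C"
    using pair_expect_bound[of "max k l"] by blast
  define N where "N = (k + l) ^ (k + l)"
  show ?thesis
  proof (intro exI[of _ "2 ^ k * 2 ^ l * C * real N"] conjI allI impI)
    show "0 \<le> 2 ^ k * 2 ^ l * C * real N" using C(1) by simp
    fix s t and B B1 B2 :: "nat set" assume B: "finite B" "B \<subseteq> {1..}" and B12: "B1 \<subseteq> B" "B2 \<subseteq> B"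
    have fin: "finite B1" "finite B2" using B B12 finite_subset by blast+
    have pos: "B1 \<subseteq> {1..}" "B2 \<subseteq> {1..}" using B B12 by blast+
    let ?A1 = "walk_pairs k B1" and ?A2 = "walk_pairs l B2"
    have mem: "set (fst x) \<subseteq> {1..}" "admissible (fst x) (snd x)" "length (fst x) = k" if "x \<in> ?A1" for x
      using that pos by (auto simp: walk_pairs_def words_def)
    have mem': "set (fst x) \<subseteq> {1..}" "admissible (fst x) (snd x)" "length (fst x) = l" if "x \<in> ?A2" for x
      using that pos by (auto simp: walk_pairs_def words_def)
    have CC: "integrable M (\<lambda>\<omega>. walk_term s x \<omega> * walk_term t x' \<omega>)" "cmod (pair_expect s t x x') \<le> C"
      if "x \<in> ?A1" "x' \<in> ?A2" for x x'
      using C(2)[of x x' s t] mem[OF that(1)] mem'[OF that(2)] by auto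
    have "expectation (\<lambda>\<omega>. fluct B1 s k \<omega> * fluct B2 t l \<omega>) =
        expectation (\<lambda>\<omega>. \<Sum>x\<in>?A1. \<Sum>x'\<in>?A2. walk_term s x \<omega> * walk_term t x' \<omega>)"
      unfolding fluct_conv_pairs[OF pos(1) fin(1)] fluct_conv_pairs[OF pos(2) fin(2)] sum_product ..
    also have "\<dots> = (\<Sum>x\<in>?A1. \<Sum>x'\<in>?A2. pair_expect s t x x')"
      using CC(1) by (simp add: pair_expect_def)
    finally have E: "expectation (\<lambda>\<omega>. fluct B1 s k \<omega> * fluct B2 t l \<omega>) = (\<Sum>x\<in>?A1. \<Sum>x'\<in>?A2. pair_expect s t x x')" .
    let ?g = "\<lambda>x x'. if x \<in> good_pairs k B1 \<and> x' \<in> good_pairs l B2 then pair_expect s t x x' else 0"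
    have res: "(\<Sum>x\<in>A. if x \<in> G then f x else 0) = sum f G" if "finite A" "G \<subseteq> A"
      for A G and f :: "nat list \<times> (nat \<times> nat) set \<Rightarrow> complex"
      using sum.inter_restrict[OF that(1), of f G] Int_absorb1[OF that(2)] by simp
    have "(\<Sum>x\<in>?A1. \<Sum>x'\<in>?A2. ?g x x') = (\<Sum>x\<in>?A1. if x \<in> good_pairs k B1 then \<Sum>x'\<in>?A2. if x' \<in> good_pairs l B2 then pair_expect s t x x' else 0 else 0)"
      by (intro sum.cong refl) auto
    also have "\<dots> = (\<Sum>x\<in>good_pairs k B1. \<Sum>x'\<in>?A2. if x' \<in> good_pairs l B2 then pair_expect s t x x' else 0)"
      by (rule res[OF finite_walk_pairs[OF fin(1)] good_pairs_subset])
    also have "\<dots> = (\<Sum>x\<in>good_pairs k B1. \<Sum>x'\<in>good_pairs l B2. pair_expect s t x x')"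
      by (intro sum.cong refl res[OF finite_walk_pairs[OF fin(2)] good_pairs_subset])
    finally have G: "(\<Sum>x\<in>?A1. \<Sum>x'\<in>?A2. ?g x x') = (\<Sum>x\<in>good_pairs k B1. \<Sum>x'\<in>good_pairs l B2. pair_expect s t x x')" .
    have "cmod ((\<Sum>x\<in>?A1. \<Sum>x'\<in>?A2. pair_expect s t x x') - (\<Sum>x\<in>?A1. \<Sum>x'\<in>?A2. ?g x x')) =
        cmod (\<Sum>x\<in>?A1. \<Sum>x'\<in>?A2. pair_expect s t x x' - ?g x x')"
      by (simp add: sum_subtractf)
    also have "\<dots> \<le> (\<Sum>x\<in>?A1. \<Sum>x'\<in>?A2. cmod (pair_expect s t x x' - ?g x x'))"
      by (intro order_trans[OF norm_sum] sum_mono norm_sum)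
    also have "\<dots> \<le> (\<Sum>x\<in>?A1. \<Sum>x'\<in>?A2. if card (set (fst x) \<union> set (fst x')) \<le> v then C else 0)"
    proof (intro sum_mono)
      fix x x' assume x: "x \<in> ?A1" "x' \<in> ?A2"
      note m = mem[OF x(1)] mem'[OF x(2)]
      show "cmod (pair_expect s t x x' - ?g x x') \<le> (if card (set (fst x) \<union> set (fst x')) \<le> v then C else 0)"
      proof (cases "pair_expect s t x x' = ?g x x'")
        case True then show ?thesis using C(1) by simp
      next
        case False
        then have ng: "\<not> (x \<in> good_pairs k B1 \<and> x' \<in> good_pairs l B2)" "pair_expect s t x x' \<noteq> 0" by (auto split: if_splits)
        note pn = pair_expect_nonzero[OF m(1,2) m(4,5) ng(2)]
        have "\<not> (good (fst x) (snd x) \<and> good (fst x') (snd x'))"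
          using ng(1) x by (auto simp: good_pairs_def walk_pairs_def)
        then have "2 * card (set (fst x) \<union> set (fst x')) < k + l" using pn(2,3) m(3,6) by fastforce
        then have "card (set (fst x) \<union> set (fst x')) \<le> v" unfolding v_def by linarith
        moreover have "?g x x' = 0" using ng(1) by (simp only: if_False)
        ultimately show ?thesis using CC(2)[OF x] by simp
      qed
    qed
    also have "\<dots> = (\<Sum>w\<in>words k B1. real (card {F. admissible w F}) * (\<Sum>w'\<in>words l B2. real (card {F. admissible w' F}) *
        (if card (set w \<union> set w') \<le> v then C else 0)))"
      unfolding sum_walk_pairs[OF fin(2), of "\<lambda>w'. if card (set (fst _) \<union> set w') \<le> v then C else 0"]
      by (rule sum_walk_pairs[OF fin(1), of "\<lambda>w. \<Sum>w'\<in>words l B2. real (card {F. admissible w' F}) *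
        (if card (set w \<union> set w') \<le> v then C else 0)"])
    also have "\<dots> = (\<Sum>w\<in>words k B1. \<Sum>w'\<in>words l B2. real (card {F. admissible w F}) * (real (card {F. admissible w' F}) *
        (if card (set w \<union> set w') \<le> v then C else 0)))"
      by (simp add: sum_distrib_left)
    also have "\<dots> \<le> (\<Sum>w\<in>words k B1. \<Sum>w'\<in>words l B2. 2 ^ k * (2 ^ l * (if card (set w \<union> set w') \<le> v then C else 0)))"
    proof (intro sum_mono)
      fix w w' assume "w \<in> words k B1" "w' \<in> words l B2"
      then have "real (card {F. admissible w F}) \<le> 2 ^ k" "real (card {F. admissible w' F}) \<le> 2 ^ l"
        using card_admissible[of w] card_admissible[of w']
        by (simp_all add: words_def)
      then show "real (card {F. admissible w F}) * (real (card {F. admissible w' F}) * (if card (set w \<union> set w') \<le> v then C else 0)) \<le>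
          2 ^ k * (2 ^ l * (if card (set w \<union> set w') \<le> v then C else 0))"
        using C(1) by (intro mult_mono) auto
    qed
    also have "\<dots> = 2 ^ k * 2 ^ l * (\<Sum>(w, w')\<in>words k B1 \<times> words l B2. if card (set w \<union> set w') \<le> v then C else 0)"
      by (simp add: sum_distrib_left sum.cartesian_product mult.assoc case_prod_unfold)
    also have "(\<Sum>(w, w')\<in>words k B1 \<times> words l B2. if card (set w \<union> set w') \<le> v then C else 0) =
        (\<Sum>x\<in>words k B1 \<times> words l B2. if card (set (fst x) \<union> set (snd x)) \<le> v then C else 0)"
      by (simp add: case_prod_unfold)
    also have "\<dots> = C * real (card {x \<in> words k B1 \<times> words l B2. card (set (fst x) \<union> set (snd x)) \<le> v})"
      using fin by (simp add: sum.If_cases Int_def)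
    also have "2 ^ k * 2 ^ l * \<dots> \<le> 2 ^ k * 2 ^ l * (C * real (N * max 1 (card B) ^ v))"
      using card_word_pairs[OF B(1) B12, of k l v] C(1)
      by (intro mult_left_mono) (auto simp only: N_def of_nat_le_iff mult_nonneg_nonneg zero_le_power zero_le_numeral)
    finally show "cmod (expectation (\<lambda>\<omega>. fluct B1 s k \<omega> * fluct B2 t l \<omega>) -
      (\<Sum>x\<in>good_pairs k B1. \<Sum>x'\<in>good_pairs l B2. pair_expect s t x x')) \<le>
      2 ^ k * 2 ^ l * C * real N * real (max 1 (card B)) ^ ((k + l - 1) div 2)"
      unfolding E G by (simp add: v_def mult.assoc)
  qed
qed

end

section \<open>Reduction of good pairs to cycles\<close>

text \<open>The factor of \<open>sum_goods\<close> for a core of length \<open>k - 2 * j\<close> in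
  a set of \<open>n\<close> letters.\<close>

definition tree_coef :: "nat \<Rightarrow> nat \<Rightarrow> nat \<Rightarrow> real" where
  "tree_coef k n j = real (k choose j) * (\<Prod>i<j. real n - real (k - 2 * j + i))"

text \<open>The good pairs are sorted by the number \<open>j\<close> of tree vertices; the core has
  length \<open>k - 2 * j\<close>, which is at least 1.\<close>

lemma sum_good_pairs_cycles:
  fixes y :: "nat list \<times> (nat \<times> nat) set \<Rightarrow> complex"
  assumes B: "finite B"
    and y: "\<And>w F. w \<noteq> [] \<Longrightarrow> set w \<subseteq> B \<Longrightarrow> y (rotate1 w, F) = y (w, F)"
      "\<And>w F x. w \<noteq> [] \<Longrightarrow> set w \<subseteq> B \<Longrightarrow> x \<in> B - set w \<Longrightarrow> admissible w F \<Longrightarrow> y (w @ [hd w, x], F) = y (w, F)"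
  shows "(\<Sum>x | fst x \<in> words k B \<and> good (fst x) (snd x). y x) =
    (\<Sum>j | 2 * j < k. complex_of_real (tree_coef k (card B) j) * (\<Sum>w\<in>cycles (k - 2 * j) B. y (w, edges_of w)))"
proof -
  have fin: "finite {j. 2 * j < k}" by (rule finite_subset[of _ "{..k}"]) auto
  have "{x. fst x \<in> words k B \<and> good (fst x) (snd x)} = (\<Union>j\<in>{j. 2 * j < k}. goods k (k - 2 * j) B)"
  proof (intro equalityI subsetI)
    fix x assume x: "x \<in> {x. fst x \<in> words k B \<and> good (fst x) (snd x)}"
    then have g: "(fst x, snd x) \<in> goods k (card (verts (snd x))) B" by (simp add: goods_def case_prod_unfold)
    from goods_lengthE[OF g] obtain j where j: "k = card (verts (snd x)) + 2 * j" "1 \<le> card (verts (snd x))" by auto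
    then have "k - 2 * j = card (verts (snd x))" "2 * j < k" by auto
    then show "x \<in> (\<Union>j\<in>{j. 2 * j < k}. goods k (k - 2 * j) B)" using g by (intro UN_I[of j]) auto
  qed (auto simp: goods_def)
  then have "(\<Sum>x | fst x \<in> words k B \<and> good (fst x) (snd x). y x) = sum y (\<Union>j\<in>{j. 2 * j < k}. goods k (k - 2 * j) B)"
    by simp
  also have "\<dots> = (\<Sum>j | 2 * j < k. sum y (goods k (k - 2 * j) B))"
  proof (rule sum.UNION_disjoint[OF fin])
    show "\<forall>j\<in>{j. 2 * j < k}. finite (goods k (k - 2 * j) B)" using B by simp
    show "\<forall>i\<in>{j. 2 * j < k}. \<forall>j\<in>{j. 2 * j < k}. i \<noteq> j \<longrightarrow> goods k (k - 2 * i) B \<inter> goods k (k - 2 * j) B = {}"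
      by (auto simp: goods_def)
  qed
  also have "\<dots> = (\<Sum>j | 2 * j < k. complex_of_real (tree_coef k (card B) j) * (\<Sum>w\<in>cycles (k - 2 * j) B. y (w, edges_of w)))"
  proof (rule sum.cong[OF refl])
    fix j assume "j \<in> {j. 2 * j < k}"
    then have "1 \<le> k - 2 * j" "k = k - 2 * j + 2 * j" by auto
    from sum_goods[OF B y this]
    show "sum y (goods k (k - 2 * j) B) = complex_of_real (tree_coef k (card B) j) * (\<Sum>w\<in>cycles (k - 2 * j) B. y (w, edges_of w))"
      by (simp add: tree_coef_def)
  qed
  finally show ?thesis .
qed

lemma cycle_admissible:
  assumes "distinct w" "w \<noteq> []" shows "admissible w (edges_of w)"
proof -
  have "1 \<le> length w" using assms(2) by (cases w) auto
  from goods_diagonal(1)[OF this, of "set w"] have "(w, edges_of w) \<in> goods (length w) (length w) (set w)"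
    using assms(1) by (auto simp: cycles_def)
  then show ?thesis by (rule goods_admissible)
qed

lemma (in prob_space) moment_bounded_mult_integrable:
  assumes "moment_bounded c f" "moment_bounded c g"
  shows "integrable M (\<lambda>\<omega>. f \<omega> * g \<omega>)"
proof -
  have "moment_bounded (\<lambda>q. 1 + real 2 * c (2 * q)) (\<lambda>\<omega>. \<Prod>i\<in>{0, 1::nat}. (if i = 0 then f else g) \<omega>)"
    using assms moment_bounded_nonneg[OF assms(1)] by (intro moment_bounded_prod) auto
  then show ?thesis by (auto dest: moment_bounded_integrable)
qed

context time_dependent_wigner
begin

lemma edge_prod_rotate1: "edge_prod t (rotate1 w) e = edge_prod t w e"
  using mset_steps_rotate[of 1 w] by (simp add: edge_prod_def[abs_def] edge_steps_def)

lemma walk_term_rotate1: "walk_term t (rotate1 w, F) = walk_term t (w, F)"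
  using edges_of_rotate[of 1 w] by (simp add: walk_term_def[abs_def] edge_prod_rotate1)

lemma expectation_edge_norm:
  assumes "1 \<le> u" "1 \<le> v" "u \<noteq> v"
  shows "expectation (\<lambda>\<omega>. entry t (u, v) \<omega> * entry t (v, u) \<omega>) = 1"
  using expectation_entry_opposite[OF assms(1,2), of t t] assms(3) cov_diag by simp

lemma walk_term_leaf:
  assumes w: "w \<noteq> []" "set w \<subseteq> {1..}" and x: "1 \<le> x" "x \<notin> set w" and adm: "admissible w F"
  shows "walk_term t (w @ [hd w, x], F) = walk_term t (w, F)"
proof -
  define e0 where "e0 = edge (hd w, x)"
  have e0F: "e0 \<notin> F" unfolding e0_def by (rule admissible_new_edge[OF adm x(2)])
  have e0: "e0 \<notin> edges_of w"
    using verts_edgeD[of "hd w" x "edges_of w"] x(2) by (auto simp: e0_def verts_edges_of)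
  have ms: "mset (steps (w @ [hd w, x])) = mset (steps w) + {#(hd w, x), (x, hd w)#}"
    by (simp add: steps_append_leaf[OF w(1)])
  have same: "edge_prod t (w @ [hd w, x]) e = edge_prod t w e" if "e \<noteq> e0" for e
    using that unfolding edge_prod_def[abs_def] edge_steps_def ms e0_def by (simp add: edge_commute[of x])
  have "size (edge_steps w e0) = 0"
    using e0 by (auto simp: size_edge_steps edges_of_def count_list_0_iff)
  then have "edge_steps w e0 = {#}" by simp
  then have "edge_steps (w @ [hd w, x]) e0 = {#(hd w, x), (x, hd w)#}"
    unfolding edge_steps_def ms by (simp add: e0_def edge_commute[of x])
  then have new: "edge_prod t (w @ [hd w, x]) e0 = (\<lambda>\<omega>. entry t (hd w, x) \<omega> * entry t (x, hd w) \<omega>)"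
    by (simp add: edge_prod_def fun_eq_iff)
  have "hd w \<in> set w" using w(1) by simp
  then have hd: "1 \<le> hd w" "hd w \<noteq> x" using w(2) x(2) by auto
  have one: "expectation (edge_prod t (w @ [hd w, x]) e0) = 1"
    unfolding new by (rule expectation_edge_norm[OF hd(1) x(1) hd(2)])
  have F: "F \<subseteq> edges_of w" using adm by (simp add: admissible_def)
  have "edges_of (w @ [hd w, x]) - F = insert e0 (edges_of w - F)"
    unfolding edges_of_append_leaf[OF w(1)] e0_def[symmetric] using e0F by auto
  then have "(\<Prod>e\<in>edges_of (w @ [hd w, x]) - F. expectation (edge_prod t (w @ [hd w, x]) e)) =
      (\<Prod>e\<in>edges_of w - F. expectation (edge_prod t (w @ [hd w, x]) e))"
    using e0 one by simp
  also have "\<dots> = (\<Prod>e\<in>edges_of w - F. expectation (edge_prod t w e))"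
  proof (rule prod.cong[OF refl])
    fix e assume "e \<in> edges_of w - F"
    then have "e \<noteq> e0" using e0 by auto
    from same[OF this] show "expectation (edge_prod t (w @ [hd w, x]) e) = expectation (edge_prod t w e)" by simp
  qed
  finally have 1: "(\<Prod>e\<in>edges_of (w @ [hd w, x]) - F. expectation (edge_prod t (w @ [hd w, x]) e)) =
      (\<Prod>e\<in>edges_of w - F. expectation (edge_prod t w e))" .
  have "(\<Prod>e\<in>F. edge_prod t (w @ [hd w, x]) e \<omega> - expectation (edge_prod t (w @ [hd w, x]) e)) =
      (\<Prod>e\<in>F. edge_prod t w e \<omega> - expectation (edge_prod t w e))" for \<omega>
  proof (rule prod.cong[OF refl])
    fix e assume "e \<in> F"
    then have "e \<noteq> e0" using e0F by auto
    from same[OF this] show "edge_prod t (w @ [hd w, x]) e \<omega> - expectation (edge_prod t (w @ [hd w, x]) e) =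
        edge_prod t w e \<omega> - expectation (edge_prod t w e)" by simp
  qed
  then show ?thesis unfolding walk_term_def[abs_def] by (simp add: 1)
qed

text \<open>The trees are cut in the second argument first. The resulting sum, as a function of the
  first argument, is again invariant under rotation and attaching leaves.\<close>

lemma sum_pair_expect_cycles:
  assumes B1: "finite B1" "B1 \<subseteq> {1..}" and B2: "finite B2" "B2 \<subseteq> {1..}"
  shows "(\<Sum>x\<in>good_pairs k B1. \<Sum>x'\<in>good_pairs l B2. pair_expect s t x x') =
    (\<Sum>i | 2 * i < k. \<Sum>j | 2 * j < l. complex_of_real (tree_coef k (card B1) i * tree_coef l (card B2) j) *
      (\<Sum>w\<in>cycles (k - 2 * i) B1. \<Sum>w'\<in>cycles (l - 2 * j) B2. pair_expect s t (w, edges_of w) (w', edges_of w')))"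
proof -
  have 1: "(\<Sum>x'\<in>good_pairs l B2. pair_expect s t x x') = (\<Sum>j | 2 * j < l. complex_of_real (tree_coef l (card B2) j) *
      (\<Sum>w'\<in>cycles (l - 2 * j) B2. pair_expect s t x (w', edges_of w')))" for x
    unfolding good_pairs_def
    by (rule sum_good_pairs_cycles[OF B2(1)]) (use B2 in \<open>auto simp: pair_expect_def walk_term_rotate1 walk_term_leaf subset_iff\<close>)
  have "(\<Sum>x\<in>good_pairs k B1. \<Sum>x'\<in>good_pairs l B2. pair_expect s t x x') =
      (\<Sum>x\<in>good_pairs k B1. \<Sum>j | 2 * j < l. complex_of_real (tree_coef l (card B2) j) *
      (\<Sum>w'\<in>cycles (l - 2 * j) B2. pair_expect s t x (w', edges_of w')))"
    by (simp only: 1)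
  also have "\<dots> = (\<Sum>i | 2 * i < k. complex_of_real (tree_coef k (card B1) i) * (\<Sum>w\<in>cycles (k - 2 * i) B1.
      \<Sum>j | 2 * j < l. complex_of_real (tree_coef l (card B2) j) *
      (\<Sum>w'\<in>cycles (l - 2 * j) B2. pair_expect s t (w, edges_of w) (w', edges_of w'))))"
    unfolding good_pairs_def
    by (rule sum_good_pairs_cycles[OF B1(1)]) (use B1 in \<open>auto simp: pair_expect_def walk_term_rotate1 walk_term_leaf subset_iff\<close>)
  also have "\<dots> = (\<Sum>i | 2 * i < k. \<Sum>j | 2 * j < l. complex_of_real (tree_coef k (card B1) i * tree_coef l (card B2) j) *
      (\<Sum>w\<in>cycles (k - 2 * i) B1. \<Sum>w'\<in>cycles (l - 2 * j) B2. pair_expect s t (w, edges_of w) (w', edges_of w')))"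
  proof (rule sum.cong[OF refl])
    fix i
    have "(\<Sum>w\<in>cycles (k - 2 * i) B1. \<Sum>j | 2 * j < l. complex_of_real (tree_coef l (card B2) j) *
      (\<Sum>w'\<in>cycles (l - 2 * j) B2. pair_expect s t (w, edges_of w) (w', edges_of w'))) =
      (\<Sum>j | 2 * j < l. \<Sum>w\<in>cycles (k - 2 * i) B1. complex_of_real (tree_coef l (card B2) j) *
      (\<Sum>w'\<in>cycles (l - 2 * j) B2. pair_expect s t (w, edges_of w) (w', edges_of w')))" by (rule sum.swap)
    then show "complex_of_real (tree_coef k (card B1) i) * (\<Sum>w\<in>cycles (k - 2 * i) B1.
      \<Sum>j | 2 * j < l. complex_of_real (tree_coef l (card B2) j) *
      (\<Sum>w'\<in>cycles (l - 2 * j) B2. pair_expect s t (w, edges_of w) (w', edges_of w'))) =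
      (\<Sum>j | 2 * j < l. complex_of_real (tree_coef k (card B1) i * tree_coef l (card B2) j) *
      (\<Sum>w\<in>cycles (k - 2 * i) B1. \<Sum>w'\<in>cycles (l - 2 * j) B2. pair_expect s t (w, edges_of w) (w', edges_of w')))"
      by (simp add: sum_distrib_left mult.assoc)
  qed
  finally show ?thesis .
qed

section \<open>Covariances of cycles\<close>

definition same_cycle :: "nat list \<Rightarrow> nat list set" where
  "same_cycle w = {w'. distinct w' \<and> length w' = length w \<and> edges_of w' = edges_of w}"

lemma loop_pair_expect:
  assumes u: "1 \<le> u"
  shows "pair_expect s t ([u], edges_of [u]) ([u], edges_of [u]) = complex_of_real (2 / real \<beta> * covar s t)"
proof -
  have st: "steps [u] = [(u, u)]" by (simp add: steps_def)
  have ed: "edges_of [u] = {edge (u, u)}" by (simp add: edges_of_def st)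
  have "edge_prod t [u] (edge (u, u)) = entry t (u, u)" for t
    by (simp add: edge_prod_def edge_steps_def st fun_eq_iff)
  then have "walk_term t ([u], edges_of [u]) \<omega> = entry t (u, u) \<omega>" for t \<omega>
    using u by (simp add: walk_term_def ed expectation_entry)
  then show ?thesis using expectation_entry_opposite[OF u u, of s t] by (simp add: pair_expect_def)
qed

text \<open>A cycle of length 2 goes along one edge and back, so its centred factor is the squared
  modulus of the entry minus 1. The covariance is the mixed fourth moment minus 1.\<close>

lemma edge_pair_expect:
  assumes uv: "1 \<le> u" "1 \<le> v" "u \<noteq> v" and w: "w \<in> {[u, v], [v, u]}" and w': "w' \<in> {[u, v], [v, u]}"
  shows "pair_expect s t (w, edges_of w) (w', edges_of w') = complex_of_real (2 / real \<beta> * (covar s t)\<^sup>2)"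
proof -
  define e where "e = edge (u, v)"
  have ev: "e \<in> valid_edges" unfolding e_def using uv by (intro edge_valid) auto
  have lt: "fst e < snd e" using uv(3) by (auto simp: e_def edge_def min_def max_def)
  define a where "a t \<omega> = complex_of_real ((cmod (path e \<omega> t))\<^sup>2)" for t \<omega>
  have ent: "entry t (u, v) \<omega> * entry t (v, u) \<omega> = a t \<omega>" for t \<omega>
  proof -
    have "cmod (entry t (u, v) \<omega>) = cmod (path e \<omega> t)" by (simp add: entry_conv_path e_def)
    moreover have "complex_of_real ((cmod (entry t (u, v) \<omega>))\<^sup>2) = entry t (u, v) \<omega> * entry t (v, u) \<omega>"
      unfolding entry_swap[of t v u] by (rule complex_norm_square)
    ultimately show ?thesis by (simp only: a_def)
  qed
  have a1: "expectation (a t) = 1" for t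
    using expectation_edge_norm[OF uv, of t] unfolding ent .
  have wt: "walk_term t (x, edges_of x) \<omega> = a t \<omega> - 1" if "x \<in> {[u, v], [v, u]}" for x t \<omega>
  proof -
    have st: "steps x = [(u, v), (v, u)] \<or> steps x = [(v, u), (u, v)]" using that by (auto simp: steps_def)
    then have ed: "edges_of x = {e}" by (auto simp: edges_of_def e_def edge_commute)
    have "edge_prod t x e = a t" for t
      using st by (auto simp: edge_prod_def edge_steps_def fun_eq_iff e_def edge_commute[of v u] ent mult.commute[of "entry t (v, u) _"])
    then show ?thesis by (simp add: walk_term_def ed a1)
  qed
  obtain c where c: "moment_bounded c (a s)" "moment_bounded c (a t)"
  proof -
    obtain c where c: "\<And>t w e. length w \<le> 2 \<Longrightarrow> set w \<subseteq> {1..} \<Longrightarrow> moment_bounded c (edge_prod t w e)"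
      using walk_moments[of 2] by blast
    have "edge_prod t [u, v] e = a t" for t
      by (auto simp: edge_prod_def edge_steps_def steps_def fun_eq_iff e_def edge_commute[of v u] ent)
    then show ?thesis using that c[of "[u, v]" s e] c[of "[u, v]" t e] uv by auto
  qed
  have "expectation (\<lambda>\<omega>. (a s \<omega> - 1) * (a t \<omega> - 1)) = expectation (\<lambda>\<omega>. a s \<omega> * a t \<omega> - a s \<omega> - a t \<omega> + 1)"
    by (intro Bochner_Integration.integral_cong refl) (simp add: algebra_simps)
  also have "\<dots> = expectation (\<lambda>\<omega>. a s \<omega> * a t \<omega>) - expectation (a s) - expectation (a t) + 1"
    using moment_bounded_mult_integrable[OF c] moment_bounded_integrable[OF c(1)] moment_bounded_integrable[OF c(2)]
    by (simp add: prob_space)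
  also have "expectation (\<lambda>\<omega>. a s \<omega> * a t \<omega>) = complex_of_real (expectation (\<lambda>\<omega>. (cmod (path e \<omega> s))\<^sup>2 * (cmod (path e \<omega> t))\<^sup>2))"
    unfolding a_def of_real_mult[symmetric] by (rule integral_complex_of_real)
  finally show ?thesis unfolding pair_expect_def wt[OF w] wt[OF w'] expectation_path_fourth[OF ev lt] a1 by simp
qed

text \<open>From length 3 on every edge is traversed once by each word and the means vanish, so the
  covariance is a product over edges. Opposite directions pair an entry with its conjugate and give
  \<open>covar s t\<close>; equal directions give \<open>E Z Z\<close>, which is 0 for
  \<open>\<beta> = 2\<close>.\<close>

lemma cycle_pair_expect:
  assumes w: "distinct w" "3 \<le> length w" "set w \<subseteq> {1..}" and m: "w' = rotate m w \<or> w' = rotate m (rev w)"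
  shows "pair_expect s t (w, edges_of w) (w', edges_of w') =
    complex_of_real (if w' = rotate m (rev w) \<or> \<beta> = 1 then (covar s t) ^ length w else 0)"
proof -
  have er: "edges_of w' = edges_of w" using m by (auto simp: edges_of_rev)
  have w': "distinct w'" "3 \<le> length w'" "set w' \<subseteq> {1..}" using w m by auto
  have z: "expectation (edge_prod t x e) = 0" if "x = w \<or> x = w'" "e \<in> edges_of w" for x t e
    using expectation_simple_edge[of x e t] cycle_simple(1)[of x e] that w w' er by auto
  define F where "F = (\<lambda>i::nat. edges_of w)"
  let ?W = "\<lambda>i::nat. if i = 0 then w else w'" and ?\<tau> = "\<lambda>i::nat. if i = 0 then s else t"
  have "pair_expect s t (w, edges_of w) (w', edges_of w') = term_expect ?\<tau> ?W F {0, 1}"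
    unfolding pair_expect_def term_expect_def by (simp add: er F_def)
  also have "\<dots> = (\<Prod>a\<in>{0, 1}. \<Prod>e\<in>edges_of (?W a) - F a. expectation (edge_prod (?\<tau> a) (?W a) e)) *
    (\<Prod>e\<in>\<Union> (F ` {0, 1}). expectation (\<lambda>\<omega>. \<Prod>a | a \<in> {0, 1} \<and> e \<in> F a.
        edge_prod (?\<tau> a) (?W a) e \<omega> - expectation (edge_prod (?\<tau> a) (?W a) e)))"
    by (rule term_expect_factor[where I = "{0, 1}"]) (use w w' er in \<open>auto simp: F_def\<close>)
  also have "\<dots> = (\<Prod>e\<in>edges_of w. expectation (\<lambda>\<omega>. edge_prod s w e \<omega> * edge_prod t w' e \<omega>))"
  proof -
    have "{a. a \<in> {0, 1 :: nat} \<and> e \<in> F a} = {0, 1}" if "e \<in> edges_of w" for e using that by (auto simp: F_def)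
    then have "(\<Prod>e\<in>edges_of w. expectation (\<lambda>\<omega>. \<Prod>a | a \<in> {0, 1} \<and> e \<in> F a.
        edge_prod (?\<tau> a) (?W a) e \<omega> - expectation (edge_prod (?\<tau> a) (?W a) e))) =
        (\<Prod>e\<in>edges_of w. expectation (\<lambda>\<omega>. edge_prod s w e \<omega> * edge_prod t w' e \<omega>))"
      by (intro prod.cong refl) (simp add: z)
    moreover have "\<Union> (F ` {0, 1}) = edges_of w" by (simp add: F_def)
    moreover have "(\<Prod>a\<in>{0, 1}. \<Prod>e\<in>edges_of (?W a) - F a. expectation (edge_prod (?\<tau> a) (?W a) e)) = 1"
      by (simp add: F_def er)
    ultimately show ?thesis by (simp only: mult_1_left)
  qed
  also have "\<dots> = (\<Prod>e\<in>edges_of w. complex_of_real (if w' = rotate m (rev w) \<or> \<beta> = 1 then covar s t else 0))"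
  proof (rule prod.cong[OF refl])
    fix e assume e: "e \<in> edges_of w"
    have "size (edge_steps w e) = 1" using cycle_simple(1)[OF w(1,2) e] by (simp add: size_edge_steps)
    then obtain st where st: "edge_steps w e = {#st#}" using size_1_singleton_mset by blast
    obtain u v where uv: "st = (u, v)" by (cases st)
    have "st \<in># edge_steps w e" using st by simp
    then have "st \<in> set (steps w)" by (simp add: edge_steps_def)
    then obtain j where j: "j < length w" "u = w ! j" "v = w ! (Suc j mod length w)"
      unfolding set_steps uv by auto
    have neq: "u \<noteq> v"
      using cycle_index(3,5)[OF w(2) j(1)] nth_eq_iff_index_eq[OF w(1) j(1) cycle_index(5)[OF w(2) j(1)]] j by simp
    have pos: "1 \<le> u" "1 \<le> v" using j w(3) cycle_index(5)[OF w(2) j(1)] nth_mem by fastforce+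
    have es: "edge_prod s w e = entry s (u, v)" by (simp add: edge_prod_def st uv fun_eq_iff)
    show "expectation (\<lambda>\<omega>. edge_prod s w e \<omega> * edge_prod t w' e \<omega>) =
        complex_of_real (if w' = rotate m (rev w) \<or> \<beta> = 1 then covar s t else 0)"
    proof (cases "w' = rotate m (rev w)")
      case True
      have "edge_steps w' e = image_mset prod.swap (edge_steps w e)"
        unfolding edge_steps_def True mset_steps_rotate mset_steps_rev
        by (simp add: filter_mset_image_mset o_def) (intro arg_cong[where f = "image_mset prod.swap"] filter_mset_cong refl, auto simp: edge_commute)
      then have "edge_prod t w' e = entry t (v, u)" by (simp add: edge_prod_def st uv fun_eq_iff)
      then show ?thesis unfolding es using expectation_entry_opposite[OF pos, of s t] neq True by simp
    next
      case False
      then have "w' = rotate m w" using m by simp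
      then have "edge_steps w' e = edge_steps w e" by (simp add: edge_steps_def mset_steps_rotate)
      then have "edge_prod t w' e = entry t (u, v)" by (simp add: edge_prod_def st uv fun_eq_iff)
      then show ?thesis unfolding es using expectation_entry_same[OF pos neq, of s t] False by simp
    qed
  qed
  also have "\<dots> = complex_of_real (if w' = rotate m (rev w) \<or> \<beta> = 1 then (covar s t) ^ length w else 0)"
  proof -
    have "0 < length w" using w(2) by linarith
    then have "w \<noteq> []" by simp
    then show ?thesis by (simp add: cycle_simple(2)[OF w(1,2)])
  qed
  finally show ?thesis .
qed

text \<open>One loop with covariance \<open>2 / \<beta> * c\<close>, or two words on a doubled edge
  with \<open>2 / \<beta> * c\<^sup>2\<close> each, or for \<open>r \<ge> 3\<close> the
  \<open>r\<close> rotations of the reversal and, if \<open>\<beta> = 1\<close>, also the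
  \<open>r\<close> rotations of \<open>w\<close>: all total
  \<open>2 * r / \<beta> * c ^ r\<close>.\<close>

lemma sum_same_cycle:
  assumes w: "distinct w" "w \<noteq> []" "set w \<subseteq> {1..}"
  shows "(\<Sum>w'\<in>same_cycle w. pair_expect s t (w, edges_of w) (w', edges_of w')) =
    complex_of_real (2 / real \<beta> * real (length w) * (covar s t) ^ length w)"
proof -
  have sw: "set w' = set w" if "w' \<in> same_cycle w" for w'
    using that by (metis (mono_tags, lifting) mem_Collect_eq same_cycle_def verts_edges_of)
  have "0 < length w" using w(2) by simp
  then consider "length w = 1" | "length w = 2" | "3 \<le> length w" by linarith
  then show ?thesis
  proof cases
    case 1
    then obtain u where u: "w = [u]" by (auto simp: length_Suc_conv)
    have "same_cycle w = {w}"
    proof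
      show "same_cycle w \<subseteq> {w}"
      proof
        fix w' assume w': "w' \<in> same_cycle w"
        then have "length w' = 1" using 1 by (simp add: same_cycle_def)
        then obtain u' where "w' = [u']" by (auto simp: length_Suc_conv)
        then show "w' \<in> {w}" using sw[OF w'] u by simp
      qed
    qed (use w in \<open>auto simp: same_cycle_def\<close>)
    then show ?thesis using loop_pair_expect[of u s t] w u by simp
  next
    case 2
    then obtain u v where u: "w = [u, v]" by (auto simp: length_Suc_conv numeral_2_eq_2)
    have uv: "1 \<le> u" "1 \<le> v" "u \<noteq> v" using w u by auto
    have "same_cycle w = {[u, v], [v, u]}"
    proof
      show "same_cycle w \<subseteq> {[u, v], [v, u]}"
      proof
        fix w' assume w': "w' \<in> same_cycle w"
        then have "length w' = 2" "distinct w'" using 2 by (simp_all add: same_cycle_def)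
        then obtain a b where "w' = [a, b]" "a \<noteq> b" by (auto simp: length_Suc_conv numeral_2_eq_2)
        then show "w' \<in> {[u, v], [v, u]}" using sw[OF w'] u by auto
      qed
      show "{[u, v], [v, u]} \<subseteq> same_cycle w"
        using uv u by (auto simp: same_cycle_def edges_of_def steps_def edge_commute)
    qed
    moreover have "[u, v] \<noteq> [v, u]" using uv by simp
    ultimately have "(\<Sum>w'\<in>same_cycle w. pair_expect s t (w, edges_of w) (w', edges_of w')) =
        complex_of_real (2 / real \<beta> * (covar s t)\<^sup>2) + complex_of_real (2 / real \<beta> * (covar s t)\<^sup>2)"
      using edge_pair_expect[OF uv, of w "[u, v]" s t] edge_pair_expect[OF uv, of w "[v, u]" s t] u by simp
    then show ?thesis using 2 by simp
  next
    case 3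
    define R1 where "R1 = (\<lambda>m. rotate m w) ` {..<length w}"
    define R2 where "R2 = (\<lambda>m. rotate m (rev w)) ` {..<length w}"
    have disj: "R1 \<inter> R2 = {}" unfolding R1_def R2_def by (rule cycle_rotations_disjoint[OF w(1) 3])
    have c1: "card R1 = length w" unfolding R1_def using card_image[OF cycle_rotations_inj[OF w(1)]] by simp
    have c2: "card R2 = length w" unfolding R2_def
      using card_image[OF cycle_rotations_inj[of "rev w"]] w(1) by simp
    have "same_cycle w = R1 \<union> R2"
    proof
      show "same_cycle w \<subseteq> R1 \<union> R2"
        unfolding R1_def R2_def using cycle_classification[OF w(1) 3] by (auto simp: same_cycle_def)
      show "R1 \<union> R2 \<subseteq> same_cycle w"
        using w(1) by (auto simp: R1_def R2_def same_cycle_def edges_of_rev)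
    qed
    then have "(\<Sum>w'\<in>same_cycle w. pair_expect s t (w, edges_of w) (w', edges_of w')) =
      (\<Sum>w'\<in>R1. pair_expect s t (w, edges_of w) (w', edges_of w')) + (\<Sum>w'\<in>R2. pair_expect s t (w, edges_of w) (w', edges_of w'))"
      using disj by (simp add: sum.union_disjoint R1_def R2_def)
    also have "(\<Sum>w'\<in>R1. pair_expect s t (w, edges_of w) (w', edges_of w')) =
        (\<Sum>w'\<in>R1. complex_of_real (if \<beta> = 1 then (covar s t) ^ length w else 0))"
    proof (rule sum.cong[OF refl])
      fix w' assume w': "w' \<in> R1"
      then obtain m where m: "m < length w" "w' = rotate m w" by (auto simp: R1_def)
      have "w' \<noteq> rotate m (rev w)" using w' disj m by (auto simp: R2_def)
      then show "pair_expect s t (w, edges_of w) (w', edges_of w') = complex_of_real (if \<beta> = 1 then (covar s t) ^ length w else 0)"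
        using cycle_pair_expect[OF w(1) 3 w(3), of w' m s t] m by simp
    qed
    also have "(\<Sum>w'\<in>R2. pair_expect s t (w, edges_of w) (w', edges_of w')) = (\<Sum>w'\<in>R2. complex_of_real ((covar s t) ^ length w))"
    proof (rule sum.cong[OF refl])
      fix w' assume w': "w' \<in> R2"
      then obtain m where m: "m < length w" "w' = rotate m (rev w)" by (auto simp: R2_def)
      then show "pair_expect s t (w, edges_of w) (w', edges_of w') = complex_of_real ((covar s t) ^ length w)"
        using cycle_pair_expect[OF w(1) 3 w(3), of w' m s t] by simp
    qed
    finally show ?thesis using beta c1 c2 by auto
  qed
qed

text \<open>A cycle correlates only with cycles on the same edges, hence on the same vertices, so
  only cycles inside \<open>B1 \<inter> B2\<close> contribute.\<close>

lemma sum_cycles_pair_expect: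
  assumes B1: "finite B1" "B1 \<subseteq> {1..}" and B2: "finite B2" "B2 \<subseteq> {1..}" and r: "1 \<le> r" "1 \<le> r'"
  shows "(\<Sum>w\<in>cycles r B1. \<Sum>w'\<in>cycles r' B2. pair_expect s t (w, edges_of w) (w', edges_of w')) =
    complex_of_real (if r = r' then 2 / real \<beta> * real r * (covar s t) ^ r * (\<Prod>i<r. real (card (B1 \<inter> B2)) - real i) else 0)"
proof -
  have finc: "finite (cycles r B)" if "finite B" for r and B :: "nat set"
    by (rule finite_subset[OF _ finite_words[OF that, of r]]) (auto simp: cycles_def words_def)
  have inner: "(\<Sum>w'\<in>cycles r' B2. pair_expect s t (w, edges_of w) (w', edges_of w')) =
    (if r = r' \<and> set w \<subseteq> B2 then complex_of_real (2 / real \<beta> * real r * (covar s t) ^ r) else 0)" if w: "w \<in> cycles r B1" for w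
  proof -
    have w1: "distinct w" "w \<noteq> []" "set w \<subseteq> {1..}" "length w = r" using w B1 r by (auto simp: cycles_def)
    have nz: "w' \<in> same_cycle w \<and> set w' = set w \<and> r = r'" if w': "w' \<in> cycles r' B2" and "pair_expect s t (w, edges_of w) (w', edges_of w') \<noteq> 0" for w'
    proof -
      have w2: "distinct w'" "w' \<noteq> []" "set w' \<subseteq> {1..}" "length w' = r'" using w' B2 r by (auto simp: cycles_def)
      have e: "edges_of w = edges_of w'"
        using pair_expect_nonzero(1)[of "(w, edges_of w)" "(w', edges_of w')" s t] that(2)
          cycle_admissible[OF w1(1,2)] cycle_admissible[OF w2(1,2)] w1 w2 by simp
      then have "set w = set w'" by (metis verts_edges_of)
      then have "r = r'" using w1 w2 by (metis distinct_card)
      then show ?thesis using e \<open>set w = set w'\<close> w1 w2 by (simp add: same_cycle_def)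
    qed
    show ?thesis
    proof (cases "r = r' \<and> set w \<subseteq> B2")
      case False
      have "(\<Sum>w'\<in>cycles r' B2. pair_expect s t (w, edges_of w) (w', edges_of w')) = 0"
        using nz False by (intro sum.neutral) (fastforce simp: cycles_def)
      then show ?thesis using False by (simp only: if_False)
    next
      case True
      have sub: "same_cycle w \<subseteq> cycles r' B2"
      proof
        fix w' assume w': "w' \<in> same_cycle w"
        then have "set w' = set w" by (metis (mono_tags, lifting) mem_Collect_eq same_cycle_def verts_edges_of)
        then show "w' \<in> cycles r' B2" using w' True w1 by (simp add: same_cycle_def cycles_def)
      qed
      have "(\<Sum>w'\<in>cycles r' B2. pair_expect s t (w, edges_of w) (w', edges_of w')) =
          (\<Sum>w'\<in>same_cycle w. pair_expect s t (w, edges_of w) (w', edges_of w'))"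
        using nz sub finc[OF B2(1)] by (intro sum.mono_neutral_right) auto
      then show ?thesis using sum_same_cycle[OF w1(1-3), of s t] True w1(4) by simp
    qed
  qed
  have "(\<Sum>w\<in>cycles r B1. \<Sum>w'\<in>cycles r' B2. pair_expect s t (w, edges_of w) (w', edges_of w')) =
      (\<Sum>w\<in>cycles r B1. if r = r' \<and> set w \<subseteq> B2 then complex_of_real (2 / real \<beta> * real r * (covar s t) ^ r) else 0)"
    by (intro sum.cong refl inner)
  also have "\<dots> = (if r = r' then of_nat (card (cycles r (B1 \<inter> B2))) * complex_of_real (2 / real \<beta> * real r * (covar s t) ^ r) else 0)"
  proof (cases "r = r'")
    case True
    have "cycles r B1 \<inter> {w. set w \<subseteq> B2} = cycles r (B1 \<inter> B2)" by (auto simp: cycles_def)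
    then show ?thesis using True finc[OF B1(1)] by (simp add: sum.If_cases)
  qed simp
  also have "\<dots> = complex_of_real (if r = r' then 2 / real \<beta> * real r * (covar s t) ^ r * (\<Prod>i<r. real (card (B1 \<inter> B2)) - real i) else 0)"
  proof (cases "r = r'")
    case True
    have "real (card (cycles r (B1 \<inter> B2))) = (\<Prod>i<r. real (card (B1 \<inter> B2)) - real i)"
      by (rule card_cycles) (use B1(1) in simp)
    then have "complex_of_real (real (card (cycles r (B1 \<inter> B2)))) = complex_of_real (\<Prod>i<r. real (card (B1 \<inter> B2)) - real i)"
      by (rule arg_cong)
    then have e: "of_nat (card (cycles r (B1 \<inter> B2))) = complex_of_real (\<Prod>i<r. real (card (B1 \<inter> B2)) - real i)"
      by (simp only: of_real_of_nat_eq)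
    show ?thesis unfolding e if_P[OF True] of_real_mult by (rule mult.commute)
  qed simp
  finally show ?thesis .
qed

end

section \<open>The integral formula for the covariance\<close>

text \<open>The coefficient of \<open>exp (\<i> n \<theta>)\<close> in
  \<open>(2 cos \<theta>) ^ k\<close>, which is \<open>k choose (k - n) / 2\<close> when this makes
  sense. Integer \<open>n\<close> lets the recursion pass through negative frequencies.\<close>

definition cos_coef :: "nat \<Rightarrow> int \<Rightarrow> real" where
  "cos_coef k n = (\<Sum>j\<le>k. real (k choose j) * of_bool (int k - 2 * int j = n))"

lemma sum_choose_Suc:
  fixes g :: "nat \<Rightarrow> 'a :: comm_semiring_1"
  shows "(\<Sum>j\<le>Suc k. of_nat (Suc k choose j) * g j) = (\<Sum>j\<le>k. of_nat (k choose j) * (g j + g (Suc j)))"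
proof -
  have "(\<Sum>j\<le>Suc k. of_nat (Suc k choose j) * g j) = g 0 + (\<Sum>j\<le>k. of_nat ((k choose j) + (k choose Suc j)) * g (Suc j))"
    unfolding sum.atMost_Suc_shift binomial_Suc_Suc by (simp only: binomial_n_0 of_nat_1 mult_1_left)
  also have "\<dots> = (g 0 + (\<Sum>j\<le>k. of_nat (k choose Suc j) * g (Suc j))) + (\<Sum>j\<le>k. of_nat (k choose j) * g (Suc j))"
    by (simp add: algebra_simps sum.distrib)
  also have "g 0 + (\<Sum>j\<le>k. of_nat (k choose Suc j) * g (Suc j)) = (\<Sum>j\<le>Suc k. of_nat (k choose j) * g j)"
    by (subst sum.atMost_Suc_shift) simp
  finally show ?thesis by (simp add: binomial_eq_0 distrib_left sum.distrib add_ac)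
qed

lemma cos_coef_Suc: "cos_coef (Suc k) n = cos_coef k (n - 1) + cos_coef k (n + 1)"
proof -
  have "cos_coef (Suc k) n = (\<Sum>j\<le>k. real (k choose j) *
      (of_bool (int (Suc k) - 2 * int j = n) + of_bool (int (Suc k) - 2 * int (Suc j) = n)))"
    unfolding cos_coef_def by (rule sum_choose_Suc)
  also have "\<dots> = (\<Sum>j\<le>k. real (k choose j) * of_bool (int k - 2 * int j = n - 1) +
      real (k choose j) * of_bool (int k - 2 * int j = n + 1))"
    by (intro sum.cong refl) (auto simp: algebra_simps)
  finally show ?thesis by (simp add: cos_coef_def sum.distrib)
qed

lemma cos_coef_nat:
  assumes "1 \<le> n"
  shows "cos_coef k (int n) = (\<Sum>j | 2 * j < k. if k - 2 * j = n then real (k choose j) else 0)"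
proof -
  have "cos_coef k (int n) = (\<Sum>j\<in>{..k}. if 2 * j < k \<and> k - 2 * j = n then real (k choose j) else 0)"
    unfolding cos_coef_def using assms by (intro sum.cong refl) auto
  also have "\<dots> = (\<Sum>j | 2 * j < k. if 2 * j < k \<and> k - 2 * j = n then real (k choose j) else 0)"
    by (intro sum.mono_neutral_right) auto
  finally show ?thesis by simp
qed

lemma cos_coef_eq_0: "k < n \<Longrightarrow> cos_coef k (int n) = 0"
  unfolding cos_coef_def by (intro sum.neutral) auto

text \<open>One factor \<open>2 cos \<theta>\<close> shifts the frequency by 1 in both directions,
  which is the recursion \<open>cos_coef_Suc\<close>.\<close>

lemma has_integral_cos_power:
  "((\<lambda>\<theta>. (2 * cos \<theta>) ^ k * cos (of_int n * \<theta>)) has_integral pi * cos_coef k n) {0..pi}"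
proof (induction k arbitrary: n)
  case 0
  show ?case
  proof (cases "n = 0")
    case True
    then show ?thesis using has_integral_const_real[of "1::real" 0 pi] by (simp add: cos_coef_def)
  next
    case False
    have "((\<lambda>\<theta>. cos (of_int n * \<theta>)) has_integral (sin (of_int n * pi) / of_int n - sin (of_int n * 0) / of_int n)) {0..pi}"
      using False by (intro fundamental_theorem_of_calculus)
        (auto intro!: derivative_eq_intros simp flip: has_real_derivative_iff_has_vector_derivative)
    then show ?thesis using False by (simp add: cos_coef_def mult.commute[of _ pi])
  qed
next
  case (Suc k)
  have "2 * cos \<theta> * cos (of_int n * \<theta>) = cos (of_int (n - 1) * \<theta>) + cos (of_int (n + 1) * \<theta>)" for \<theta> :: real
    using cos_times_cos[of \<theta> "of_int n * \<theta>"] by (simp add: algebra_simps cos_diff cos_add)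
  then have "(2 * cos \<theta>) ^ Suc k * cos (of_int n * \<theta>) =
      (2 * cos \<theta>) ^ k * cos (of_int (n - 1) * \<theta>) + (2 * cos \<theta>) ^ k * cos (of_int (n + 1) * \<theta>)" for \<theta> :: real
    by (simp only: power_Suc distrib_left[symmetric] mult.assoc mult.left_commute) (simp add: mult_ac)
  then show ?case using has_integral_add[OF Suc[of "n - 1"] Suc[of "n + 1"]]
    by (simp only: cos_coef_Suc distrib_left)
qed

text \<open>Clipping the argument to the domain of \<open>arccos\<close> makes this continuous on the whole line.\<close>

definition semicircle_angle :: "real \<Rightarrow> real \<Rightarrow> real" where
  "semicircle_angle a x = arccos (max (-1) (min 1 (x / (2 * a))))"

lemma semicircle_angle_measurable [measurable (raw)]:
  assumes "f \<in> borel_measurable M" shows "(\<lambda>x. semicircle_angle a (f x)) \<in> borel_measurable M"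
proof -
  have "(\<lambda>x. semicircle_angle a x) \<in> borel_measurable borel"
    unfolding semicircle_angle_def divide_inverse
  proof (rule borel_measurable_continuous_onI, rule continuous_on_arccos)
    show "continuous_on UNIV (\<lambda>x. max (-1) (min 1 (x * inverse (2 * a))))"
      by (intro continuous_on_max continuous_on_min continuous_on_mult continuous_on_const continuous_on_id)
  qed simp
  then show ?thesis by (rule measurable_compose[OF assms])
qed

lemma semicircle_angle:
  assumes "0 < a" "x \<in> {-2 * a..2 * a}"
  shows "cos (semicircle_angle a x) = x / (2 * a)" "0 \<le> semicircle_angle a x" "semicircle_angle a x \<le> pi"
    "sin (semicircle_angle a x) = sqrt (1 - (x / (2 * a))\<^sup>2)"
proof -
  have r: "-1 \<le> x / (2 * a)" "x / (2 * a) \<le> 1" using assms by (auto simp: field_simps)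
  then have e: "semicircle_angle a x = arccos (x / (2 * a))" by (simp add: semicircle_angle_def)
  show "cos (semicircle_angle a x) = x / (2 * a)" "0 \<le> semicircle_angle a x" "semicircle_angle a x \<le> pi"
    unfolding e using arccos[OF r] by auto
  show "sin (semicircle_angle a x) = sqrt (1 - (x / (2 * a))\<^sup>2)" unfolding e by (rule sin_arccos_abs) (use r in auto)
qed

lemma semicircle_angle_cos: "0 < a \<Longrightarrow> 0 \<le> \<theta> \<Longrightarrow> \<theta> \<le> pi \<Longrightarrow> semicircle_angle a (2 * a * cos \<theta>) = \<theta>"
  by (simp add: semicircle_angle_def arccos_cos)

definition semicircle_sine :: "real \<Rightarrow> nat \<Rightarrow> real \<Rightarrow> real" where
  "semicircle_sine a n x = sin (real n * semicircle_angle a x)"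

lemma continuous_on_semicircle_sine:
  assumes "0 < a" shows "continuous_on {-2 * a..2 * a} (semicircle_sine a n)"
  unfolding semicircle_sine_def semicircle_angle_def by (intro continuous_intros) (use assms in auto)

text \<open>Substitute \<open>x = 2 a cos \<theta>\<close> and integrate by parts. The boundary term
  \<open>(2 a cos \<theta>) ^ k * sin (n \<theta>)\<close> vanishes at 0 and \<open>pi\<close>, and
  a cosine moment remains.\<close>

lemma semicircle_sine_moment:
  assumes a: "0 < a" and k: "1 \<le> k"
  shows "real k * (LINT x:{-2 * a..2 * a}|lborel. x ^ (k - 1) * semicircle_sine a n x) =
    real n * pi * a ^ k * cos_coef k (int n)"
proof -
  define f where "f x = x ^ (k - 1) * semicircle_sine a n x" for x
  define I where "I = integral {-2 * a..2 * a} f"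
  have cf: "continuous_on {-2 * a..2 * a} f"
    unfolding f_def using continuous_on_semicircle_sine[OF a] by (intro continuous_intros) auto
  have "((\<lambda>\<theta>. (- 2 * a * sin \<theta>) *\<^sub>R f (2 * a * cos \<theta>)) has_integral
      (integral {2 * a * cos 0..2 * a * cos pi} f - integral {2 * a * cos pi..2 * a * cos 0} f)) {0..pi}"
  proof (rule has_integral_substitution_general[of "{}", OF _ _ _ cf])
    show "(\<lambda>\<theta>. 2 * a * cos \<theta>) ` {0..pi} \<subseteq> {-2 * a..2 * a}"
    proof
      fix y assume "y \<in> (\<lambda>\<theta>. 2 * a * cos \<theta>) ` {0..pi}"
      then obtain \<theta> where y: "y = 2 * a * cos \<theta>" by auto
      have "a * cos \<theta> \<le> a * 1" "a * (- 1) \<le> a * cos \<theta>" using a by (intro mult_left_mono; simp)+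
      then show "y \<in> {-2 * a..2 * a}" using y by simp
    qed
  qed (auto intro!: continuous_intros derivative_eq_intros)
  \<comment> \<open>The first interval, from \<open>2 * a\<close> to \<open>-2 * a\<close>, is
    empty; the sign records that \<open>x\<close> decreases as \<open>\<theta>\<close>
    grows.\<close>
  then have "((\<lambda>\<theta>. (- 2 * a * sin \<theta>) * f (2 * a * cos \<theta>)) has_integral - I) {0..pi}"
    using a by (simp add: I_def)
  then have 1: "((\<lambda>\<theta>. real k * ((- 2 * a * sin \<theta>) * f (2 * a * cos \<theta>))) has_integral real k * - I) {0..pi}"
    by (rule has_integral_mult_right)
  have 2: "((\<lambda>\<theta>. a ^ k * real n * ((2 * cos \<theta>) ^ k * cos (of_int (int n) * \<theta>))) has_integral
      a ^ k * real n * (pi * cos_coef k (int n))) {0..pi}"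
    by (rule has_integral_mult_right[OF has_integral_cos_power])
  have "((\<lambda>\<theta>. real k * (2 * a * cos \<theta>) ^ (k - 1) * (- 2 * a * sin \<theta>) * sin (real n * \<theta>) +
      (2 * a * cos \<theta>) ^ k * (real n * cos (real n * \<theta>))) has_integral
      ((2 * a * cos pi) ^ k * sin (real n * pi) - (2 * a * cos 0) ^ k * sin (real n * 0))) {0..pi}"
  proof (rule fundamental_theorem_of_calculus)
    fix \<theta> :: real assume "\<theta> \<in> {0..pi}"
    show "((\<lambda>\<theta>. (2 * a * cos \<theta>) ^ k * sin (real n * \<theta>)) has_vector_derivative
      real k * (2 * a * cos \<theta>) ^ (k - 1) * (- 2 * a * sin \<theta>) * sin (real n * \<theta>) +
      (2 * a * cos \<theta>) ^ k * (real n * cos (real n * \<theta>))) (at \<theta> within {0..pi})"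
    proof -
      have "((\<lambda>\<theta>. 2 * a * cos \<theta>) has_real_derivative - 2 * a * sin \<theta>) (at \<theta> within {0..pi})"
        by (auto intro!: derivative_eq_intros)
      from DERIV_power[OF this, of k]
      have 1: "((\<lambda>\<theta>. (2 * a * cos \<theta>) ^ k) has_real_derivative real k * (2 * a * cos \<theta>) ^ (k - 1) * (- 2 * a * sin \<theta>)) (at \<theta> within {0..pi})"
        by (simp add: mult_ac)
      have 2: "((\<lambda>\<theta>. sin (real n * \<theta>)) has_real_derivative real n * cos (real n * \<theta>)) (at \<theta> within {0..pi})"
        by (auto intro!: derivative_eq_intros)
      show ?thesis unfolding has_real_derivative_iff_has_vector_derivative[symmetric]
        using DERIV_mult[OF 1 2] by (simp add: mult_ac add_ac)
    qed
  qed simp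
  then have "((\<lambda>\<theta>. real k * ((- 2 * a * sin \<theta>) * f (2 * a * cos \<theta>)) +
      a ^ k * real n * ((2 * cos \<theta>) ^ k * cos (of_int (int n) * \<theta>))) has_integral 0) {0..pi}"
  proof (rule has_integral_eq_rhs[OF has_integral_eq, rotated])
    fix \<theta> :: real assume "\<theta> \<in> {0..pi}"
    then have "f (2 * a * cos \<theta>) = (2 * a * cos \<theta>) ^ (k - 1) * sin (real n * \<theta>)"
      using a by (simp add: f_def semicircle_sine_def semicircle_angle_cos)
    then show "real k * (2 * a * cos \<theta>) ^ (k - 1) * (- 2 * a * sin \<theta>) * sin (real n * \<theta>) +
      (2 * a * cos \<theta>) ^ k * (real n * cos (real n * \<theta>)) = real k * ((- 2 * a * sin \<theta>) * f (2 * a * cos \<theta>)) +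
      a ^ k * real n * ((2 * cos \<theta>) ^ k * cos (of_int (int n) * \<theta>))"
      by (simp add: power_mult_distrib mult_ac)
  qed simp
  from has_integral_unique[OF this has_integral_add[OF 1 2]]
  have "real k * I = real n * pi * a ^ k * cos_coef k (int n)" by (simp add: mult_ac)
  moreover have "(LINT x:{-2 * a..2 * a}|lborel. f x) = I"
    unfolding I_def by (intro set_borel_integral_eq_integral borel_integrable_atLeastAtMost' cf)
  ultimately show ?thesis by (simp add: f_def)
qed

section \<open>The logarithmic kernel\<close>

text \<open>The logarithm of the ratio of the distances from \<open>\<rho>\<close> to
  \<open>cis (\<theta> + \<phi>)\<close> and to \<open>cis (\<theta> - \<phi>)\<close>; the division
  by 2 compensates for squared distances.\<close>

definition log_kernel :: "real \<Rightarrow> real \<Rightarrow> real \<Rightarrow> real" where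
  "log_kernel \<rho> \<theta> \<phi> = ln ((1 + \<rho>\<^sup>2 - 2 * \<rho> * cos (\<theta> + \<phi>)) / (1 + \<rho>\<^sup>2 - 2 * \<rho> * cos (\<theta> - \<phi>))) / 2"

lemma quadratic_pos:
  fixes \<rho> u :: real assumes "0 \<le> \<rho>" "\<rho> \<le> 1" "\<rho> < 1 \<or> u < 1" "u \<le> 1"
  shows "0 < 1 + \<rho>\<^sup>2 - 2 * \<rho> * u"
proof -
  have e: "1 + \<rho>\<^sup>2 - 2 * \<rho> * u = (1 - \<rho>)\<^sup>2 + 2 * \<rho> * (1 - u)" by (simp add: power2_eq_square algebra_simps)
  have n: "0 \<le> 2 * \<rho> * (1 - u)" using assms by simp
  show ?thesis
  proof (cases "\<rho> < 1")
    case True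
    then have "0 < (1 - \<rho>)\<^sup>2" by simp
    then show ?thesis unfolding e using n by linarith
  next
    case False
    then have "\<rho> = 1" "u < 1" using assms by auto
    then show ?thesis by simp
  qed
qed

text \<open>Twice the real part of the power series of \<open>ln (1 - z)\<close> at
  \<open>z = \<rho> cis \<alpha>\<close>. The term \<open>n = 0\<close> is 0 because division by
  zero gives 0.\<close>

lemma ln_quadratic_sums:
  assumes "0 \<le> \<rho>" "\<rho> < 1"
  shows "(\<lambda>n. - (2 * \<rho> ^ n * cos (real n * \<alpha>) / real n)) sums ln (1 + \<rho>\<^sup>2 - 2 * \<rho> * cos \<alpha>)"
proof -
  define z where "z = complex_of_real \<rho> * cis \<alpha>"
  have z: "cmod z < 1" using assms by (simp add: z_def norm_mult)
  then have "(\<lambda>n. - ((- (- z)) ^ n) / of_nat n) sums ln (1 + (- z))" by (intro Ln_series') simp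
  then have "(\<lambda>n. 2 * Re (- (z ^ n) / of_nat n)) sums (2 * Re (ln (1 - z)))"
    by (intro sums_mult sums_Re) simp
  moreover have "2 * Re (- (z ^ n) / of_nat n) = - (2 * \<rho> ^ n * cos (real n * \<alpha>) / real n)" for n
  proof -
    have "z ^ n = complex_of_real (\<rho> ^ n) * cis (real n * \<alpha>)" by (simp only: z_def power_mult_distrib Complex.DeMoivre of_real_power)
    then have "Re (z ^ n) = \<rho> ^ n * cos (real n * \<alpha>)" by simp
    then show ?thesis by simp
  qed
  moreover have "2 * Re (ln (1 - z)) = ln (1 + \<rho>\<^sup>2 - 2 * \<rho> * cos \<alpha>)"
  proof -
    have nz: "1 - z \<noteq> 0" using z by auto
    have "(cmod (1 - z))\<^sup>2 = (1 - \<rho> * cos \<alpha>)\<^sup>2 + (\<rho> * sin \<alpha>)\<^sup>2" by (simp add: cmod_power2 z_def)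
    also have "\<dots> = 1 - 2 * \<rho> * cos \<alpha> + \<rho>\<^sup>2 * ((cos \<alpha>)\<^sup>2 + (sin \<alpha>)\<^sup>2)"
      by (simp add: power2_eq_square algebra_simps del: sin_cos_squared_add sin_cos_squared_add2 sin_cos_squared_add3)
    also have "(cos \<alpha>)\<^sup>2 + (sin \<alpha>)\<^sup>2 = 1" by simp
    finally have e: "(cmod (1 - z))\<^sup>2 = 1 + \<rho>\<^sup>2 - 2 * \<rho> * cos \<alpha>" by simp
    have "2 * Re (ln (1 - z)) = 2 * ln (cmod (1 - z))" using nz by simp
    also have "\<dots> = ln ((cmod (1 - z))\<^sup>2)" using nz by (simp add: ln_realpow)
    finally show ?thesis by (simp add: e)
  qed
  ultimately show ?thesis by (simp only:)
qed

lemma log_kernel_sums: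
  assumes "0 \<le> \<rho>" "\<rho> < 1"
  shows "(\<lambda>n. 2 * \<rho> ^ n / real n * (sin (real n * \<theta>) * sin (real n * \<phi>))) sums log_kernel \<rho> \<theta> \<phi>"
proof -
  have "log_kernel \<rho> \<theta> \<phi> = (ln (1 + \<rho>\<^sup>2 - 2 * \<rho> * cos (\<theta> + \<phi>)) - ln (1 + \<rho>\<^sup>2 - 2 * \<rho> * cos (\<theta> - \<phi>))) / 2"
  proof -
    have "0 < 1 + \<rho>\<^sup>2 - 2 * \<rho> * cos \<alpha>" for \<alpha> using assms by (intro quadratic_pos) auto
    then have "1 + \<rho>\<^sup>2 - 2 * \<rho> * cos \<alpha> \<noteq> 0" for \<alpha> by (metis less_irrefl)
    then show ?thesis unfolding log_kernel_def by (simp only: ln_div simp_thms if_True)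
  qed
  then have "(\<lambda>n. (- (2 * \<rho> ^ n * cos (real n * (\<theta> + \<phi>)) / real n) - - (2 * \<rho> ^ n * cos (real n * (\<theta> - \<phi>)) / real n)) / 2)
      sums log_kernel \<rho> \<theta> \<phi>"
    by (simp only:) (intro sums_divide sums_diff ln_quadratic_sums assms)
  moreover have "(- (2 * \<rho> ^ n * cos (real n * (\<theta> + \<phi>)) / real n) - - (2 * \<rho> ^ n * cos (real n * (\<theta> - \<phi>)) / real n)) / 2 =
      2 * \<rho> ^ n / real n * (sin (real n * \<theta>) * sin (real n * \<phi>))" for n
  proof -
    have "cos (real n * (\<theta> - \<phi>)) = cos (real n * (\<theta> + \<phi>)) + 2 * (sin (real n * \<theta>) * sin (real n * \<phi>))"
      by (simp add: distrib_left right_diff_distrib cos_add cos_diff)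
    then show ?thesis by (simp add: distrib_left add_divide_distrib)
  qed
  ultimately show ?thesis by (simp only:)
qed

text \<open>After cross-multiplication the difference factors as \<open>2 * (w - u) * ((\<sigma> -
  \<rho>) * (1 - \<rho> * \<sigma>))\<close>, and \<open>w - u\<close> is twice the product of the
  two sines.\<close>

lemma log_kernel_mono:
  assumes \<rho>: "0 \<le> \<rho>" "\<rho> \<le> \<sigma>" "\<sigma> \<le> 1" and \<theta>: "0 \<le> sin \<theta>" "0 \<le> sin \<phi>" and v: "cos (\<theta> - \<phi>) < 1"
  shows "log_kernel \<rho> \<theta> \<phi> \<le> log_kernel \<sigma> \<theta> \<phi>"
proof -
  define u where "u = cos (\<theta> + \<phi>)"
  define w where "w = cos (\<theta> - \<phi>)"
  have uw: "u \<le> w" using mult_nonneg_nonneg[OF \<theta>] by (simp add: u_def w_def cos_add cos_diff)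
  have w1: "w < 1" using v by (simp add: w_def)
  have pos: "0 < 1 + x\<^sup>2 - 2 * x * u" "0 < 1 + x\<^sup>2 - 2 * x * w" if "0 \<le> x" "x \<le> 1" for x :: real
    using that uw w1 by (intro quadratic_pos; simp)+
  have "0 \<le> 2 * (w - u) * ((\<sigma> - \<rho>) * (1 - \<rho> * \<sigma>))"
    using uw \<rho> by (auto intro!: mult_nonneg_nonneg mult_le_one)
  then have "(1 + \<rho>\<^sup>2 - 2 * \<rho> * u) * (1 + \<sigma>\<^sup>2 - 2 * \<sigma> * w) \<le> (1 + \<sigma>\<^sup>2 - 2 * \<sigma> * u) * (1 + \<rho>\<^sup>2 - 2 * \<rho> * w)"
    by (simp add: power2_eq_square algebra_simps)
  then have "(1 + \<rho>\<^sup>2 - 2 * \<rho> * u) / (1 + \<rho>\<^sup>2 - 2 * \<rho> * w) \<le> (1 + \<sigma>\<^sup>2 - 2 * \<sigma> * u) / (1 + \<sigma>\<^sup>2 - 2 * \<sigma> * w)"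
    using pos[of \<rho>] pos[of \<sigma>] \<rho> by (simp add: divide_le_eq le_divide_eq mult_ac)
  then show ?thesis unfolding log_kernel_def u_def[symmetric] w_def[symmetric]
    using pos[of \<rho>] pos[of \<sigma>] \<rho> by (intro divide_right_mono ln_mono) auto
qed

lemma log_kernel_tendsto_1:
  assumes \<theta>: "0 \<le> sin \<theta>" "0 \<le> sin \<phi>" and v: "cos (\<theta> - \<phi>) < 1" and r: "(r \<longlongrightarrow> 1) F"
  shows "((\<lambda>j. log_kernel (r j) \<theta> \<phi>) \<longlongrightarrow> log_kernel 1 \<theta> \<phi>) F"
proof -
  have "cos (\<theta> + \<phi>) < 1" using mult_nonneg_nonneg[OF \<theta>] v by (simp add: cos_add cos_diff)
  then show ?thesis unfolding log_kernel_def using v by (intro tendsto_intros r) auto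
qed

section \<open>Integration of the kernel over the rectangle\<close>

definition semicircle_measure :: "real \<Rightarrow> real measure" where
  "semicircle_measure a = restrict_space lborel {-2 * a..2 * a}"

lemma space_semicircle_measure: "space (semicircle_measure a) = {-2 * a..2 * a}"
  by (simp add: semicircle_measure_def space_restrict_space)

lemma finite_semicircle_measure: "finite_measure (semicircle_measure a)"
proof (rule finite_measureI)
  have "emeasure (semicircle_measure a) (space (semicircle_measure a)) = emeasure lborel {-2 * a..2 * a}"
    unfolding space_semicircle_measure by (simp add: semicircle_measure_def emeasure_restrict_space)
  then show "emeasure (semicircle_measure a) (space (semicircle_measure a)) \<noteq> \<infinity>"
    using emeasure_lborel_Icc_eq[of "-2 * a" "2 * a"] by simp
qed

lemma measurable_semicircle_measure:
  fixes h :: "real \<Rightarrow> real"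
  assumes "h \<in> borel_measurable borel" shows "h \<in> borel_measurable (semicircle_measure a)"
proof -
  have "h \<in> borel_measurable lborel" using assms by (subst measurable_cong_sets[OF sets_lborel refl])
  from measurable_restrict_space1[OF this, of "{-2 * a..2 * a}"] show ?thesis by (simp only: semicircle_measure_def)
qed

lemma integral_semicircle_measure:
  fixes f :: "real \<Rightarrow> real"
  shows "(\<integral>x. f x \<partial>semicircle_measure a) = (LINT x:{-2 * a..2 * a}|lborel. f x)"
proof -
  have "{-2 * a..2 * a} \<inter> space lborel \<in> sets lborel"
    by (simp only: space_lborel space_borel Int_UNIV_right sets_lborel atLeastAtMost_borel)
  from integral_restrict_space[OF this, of f] show ?thesis
    by (simp only: semicircle_measure_def set_lebesgue_integral_def)
qed

lemma semicircle_sine_measurable [measurable (raw)]: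
  assumes "f \<in> borel_measurable M" shows "(\<lambda>x. semicircle_sine a n (f x)) \<in> borel_measurable M"
  unfolding semicircle_sine_def
  by (intro measurable_compose[OF _ borel_measurable_sin] borel_measurable_times borel_measurable_const semicircle_angle_measurable assms)

lemma (in pair_sigma_finite) integral_mult_product:
  fixes f g :: "_ \<Rightarrow> real"
  assumes "integrable M1 f" "integrable M2 g"
  shows "integrable (M1 \<Otimes>\<^sub>M M2) (\<lambda>(x, y). f x * g y)"
    and "(\<integral>(x, y). f x * g y \<partial>(M1 \<Otimes>\<^sub>M M2)) = (\<integral>x. f x \<partial>M1) * (\<integral>y. g y \<partial>M2)"
proof -
  note [measurable] = borel_measurable_integrable[OF assms(1)] borel_measurable_integrable[OF assms(2)]
  show i: "integrable (M1 \<Otimes>\<^sub>M M2) (\<lambda>(x, y). f x * g y)"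
  proof (rule Fubini_integrable)
    show "(\<lambda>(x, y). f x * g y) \<in> borel_measurable (M1 \<Otimes>\<^sub>M M2)" by measurable
    show "integrable M1 (\<lambda>x. \<integral>y. norm (case (x, y) of (x, y) \<Rightarrow> f x * g y) \<partial>M2)"
      using assms(1) by (simp add: abs_mult)
    show "AE x in M1. integrable M2 (\<lambda>y. case (x, y) of (x, y) \<Rightarrow> f x * g y)" using assms(2) by simp
  qed
  show "(\<integral>(x, y). f x * g y \<partial>(M1 \<Otimes>\<^sub>M M2)) = (\<integral>x. f x \<partial>M1) * (\<integral>y. g y \<partial>M2)"
    using integral_fst'[OF i] by simp
qed

definition semicircle_kernel :: "real \<Rightarrow> real \<Rightarrow> real \<Rightarrow> real \<times> real \<Rightarrow> real" where
  "semicircle_kernel a a' \<rho> z = log_kernel \<rho> (semicircle_angle a (fst z)) (semicircle_angle a' (snd z))"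

text \<open>The range may stop at \<open>k\<close> because \<open>cos_coef k n\<close> vanishes for
  \<open>n > k\<close>: against polynomials the sine series is finite.\<close>

definition cos_sum :: "nat \<Rightarrow> nat \<Rightarrow> real \<Rightarrow> real" where
  "cos_sum k l \<rho> = (\<Sum>n\<in>{1..k}. real n * \<rho> ^ n * cos_coef k (int n) * cos_coef l (int n))"

context
  fixes a a' :: real
  assumes a: "0 < a" "0 < a'"
begin

definition "Mx = semicircle_measure a"
definition "My = semicircle_measure a'"
definition "Pxy = Mx \<Otimes>\<^sub>M My"

lemma finite_My: "finite_measure Mx" "finite_measure My" by (simp_all add: Mx_def My_def finite_semicircle_measure)

interpretation Mx: finite_measure Mx by (rule finite_My)
interpretation My: finite_measure My by (rule finite_My)
interpretation P: pair_sigma_finite Mx My ..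
interpretation PP: finite_measure Pxy unfolding Pxy_def by (intro finite_measure_pair_measure finite_My)

lemma space_Pxy: "space Pxy = {-2 * a..2 * a} \<times> {-2 * a'..2 * a'}"
  by (simp add: Pxy_def Mx_def My_def space_pair_measure space_semicircle_measure)

lemma measurable_fst_snd [measurable]: "fst \<in> borel_measurable Pxy" "snd \<in> borel_measurable Pxy"
proof -
  have "(\<lambda>x. x) \<in> borel_measurable Mx" "(\<lambda>x. x) \<in> borel_measurable My"
    by (auto simp: Mx_def My_def intro!: measurable_semicircle_measure)
  from measurable_compose[OF measurable_fst this(1), of My] measurable_compose[OF measurable_snd this(2), of Mx]
  show "fst \<in> borel_measurable Pxy" "snd \<in> borel_measurable Pxy" by (simp_all add: Pxy_def)
qed

lemma angles:
  assumes "z \<in> space Pxy"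
  shows "0 \<le> sin (semicircle_angle a (fst z))" "0 \<le> sin (semicircle_angle a' (snd z))"
    "fst z / a \<noteq> snd z / a' \<Longrightarrow> cos (semicircle_angle a (fst z) - semicircle_angle a' (snd z)) < 1"
proof -
  have z: "fst z \<in> {-2 * a..2 * a}" "snd z \<in> {-2 * a'..2 * a'}"
    using assms by (auto simp: space_Pxy)
  define \<theta> where "\<theta> = semicircle_angle a (fst z)"
  define \<phi> where "\<phi> = semicircle_angle a' (snd z)"
  note b = semicircle_angle(2,3)[OF a(1) z(1), folded \<theta>_def] semicircle_angle(2,3)[OF a(2) z(2), folded \<phi>_def]
  show "0 \<le> sin (semicircle_angle a (fst z))" "0 \<le> sin (semicircle_angle a' (snd z))"
    using b by (auto simp: \<theta>_def \<phi>_def intro!: sin_ge_zero)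
  assume "fst z / a \<noteq> snd z / a'"
  moreover have "cos \<theta> = fst z / (2 * a)" "cos \<phi> = snd z / (2 * a')"
    unfolding \<theta>_def \<phi>_def using semicircle_angle(1) a z by auto
  moreover have "fst z / a = 2 * (fst z / (2 * a))" "snd z / a' = 2 * (snd z / (2 * a'))" by simp_all
  ultimately have ne: "\<theta> \<noteq> \<phi>" by metis
  have "cos \<bar>\<theta> - \<phi>\<bar> < cos 0" by (rule cos_monotone_0_pi) (use b ne in auto)
  then show "cos (semicircle_angle a (fst z) - semicircle_angle a' (snd z)) < 1" by (simp add: \<theta>_def \<phi>_def)
qed

text \<open>For \<open>\<rho> = 1\<close> the kernel is singular where the two angles agree, that is
  where \<open>fst z / a = snd z / a'\<close>; for fixed first coordinate this is a single
  point.\<close>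

lemma off_diagonal: "AE z in Pxy. fst z / a \<noteq> snd z / a'"
  unfolding Pxy_def
proof (rule P.AE_pair_measure)
  show "{z \<in> space (Mx \<Otimes>\<^sub>M My). fst z / a \<noteq> snd z / a'} \<in> sets (Mx \<Otimes>\<^sub>M My)"
    unfolding Pxy_def[symmetric] by measurable
  show "AE x in Mx. AE y in My. fst (x, y) / a \<noteq> snd (x, y) / a'"
  proof (rule AE_I2)
    fix x
    have "AE y in lborel. y \<noteq> x / a * a'" by (rule AE_lborel_singleton)
    then show "AE y in My. fst (x, y) / a \<noteq> snd (x, y) / a'"
      unfolding My_def semicircle_measure_def using a
      by (subst AE_restrict_space_iff) (auto simp: field_simps elim!: eventually_mono)
  qed
qed

lemma kernel_measurable [measurable]: "semicircle_kernel a a' \<rho> \<in> borel_measurable Pxy"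
  unfolding semicircle_kernel_def log_kernel_def by measurable

lemma sine_integrable:
  "integrable Mx (\<lambda>x. x ^ k * semicircle_sine a n x)" "integrable My (\<lambda>x. x ^ k * semicircle_sine a' n x)"
proof -
  have "integrable (semicircle_measure c) (\<lambda>x. x ^ k * semicircle_sine c n x)" if "0 < c" for c
  proof (rule finite_measure.integrable_const_bound[OF finite_semicircle_measure])
    show "AE x in semicircle_measure c. norm (x ^ k * semicircle_sine c n x) \<le> (2 * c) ^ k * 1"
    proof (rule AE_I2)
      fix x assume "x \<in> space (semicircle_measure c)"
      then have "\<bar>x\<bar> \<le> 2 * c" by (auto simp: space_semicircle_measure)
      then show "norm (x ^ k * semicircle_sine c n x) \<le> (2 * c) ^ k * 1"
        unfolding real_norm_def abs_mult power_abs using that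
        by (intro mult_mono power_mono) (auto simp: semicircle_sine_def)
    qed
  qed (rule measurable_semicircle_measure, measurable)
  then show "integrable Mx (\<lambda>x. x ^ k * semicircle_sine a n x)" "integrable My (\<lambda>x. x ^ k * semicircle_sine a' n x)"
    using a by (simp_all add: Mx_def My_def)
qed

text \<open>The sine series is integrated term by term, dominated by the geometric series of
  \<open>2 * D * \<rho> ^ n\<close>. Each term is a product of two sine moments.\<close>

lemma kernel_integral_less:
  assumes kl: "1 \<le> k" "1 \<le> l" and \<rho>: "0 \<le> \<rho>" "\<rho> < 1"
  shows "integrable Pxy (\<lambda>z. fst z ^ (k - 1) * snd z ^ (l - 1) * semicircle_kernel a a' \<rho> z)"
    and "real k * real l * (\<integral>z. fst z ^ (k - 1) * snd z ^ (l - 1) * semicircle_kernel a a' \<rho> z \<partial>Pxy) =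
      2 * pi\<^sup>2 * a ^ k * a' ^ l * cos_sum k l \<rho>"
proof -
  define D where "D = (2 * a) ^ (k - 1) * (2 * a') ^ (l - 1)"
  define g where "g n z = 2 * \<rho> ^ n / real n * (fst z ^ (k - 1) * semicircle_sine a n (fst z) * (snd z ^ (l - 1) * semicircle_sine a' n (snd z)))"
    for n and z :: "real \<times> real"
  have [measurable]: "g n \<in> borel_measurable Pxy" for n unfolding g_def by measurable
  have gs: "(\<lambda>n. g n z) sums (fst z ^ (k - 1) * snd z ^ (l - 1) * semicircle_kernel a a' \<rho> z)" for z
    using sums_mult[OF log_kernel_sums[OF \<rho>, of "semicircle_angle a (fst z)" "semicircle_angle a' (snd z)"], of "fst z ^ (k - 1) * snd z ^ (l - 1)"]
    unfolding g_def semicircle_kernel_def semicircle_sine_def by (simp add: mult_ac)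
  have gb: "norm (g n z) \<le> 2 * D * \<rho> ^ n" if "z \<in> space Pxy" for n z
  proof -
    have z: "\<bar>fst z\<bar> \<le> 2 * a" "\<bar>snd z\<bar> \<le> 2 * a'" using that by (auto simp: space_Pxy)
    have "\<bar>fst z ^ (k - 1) * semicircle_sine a n (fst z) * (snd z ^ (l - 1) * semicircle_sine a' n (snd z))\<bar> \<le>
      ((2 * a) ^ (k - 1) * 1) * ((2 * a') ^ (l - 1) * 1)"
      unfolding abs_mult power_abs using z a by (intro mult_mono power_mono) (auto simp: semicircle_sine_def)
    moreover have "\<bar>2 * \<rho> ^ n / real n\<bar> \<le> 2 * \<rho> ^ n"
    proof (cases n)
      case (Suc m)
      have "2 * \<rho> ^ n / real n \<le> 2 * \<rho> ^ n / 1" using \<rho> Suc by (intro divide_left_mono) auto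
      then show ?thesis using \<rho> by (simp add: abs_mult)
    qed simp
    ultimately have "\<bar>g n z\<bar> \<le> (2 * \<rho> ^ n) * (((2 * a) ^ (k - 1) * 1) * ((2 * a') ^ (l - 1) * 1))"
      unfolding g_def abs_mult[of "2 * \<rho> ^ n / real n"] using \<rho> by (intro mult_mono) auto
    then show ?thesis by (simp add: D_def mult_ac)
  qed
  have gi: "integrable Pxy (g n)" for n
    by (rule PP.integrable_const_bound[of _ "2 * D * \<rho> ^ n"]) (use gb in auto)
  have sg: "summable (\<lambda>n. 2 * D * \<rho> ^ n)" using \<rho> by (intro summable_mult summable_geometric) auto
  have s1: "AE z in Pxy. summable (\<lambda>n. norm (g n z))"
    by (rule AE_I2, rule summable_comparison_test'[OF sg, of 0]) (use gb in auto)
  have s2: "summable (\<lambda>n. \<integral>z. norm (g n z) \<partial>Pxy)"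
  proof (rule summable_comparison_test'[where N = 0])
    show "summable (\<lambda>n. 2 * D * \<rho> ^ n * measure Pxy (space Pxy))" by (rule summable_mult2[OF sg])
    fix n :: nat
    have "(\<integral>z. norm (g n z) \<partial>Pxy) \<le> (\<integral>z. 2 * D * \<rho> ^ n \<partial>Pxy)"
      using gi gb by (intro integral_mono) auto
    then show "norm (\<integral>z. norm (g n z) \<partial>Pxy) \<le> 2 * D * \<rho> ^ n * measure Pxy (space Pxy)" by (simp add: mult_ac)
  qed
  have eq: "(\<Sum>n. g n z) = fst z ^ (k - 1) * snd z ^ (l - 1) * semicircle_kernel a a' \<rho> z" for z
    using gs by (rule sums_unique[symmetric])
  show "integrable Pxy (\<lambda>z. fst z ^ (k - 1) * snd z ^ (l - 1) * semicircle_kernel a a' \<rho> z)"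
    using integrable_suminf[OF gi s1 s2] by (simp add: eq)
  have int_g: "real k * real l * (\<integral>z. g n z \<partial>Pxy) = 2 * pi\<^sup>2 * a ^ k * a' ^ l * (real n * \<rho> ^ n * cos_coef k (int n) * cos_coef l (int n))" for n
  proof -
    have "(\<integral>z. g n z \<partial>Pxy) = 2 * \<rho> ^ n / real n * (\<integral>(x, y). (x ^ (k - 1) * semicircle_sine a n x) * (y ^ (l - 1) * semicircle_sine a' n y) \<partial>Pxy)"
      unfolding g_def by (simp add: case_prod_unfold)
    also have "(\<integral>(x, y). (x ^ (k - 1) * semicircle_sine a n x) * (y ^ (l - 1) * semicircle_sine a' n y) \<partial>Pxy) =
        (\<integral>x. x ^ (k - 1) * semicircle_sine a n x \<partial>Mx) * (\<integral>y. y ^ (l - 1) * semicircle_sine a' n y \<partial>My)"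
      unfolding Pxy_def by (rule P.integral_mult_product(2)[OF sine_integrable])
    finally have "real k * real l * (\<integral>z. g n z \<partial>Pxy) = 2 * \<rho> ^ n / real n *
        ((real k * (\<integral>x. x ^ (k - 1) * semicircle_sine a n x \<partial>Mx)) * (real l * (\<integral>y. y ^ (l - 1) * semicircle_sine a' n y \<partial>My)))"
      by simp
    also have "\<dots> = 2 * \<rho> ^ n / real n * ((real n * pi * a ^ k * cos_coef k (int n)) * (real n * pi * a' ^ l * cos_coef l (int n)))"
      by (simp only: Mx_def My_def integral_semicircle_measure semicircle_sine_moment[OF a(1) kl(1)] semicircle_sine_moment[OF a(2) kl(2)])
    also have "\<dots> = 2 * pi\<^sup>2 * a ^ k * a' ^ l * (real n * \<rho> ^ n * cos_coef k (int n) * cos_coef l (int n))"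
      by (cases "n = 0") (simp_all add: power2_eq_square field_simps)
    finally show ?thesis .
  qed
  have "(\<lambda>n. real k * real l * (\<integral>z. g n z \<partial>Pxy)) sums (real k * real l * (\<integral>z. fst z ^ (k - 1) * snd z ^ (l - 1) * semicircle_kernel a a' \<rho> z \<partial>Pxy))"
    using sums_mult[OF sums_integral[OF gi s1 s2]] by (simp only: eq)
  moreover have "(\<lambda>n. real k * real l * (\<integral>z. g n z \<partial>Pxy)) sums (\<Sum>n\<in>{1..k}. real k * real l * (\<integral>z. g n z \<partial>Pxy))"
  proof (rule sums_finite)
    fix n assume "n \<notin> {1..k}"
    then have "n = 0 \<or> k < n" by auto
    then show "real k * real l * (\<integral>z. g n z \<partial>Pxy) = 0" unfolding int_g using cos_coef_eq_0[of k n] by auto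
  qed simp
  ultimately show "real k * real l * (\<integral>z. fst z ^ (k - 1) * snd z ^ (l - 1) * semicircle_kernel a a' \<rho> z \<partial>Pxy) =
      2 * pi\<^sup>2 * a ^ k * a' ^ l * cos_sum k l \<rho>"
    unfolding cos_sum_def sum_distrib_left int_g[symmetric] by (rule sums_unique2)
qed

text \<open>For \<open>\<rho> = 1\<close> the series no longer converges absolutely; the kernel increases with \<open>\<rho>\<close>, so monotone
  convergence from \<open>\<rho> < 1\<close> makes it integrable and gives a majorant.\<close>

lemma kernel_integral:
  assumes kl: "1 \<le> k" "1 \<le> l" and \<rho>: "0 \<le> \<rho>" "\<rho> \<le> 1"
  shows "integrable Pxy (\<lambda>z. fst z ^ (k - 1) * snd z ^ (l - 1) * semicircle_kernel a a' \<rho> z)"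
    and "real k * real l * (\<integral>z. fst z ^ (k - 1) * snd z ^ (l - 1) * semicircle_kernel a a' \<rho> z \<partial>Pxy) =
      2 * pi\<^sup>2 * a ^ k * a' ^ l * cos_sum k l \<rho>"
proof -
  define r where "r j = 1 - inverse (real (Suc j))" for j
  have r: "0 \<le> r j" "r j < 1" for j by (auto simp: r_def field_simps)
  have rmono: "r i \<le> r j" if "i \<le> j" for i j using that by (auto simp: r_def intro!: le_imp_inverse_le)
  have rlim: "r \<longlonglongrightarrow> 1" unfolding r_def using tendsto_diff[OF tendsto_const LIMSEQ_inverse_real_of_nat, of 1] by simp
  have sums_lim: "(\<lambda>j. cos_sum k l (r j)) \<longlonglongrightarrow> cos_sum k l 1" for k l
    unfolding cos_sum_def by (intro tendsto_intros rlim)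
  have K_lim: "(\<lambda>j. semicircle_kernel a a' (r j) z) \<longlonglongrightarrow> semicircle_kernel a a' 1 z"
    and K_nonneg: "0 \<le> semicircle_kernel a a' (r j) z"
    and K_mono: "i \<le> j \<Longrightarrow> semicircle_kernel a a' (r i) z \<le> semicircle_kernel a a' (r j) z"
    and K_le: "semicircle_kernel a a' (r j) z \<le> semicircle_kernel a a' 1 z"
    if z: "z \<in> space Pxy" "fst z / a \<noteq> snd z / a'" for z i j
  proof -
    note A = angles(1,2)[OF z(1)] angles(3)[OF z]
    show "(\<lambda>j. semicircle_kernel a a' (r j) z) \<longlonglongrightarrow> semicircle_kernel a a' 1 z"
      unfolding semicircle_kernel_def by (rule log_kernel_tendsto_1[OF A rlim])
    have "log_kernel 0 (semicircle_angle a (fst z)) (semicircle_angle a' (snd z)) \<le> semicircle_kernel a a' (r j) z"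
      unfolding semicircle_kernel_def using r[of j] by (intro log_kernel_mono A) auto
    then show "0 \<le> semicircle_kernel a a' (r j) z" by (simp add: log_kernel_def)
    show "semicircle_kernel a a' (r i) z \<le> semicircle_kernel a a' (r j) z" if "i \<le> j"
      unfolding semicircle_kernel_def using r rmono[OF that] by (intro log_kernel_mono A) (auto simp: less_imp_le)
    show "semicircle_kernel a a' (r j) z \<le> semicircle_kernel a a' 1 z"
      unfolding semicircle_kernel_def using r[of j] by (intro log_kernel_mono A) auto
  qed
  \<comment> \<open>For \<open>k = l = 1\<close> the powers, whose signs vary, disappear, so
    monotone convergence applies. The limit times \<open>D\<close> then dominates the integrands for
    general \<open>k\<close> and \<open>l\<close>.\<close>
  have K1: "integrable Pxy (semicircle_kernel a a' 1)"
  proof (rule integrable_monotone_convergence[where f = "\<lambda>j. semicircle_kernel a a' (r j)" and x = "2 * pi\<^sup>2 * a * a' * cos_sum 1 1 1"])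
    show "integrable Pxy (semicircle_kernel a a' (r j))" for j
      using kernel_integral_less(1)[of 1 1 "r j"] r by simp
    show "AE z in Pxy. mono (\<lambda>j. semicircle_kernel a a' (r j) z)"
      using off_diagonal AE_space by eventually_elim (auto intro!: monoI K_mono)
    show "AE z in Pxy. (\<lambda>j. semicircle_kernel a a' (r j) z) \<longlonglongrightarrow> semicircle_kernel a a' 1 z"
      using off_diagonal AE_space by eventually_elim (rule K_lim)
    have "(\<integral>z. semicircle_kernel a a' (r j) z \<partial>Pxy) = 2 * pi\<^sup>2 * a * a' * cos_sum 1 1 (r j)" for j
      using kernel_integral_less(2)[of 1 1 "r j"] r by simp
    moreover have "(\<lambda>j. 2 * pi\<^sup>2 * a * a' * cos_sum 1 1 (r j)) \<longlonglongrightarrow> 2 * pi\<^sup>2 * a * a' * cos_sum 1 1 1"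
      by (intro tendsto_intros sums_lim)
    ultimately show "(\<lambda>j. \<integral>z. semicircle_kernel a a' (r j) z \<partial>Pxy) \<longlonglongrightarrow> 2 * pi\<^sup>2 * a * a' * cos_sum 1 1 1" by simp
  qed simp
  define h where "h \<rho> z = fst z ^ (k - 1) * snd z ^ (l - 1) * semicircle_kernel a a' \<rho> z" for \<rho> and z :: "real \<times> real"
  have hm[measurable]: "h \<rho> \<in> borel_measurable Pxy" for \<rho> unfolding h_def by measurable
  define D where "D = (2 * a) ^ (k - 1) * (2 * a') ^ (l - 1)"
  have Di: "integrable Pxy (\<lambda>z. D * semicircle_kernel a a' 1 z)" using K1 by simp
  have hlim: "AE z in Pxy. (\<lambda>j. h (r j) z) \<longlonglongrightarrow> h 1 z"
    using off_diagonal AE_space unfolding h_def by eventually_elim (intro tendsto_intros K_lim)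
  have hb: "AE z in Pxy. norm (h (r j) z) \<le> D * semicircle_kernel a a' 1 z" for j
    using off_diagonal AE_space
  proof eventually_elim
    case (elim z)
    have z: "\<bar>fst z\<bar> \<le> 2 * a" "\<bar>snd z\<bar> \<le> 2 * a'" using elim(2) by (auto simp: space_Pxy)
    have "\<bar>fst z ^ (k - 1) * snd z ^ (l - 1)\<bar> \<le> D"
      unfolding abs_mult power_abs D_def using z a by (intro mult_mono power_mono) auto
    then show ?case unfolding h_def real_norm_def abs_mult[of "fst z ^ (k - 1) * snd z ^ (l - 1)"]
      using K_nonneg[OF elim(2,1)] K_le[OF elim(2,1), of j] a by (intro mult_mono) (auto simp: D_def)
  qed
  have h1i: "integrable Pxy (h 1)"
    by (rule integrable_dominated_convergence[OF hm hm Di hlim hb])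
  have "(\<lambda>j. \<integral>z. h (r j) z \<partial>Pxy) \<longlonglongrightarrow> (\<integral>z. h 1 z \<partial>Pxy)"
    by (rule integral_dominated_convergence[OF hm hm Di hlim hb])
  then have "(\<lambda>j. real k * real l * (\<integral>z. h (r j) z \<partial>Pxy)) \<longlonglongrightarrow> real k * real l * (\<integral>z. h 1 z \<partial>Pxy)"
    by (intro tendsto_intros)
  moreover have "real k * real l * (\<integral>z. h (r j) z \<partial>Pxy) = 2 * pi\<^sup>2 * a ^ k * a' ^ l * cos_sum k l (r j)" for j
    unfolding h_def by (rule kernel_integral_less(2)[OF kl r])
  moreover have "(\<lambda>j. 2 * pi\<^sup>2 * a ^ k * a' ^ l * cos_sum k l (r j)) \<longlonglongrightarrow> 2 * pi\<^sup>2 * a ^ k * a' ^ l * cos_sum k l 1"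
    by (intro tendsto_intros sums_lim)
  ultimately have h1: "real k * real l * (\<integral>z. h 1 z \<partial>Pxy) = 2 * pi\<^sup>2 * a ^ k * a' ^ l * cos_sum k l 1"
    using LIMSEQ_unique by simp
  show "integrable Pxy (\<lambda>z. fst z ^ (k - 1) * snd z ^ (l - 1) * semicircle_kernel a a' \<rho> z)"
    using kernel_integral_less(1)[OF kl \<rho>(1)] h1i \<rho>(2) by (cases "\<rho> < 1") (auto simp: h_def[abs_def])
  show "real k * real l * (\<integral>z. fst z ^ (k - 1) * snd z ^ (l - 1) * semicircle_kernel a a' \<rho> z \<partial>Pxy) =
      2 * pi\<^sup>2 * a ^ k * a' ^ l * cos_sum k l \<rho>"
    using kernel_integral_less(2)[OF kl \<rho>(1)] h1 \<rho>(2) by (cases "\<rho> < 1") (auto simp: h_def)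
qed

lemma iterated_kernel_integral:
  assumes kl: "1 \<le> k" "1 \<le> l" and \<rho>: "0 \<le> \<rho>" "\<rho> \<le> 1"
  shows "real k * real l * (LINT x:{-2 * a..2 * a}|lborel. LINT y:{-2 * a'..2 * a'}|lborel.
      x ^ (k - 1) * y ^ (l - 1) * semicircle_kernel a a' \<rho> (x, y)) = 2 * pi\<^sup>2 * a ^ k * a' ^ l * cos_sum k l \<rho>"
  using P.integral_fst'[OF kernel_integral(1)[OF kl \<rho>, unfolded Pxy_def]] kernel_integral(2)[OF kl \<rho>]
  by (simp add: Pxy_def Mx_def My_def integral_semicircle_measure)

end

section \<open>Evaluation of the covariance formula\<close>

text \<open>Only the frequency \<open>r = k - 2 * i = l - 2 * j\<close> survives in the product of
  the two coefficients, and there the powers of \<open>a\<close> and \<open>a'\<close> left after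
  division by \<open>(a * a') ^ r\<close> are \<open>a ^ (2 * i)\<close> and
  \<open>a' ^ (2 * j)\<close>.\<close>

lemma cos_sum_conv:
  assumes a: "0 < a" "0 < a'"
  shows "a ^ k * a' ^ l * cos_sum k l (e / (a * a')) = (\<Sum>i | 2 * i < k. \<Sum>j | 2 * j < l.
    if k - 2 * i = l - 2 * j then real (k - 2 * i) * (real (k choose i) * (a\<^sup>2) ^ i) * (real (l choose j) * (a'\<^sup>2) ^ j) * e ^ (k - 2 * i) else 0)"
proof -
  define \<rho> where "\<rho> = e / (a * a')"
  let ?u = "\<lambda>n i. if k - 2 * i = n then real (k choose i) else 0" and ?v = "\<lambda>n j. if l - 2 * j = n then real (l choose j) else 0"
  have "a ^ k * a' ^ l * cos_sum k l \<rho> = (\<Sum>n\<in>{1..k}. \<Sum>i | 2 * i < k. \<Sum>j | 2 * j < l. a ^ k * a' ^ l * (real n * \<rho> ^ n * ?u n i * ?v n j))"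
  proof -
    have "a ^ k * a' ^ l * (real n * \<rho> ^ n * cos_coef k (int n) * cos_coef l (int n)) =
      (\<Sum>i | 2 * i < k. \<Sum>j | 2 * j < l. a ^ k * a' ^ l * (real n * \<rho> ^ n * ?u n i * ?v n j))" if "n \<in> {1..k}" for n
    proof -
      have "1 \<le> n" using that by simp
      then show ?thesis unfolding cos_coef_nat[OF \<open>1 \<le> n\<close>] mult.assoc sum_product by (simp only: sum_distrib_left)
    qed
    then show ?thesis unfolding cos_sum_def sum_distrib_left by (intro sum.cong refl) auto
  qed
  also have "\<dots> = (\<Sum>i | 2 * i < k. \<Sum>j | 2 * j < l. \<Sum>n\<in>{1..k}. a ^ k * a' ^ l * (real n * \<rho> ^ n * ?u n i * ?v n j))"
    by (subst sum.swap, rule sum.cong[OF refl], rule sum.swap)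
  also have "\<dots> = (\<Sum>i | 2 * i < k. \<Sum>j | 2 * j < l.
    if k - 2 * i = l - 2 * j then real (k - 2 * i) * (real (k choose i) * (a\<^sup>2) ^ i) * (real (l choose j) * (a'\<^sup>2) ^ j) * e ^ (k - 2 * i) else 0)"
  proof (intro sum.cong refl)
    fix i j assume "i \<in> {i. 2 * i < k}" "j \<in> {j. 2 * j < l}"
    then have ij: "2 * i < k" "2 * j < l" by auto
    define r where "r = k - 2 * i"
    have r: "r \<in> {1..k}" "k = 2 * i + r" using ij by (auto simp: r_def)
    have "(\<Sum>n\<in>{1..k}. a ^ k * a' ^ l * (real n * \<rho> ^ n * ?u n i * ?v n j)) =
        (\<Sum>n\<in>{1..k}. if n = r then a ^ k * a' ^ l * (real n * \<rho> ^ n * real (k choose i) * ?v n j) else 0)"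
      by (intro sum.cong refl) (auto simp: r_def)
    also have "\<dots> = a ^ k * a' ^ l * (real r * \<rho> ^ r * real (k choose i) * ?v r j)" using r(1) by simp
    also have "\<dots> = (if r = l - 2 * j then real r * (real (k choose i) * (a\<^sup>2) ^ i) * (real (l choose j) * (a'\<^sup>2) ^ j) * e ^ r else 0)"
    proof (cases "r = l - 2 * j")
      case True
      then have l: "l = 2 * j + r" using ij by simp
      have "a ^ k * a' ^ l * \<rho> ^ r = (a\<^sup>2) ^ i * (a'\<^sup>2) ^ j * e ^ r"
        unfolding l r(2) \<rho>_def power_add power_mult power_divide power_mult_distrib using a by simp
      then show ?thesis using True by (simp add: mult_ac)
    qed simp
    finally show "(\<Sum>n\<in>{1..k}. a ^ k * a' ^ l * (real n * \<rho> ^ n * ?u n i * ?v n j)) =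
      (if k - 2 * i = l - 2 * j then real (k - 2 * i) * (real (k choose i) * (a\<^sup>2) ^ i) * (real (l choose j) * (a'\<^sup>2) ^ j) * e ^ (k - 2 * i) else 0)"
      by (simp only: r_def)
  qed
  finally show ?thesis by (simp only: \<rho>_def)
qed

lemma semicircle_point_cis:
  assumes "0 < b" "x \<in> {-2 * sqrt b..2 * sqrt b}"
  shows "semicircle_point b x = complex_of_real (sqrt b) * cis (semicircle_angle (sqrt b) x)"
proof (rule complex_eqI)
  note ang = semicircle_angle[OF _ assms(2), simplified, OF assms(1)]
  show "Re (semicircle_point b x) = Re (complex_of_real (sqrt b) * cis (semicircle_angle (sqrt b) x))"
    using assms(1) ang(1) by (simp add: semicircle_point_def)
  have "b * (1 - (x / (2 * sqrt b))\<^sup>2) = b - (x / 2)\<^sup>2" using assms(1) by (simp add: power_divide power_mult_distrib field_simps)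
  then have "sqrt b * sqrt (1 - (x / (2 * sqrt b))\<^sup>2) = sqrt (b - (x / 2)\<^sup>2)" by (simp only: real_sqrt_mult[symmetric])
  then show "Im (semicircle_point b x) = Im (complex_of_real (sqrt b) * cis (semicircle_angle (sqrt b) x))"
    using ang(4) by (simp add: semicircle_point_def)
qed

lemma cmod_diff_cis: "cmod (complex_of_real \<rho> - cis \<alpha>) = sqrt (1 + \<rho>\<^sup>2 - 2 * \<rho> * cos \<alpha>)"
proof -
  have "(cmod (complex_of_real \<rho> - cis \<alpha>))\<^sup>2 = (\<rho> - cos \<alpha>)\<^sup>2 + (sin \<alpha>)\<^sup>2" by (simp add: cmod_power2)
  also have "\<dots> = \<rho>\<^sup>2 - 2 * \<rho> * cos \<alpha> + ((cos \<alpha>)\<^sup>2 + (sin \<alpha>)\<^sup>2)"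
    by (simp add: power2_eq_square algebra_simps del: sin_cos_squared_add sin_cos_squared_add2 sin_cos_squared_add3)
  also have "(cos \<alpha>)\<^sup>2 + (sin \<alpha>)\<^sup>2 = 1" by simp
  finally have "(cmod (complex_of_real \<rho> - cis \<alpha>))\<^sup>2 = 1 + \<rho>\<^sup>2 - 2 * \<rho> * cos \<alpha>" by simp
  then show ?thesis by (metis norm_ge_zero real_sqrt_unique)
qed

lemma ln_ratio_log_kernel:
  assumes a: "0 < a" "0 < a'" and z: "z = complex_of_real a * cis \<theta>" and w: "w = complex_of_real a' * cis \<phi>"
  shows "ln (cmod ((complex_of_real e - z * w) / (complex_of_real e - z * cnj w))) = log_kernel (e / (a * a')) \<theta> \<phi>"
proof -
  define \<rho> where "\<rho> = e / (a * a')"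
  have e: "complex_of_real e = complex_of_real (a * a') * complex_of_real \<rho>"
    using a by (simp add: \<rho>_def)
  have "complex_of_real e - z * w = complex_of_real (a * a') * (complex_of_real \<rho> - cis (\<theta> + \<phi>))"
    unfolding e z w cis_mult[symmetric] by (simp add: algebra_simps)
  moreover have "complex_of_real e - z * cnj w = complex_of_real (a * a') * (complex_of_real \<rho> - cis (\<theta> - \<phi>))"
    unfolding e z w diff_conv_add_uminus[of \<theta> \<phi>] cis_mult[symmetric] by (simp add: algebra_simps cis_cnj)
  ultimately have "cmod ((complex_of_real e - z * w) / (complex_of_real e - z * cnj w)) =
      cmod (complex_of_real \<rho> - cis (\<theta> + \<phi>)) / cmod (complex_of_real \<rho> - cis (\<theta> - \<phi>))"
    using a by (simp add: norm_divide norm_mult)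
  also have "\<dots> = sqrt ((1 + \<rho>\<^sup>2 - 2 * \<rho> * cos (\<theta> + \<phi>)) / (1 + \<rho>\<^sup>2 - 2 * \<rho> * cos (\<theta> - \<phi>)))"
    unfolding cmod_diff_cis real_sqrt_divide ..
  finally have 1: "ln (cmod ((complex_of_real e - z * w) / (complex_of_real e - z * cnj w))) =
    ln (sqrt ((1 + \<rho>\<^sup>2 - 2 * \<rho> * cos (\<theta> + \<phi>)) / (1 + \<rho>\<^sup>2 - 2 * \<rho> * cos (\<theta> - \<phi>))))" by (rule arg_cong)
  \<comment> \<open>True at 0 as well, where both sides are 0 by \<open>ln 0 = 0\<close>; so
    singular points need no exception.\<close>
  have ln_sqrt0: "ln (sqrt x) = ln x / 2" if "0 \<le> x" for x :: real using that by (cases "x = 0") (auto simp: ln_sqrt)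
  have "0 \<le> 1 + \<rho>\<^sup>2 - 2 * \<rho> * cos \<alpha>" for \<alpha>
    using norm_ge_zero[of "complex_of_real \<rho> - cis \<alpha>"] unfolding cmod_diff_cis by simp
  then show ?thesis unfolding 1 log_kernel_def \<rho>_def[symmetric] by (intro ln_sqrt0 divide_nonneg_nonneg)
qed

text \<open>The prefactors \<open>2 * k * l / (\<beta> * pi)\<close> and \<open>1 / (2 * pi)\<close>
  reduce the \<open>2 * pi\<^sup>2\<close> of the kernel integral to \<open>2 / \<beta>\<close>. The
  bounds on \<open>c * d\<close> say \<open>0 \<le> \<rho> \<le> 1\<close>.\<close>

lemma limit_covariance_conv:
  assumes b: "0 < b" "0 < b'" and kl: "1 \<le> k" "1 \<le> l" and cd: "0 \<le> c * d" "c * d \<le> sqrt b * sqrt b'" and \<beta>: "0 < \<beta>"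
  shows "limit_covariance \<beta> c k l b b' d = (\<Sum>i | 2 * i < k. \<Sum>j | 2 * j < l.
    if k - 2 * i = l - 2 * j then 2 / real \<beta> * real (k - 2 * i) * (real (k choose i) * b ^ i) * (real (l choose j) * b' ^ j) * (c * d) ^ (k - 2 * i) else 0)"
proof -
  define a where "a = sqrt b"
  define a' where "a' = sqrt b'"
  have a: "0 < a" "0 < a'" using b by (simp_all add: a_def a'_def)
  define \<rho> where "\<rho> = c * d / (a * a')"
  have \<rho>: "0 \<le> \<rho>" "\<rho> \<le> 1" using cd a by (auto simp: \<rho>_def a_def a'_def)
  define J where "J = (LINT x:{-2 * a..2 * a}|lborel. LINT y:{-2 * a'..2 * a'}|lborel. x ^ (k - 1) * y ^ (l - 1) * semicircle_kernel a a' \<rho> (x, y))"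
  have "semicircle_integral b (\<lambda>z. semicircle_integral b' (\<lambda>w. xcoord z ^ (k - 1) * xcoord w ^ (l - 1) *
      (1 / (2 * pi) * ln (cmod ((complex_of_real (c * d) - z * w) / (complex_of_real (c * d) - z * cnj w)))))) =
      (LINT x:{-2 * a..2 * a}|lborel. LINT y:{-2 * a'..2 * a'}|lborel. 1 / (2 * pi) * (x ^ (k - 1) * y ^ (l - 1) * semicircle_kernel a a' \<rho> (x, y)))"
    unfolding semicircle_integral_def a_def[symmetric] a'_def[symmetric]
  proof (intro set_lebesgue_integral_cong allI impI)
    fix x y assume x: "x \<in> {-2 * a..2 * a}" and y: "y \<in> {-2 * a'..2 * a'}"
    have xc: "xcoord (semicircle_point b x) = x" for b x by (simp add: xcoord_def semicircle_point_def)
    note 1 = semicircle_point_cis[OF b(1), folded a_def, OF x] and 2 = semicircle_point_cis[OF b(2), folded a'_def, OF y]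
    show "xcoord (semicircle_point b x) ^ (k - 1) * xcoord (semicircle_point b' y) ^ (l - 1) *
        (1 / (2 * pi) * ln (cmod ((complex_of_real (c * d) - semicircle_point b x * semicircle_point b' y) /
          (complex_of_real (c * d) - semicircle_point b x * cnj (semicircle_point b' y))))) =
      1 / (2 * pi) * (x ^ (k - 1) * y ^ (l - 1) * semicircle_kernel a a' \<rho> (x, y))"
      unfolding xc ln_ratio_log_kernel[OF a 1 2] semicircle_kernel_def \<rho>_def by simp
  qed auto
  also have "\<dots> = 1 / (2 * pi) * J" unfolding J_def by (simp only: set_integral_mult_right)
  finally have "limit_covariance \<beta> c k l b b' d = 2 * real k * real l / (real \<beta> * pi) * (1 / (2 * pi) * J)"
    unfolding limit_covariance_def by (simp only:)
  also have "\<dots> = 1 / (real \<beta> * pi\<^sup>2) * (real k * real l * J)" by (simp add: power2_eq_square)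
  also have "real k * real l * J = 2 * pi\<^sup>2 * (a ^ k * a' ^ l * cos_sum k l \<rho>)"
    unfolding J_def iterated_kernel_integral[OF a kl \<rho>] by (simp only: mult.assoc)
  also have "1 / (real \<beta> * pi\<^sup>2) * \<dots> = 2 / real \<beta> * (a ^ k * a' ^ l * cos_sum k l \<rho>)" by simp
  also have "\<dots> = (\<Sum>i | 2 * i < k. \<Sum>j | 2 * j < l.
    if k - 2 * i = l - 2 * j then 2 / real \<beta> * real (k - 2 * i) * (real (k choose i) * b ^ i) * (real (l choose j) * b' ^ j) * (c * d) ^ (k - 2 * i) else 0)"
    unfolding \<rho>_def cos_sum_conv[OF a] sum_distrib_left using b
    by (intro sum.cong refl) (simp add: a_def a'_def)
  finally show ?thesis .
qed

section \<open>The limit of the joint moments\<close>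

text \<open>\<open>rec\<close> is the recursion of the normal moments up to a vanishing error, with
  \<open>m 2\<close> in place of its limit \<open>v\<close>.\<close>

lemma normal_moment_limit:
  fixes m :: "nat \<Rightarrow> 'l \<Rightarrow> real"
  assumes 0: "(m 0 \<longlongrightarrow> 1) F" and 1: "(m 1 \<longlongrightarrow> 0) F" and 2: "(m 2 \<longlongrightarrow> v) F"
    and rec: "\<And>n. ((\<lambda>L. m (n + 2) L - real (n + 1) * m 2 L * m n L) \<longlongrightarrow> 0) F"
  shows "(m n \<longlongrightarrow> normal_moment v n) F"
proof (induction n rule: less_induct)
  case (less n)
  consider "n = 0" | "n = 1" | k where "n = k + 2" by (metis One_nat_def add_2_eq_Suc' not0_implies_Suc)
  then show ?case
  proof cases
    case 3
    have "((\<lambda>L. (m (k + 2) L - real (k + 1) * m 2 L * m k L) + real (k + 1) * m 2 L * m k L) \<longlongrightarrow>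
        0 + real (k + 1) * v * normal_moment v k) F"
      using 3 by (intro tendsto_add rec tendsto_mult tendsto_const 2 less) auto
    then show ?thesis unfolding 3 normal_moment_rec(3) by simp
  next
    case 2
    then show ?thesis using \<open>(m 1 \<longlongrightarrow> 0) F\<close> by (simp only: normal_moment_rec)
  next
    case 1
    then show ?thesis using \<open>(m 0 \<longlongrightarrow> 1) F\<close> by (simp only: normal_moment_rec)
  qed
qed

lemma prod_shift_tendsto:
  fixes f :: "real \<Rightarrow> real"
  assumes "((\<lambda>L. f L / L) \<longlongrightarrow> b) at_top"
  shows "((\<lambda>L. (\<Prod>i<j. f L - c i) / L ^ j) \<longlongrightarrow> b ^ j) at_top"
proof -
  have "((\<lambda>L. \<Prod>i<j. f L / L - c i / L) \<longlongrightarrow> (\<Prod>i<j. b - 0)) at_top"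
    by (intro tendsto_prod tendsto_diff assms tendsto_divide_0[OF tendsto_const] filterlim_at_top_imp_at_infinity filterlim_ident)
  moreover have "(\<Prod>i<j. f L / L - c i / L) = (\<Prod>i<j. f L - c i) / L ^ j" for L
    by (simp add: diff_divide_distrib[symmetric] prod_dividef)
  ultimately show ?thesis by simp
qed

text \<open>Integrate \<open>2 a b \<le> a\<^sup>2 + b\<^sup>2\<close> and use the normalization
  \<open>cov_diag\<close>. In the formal case of a non-integrable product the integral is 0 by
  convention.\<close>

lemma (in time_dependent_wigner) covar_le_1: "covar s t \<le> 1"
proof (cases "integrable M (\<lambda>\<omega>. Y 1 s \<omega> * Y 1 t \<omega>)")
  case True
  have i2: "integrable M (\<lambda>\<omega>. Y 1 x \<omega> * Y 1 x \<omega>)" for x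
    using moments_Y[of 2] by (auto simp: power2_eq_square)
  have "2 * (a * b) \<le> a * a + b * b" for a b :: real
    using sum_squares_bound[of a b] by (simp add: power2_eq_square)
  then have "expectation (\<lambda>\<omega>. 2 * (Y 1 s \<omega> * Y 1 t \<omega>)) \<le> expectation (\<lambda>\<omega>. Y 1 s \<omega> * Y 1 s \<omega> + Y 1 t \<omega> * Y 1 t \<omega>)"
    using True i2 by (intro integral_mono) auto
  then have "2 * expectation (\<lambda>\<omega>. Y 1 s \<omega> * Y 1 t \<omega>) \<le> expectation (\<lambda>\<omega>. Y 1 s \<omega> * Y 1 s \<omega>) + expectation (\<lambda>\<omega>. Y 1 t \<omega> * Y 1 t \<omega>)"
    using i2 by simp
  from mult_left_mono[OF this, of "real \<beta> / 2"]
  have "2 * covar s t \<le> covar s s + covar t t" by (simp add: wigner_cov_def algebra_simps)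
  then show ?thesis using cov_diag by simp
qed (simp add: wigner_cov_def not_integrable_integral_eq)

section \<open>Scaling limit of the traces\<close>

locale wigner_submatrices = time_dependent_wigner M \<beta> Z Y
  for M :: "'a measure" and \<beta> Z Y +
  fixes k :: "'m::finite \<Rightarrow> nat" and t :: "'m \<Rightarrow> real" and B :: "real \<Rightarrow> 'm \<Rightarrow> nat set"
    and b :: "'m \<Rightarrow> real" and bb :: "'m \<Rightarrow> 'm \<Rightarrow> real"
  assumes k: "\<And>p. 1 \<le> k p"
    and B: "\<And>L p. 0 < L \<Longrightarrow> finite (B L p) \<and> B L p \<subseteq> {1..}"
    and b: "\<And>p. ((\<lambda>L. real (card (B L p)) / L) \<longlongrightarrow> b p) at_top"
    and b_pos: "\<And>p. 0 < b p"
    and bb: "\<And>p q. ((\<lambda>L. real (card (B L p \<inter> B L q)) / L) \<longlongrightarrow> bb p q) at_top"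
begin

definition coord :: "'m \<Rightarrow> real \<Rightarrow> 'a \<Rightarrow> real" where
  "coord p L \<omega> = L powr (- (real (k p) / 2)) *
    (trace_power Z Y (B L p) (t p) (k p) \<omega> - expectation (trace_power Z Y (B L p) (t p) (k p)))"

text \<open>\<open>A\<close> is a set of positions and \<open>P\<close> names the coordinate at
  each, so a repeated coordinate counts as several factors.\<close>

definition joint :: "nat set \<Rightarrow> (nat \<Rightarrow> 'm) \<Rightarrow> real \<Rightarrow> real" where
  "joint A P L = expectation (\<lambda>\<omega>. \<Prod>a\<in>A. coord (P a) L \<omega>)"

definition scale :: "nat set \<Rightarrow> (nat \<Rightarrow> 'm) \<Rightarrow> real \<Rightarrow> real" where
  "scale A P L = (\<Prod>a\<in>A. L powr (- (real (k (P a)) / 2)))"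

definition fluct_joint :: "nat set \<Rightarrow> (nat \<Rightarrow> 'm) \<Rightarrow> real \<Rightarrow> complex" where
  "fluct_joint A P L = expectation (\<lambda>\<omega>. \<Prod>a\<in>A. fluct (B L (P a)) (t (P a)) (k (P a)) \<omega>)"

definition window :: "real \<Rightarrow> nat set" where "window L = (\<Union>p. B L p)"

lemma coord_conv_fluct:
  assumes "0 < L"
  shows "complex_of_real (coord p L \<omega>) = complex_of_real (L powr (- (real (k p) / 2))) * fluct (B L p) (t p) (k p) \<omega>"
proof -
  have "finite (B L p)" "B L p \<subseteq> {1..}" using B[OF assms, of p] by auto
  from fluct_conv_trace(1)[OF this k] show ?thesis by (simp only: coord_def of_real_mult)
qed

lemma coord_measurable: 
  assumes "0 < L" shows "coord p L \<in> borel_measurable M"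
proof -
  have "finite (B L p)" "B L p \<subseteq> {1..}" using B[OF assms, of p] by auto
  from fluct_conv_trace(2)[OF this k] show ?thesis
    unfolding coord_def[abs_def] by (intro borel_measurable_times borel_measurable_diff borel_measurable_const)
qed

lemma prod_coord_conv_fluct:
  assumes "0 < L"
  shows "complex_of_real (\<Prod>a\<in>A. coord (P a) L \<omega>) = complex_of_real (scale A P L) * (\<Prod>a\<in>A. fluct (B L (P a)) (t (P a)) (k (P a)) \<omega>)"
  unfolding of_real_prod coord_conv_fluct[OF assms] scale_def prod.distrib ..

lemma prod_coord_integrable:
  fixes A :: "nat set"
  assumes "0 < L" "finite A"
  shows "integrable M (\<lambda>\<omega>. \<Prod>a\<in>A. coord (P a) L \<omega>)"
proof -
  have "integrable M (\<lambda>\<omega>. \<Prod>a\<in>A. fluct (B L (P a)) (t (P a)) (k (P a)) \<omega>)"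
    using prod_fluct(1)[OF assms(2), of "\<lambda>a. B L (P a)" "\<lambda>a. t (P a)" "\<lambda>a. k (P a)"] B[OF assms(1)] by auto
  then have "integrable M (\<lambda>\<omega>. complex_of_real (\<Prod>a\<in>A. coord (P a) L \<omega>))"
    unfolding prod_coord_conv_fluct[OF assms(1)] by (intro integrable_mult_right)
  from integrable_Re[OF this] show ?thesis by (simp only: Re_complex_of_real)
qed

lemma joint_conv_fluct:
  assumes "0 < L"
  shows "complex_of_real (joint A P L) = complex_of_real (scale A P L) * fluct_joint A P L"
proof -
  have "complex_of_real (joint A P L) = expectation (\<lambda>\<omega>. complex_of_real (\<Prod>a\<in>A. coord (P a) L \<omega>))"
    unfolding joint_def by (rule integral_complex_of_real[symmetric])
  also have "\<dots> = complex_of_real (scale A P L) * fluct_joint A P L"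
    unfolding prod_coord_conv_fluct[OF assms] fluct_joint_def by (rule integral_mult_right_zero)
  finally show ?thesis .
qed

lemma window_simps:
  assumes "0 < L" shows "finite (window L)" "window L \<subseteq> {1..}" "B L p \<subseteq> window L"
  using B[OF assms] by (auto simp: window_def)

lemma window_card: "\<exists>D\<ge>1. \<forall>\<^sub>F L in at_top. real (max 1 (card (window L))) \<le> D * L"
proof (intro exI conjI)
  let ?D = "1 + (\<Sum>p\<in>UNIV. b p + 1)"
  have D0: "0 \<le> (\<Sum>p\<in>UNIV. b p + 1)" by (intro sum_nonneg add_nonneg_nonneg less_imp_le[OF b_pos]) simp
  then show "1 \<le> ?D" by simp
  have "\<forall>\<^sub>F L in at_top. real (card (B L p)) / L < b p + 1" for p by (rule order_tendstoD(2)[OF b]) simp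
  then have "\<forall>\<^sub>F L in at_top. \<forall>p. real (card (B L p)) / L < b p + 1" by (rule eventually_all_finite)
  then show "\<forall>\<^sub>F L in at_top. real (max 1 (card (window L))) \<le> ?D * L"
    using eventually_ge_at_top[of 1]
  proof eventually_elim
    case (elim L)
    have "card (window L) \<le> (\<Sum>p\<in>UNIV. card (B L p))" unfolding window_def by (rule card_UN_le) simp
    then have "real (card (window L)) \<le> (\<Sum>p\<in>UNIV. real (card (B L p)))" by (metis of_nat_le_iff of_nat_sum)
    also have "\<dots> \<le> (\<Sum>p\<in>UNIV. (b p + 1) * L)" using elim 
    proof (intro sum_mono)
      fix p
      have "real (card (B L p)) / L < b p + 1" "0 < L" using elim by auto
      then show "real (card (B L p)) \<le> (b p + 1) * L" by (simp add: divide_less_eq less_imp_le)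
    qed
    finally have 1: "real (card (window L)) \<le> (\<Sum>p\<in>UNIV. b p + 1) * L" by (simp only: sum_distrib_right)
    have "0 \<le> (\<Sum>p\<in>UNIV. b p + 1) * L" using elim D0 by (intro mult_nonneg_nonneg) auto
    then have "real (card (window L)) \<le> ?D * L" "1 \<le> ?D * L" using 1 elim by (simp_all add: distrib_right)
    then show ?case by (simp add: max_def)
  qed
qed

text \<open>\<open>(s - 1) div 2\<close> is at most \<open>(s - 1) / 2\<close>, so against the
  scaling \<open>L powr (- s / 2)\<close> at least half a power of \<open>L\<close> is lost.\<close>

lemma negligible:
  fixes f :: "real \<Rightarrow> real"
  assumes s: "1 \<le> s" and C: "0 \<le> C"
    and f: "\<And>L. 0 < L \<Longrightarrow> \<bar>f L\<bar> \<le> L powr (- (real s / 2)) * (C * real (max 1 (card (window L))) ^ ((s - 1) div 2))"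
  shows "(f \<longlongrightarrow> 0) at_top"
proof -
  obtain D where D: "1 \<le> D" "\<forall>\<^sub>F L in at_top. real (max 1 (card (window L))) \<le> D * L" using window_card by blast
  define v where "v = (s - 1) div 2"
  have v: "real v \<le> (real s - 1) / 2" using s by (simp add: v_def)
  show ?thesis
  proof (rule tendsto_0_le[where K = 1])
    show "((\<lambda>L. C * D ^ v * L powr (- (1 / 2))) \<longlongrightarrow> 0) at_top"
      by (intro tendsto_mult_right_zero tendsto_neg_powr filterlim_ident) simp
    show "\<forall>\<^sub>F L in at_top. norm (f L) \<le> norm (C * D ^ v * L powr (- (1 / 2))) * 1"
      using D(2) eventually_ge_at_top[of 1]
    proof eventually_elim
      case (elim L)
      have "real (max 1 (card (window L))) ^ v \<le> (D * L) ^ v" using elim by (intro power_mono) auto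
      then have "C * real (max 1 (card (window L))) ^ v \<le> C * (D ^ v * L powr real v)"
        using C elim by (intro mult_left_mono) (auto simp: power_mult_distrib powr_realpow)
      then have "L powr (- (real s / 2)) * (C * real (max 1 (card (window L))) ^ v) \<le> L powr (- (real s / 2)) * (C * (D ^ v * L powr real v))"
        by (rule mult_left_mono) simp
      then have "\<bar>f L\<bar> \<le> L powr (- (real s / 2)) * (C * (D ^ v * L powr real v))"
        using f[of L] elim unfolding v_def[symmetric] by linarith
      also have "\<dots> = C * D ^ v * (L powr real v * L powr (- (real s / 2)))" by (simp only: mult_ac)
      also have "L powr real v * L powr (- (real s / 2)) = L powr (real v - real s / 2)" by (simp add: powr_add[symmetric])
      also have "C * D ^ v * L powr (real v - real s / 2) \<le> C * D ^ v * L powr (- (1 / 2))"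
        using C D elim v by (intro mult_left_mono powr_mono) auto
      finally show ?case using C D by (simp add: abs_mult)
    qed
  qed
qed

lemma scale_conv: "0 < L \<Longrightarrow> scale A P L = L powr (- (real (\<Sum>a\<in>A. k (P a)) / 2))"
  unfolding scale_def by (simp add: powr_sum[symmetric] sum_negf sum_divide_distrib)

text \<open>\<open>fluct_wick_bound\<close> rescaled: the factors of \<open>{0, c}\<close> and of
  the other positions multiply to the scale of all positions.\<close>

lemma joint_wick:
  assumes n: "1 \<le> n"
  shows "((\<lambda>L. joint {..<n} P L - (\<Sum>c\<in>{..<n} - {0}. joint {0, c} P L * joint ({..<n} - {0, c}) P L)) \<longlongrightarrow> 0) at_top"
proof -
  define s where "s = (\<Sum>a<n. k (P a))"
  obtain C where C: "0 \<le> C" "\<And>\<tau> Bs B. finite B \<Longrightarrow> B \<subseteq> {1..} \<Longrightarrow> (\<And>a. a < n \<Longrightarrow> Bs a \<subseteq> B) \<Longrightarrow>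
    cmod (expectation (\<lambda>\<omega>. \<Prod>a<n. fluct (Bs a) (\<tau> a) (k (P a)) \<omega>) -
      (\<Sum>b\<in>{..<n} - {0}. expectation (\<lambda>\<omega>. \<Prod>a\<in>{0, b}. fluct (Bs a) (\<tau> a) (k (P a)) \<omega>) *
         expectation (\<lambda>\<omega>. \<Prod>a\<in>{..<n} - {0, b}. fluct (Bs a) (\<tau> a) (k (P a)) \<omega>)))
    \<le> C * real (max 1 (card B)) ^ ((s - 1) div 2)"
    using fluct_wick_bound[OF n, of "\<lambda>a. k (P a)"] unfolding s_def by blast
  show ?thesis
  proof (rule negligible[of s C])
    have "k (P 0) \<le> s" unfolding s_def using n by (intro member_le_sum) auto
    then show "1 \<le> s" using k[of "P 0"] by linarith
    fix L :: real assume L: "0 < L"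
    have sc: "scale {0, c} P L * scale ({..<n} - {0, c}) P L = scale {..<n} P L" if "c \<in> {..<n} - {0}" for c
      unfolding scale_def using that by (subst prod.union_disjoint[symmetric]) (auto intro!: prod.cong)
    have "complex_of_real (joint {..<n} P L - (\<Sum>c\<in>{..<n} - {0}. joint {0, c} P L * joint ({..<n} - {0, c}) P L)) =
      complex_of_real (scale {..<n} P L) * (fluct_joint {..<n} P L - (\<Sum>c\<in>{..<n} - {0}. fluct_joint {0, c} P L * fluct_joint ({..<n} - {0, c}) P L))"
    proof -
      have "complex_of_real (joint {0, c} P L * joint ({..<n} - {0, c}) P L) =
          complex_of_real (scale {..<n} P L) * (fluct_joint {0, c} P L * fluct_joint ({..<n} - {0, c}) P L)" if "c \<in> {..<n} - {0}" for c
        unfolding of_real_mult joint_conv_fluct[OF L] sc[OF that, symmetric] by (simp only: mult_ac)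
      then have "(\<Sum>c\<in>{..<n} - {0}. complex_of_real (joint {0, c} P L * joint ({..<n} - {0, c}) P L)) =
          (\<Sum>c\<in>{..<n} - {0}. complex_of_real (scale {..<n} P L) * (fluct_joint {0, c} P L * fluct_joint ({..<n} - {0, c}) P L))"
        by (rule sum.cong[OF refl])
      then show ?thesis
        by (simp only: of_real_diff of_real_sum right_diff_distrib sum_distrib_left joint_conv_fluct[OF L, of "{..<n}"])
    qed
    from arg_cong[OF this, of cmod]
    have "\<bar>joint {..<n} P L - (\<Sum>c\<in>{..<n} - {0}. joint {0, c} P L * joint ({..<n} - {0, c}) P L)\<bar> =
      \<bar>scale {..<n} P L\<bar> * cmod (fluct_joint {..<n} P L - (\<Sum>c\<in>{..<n} - {0}. fluct_joint {0, c} P L * fluct_joint ({..<n} - {0, c}) P L))"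
      by (simp only: norm_mult norm_of_real)
    also have "\<dots> \<le> \<bar>scale {..<n} P L\<bar> * (C * real (max 1 (card (window L))) ^ ((s - 1) div 2))"
      unfolding fluct_joint_def
      by (rule mult_left_mono[OF C(2)[OF window_simps(1,2)[OF L], of "\<lambda>a. B L (P a)" "\<lambda>a. t (P a)"]]) (use window_simps(3)[OF L] in auto)
    also have "\<bar>scale {..<n} P L\<bar> = L powr (- (real s / 2))" by (simp add: scale_conv[OF L] s_def)
    finally show "\<bar>joint {..<n} P L - (\<Sum>c\<in>{..<n} - {0}. joint {0, c} P L * joint ({..<n} - {0, c}) P L)\<bar> \<le>
      L powr (- (real s / 2)) * (C * real (max 1 (card (window L))) ^ ((s - 1) div 2))" .
  qed (rule C(1))
qed

definition moment :: "('m \<Rightarrow> real) \<Rightarrow> nat \<Rightarrow> real \<Rightarrow> real" where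
  "moment u n L = expectation (\<lambda>\<omega>. (\<Sum>p\<in>UNIV. u p * coord p L \<omega>) ^ n)"

text \<open>The power is indexed by a set \<open>A\<close> of positions instead of its size, so that
  \<open>{..<n}\<close> can later be split into \<open>{0, c}\<close> and the rest.\<close>

lemma moment_expand:
  assumes "0 < L" "finite A"
  shows "integrable M (\<lambda>\<omega>. (\<Sum>p\<in>UNIV. u p * coord p L \<omega>) ^ card A)"
    and "moment u (card A) L = (\<Sum>P\<in>(\<Pi>\<^sub>E a\<in>A. UNIV). (\<Prod>a\<in>A. u (P a)) * joint A P L)"
proof -
  have e: "(\<Sum>p\<in>UNIV. u p * coord p L \<omega>) ^ card A = (\<Sum>P\<in>(\<Pi>\<^sub>E a\<in>A. UNIV). (\<Prod>a\<in>A. u (P a)) * (\<Prod>a\<in>A. coord (P a) L \<omega>))" for \<omega>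
  proof -
    have "(\<Sum>p\<in>UNIV. u p * coord p L \<omega>) ^ card A = (\<Prod>a\<in>A. \<Sum>p\<in>UNIV. u p * coord p L \<omega>)" by simp
    also have "\<dots> = (\<Sum>P\<in>(\<Pi>\<^sub>E a\<in>A. UNIV). \<Prod>a\<in>A. u (P a) * coord (P a) L \<omega>)" by (rule prod_sum_PiE[OF assms(2)]) simp
    finally show ?thesis by (simp only: prod.distrib)
  qed
  show "integrable M (\<lambda>\<omega>. (\<Sum>p\<in>UNIV. u p * coord p L \<omega>) ^ card A)"
    unfolding e by (intro Bochner_Integration.integrable_sum integrable_mult_right prod_coord_integrable assms)
  show "moment u (card A) L = (\<Sum>P\<in>(\<Pi>\<^sub>E a\<in>A. UNIV). (\<Prod>a\<in>A. u (P a)) * joint A P L)"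
    unfolding moment_def e joint_def
    by (subst Bochner_Integration.integral_sum) (auto intro!: integrable_mult_right prod_coord_integrable assms)
qed

lemma joint_restrict: "A \<subseteq> A' \<Longrightarrow> joint A (restrict P A') L = joint A P L"
  unfolding joint_def by (intro arg_cong[where f = expectation] ext prod.cong) auto

text \<open>\<open>joint_wick\<close> is summed over all assignments of coordinates to positions.
  Each of the \<open>n - 1\<close> partners \<open>c\<close> of position 0 then gives the same
  product of two moments.\<close>

lemma moment_wick:
  assumes n: "1 \<le> n"
  shows "((\<lambda>L. moment u n L - real (n - 1) * moment u 2 L * moment u (n - 2) L) \<longlongrightarrow> 0) at_top"
proof -
  let ?w = "\<lambda>A P. \<Prod>a\<in>A. u (P a)"
  have rearrange: "(x * y) * (x' * y') = z * (y * y')" if "x * x' = z" for x x' y y' z :: real using that by auto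
  have eq: "(\<Sum>P\<in>(\<Pi>\<^sub>E a\<in>{..<n}. UNIV). ?w {..<n} P * (joint {..<n} P L - (\<Sum>c\<in>{..<n} - {0}. joint {0, c} P L * joint ({..<n} - {0, c}) P L))) =
     moment u n L - real (n - 1) * moment u 2 L * moment u (n - 2) L" if L: "0 < L" for L
  proof -
    have c: "(\<Sum>P\<in>(\<Pi>\<^sub>E a\<in>{..<n}. UNIV). ?w {..<n} P * (joint {0, c} P L * joint ({..<n} - {0, c}) P L)) = moment u 2 L * moment u (n - 2) L"
      if c: "c \<in> {..<n} - {0}" for c
    proof -
      have u: "{0, c} \<union> ({..<n} - {0, c}) = {..<n}" and cd: "card {0, c} = 2" "card ({..<n} - {0, c}) = n - 2"
        using c by (auto simp: card_Diff_subset)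
      have "moment u 2 L * moment u (n - 2) L = (\<Sum>P\<in>(\<Pi>\<^sub>E a\<in>{0, c}. UNIV). ?w {0, c} P * joint {0, c} P L) *
          (\<Sum>P\<in>(\<Pi>\<^sub>E a\<in>{..<n} - {0, c}. UNIV). ?w ({..<n} - {0, c}) P * joint ({..<n} - {0, c}) P L)"
        using moment_expand(2)[OF L, of "{0, c}" u] moment_expand(2)[OF L, of "{..<n} - {0, c}" u] unfolding cd by simp
      also have "\<dots> = (\<Sum>P\<in>(\<Pi>\<^sub>E a\<in>{0, c} \<union> ({..<n} - {0, c}). UNIV). (?w {0, c} P * joint {0, c} P L) * (?w ({..<n} - {0, c}) P * joint ({..<n} - {0, c}) P L))"
        by (rule sum_PiE_split) (auto simp: joint_restrict intro!: arg_cong2[where f = "(*)"] prod.cong)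
      also have "\<dots> = (\<Sum>P\<in>(\<Pi>\<^sub>E a\<in>{..<n}. UNIV). ?w {..<n} P * (joint {0, c} P L * joint ({..<n} - {0, c}) P L))"
        unfolding u
      proof (rule sum.cong[OF refl])
        fix P
        have "?w {0, c} P * ?w ({..<n} - {0, c}) P = ?w {..<n} P"
          by (subst prod.union_disjoint[symmetric]) (use u in auto)
        then show "(?w {0, c} P * joint {0, c} P L) * (?w ({..<n} - {0, c}) P * joint ({..<n} - {0, c}) P L) =
            ?w {..<n} P * (joint {0, c} P L * joint ({..<n} - {0, c}) P L)"
          by (rule rearrange)
      qed
      finally show ?thesis by (rule sym)
    qed
    have "(\<Sum>P\<in>(\<Pi>\<^sub>E a\<in>{..<n}. UNIV). ?w {..<n} P * (joint {..<n} P L - (\<Sum>c\<in>{..<n} - {0}. joint {0, c} P L * joint ({..<n} - {0, c}) P L))) =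
      moment u (card {..<n}) L - (\<Sum>c\<in>{..<n} - {0}. \<Sum>P\<in>(\<Pi>\<^sub>E a\<in>{..<n}. UNIV). ?w {..<n} P * (joint {0, c} P L * joint ({..<n} - {0, c}) P L))"
      unfolding right_diff_distrib sum_subtractf sum_distrib_left moment_expand(2)[OF L finite_lessThan]
      by (intro arg_cong2[where f = "(-)"] refl sum.swap)
    also have "\<dots> = moment u n L - (\<Sum>c\<in>{..<n} - {0}. moment u 2 L * moment u (n - 2) L)" by (simp add: c)
    finally show ?thesis using n by (simp add: card_Diff_subset)
  qed
  have "((\<lambda>L. \<Sum>P\<in>(\<Pi>\<^sub>E a\<in>{..<n}. UNIV). ?w {..<n} P * (joint {..<n} P L - (\<Sum>c\<in>{..<n} - {0}. joint {0, c} P L * joint ({..<n} - {0, c}) P L))) \<longlongrightarrow> 0) at_top"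
    by (intro tendsto_null_sum tendsto_mult_right_zero joint_wick n)
  then show ?thesis
    by (rule Lim_transform_eventually) (rule eventually_mono[OF eventually_gt_at_top[of 0] eq])
qed

definition cov_limit :: "'m \<Rightarrow> 'm \<Rightarrow> real" where
  "cov_limit p q = (\<Sum>i | 2 * i < k p. \<Sum>j | 2 * j < k q.
    if k p - 2 * i = k q - 2 * j then 2 / real \<beta> * real (k p - 2 * i) * (real (k p choose i) * b p ^ i) * (real (k q choose j) * b q ^ j) *
      (covar (t p) (t q) * bb p q) ^ (k p - 2 * i) else 0)"

lemma tree_coef_limit:
  assumes "((\<lambda>L. f L / L) \<longlongrightarrow> x) at_top" "\<And>L. f L = real (n L)"
  shows "((\<lambda>L. tree_coef m (n L) i / L ^ i) \<longlongrightarrow> real (m choose i) * x ^ i) at_top"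
proof -
  have "((\<lambda>L. real (m choose i) * ((\<Prod>j<i. f L - real (m - 2 * i + j)) / L ^ i)) \<longlongrightarrow> real (m choose i) * x ^ i) at_top"
    by (intro tendsto_mult tendsto_const prod_shift_tendsto assms(1))
  then show ?thesis by (simp add: tree_coef_def assms(2))
qed

text \<open>\<open>G\<close> is the sum over good pairs, an explicit combination of falling products
  of cardinalities. What \<open>covariance_good_pairs\<close> discards is
  \<open>negligible\<close>.\<close>

lemma covariance_limit: "((\<lambda>L. expectation (\<lambda>\<omega>. coord p L \<omega> * coord q L \<omega>)) \<longlongrightarrow> cov_limit p q) at_top"
proof -
  define s where "s = k p + k q"
  define T where "T i j L = tree_coef (k p) (card (B L p)) i * tree_coef (k q) (card (B L q)) j *
    (if k p - 2 * i = k q - 2 * j then 2 / real \<beta> * real (k p - 2 * i) * covar (t p) (t q) ^ (k p - 2 * i) *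
      (\<Prod>x<k p - 2 * i. real (card (B L p \<inter> B L q)) - real x) else 0)" for i j L
  define G where "G L = (\<Sum>i | 2 * i < k p. \<Sum>j | 2 * j < k q. T i j L)" for L
  obtain C where C: "0 \<le> C" "\<And>s t B B1 B2. finite B \<Longrightarrow> B \<subseteq> {1..} \<Longrightarrow> B1 \<subseteq> B \<Longrightarrow> B2 \<subseteq> B \<Longrightarrow>
    cmod (expectation (\<lambda>\<omega>. fluct B1 s (k p) \<omega> * fluct B2 t (k q) \<omega>) -
      (\<Sum>x\<in>good_pairs (k p) B1. \<Sum>x'\<in>good_pairs (k q) B2. pair_expect s t x x'))
    \<le> C * real (max 1 (card B)) ^ ((k p + k q - 1) div 2)"
    using covariance_good_pairs[of "k p" "k q"] by blast
  have GP: "(\<Sum>x\<in>good_pairs (k p) (B L p). \<Sum>x'\<in>good_pairs (k q) (B L q). pair_expect (t p) (t q) x x') = complex_of_real (G L)"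
    if L: "0 < L" for L
  proof -
    note B' = B[OF L, of p, THEN conjunct1] B[OF L, of p, THEN conjunct2] B[OF L, of q, THEN conjunct1] B[OF L, of q, THEN conjunct2]
    show ?thesis unfolding sum_pair_expect_cycles[OF B'] G_def of_real_sum
    proof (intro sum.cong refl)
      fix i j assume "i \<in> {i. 2 * i < k p}" "j \<in> {j. 2 * j < k q}"
      then have "1 \<le> k p - 2 * i" "1 \<le> k q - 2 * j" by auto
      then show "complex_of_real (tree_coef (k p) (card (B L p)) i * tree_coef (k q) (card (B L q)) j) *
        (\<Sum>w\<in>cycles (k p - 2 * i) (B L p). \<Sum>w'\<in>cycles (k q - 2 * j) (B L q). pair_expect (t p) (t q) (w, edges_of w) (w', edges_of w')) =
        complex_of_real (T i j L)"
        unfolding T_def of_real_mult[of "tree_coef (k p) (card (B L p)) i * tree_coef (k q) (card (B L q)) j"]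
        by (simp only: sum_cycles_pair_expect[OF B'])
    qed
  qed
  define E where "E L = expectation (\<lambda>\<omega>. coord p L \<omega> * coord q L \<omega>)" for L
  have 1: "((\<lambda>L. E L - L powr (- (real s / 2)) * G L) \<longlongrightarrow> 0) at_top"
  proof (rule negligible[of s C])
    show "1 \<le> s" using k[of p] by (simp add: s_def)
    fix L :: real assume L: "0 < L"
    have pw: "L powr (- (real (k p) / 2)) * L powr (- (real (k q) / 2)) = L powr (- (real s / 2))"
      by (simp add: s_def powr_add[symmetric] add_divide_distrib)
    have "complex_of_real (E L) = expectation (\<lambda>\<omega>. complex_of_real (coord p L \<omega>) * complex_of_real (coord q L \<omega>))"
      unfolding E_def of_real_mult[symmetric] by (rule integral_complex_of_real[symmetric])
    also have "\<dots> = expectation (\<lambda>\<omega>. complex_of_real (L powr (- (real s / 2))) * (fluct (B L p) (t p) (k p) \<omega> * fluct (B L q) (t q) (k q) \<omega>))"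
      unfolding coord_conv_fluct[OF L] pw[symmetric] of_real_mult by (simp only: mult_ac)
    also have "\<dots> = complex_of_real (L powr (- (real s / 2))) * expectation (\<lambda>\<omega>. fluct (B L p) (t p) (k p) \<omega> * fluct (B L q) (t q) (k q) \<omega>)"
      by (rule integral_mult_right_zero)
    finally have "complex_of_real (E L - L powr (- (real s / 2)) * G L) =
      complex_of_real (L powr (- (real s / 2))) * (expectation (\<lambda>\<omega>. fluct (B L p) (t p) (k p) \<omega> * fluct (B L q) (t q) (k q) \<omega>) - complex_of_real (G L))"
      by (simp only: of_real_diff of_real_mult right_diff_distrib)
    from arg_cong[OF this, of cmod]
    have "\<bar>E L - L powr (- (real s / 2)) * G L\<bar> = \<bar>L powr (- (real s / 2))\<bar> *
       cmod (expectation (\<lambda>\<omega>. fluct (B L p) (t p) (k p) \<omega> * fluct (B L q) (t q) (k q) \<omega>) - complex_of_real (G L))"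
      by (simp only: norm_mult norm_of_real)
    also have "\<dots> \<le> \<bar>L powr (- (real s / 2))\<bar> * (C * real (max 1 (card (window L))) ^ ((s - 1) div 2))"
      unfolding GP[OF L, symmetric] s_def by (intro mult_left_mono C(2) window_simps[OF L]) simp
    finally show "\<bar>E L - L powr (- (real s / 2)) * G L\<bar> \<le> L powr (- (real s / 2)) * (C * real (max 1 (card (window L))) ^ ((s - 1) div 2))"
      by simp
  qed (rule C(1))
  have 2: "((\<lambda>L. L powr (- (real s / 2)) * G L) \<longlongrightarrow> cov_limit p q) at_top"
    unfolding G_def cov_limit_def sum_distrib_left
  proof (intro tendsto_sum)
    fix i j assume "i \<in> {i. 2 * i < k p}" "j \<in> {j. 2 * j < k q}"
    then have ij: "2 * i < k p" "2 * j < k q" by auto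
    define r where "r = k p - 2 * i"
    show "((\<lambda>L. L powr (- (real s / 2)) * T i j L) \<longlongrightarrow> (if k p - 2 * i = k q - 2 * j then
      2 / real \<beta> * real (k p - 2 * i) * (real (k p choose i) * b p ^ i) * (real (k q choose j) * b q ^ j) *
      (covar (t p) (t q) * bb p q) ^ (k p - 2 * i) else 0)) at_top"
    proof (cases "k p - 2 * i = k q - 2 * j")
      case True
      \<comment> \<open>Here \<open>k p + k q = 2 * (i + j + r)\<close>, so the scaling distributes
        exactly over the two tree factors and the cycle factor.\<close>
      then have s: "real s / 2 = real (i + j + r)" using ij by (simp add: s_def r_def)
      have "((\<lambda>L. 2 / real \<beta> * real r * (tree_coef (k p) (card (B L p)) i / L ^ i) * (tree_coef (k q) (card (B L q)) j / L ^ j) *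
        (covar (t p) (t q) ^ r * ((\<Prod>x<r. real (card (B L p \<inter> B L q)) - real x) / L ^ r))) \<longlongrightarrow>
        2 / real \<beta> * real r * (real (k p choose i) * b p ^ i) * (real (k q choose j) * b q ^ j) * (covar (t p) (t q) ^ r * bb p q ^ r)) at_top"
        by (intro tendsto_mult tendsto_const tree_coef_limit[OF b refl] prod_shift_tendsto bb)
      moreover have "\<forall>\<^sub>F L in at_top. 2 / real \<beta> * real r * (tree_coef (k p) (card (B L p)) i / L ^ i) * (tree_coef (k q) (card (B L q)) j / L ^ j) *
        (covar (t p) (t q) ^ r * ((\<Prod>x<r. real (card (B L p \<inter> B L q)) - real x) / L ^ r)) = L powr (- (real s / 2)) * T i j L"
        using eventually_gt_at_top[of 0]
      proof eventually_elim
        case (elim L)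
        have "L powr (- (real s / 2)) = 1 / (L ^ i * L ^ j * L ^ r)"
          unfolding s powr_minus powr_realpow[OF elim] by (simp add: power_add divide_inverse)
        then show ?case using True by (simp add: T_def r_def mult_ac)
      qed
      ultimately have "((\<lambda>L. L powr (- (real s / 2)) * T i j L) \<longlongrightarrow>
        2 / real \<beta> * real r * (real (k p choose i) * b p ^ i) * (real (k q choose j) * b q ^ j) * (covar (t p) (t q) ^ r * bb p q ^ r)) at_top"
        by (rule Lim_transform_eventually)
      then show ?thesis unfolding r_def[symmetric] if_P[OF True[folded r_def]] power_mult_distrib .
    qed (simp add: T_def)
  qed
  show ?thesis using tendsto_add[OF 1 2] unfolding diff_add_cancel add_0_left E_def .
qed

lemma moment_limit: "(moment u n \<longlongrightarrow> normal_moment (\<Sum>p\<in>UNIV. \<Sum>q\<in>UNIV. u p * u q * cov_limit p q) n) at_top"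
proof (rule normal_moment_limit)
  show "(moment u 0 \<longlongrightarrow> 1) at_top" by (simp add: moment_def[abs_def] prob_space)
  \<comment> \<open>For \<open>n = 1\<close> position 0 has no partner, the factor
    \<open>n - 1\<close> is 0, and \<open>moment_wick\<close> is the claim.\<close>
  show "(moment u 1 \<longlongrightarrow> 0) at_top" using moment_wick[of 1 u] by simp
  show "((\<lambda>L. moment u (n + 2) L - real (n + 1) * moment u 2 L * moment u n L) \<longlongrightarrow> 0) at_top" for n
    using moment_wick[of "n + 2" u] by simp
  have "((\<lambda>L. \<Sum>p\<in>UNIV. \<Sum>q\<in>UNIV. u p * u q * expectation (\<lambda>\<omega>. coord p L \<omega> * coord q L \<omega>)) \<longlongrightarrow>
      (\<Sum>p\<in>UNIV. \<Sum>q\<in>UNIV. u p * u q * cov_limit p q)) at_top"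
    by (intro tendsto_sum tendsto_mult tendsto_const covariance_limit)
  moreover have "\<forall>\<^sub>F L in at_top. (\<Sum>p\<in>UNIV. \<Sum>q\<in>UNIV. u p * u q * expectation (\<lambda>\<omega>. coord p L \<omega> * coord q L \<omega>)) = moment u 2 L"
    using eventually_gt_at_top[of 0]
  proof eventually_elim
    case (elim L)
    have i: "integrable M (\<lambda>\<omega>. coord p L \<omega> * coord q L \<omega>)" for p q
      using prod_coord_integrable[OF elim, of "{0, 1}" "\<lambda>a. if a = 0 then p else q"] by simp
    have "moment u 2 L = expectation (\<lambda>\<omega>. \<Sum>p\<in>UNIV. \<Sum>q\<in>UNIV. u p * u q * (coord p L \<omega> * coord q L \<omega>))"
      unfolding moment_def power2_eq_square sum_product by (simp only: mult_ac)
    also have "\<dots> = (\<Sum>p\<in>UNIV. \<Sum>q\<in>UNIV. u p * u q * expectation (\<lambda>\<omega>. coord p L \<omega> * coord q L \<omega>))"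
      by (simp only: Bochner_Integration.integral_sum[OF Bochner_Integration.integrable_sum[OF integrable_mult_right[OF i]]]
          Bochner_Integration.integral_sum[OF integrable_mult_right[OF i]] integral_mult_right_zero)
    finally show ?case by (rule sym)
  qed
  ultimately show "(moment u 2 \<longlongrightarrow> (\<Sum>p\<in>UNIV. \<Sum>q\<in>UNIV. u p * u q * cov_limit p q)) at_top"
    by (rule Lim_transform_eventually)
qed

lemma cov_limit_commute: "cov_limit p q = cov_limit q p"
proof -
  have "bb p q = bb q p"
    using tendsto_unique[OF trivial_limit_at_top_linorder bb[of p q]] bb[of q p] by (simp add: Int_commute)
  note eq = this covar_commute[of "t p" "t q"]
  show ?thesis unfolding cov_limit_def eq
    by (subst sum.swap, intro sum.cong refl) (auto simp only: mult_ac split: if_split)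
qed

text \<open>\<open>bb p q\<close> is at most \<open>b p\<close> and at most \<open>b q\<close>,
  hence at most their geometric mean, and \<open>covar\<close> is at most 1. This is the condition
  \<open>\<rho> \<le> 1\<close> of the integral formula.\<close>

lemma overlap_bounds: "0 \<le> covar (t p) (t q) * bb p q" "covar (t p) (t q) * bb p q \<le> sqrt (b p) * sqrt (b q)"
proof -
  have bb0: "0 \<le> bb p q"
    by (rule tendsto_lowerbound[OF bb]) (auto intro!: eventually_mono[OF eventually_gt_at_top[of 0]])
  have le: "bb p q \<le> b p'" if "p' = p \<or> p' = q" for p'
  proof (rule tendsto_le[OF trivial_limit_at_top_linorder b bb])
    show "\<forall>\<^sub>F L in at_top. real (card (B L p \<inter> B L q)) / L \<le> real (card (B L p')) / L"
      using eventually_gt_at_top[of 0]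
    proof eventually_elim
      case (elim L)
      have "card (B L p \<inter> B L q) \<le> card (B L p')" using B[OF elim] that by (intro card_mono) auto
      then show ?case using elim by (intro divide_right_mono) auto
    qed
  qed
  show "0 \<le> covar (t p) (t q) * bb p q" using bb0 cov_nonneg by simp
  have "covar (t p) (t q) * bb p q \<le> 1 * bb p q" by (rule mult_right_mono[OF covar_le_1 bb0])
  also have "\<dots> = sqrt (bb p q) * sqrt (bb p q)" using bb0 by simp
  also have "\<dots> \<le> sqrt (b p) * sqrt (b q)" using le bb0 less_imp_le[OF b_pos] by (intro mult_mono real_sqrt_le_mono) auto
  finally show "covar (t p) (t q) * bb p q \<le> sqrt (b p) * sqrt (b q)" .
qed

end

theorem theorem2:
  fixes M :: "'a measure"
    and \<beta> :: nat
    and Z :: "nat \<Rightarrow> nat \<Rightarrow> real \<Rightarrow> 'a \<Rightarrow> complex"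
    and Y :: "nat \<Rightarrow> real \<Rightarrow> 'a \<Rightarrow> real"
    and k :: "'m::finite \<Rightarrow> nat"
    and t :: "'m \<Rightarrow> real"
    and B :: "real \<Rightarrow> 'm \<Rightarrow> nat set"
    and b :: "'m \<Rightarrow> real"
    and bb :: "'m \<Rightarrow> 'm \<Rightarrow> real"
  assumes wigner: "time_dependent_wigner M \<beta> Z Y"
    and k: "\<And>p. 1 \<le> k p"
    and B: "\<And>L p. 0 < L \<Longrightarrow> finite (B L p) \<and> B L p \<subseteq> {1..}"
    and b: "\<And>p. ((\<lambda>L. real (card (B L p)) / L) \<longlongrightarrow> b p) at_top"
    and b_pos: "\<And>p. 0 < b p"
    and bb: "\<And>p q. ((\<lambda>L. real (card (B L p \<inter> B L q)) / L) \<longlongrightarrow> bb p q) at_top"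
  defines "\<xi> \<equiv> \<lambda>L \<omega>. (\<chi> p. L powr (- (real (k p) / 2)) *
             (trace_power Z Y (B L p) (t p) (k p) \<omega> -
              (\<integral>\<omega>'. trace_power Z Y (B L p) (t p) (k p) \<omega>' \<partial>M))) :: real ^ 'm"
  shows "\<exists>N :: (real ^ 'm) measure.
           gaussian_vector_law N \<and>
           (\<forall>p. (\<integral>x. x $ p \<partial>N) = 0) \<and>
           (\<forall>p q. (\<integral>x. x $ p * x $ q \<partial>N) =
              limit_covariance \<beta> (wigner_cov M \<beta> Y (t p) (t q)) (k p) (k q) (b p) (b q) (bb p q)) \<and>
           converges_in_distribution M \<xi> N at_top \<and>
           converges_with_all_moments M \<xi> N at_top"
proof -
  interpret wigner_submatrices M \<beta> Z Y k t B b bb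
    unfolding wigner_submatrices_def wigner_submatrices_axioms_def using wigner k B b b_pos bb by blast
  have cov: "limit_covariance \<beta> (wigner_cov M \<beta> Y (t p) (t q)) (k p) (k q) (b p) (b q) (bb p q) = cov_limit p q" for p q
    unfolding cov_limit_def by (rule limit_covariance_conv[OF b_pos b_pos k k overlap_bounds]) (use beta in auto)
  have \<xi>: "\<xi> L \<omega> = (\<chi> p. coord p L \<omega>)" for L \<omega> by (simp only: \<xi>_def coord_def)
  have \<xi>_nth: "\<xi> L \<omega> $ p = coord p L \<omega>" for L \<omega> p by (simp only: \<xi> vec_lambda_beta)
  show ?thesis unfolding cov
  proof (rule gaussian_limit)
    show "prob_space M" by (rule prob_space_axioms)
    show "cov_limit p q = cov_limit q p" for p q by (rule cov_limit_commute)
    show "\<forall>\<^sub>F L in at_top. \<xi> L \<in> borel_measurable M"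
      using eventually_gt_at_top[of 0]
    proof eventually_elim
      case (elim L)
      have "\<xi> L = (\<lambda>\<omega>. \<chi> p. coord p L \<omega>)" by (rule ext) (rule \<xi>)
      then show ?case using borel_measurable_vec_lambda[OF coord_measurable[OF elim]] by (simp only:)
    qed
    fix u n
    show "\<forall>\<^sub>F L in at_top. integrable M (\<lambda>\<omega>. (\<Sum>p\<in>UNIV. u p * \<xi> L \<omega> $ p) ^ n)"
      using eventually_gt_at_top[of 0]
    proof eventually_elim
      case (elim L)
      show ?case using moment_expand(1)[OF elim finite_lessThan, of u n] by (simp only: \<xi>_nth card_lessThan)
    qed
    show "((\<lambda>L. \<integral>\<omega>. (\<Sum>p\<in>UNIV. u p * \<xi> L \<omega> $ p) ^ n \<partial>M) \<longlongrightarrow>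
        normal_moment (\<Sum>p\<in>UNIV. \<Sum>q\<in>UNIV. u p * u q * cov_limit p q) n) at_top"
      using moment_limit[of u n] unfolding moment_def[abs_def] \<xi>_nth .
  qed simp
qed

end
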